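(* Let $H$ be a finite-dimensional pointed Hopf algebra over $\Bbbk$ with $G=G(H)$ abelian such that $\mathrm{gr}(H)\cong\mathfrak B(V)\#\Bbbk G$ with $V$ of type $A_2$ or of type $B_2$, with braiding parameter $q$ a root of unity of odd order $m>1$, where $m\ge5$ if the type is $A_2$ and $m\ne5$ if the type is $B_2$. If $H$ is Galois-theoretical, then $H$ is coradically graded.
   Context: $\Bbbk$ is an algebraically closed field of characteristic zero. A Hopf algebra acts on an algebra $A$ if $A$ is a left module algebra; the action is inner faithful if no nonzero Hopf ideal annihilates $A$. $H$ is Galois-theoretical if it acts inner faithfully on some field containing $\Bbbk$. $\mathrm{gr}(H)$ is the graded Hopf algebra associated with the coradical filtration of $H$; $H$ is coradically graded if $H\cong\mathrm{gr}(H)$ (i.e. $H$ is a trivial lifting). $\mathfrak B(V)\#\Bbbk G$ is the bosonization of the Nichols algebra of a Yetter–Drinfeld module $V$ over $\Bbbk G$ with basis $x_1,x_2$, where $x_i$ has $G$-degree $g_i\in G$ (so it is $(g_i,1)$-skew-primitive, $\Delta(x_i)=g_i\otimes x_i+x_i\otimes1$) and $gx_i=\chi_i(g)x_ig$ for $g\in G$, with $\chi_i\in\widehat G$. Type $A_2$ with braiding parameter $q$: $\chi_1(g_1)=\chi_2(g_2)=q$ and $\chi_1(g_2)\chi_2(g_1)=q^{-1}$. Type $B_2$ with braiding parameter $q$: $\chi_1(g_1)=q^2$, $\chi_2(g_2)=q$ and $\chi_1(g_2)\chi_2(g_1)=q^{-2}$. The finite-dimensional pointed Hopf algebras $H$ with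 $G=G(H)$ abelian and $\mathrm{gr}(H)\cong \mathfrak B(V)\#\Bbbk G$, where $V$ is of type $A_2$ (with $q$ of odd order $m\ge5$) or of type $B_2$ (with $q$ of odd order $m>1$, $m\ne5$), are those classified by Andruskiewitsch–Schneider (type $A_2$) and by Beattie–Dăscălescu–Raianu (type $B_2$). *)

theory Defs
  imports "HOL-Algebra.Algebra" "HOL-Algebra.Algebraic_Closure_Type"
begin

section \<open>Vector spaces, algebras and tensor products over a field\<close>

text \<open>
  The ground field is a type \<^typ>\<open>'k\<close> of class \<^class>\<open>field\<close>. Vector spaces and algebras over it
  are records of type \<^typ>\<open>('k, 'a) module\<close>, regarded as modules over the field
  \<^const>\<open>ring_of_type_algebra\<close>.
\<close>

abbreviation fld :: "'k::field ring" where
  "fld \<equiv> ring_of_type_algebra"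

locale k_algebra = ring A + module fld A
  for A :: "('k::field, 'a, 'm) module_scheme" (structure) +
  assumes smult_mult_left:
      "\<lbrakk>x \<in> carrier A; y \<in> carrier A\<rbrakk> \<Longrightarrow> (a \<odot> x) \<otimes> y = a \<odot> (x \<otimes> y)"
    and smult_mult_right:
      "\<lbrakk>x \<in> carrier A; y \<in> carrier A\<rbrakk> \<Longrightarrow> x \<otimes> (a \<odot> y) = a \<odot> (x \<otimes> y)"

definition lspan :: "('k::field, 'a, 'm) module_scheme \<Rightarrow> 'a set \<Rightarrow> 'a set" where
  "lspan M B = \<Inter>{N. submodule N (fld :: 'k ring) M \<and> B \<subseteq> N}"

definition finite_dimensional :: "('k::field, 'a, 'm) module_scheme \<Rightarrow> bool" where
  "finite_dimensional M \<longleftrightarrow> (\<exists>B. finite B \<and> B \<subseteq> carrier M \<and> lspan M B = carrier M)"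

definition one_dimensional :: "('k::field, 'a, 'm) module_scheme \<Rightarrow> 'a set \<Rightarrow> bool" where
  "one_dimensional M N \<longleftrightarrow> (\<exists>x\<in>carrier M. x \<noteq> \<zero>\<^bsub>M\<^esub> \<and> N = range (\<lambda>a. a \<odot>\<^bsub>M\<^esub> x))"

definition linear_form :: "('k::field, 'a, 'm) module_scheme \<Rightarrow> ('a \<Rightarrow> 'k) \<Rightarrow> bool" where
  "linear_form M f \<longleftrightarrow>
     (\<forall>x\<in>carrier M. \<forall>y\<in>carrier M. f (x \<oplus>\<^bsub>M\<^esub> y) = f x + f y) \<and>
     (\<forall>a. \<forall>x\<in>carrier M. f (a \<odot>\<^bsub>M\<^esub> x) = a * f x)"

definition bilinear_form ::
  "('k::field, 'a, 'm) module_scheme \<Rightarrow> ('k, 'b, 'n) module_scheme \<Rightarrow> ('a \<Rightarrow> 'b \<Rightarrow> 'k) \<Rightarrow> bool" where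
  "bilinear_form M N \<beta> \<longleftrightarrow>
     (\<forall>x\<in>carrier M. linear_form N (\<beta> x)) \<and> (\<forall>y\<in>carrier N. linear_form M (\<lambda>x. \<beta> x y))"

definition trilinear_form :: "('k::field, 'a, 'm) module_scheme \<Rightarrow> ('a \<Rightarrow> 'a \<Rightarrow> 'a \<Rightarrow> 'k) \<Rightarrow> bool" where
  "trilinear_form M \<tau> \<longleftrightarrow>
     (\<forall>x\<in>carrier M. bilinear_form M M (\<tau> x)) \<and>
     (\<forall>y\<in>carrier M. \<forall>z\<in>carrier M. linear_form M (\<lambda>x. \<tau> x y z))"

text \<open>
  Over a field, the canonical map from \<open>M \<otimes> N\<close> to the dual space of the space of bilinear forms
  on \<open>M \<times> N\<close> is injective, also in infinite dimension. We take its image as the model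
  of \<open>M \<otimes> N\<close>: the pure tensor of \<open>x\<close> and \<open>y\<close> is evaluation at \<open>(x, y)\<close>, and the elements of
  \<open>M \<otimes> N\<close> are the finite sums of pure tensors. Functions that are not bilinear forms
  are sent to \<open>0\<close>, so that equality of tensors is equality of functions.
\<close>

type_synonym ('k, 'a, 'b) tensor = "('a \<Rightarrow> 'b \<Rightarrow> 'k) \<Rightarrow> 'k"

definition pure_tensor ::
  "('k::field, 'a, 'm) module_scheme \<Rightarrow> ('k, 'b, 'n) module_scheme \<Rightarrow> 'a \<Rightarrow> 'b \<Rightarrow> ('k, 'a, 'b) tensor"
  where
  "pure_tensor M N x y = (\<lambda>\<beta>. if bilinear_form M N \<beta> then \<beta> x y else 0)"

definition tensor_sum ::
  "('k::field, 'a, 'm) module_scheme \<Rightarrow> ('k, 'b, 'n) module_scheme \<Rightarrow> ('a \<times> 'b) list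
     \<Rightarrow> ('k, 'a, 'b) tensor" where
  "tensor_sum M N ps = (\<lambda>\<beta>. \<Sum>(x, y)\<leftarrow>ps. pure_tensor M N x y \<beta>)"

text \<open>
  All finite sums of pure tensors \<open>x \<otimes> y\<close> with \<open>(x, y) \<in> P\<close>. For subspaces, \<open>P = X \<times> Y\<close> gives
  the subspace \<open>X \<otimes> Y\<close>, and \<open>P = X \<times> N \<union> M \<times> Y\<close> gives \<open>X \<otimes> N + M \<otimes> Y\<close>.
\<close>

definition tensors ::
  "('k::field, 'a, 'm) module_scheme \<Rightarrow> ('k, 'b, 'n) module_scheme \<Rightarrow> ('a \<times> 'b) set
     \<Rightarrow> ('k, 'a, 'b) tensor set" where
  "tensors M N P = {tensor_sum M N ps | ps. set ps \<subseteq> P}"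

text \<open>The map \<open>f \<otimes> f\<close> for a linear map \<open>f\<close> into \<open>N\<close>.\<close>

definition tensor_map ::
  "('k::field, 'b, 'n) module_scheme \<Rightarrow> ('a \<Rightarrow> 'b) \<Rightarrow> ('k, 'a, 'a) tensor \<Rightarrow> ('k, 'b, 'b) tensor" where
  "tensor_map N f t = (\<lambda>\<beta>. if bilinear_form N N \<beta> then t (\<lambda>x y. \<beta> (f x) (f y)) else 0)"

definition list_sum :: "('b, 'm) ring_scheme \<Rightarrow> ('p \<Rightarrow> 'b) \<Rightarrow> 'p list \<Rightarrow> 'b" where
  "list_sum M f ps = foldr (\<lambda>p s. f p \<oplus>\<^bsub>M\<^esub> s) ps \<zero>\<^bsub>M\<^esub>"

section \<open>Hopf algebras\<close>

record ('k, 'a) bialg = "('k, 'a) module" +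
  comult :: "'a \<Rightarrow> ('k, 'a, 'a) tensor"
  counit :: "'a \<Rightarrow> 'k"

text \<open>\<open>sweedler H x ps\<close>: the list \<open>ps\<close> is an expression of \<open>\<Delta>(x)\<close> as a sum of pure tensors.\<close>

definition sweedler :: "('k::field, 'a, 'm) bialg_scheme \<Rightarrow> 'a \<Rightarrow> ('a \<times> 'a) list \<Rightarrow> bool" where
  "sweedler H x ps \<longleftrightarrow> set ps \<subseteq> carrier H \<times> carrier H \<and> comult H x = tensor_sum H H ps"

locale bialgebra = k_algebra H for H :: "('k::field, 'a, 'm) bialg_scheme" (structure) +
  assumes comult_closed:
      "x \<in> carrier H \<Longrightarrow> comult H x \<in> tensors H H (carrier H \<times> carrier H)"
    and comult_add:
      "\<lbrakk>x \<in> carrier H; y \<in> carrier H\<rbrakk> \<Longrightarrow>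
         comult H (x \<oplus> y) = (\<lambda>\<beta>. comult H x \<beta> + comult H y \<beta>)"
    and comult_smult:
      "x \<in> carrier H \<Longrightarrow> comult H (a \<odot> x) = (\<lambda>\<beta>. a * comult H x \<beta>)"
    and counit_linear: "linear_form H (counit H)"
    and coassoc:  \<comment> \<open>equality in the threefold tensor power, tested on trilinear forms\<close>
      "\<lbrakk>x \<in> carrier H; trilinear_form H \<tau>\<rbrakk> \<Longrightarrow>
         comult H x (\<lambda>u v. comult H u (\<lambda>y z. \<tau> y z v)) =
         comult H x (\<lambda>u v. comult H v (\<lambda>y z. \<tau> u y z))"
    and counit_left:
      "\<lbrakk>x \<in> carrier H; sweedler H x ps\<rbrakk> \<Longrightarrow> list_sum H (\<lambda>(u, v). counit H u \<odot> v) ps = x"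
    and counit_right:
      "\<lbrakk>x \<in> carrier H; sweedler H x ps\<rbrakk> \<Longrightarrow> list_sum H (\<lambda>(u, v). counit H v \<odot> u) ps = x"
    and comult_one: "comult H \<one> = pure_tensor H H \<one> \<one>"
    and comult_mult:
      "\<lbrakk>x \<in> carrier H; y \<in> carrier H; sweedler H x ps; sweedler H y qs\<rbrakk> \<Longrightarrow>
         comult H (x \<otimes> y) =
         tensor_sum H H [(u \<otimes> u', v \<otimes> v'). (u, v) \<leftarrow> ps, (u', v') \<leftarrow> qs]"
    and counit_one: "counit H \<one> = 1"
    and counit_mult:
      "\<lbrakk>x \<in> carrier H; y \<in> carrier H\<rbrakk> \<Longrightarrow> counit H (x \<otimes> y) = counit H x * counit H y"

definition is_antipode :: "('k::field, 'a, 'm) bialg_scheme \<Rightarrow> ('a \<Rightarrow> 'a) \<Rightarrow> bool" where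
  "is_antipode H S \<longleftrightarrow>
     S \<in> carrier H \<rightarrow> carrier H \<and>
     (\<forall>x\<in>carrier H. \<forall>y\<in>carrier H. S (x \<oplus>\<^bsub>H\<^esub> y) = S x \<oplus>\<^bsub>H\<^esub> S y) \<and>
     (\<forall>a. \<forall>x\<in>carrier H. S (a \<odot>\<^bsub>H\<^esub> x) = a \<odot>\<^bsub>H\<^esub> S x) \<and>
     (\<forall>x\<in>carrier H. \<forall>ps. sweedler H x ps \<longrightarrow>
        list_sum H (\<lambda>(u, v). S u \<otimes>\<^bsub>H\<^esub> v) ps = counit H x \<odot>\<^bsub>H\<^esub> \<one>\<^bsub>H\<^esub> \<and>
        list_sum H (\<lambda>(u, v). u \<otimes>\<^bsub>H\<^esub> S v) ps = counit H x \<odot>\<^bsub>H\<^esub> \<one>\<^bsub>H\<^esub>)"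

text \<open>
  The antipode of a bialgebra is unique if it exists, and bialgebra isomorphisms commute with
  antipodes; it is therefore a property here and not a component of the record.
\<close>

definition hopf_algebra :: "('k::field, 'a, 'm) bialg_scheme \<Rightarrow> bool" where
  "hopf_algebra H \<longleftrightarrow> bialgebra H \<and> (\<exists>S. is_antipode H S)"

definition hopf_isomorphic ::
  "('k::field, 'a, 'm) bialg_scheme \<Rightarrow> ('k, 'b, 'n) bialg_scheme \<Rightarrow> bool" where
  "hopf_isomorphic A B \<longleftrightarrow> (\<exists>f\<in>ring_iso A B. \<forall>x\<in>carrier A.
     (\<forall>a. f (a \<odot>\<^bsub>A\<^esub> x) = a \<odot>\<^bsub>B\<^esub> f x) \<and>
     comult B (f x) = tensor_map B f (comult A x) \<and>
     counit B (f x) = counit A x)"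

definition hopf_ideal :: "('k::field, 'a, 'm) bialg_scheme \<Rightarrow> 'a set \<Rightarrow> bool" where
  "hopf_ideal H I \<longleftrightarrow>
     ideal I H \<and>
     (\<forall>x\<in>I. comult H x \<in> tensors H H (I \<times> carrier H \<union> carrier H \<times> I) \<and> counit H x = 0) \<and>
     (\<forall>S. is_antipode H S \<longrightarrow> S ` I \<subseteq> I)"

section \<open>Inner faithful actions on fields\<close>

definition module_algebra ::
  "('k::field, 'a, 'm) bialg_scheme \<Rightarrow> ('k, 'b, 'n) module_scheme \<Rightarrow> ('a \<Rightarrow> 'b \<Rightarrow> 'b) \<Rightarrow> bool" where
  "module_algebra H A act \<longleftrightarrow>
     k_algebra A \<and>
     (\<forall>h\<in>carrier H. \<forall>a\<in>carrier A. act h a \<in> carrier A) \<and>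
     (\<forall>h\<in>carrier H. \<forall>h'\<in>carrier H. \<forall>a\<in>carrier A.
        act (h \<oplus>\<^bsub>H\<^esub> h') a = act h a \<oplus>\<^bsub>A\<^esub> act h' a \<and>
        act (h \<otimes>\<^bsub>H\<^esub> h') a = act h (act h' a)) \<and>
     (\<forall>h\<in>carrier H. \<forall>a\<in>carrier A. \<forall>b\<in>carrier A.
        act h (a \<oplus>\<^bsub>A\<^esub> b) = act h a \<oplus>\<^bsub>A\<^esub> act h b \<and>
        (\<forall>ps. sweedler H h ps \<longrightarrow>
           act h (a \<otimes>\<^bsub>A\<^esub> b) = list_sum A (\<lambda>(u, v). act u a \<otimes>\<^bsub>A\<^esub> act v b) ps)) \<and>
     (\<forall>c. \<forall>h\<in>carrier H. \<forall>a\<in>carrier A.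
        act (c \<odot>\<^bsub>H\<^esub> h) a = c \<odot>\<^bsub>A\<^esub> act h a \<and> act h (c \<odot>\<^bsub>A\<^esub> a) = c \<odot>\<^bsub>A\<^esub> act h a) \<and>
     (\<forall>a\<in>carrier A. act \<one>\<^bsub>H\<^esub> a = a) \<and>
     (\<forall>h\<in>carrier H. act h \<one>\<^bsub>A\<^esub> = counit H h \<odot>\<^bsub>A\<^esub> \<one>\<^bsub>A\<^esub>)"

definition inner_faithful ::
  "('k::field, 'a, 'm) bialg_scheme \<Rightarrow> ('k, 'b, 'n) module_scheme \<Rightarrow> ('a \<Rightarrow> 'b \<Rightarrow> 'b) \<Rightarrow> bool" where
  "inner_faithful H A act \<longleftrightarrow>
     (\<forall>I. hopf_ideal H I \<and> (\<forall>h\<in>I. \<forall>a\<in>carrier A. act h a = \<zero>\<^bsub>A\<^esub>) \<longrightarrow> I = {\<zero>\<^bsub>H\<^esub>})"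

text \<open>
  A field containing the ground field is an algebra over it whose underlying ring is a field.
  HOL cannot quantify existentially over types, so the type \<^typ>\<open>'l\<close> of the elements of the field is
  a parameter. A theorem assuming \<open>galois_theoretical TYPE('l) H\<close> for a type variable \<^typ>\<open>'l\<close>
  applies to fields of every type.
\<close>

definition galois_theoretical :: "'l itself \<Rightarrow> ('k::field, 'a, 'm) bialg_scheme \<Rightarrow> bool" where
  "galois_theoretical TYPE('l) H \<longleftrightarrow>
     (\<exists>(L :: ('k, 'l) module) act. field L \<and> module_algebra H L act \<and> inner_faithful H L act)"

section \<open>Coradical filtration and associated graded Hopf algebra\<close>

definition subcoalgebra :: "('k::field, 'a, 'm) bialg_scheme \<Rightarrow> 'a set \<Rightarrow> bool" where
  "subcoalgebra H C \<longleftrightarrow>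
     submodule C (fld :: 'k ring) H \<and> (\<forall>x\<in>C. comult H x \<in> tensors H H (C \<times> C))"

definition simple_subcoalgebra :: "('k::field, 'a, 'm) bialg_scheme \<Rightarrow> 'a set \<Rightarrow> bool" where
  "simple_subcoalgebra H C \<longleftrightarrow>
     subcoalgebra H C \<and> C \<noteq> {\<zero>\<^bsub>H\<^esub>} \<and>
     (\<forall>D. subcoalgebra H D \<and> D \<subseteq> C \<longrightarrow> D = {\<zero>\<^bsub>H\<^esub>} \<or> D = C)"

definition pointed :: "('k::field, 'a, 'm) bialg_scheme \<Rightarrow> bool" where
  "pointed H \<longleftrightarrow> (\<forall>C. simple_subcoalgebra H C \<longrightarrow> one_dimensional H C)"

definition grouplikes :: "('k::field, 'a, 'm) bialg_scheme \<Rightarrow> 'a set" where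
  "grouplikes H = {g \<in> carrier H. g \<noteq> \<zero>\<^bsub>H\<^esub> \<and> comult H g = pure_tensor H H g g}"

definition grouplike_group :: "('k::field, 'a, 'm) bialg_scheme \<Rightarrow> 'a monoid" where
  "grouplike_group H = \<lparr>carrier = grouplikes H, monoid.mult = (\<otimes>\<^bsub>H\<^esub>), one = \<one>\<^bsub>H\<^esub>\<rparr>"

definition coradical :: "('k::field, 'a, 'm) bialg_scheme \<Rightarrow> 'a set" where
  "coradical H = lspan H (\<Union>{C. simple_subcoalgebra H C})"

primrec corad_filt :: "('k::field, 'a, 'm) bialg_scheme \<Rightarrow> nat \<Rightarrow> 'a set" where
  "corad_filt H 0 = coradical H"
| "corad_filt H (Suc n) =
     {x \<in> carrier H.
        comult H x \<in> tensors H H (carrier H \<times> corad_filt H n \<union> coradical H \<times> carrier H)}"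

text \<open>\<open>H\<^sub>n\<^sub>-\<^sub>1\<close>, where \<open>H\<^sub>-\<^sub>1 = 0\<close>\<close>

definition corad_below :: "('k::field, 'a, 'm) bialg_scheme \<Rightarrow> nat \<Rightarrow> 'a set" where
  "corad_below H n = (case n of 0 \<Rightarrow> {\<zero>\<^bsub>H\<^esub>} | Suc k \<Rightarrow> corad_filt H k)"

definition rep :: "'a set \<Rightarrow> 'a" where
  "rep C = (SOME x. x \<in> C)"

text \<open>
  An element of \<open>gr(H)\<close> is a sequence \<open>c\<close> of cosets \<open>c n \<in> H\<^sub>n/H\<^sub>n\<^sub>-\<^sub>1\<close>, almost all of them zero.
  \<open>gr_class H n x\<close> is the class of \<open>x \<in> H\<^sub>n\<close> in the component of degree \<open>n\<close>, and
  \<open>gr_hom H n x\<close> the corresponding homogeneous element of \<open>gr(H)\<close>. The operations are computed on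
  representatives; for pointed \<open>H\<close> the result does not depend on the choice.
\<close>

definition gr_class :: "('k::field, 'a, 'm) bialg_scheme \<Rightarrow> nat \<Rightarrow> 'a \<Rightarrow> 'a set" where
  "gr_class H n x = corad_below H n +>\<^bsub>H\<^esub> x"

definition gr_hom :: "('k::field, 'a, 'm) bialg_scheme \<Rightarrow> nat \<Rightarrow> 'a \<Rightarrow> nat \<Rightarrow> 'a set" where
  "gr_hom H n x = (\<lambda>j. if j = n then gr_class H n x else corad_below H j)"

definition gr_alg :: "('k::field, 'a, 'm) bialg_scheme \<Rightarrow> ('k, nat \<Rightarrow> 'a set) module" where
  "gr_alg H =
     \<lparr>carrier = {c. (\<forall>n. \<exists>x\<in>corad_filt H n. c n = gr_class H n x) \<and>
                    finite {n. c n \<noteq> corad_below H n}},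
      monoid.mult = (\<lambda>c d n. gr_class H n (\<Oplus>\<^bsub>H\<^esub>i\<in>{..n}. rep (c i) \<otimes>\<^bsub>H\<^esub> rep (d (n - i)))),
      one = gr_hom H 0 \<one>\<^bsub>H\<^esub>,
      ring.zero = (\<lambda>n. corad_below H n),
      ring.add = (\<lambda>c d n. c n <+>\<^bsub>H\<^esub> d n),
      module.smult = (\<lambda>a c n. gr_class H n (a \<odot>\<^bsub>H\<^esub> rep (c n)))\<rparr>"

text \<open>
  The coradical filtration satisfies \<open>\<Delta>(H\<^sub>n) \<subseteq> \<Sum>\<^sub>i H\<^sub>i \<otimes> H\<^sub>n\<^sub>-\<^sub>i\<close>. If \<open>x \<in> H\<^sub>n\<close> and
  \<open>\<Delta>(x) = \<Sum> u \<otimes> v\<close> with \<open>u \<in> H\<^sub>i\<close>, \<open>v \<in> H\<^sub>n\<^sub>-\<^sub>i\<close> (each summand with its own \<open>i\<close>), then the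
  comultiplication of \<open>gr(H)\<close> sends the class of \<open>x\<close> in degree \<open>n\<close> to the sum of
  the tensors of the classes of \<open>u\<close> in degree \<open>i\<close> and of \<open>v\<close> in degree \<open>n - i\<close>.
\<close>

definition gr_comult_hom ::
  "('k::field, 'a, 'm) bialg_scheme \<Rightarrow> nat \<Rightarrow> 'a \<Rightarrow> ('k, nat \<Rightarrow> 'a set, nat \<Rightarrow> 'a set) tensor" where
  "gr_comult_hom H n x =
     (THE t. \<exists>ps.
        (\<forall>(i, u, v)\<in>set ps. i \<le> n \<and> u \<in> corad_filt H i \<and> v \<in> corad_filt H (n - i)) \<and>
        comult H x = tensor_sum H H (map snd ps) \<and>
        t = tensor_sum (gr_alg H) (gr_alg H)
              (map (\<lambda>(i, u, v). (gr_hom H i u, gr_hom H (n - i) v)) ps))"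

definition gr :: "('k::field, 'a, 'm) bialg_scheme \<Rightarrow> ('k, nat \<Rightarrow> 'a set) bialg" where
  "gr H = module.extend (gr_alg H) (bialg.fields
     (\<lambda>c \<beta>. \<Sum>n | c n \<noteq> corad_below H n. gr_comult_hom H n (rep (c n)) \<beta>)
     (\<lambda>c. counit H (rep (c 0))))"

definition coradically_graded :: "('k::field, 'a, 'm) bialg_scheme \<Rightarrow> bool" where
  "coradically_graded H \<longleftrightarrow> hopf_isomorphic H (gr H)"

section \<open>Nichols algebras of rank two over abelian groups and their bosonizations\<close>

text \<open>
  A Yetter-Drinfeld module \<open>V\<close> over the group algebra of an abelian group \<open>G\<close> with basis
  \<open>x\<^sub>1, x\<^sub>2\<close>, where \<open>x\<^sub>i\<close> has degree \<open>\<gamma> i\<close> and \<open>G\<close> acts on \<open>x\<^sub>i\<close> by the character \<open>\<chi> i\<close>, is given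
  by \<open>\<gamma>\<close> and \<open>\<chi>\<close>; only their values at \<open>1\<close> and \<open>2\<close> matter.
\<close>

definition yd_datum ::
  "('g, 'm) monoid_scheme \<Rightarrow> (nat \<Rightarrow> 'g) \<Rightarrow> (nat \<Rightarrow> 'g \<Rightarrow> 'k::field) \<Rightarrow> bool" where
  "yd_datum G \<gamma> \<chi> \<longleftrightarrow> (\<forall>i\<in>{1, 2}. \<gamma> i \<in> carrier G \<and> \<chi> i \<in> hom G (mult_of fld))"

definition type_A2 :: "(nat \<Rightarrow> 'g) \<Rightarrow> (nat \<Rightarrow> 'g \<Rightarrow> 'k::field) \<Rightarrow> 'k \<Rightarrow> bool" where
  "type_A2 \<gamma> \<chi> q \<longleftrightarrow>
     \<chi> 1 (\<gamma> 1) = q \<and> \<chi> 2 (\<gamma> 2) = q \<and> \<chi> 1 (\<gamma> 2) * \<chi> 2 (\<gamma> 1) = inverse q"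

definition type_B2 :: "(nat \<Rightarrow> 'g) \<Rightarrow> (nat \<Rightarrow> 'g \<Rightarrow> 'k::field) \<Rightarrow> 'k \<Rightarrow> bool" where
  "type_B2 \<gamma> \<chi> q \<longleftrightarrow>
     \<chi> 1 (\<gamma> 1) = q\<^sup>2 \<and> \<chi> 2 (\<gamma> 2) = q \<and> \<chi> 1 (\<gamma> 2) * \<chi> 2 (\<gamma> 1) = inverse (q\<^sup>2)"

definition root_of_unity_of_order :: "'k::field \<Rightarrow> nat \<Rightarrow> bool" where
  "root_of_unity_of_order q m \<longleftrightarrow> 0 < m \<and> q ^ m = 1 \<and> (\<forall>j. 0 < j \<and> j < m \<longrightarrow> q ^ j \<noteq> 1)"

definition fin_supp :: "'z set \<Rightarrow> ('z \<Rightarrow> 'k::zero) set" where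
  "fin_supp Z = {f. finite {z. f z \<noteq> 0} \<and> {z. f z \<noteq> 0} \<subseteq> Z}"

definition single :: "'z \<Rightarrow> 'z \<Rightarrow> 'k::zero_neq_one" where
  "single z = (\<lambda>y. if y = z then 1 else 0)"

text \<open>The tensor algebra \<open>T(V)\<close>; its basis consists of the words in the letters \<open>1\<close> and \<open>2\<close>.\<close>

definition tensor_alg :: "('k::field, nat list \<Rightarrow> 'k) module" where
  "tensor_alg =
     \<lparr>carrier = fin_supp (lists {1, 2}),
      monoid.mult = (\<lambda>f h w. \<Sum>i\<le>length w. f (take i w) * h (drop i w)),
      one = single [],
      ring.zero = (\<lambda>w. 0),
      ring.add = (\<lambda>f h w. f w + h w),
      module.smult = (\<lambda>a f w. a * f w)\<rparr>"

definition word_char :: "(nat \<Rightarrow> 'g \<Rightarrow> 'k::field) \<Rightarrow> nat list \<Rightarrow> 'g \<Rightarrow> 'k" where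
  "word_char \<chi> w g = (\<Prod>i\<leftarrow>w. \<chi> i g)"

definition word_deg :: "('g, 'm) monoid_scheme \<Rightarrow> (nat \<Rightarrow> 'g) \<Rightarrow> nat list \<Rightarrow> 'g" where
  "word_deg G \<gamma> w = foldr (\<lambda>i s. \<gamma> i \<otimes>\<^bsub>G\<^esub> s) w \<one>\<^bsub>G\<^esub>"

text \<open>
  The comultiplication of the braided Hopf algebra \<open>T(V)\<close> on words, as a list of terms
  \<open>(c, u, v)\<close> standing for \<open>c (u \<otimes> v)\<close>. It is the algebra map to the braided tensor square of
  \<open>T(V)\<close> with \<open>\<Delta>(x\<^sub>i) = x\<^sub>i \<otimes> 1 + 1 \<otimes> x\<^sub>i\<close>; since the braiding maps \<open>x\<^sub>i \<otimes> u\<close> to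
  \<open>\<chi>\<^sub>u(g\<^sub>i) u \<otimes> x\<^sub>i\<close>, one has \<open>(x\<^sub>i \<otimes> 1)(u \<otimes> v) = x\<^sub>i u \<otimes> v\<close> and
  \<open>(1 \<otimes> x\<^sub>i)(u \<otimes> v) = \<chi>\<^sub>u(g\<^sub>i) (u \<otimes> x\<^sub>i v)\<close>.
\<close>

primrec word_comult ::
  "(nat \<Rightarrow> 'g) \<Rightarrow> (nat \<Rightarrow> 'g \<Rightarrow> 'k::field) \<Rightarrow> nat list \<Rightarrow> ('k \<times> nat list \<times> nat list) list" where
  "word_comult \<gamma> \<chi> [] = [(1, [], [])]"
| "word_comult \<gamma> \<chi> (i # w) =
     concat (map (\<lambda>(c, u, v). [(c, i # u, v), (c * word_char \<chi> u (\<gamma> i), u, i # v)])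
       (word_comult \<gamma> \<chi> w))"

definition braided_comult ::
  "(nat \<Rightarrow> 'g) \<Rightarrow> (nat \<Rightarrow> 'g \<Rightarrow> 'k::field) \<Rightarrow> (nat list \<Rightarrow> 'k)
     \<Rightarrow> ('k, nat list \<Rightarrow> 'k, nat list \<Rightarrow> 'k) tensor" where
  "braided_comult \<gamma> \<chi> f = (\<lambda>\<beta>. \<Sum>w | f w \<noteq> 0. f w *
     (\<Sum>(c, u, v)\<leftarrow>word_comult \<gamma> \<chi> w.
        c * pure_tensor tensor_alg tensor_alg (single u) (single v) \<beta>))"

text \<open>
  \<open>\<BB>(V) = T(V)/I(V)\<close>, where \<open>I(V)\<close> is the sum of all homogeneous ideals of \<open>T(V)\<close> that are generated
  in degrees at least two and are coideals for the braided comultiplication.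
\<close>

definition nichols_ideal ::
  "(nat \<Rightarrow> 'g) \<Rightarrow> (nat \<Rightarrow> 'g \<Rightarrow> 'k::field) \<Rightarrow> (nat list \<Rightarrow> 'k) set" where
  "nichols_ideal \<gamma> \<chi> = lspan tensor_alg (\<Union>{I.
     ideal I (tensor_alg :: ('k, nat list \<Rightarrow> 'k) module) \<and>
     (\<forall>f\<in>I. \<forall>n. (\<lambda>w. if length w = n then f w else 0) \<in> I) \<and>
     (\<forall>f\<in>I. \<forall>w. length w < 2 \<longrightarrow> f w = 0) \<and>
     (\<forall>f\<in>I. braided_comult \<gamma> \<chi> f \<in>
        tensors tensor_alg tensor_alg (I \<times> carrier tensor_alg \<union> carrier tensor_alg \<times> I))})"

text \<open>
  The bosonization \<open>T(V) # kG\<close>. Its basis consists of the pairs \<open>(w, g)\<close>, standing for \<open>w # g\<close>,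
  with \<open>(v # g)(w # h) = v (g \<cdot> w) # g h\<close> and
  \<open>\<Delta>(w # g) = \<Sum> (w\<^sup>(\<^sup>1\<^sup>) # (w\<^sup>(\<^sup>2\<^sup>))\<^sub>(\<^sub>-\<^sub>1\<^sub>) g) \<otimes> ((w\<^sup>(\<^sup>2\<^sup>))\<^sub>(\<^sub>0\<^sub>) # g)\<close>.
\<close>

definition smash_alg ::
  "('g, 'm) monoid_scheme \<Rightarrow> (nat \<Rightarrow> 'g \<Rightarrow> 'k::field) \<Rightarrow> ('k, nat list \<times> 'g \<Rightarrow> 'k) module" where
  "smash_alg G \<chi> =
     \<lparr>carrier = fin_supp (lists {1, 2} \<times> carrier G),
      monoid.mult = (\<lambda>f f' z. \<Sum>(v, g) | f (v, g) \<noteq> 0. \<Sum>(w, h) | f' (w, h) \<noteq> 0.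
         f (v, g) * f' (w, h) * word_char \<chi> w g * single (v @ w, g \<otimes>\<^bsub>G\<^esub> h) z),
      one = single ([], \<one>\<^bsub>G\<^esub>),
      ring.zero = (\<lambda>z. 0),
      ring.add = (\<lambda>f f' z. f z + f' z),
      module.smult = (\<lambda>a f z. a * f z)\<rparr>"

definition tensor_bosonization ::
  "('g, 'm) monoid_scheme \<Rightarrow> (nat \<Rightarrow> 'g) \<Rightarrow> (nat \<Rightarrow> 'g \<Rightarrow> 'k::field)
     \<Rightarrow> ('k, nat list \<times> 'g \<Rightarrow> 'k) bialg" where
  "tensor_bosonization G \<gamma> \<chi> = module.extend (smash_alg G \<chi>) (bialg.fields
     (\<lambda>f \<beta>. \<Sum>(w, g) | f (w, g) \<noteq> 0. f (w, g) *
        (\<Sum>(c, u, v)\<leftarrow>word_comult \<gamma> \<chi> w.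
           c * pure_tensor (smash_alg G \<chi>) (smash_alg G \<chi>)
                 (single (u, word_deg G \<gamma> v \<otimes>\<^bsub>G\<^esub> g)) (single (v, g)) \<beta>))
     (\<lambda>f. \<Sum>(w, g) | f (w, g) \<noteq> 0. if w = [] then f (w, g) else 0))"

definition quotient_alg ::
  "('k::field, 'a, 'm) module_scheme \<Rightarrow> 'a set \<Rightarrow> ('k, 'a set) module" where
  "quotient_alg H I = ring.extend (H Quot I) (module.fields (\<lambda>a C. I +>\<^bsub>H\<^esub> (a \<odot>\<^bsub>H\<^esub> rep C)))"

definition quotient_bialg ::
  "('k::field, 'a, 'm) bialg_scheme \<Rightarrow> 'a set \<Rightarrow> ('k, 'a set) bialg" where
  "quotient_bialg H I = module.extend (quotient_alg H I) (bialg.fields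
     (\<lambda>C. tensor_map (quotient_alg H I) (\<lambda>x. I +>\<^bsub>H\<^esub> x) (comult H (rep C)))
     (\<lambda>C. counit H (rep C)))"

text \<open>
  \<open>\<BB>(V) # kG\<close>, as the quotient of \<open>T(V) # kG\<close> by the Hopf ideal \<open>I(V) # kG\<close>, the kernel of the
  canonical map from \<open>T(V) \<otimes> kG\<close> onto \<open>\<BB>(V) \<otimes> kG\<close>. An element of \<open>T(V) # kG\<close> belongs to it if and
  only if its coefficient in \<open>T(V)\<close> at each \<open>g \<in> G\<close> lies in \<open>I(V)\<close>.
\<close>

definition nichols_bosonization ::
  "('g, 'm) monoid_scheme \<Rightarrow> (nat \<Rightarrow> 'g) \<Rightarrow> (nat \<Rightarrow> 'g \<Rightarrow> 'k::field)
     \<Rightarrow> ('k, (nat list \<times> 'g \<Rightarrow> 'k) set) bialg" where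
  "nichols_bosonization G \<gamma> \<chi> = quotient_bialg (tensor_bosonization G \<gamma> \<chi>)
     {f \<in> carrier (smash_alg G \<chi>). \<forall>g\<in>carrier G. (\<lambda>w. f (w, g)) \<in> nichols_ideal \<gamma> \<chi>}"

end

theory Submission
 imports Defs "HOL-Library.Function_Algebras"
begin

text \<open>
 Write \<open>G = G(H)\<close>, \<open>g\<^sub>i\<close> for the degree of \<open>x\<^sub>i\<close> and \<open>q\<^sub>i\<^sub>j = \<chi>\<^sub>j(g\<^sub>i)\<close>. The isomorphism from \<open>gr(H)\<close> identifies
 \<open>G\<close> with the group-likes of the bosonization, and it provides elements \<open>y\<^sub>1, y\<^sub>2\<close> of \<open>H\<^sub>1\<close> with
 \<open>\<Delta>(y\<^sub>i) = g\<^sub>i \<otimes> y\<^sub>i + y\<^sub>i \<otimes> 1\<close> and \<open>g y\<^sub>i = \<chi>\<^sub>i(g) y\<^sub>i g\<close> (\<open>exact_generator\<close>). They define a surjective bialgebra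
 map \<open>\<Phi>\<close> from \<open>T(V) # kG\<close> to \<open>H\<close>, and the leading parts of the elements of its kernel are
 relations of the Nichols algebra (\<open>leading_part\<close>). Hence \<open>H\<close> is isomorphic to \<open>gr(H)\<close> as soon as
 \<open>\<Phi>\<close> kills \<open>I(V) # kG\<close>, that is, if no relation of the Nichols algebra is deformed in \<open>H\<close>.

 Let \<open>H\<close> act inner faithfully on the field \<open>L\<close>. The elements of \<open>G\<close> act as automorphisms \<open>\<sigma>\<^sub>g\<close> of \<open>L\<close>, which
 are linearly independent over \<open>L\<close> (Dedekind). As \<open>L\<close> is commutative, \<open>y\<^sub>i\<close> acts as
 \<open>w\<^sub>i (1 - \<sigma>\<^sub>g)\<close> with \<open>g = g\<^sub>i\<close> for some \<open>w\<^sub>i \<noteq> 0\<close> in \<open>L\<close> with \<open>g w\<^sub>i = \<chi>\<^sub>i(g) w\<^sub>i\<close> (\<open>weight_exists\<close>). Two facts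
 control skew-primitive elements: one that acts by zero vanishes, because it generates a Hopf ideal
 (\<open>skew_prim_faithful\<close>), and every one on which \<open>G\<close> acts by a character is a combination of group-likes and
 of the \<open>y\<^sub>i\<close> that have the same character (\<open>skew_prim_form\<close>).

 In both types \<open>q\<^sub>1\<^sub>1 q\<^sub>1\<^sub>2 q\<^sub>2\<^sub>1 = 1\<close>, so that the quantum Serre element of degree \<open>(2, 1)\<close> is mapped to a
 skew-primitive element of \<open>H\<close>. Its character is that of no \<open>y\<^sub>i\<close> and is not trivial, so this element
 is zero. The coefficient of the identity in its action is a multiple of \<open>w\<^sub>1\<^sup>2 w\<^sub>2\<close>, and its vanishing means
 \<open>q\<^sub>1\<^sub>2 = 1\<close> or \<open>q\<^sub>1\<^sub>1 q\<^sub>1\<^sub>2 = 1\<close> (\<open>braiding_degenerate\<close>). The matrix \<open>(q\<^sub>i\<^sub>j)\<close> has become so degenerate that the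
 character \<open>\<chi>\<^sub>1\<^sup>a \<chi>\<^sub>2\<^sup>b\<close> determines \<open>a\<close> and \<open>b\<close> modulo \<open>m\<close> (\<open>characters_independent\<close>).

 Now let \<open>f\<close> be a relation of bidegree \<open>(a, b)\<close> and suppose that \<open>\<Phi>\<close> kills all shorter relations. Then
 \<open>\<Phi>(f)\<close> is skew-primitive of character \<open>\<chi>\<^sub>1\<^sup>a \<chi>\<^sub>2\<^sup>b\<close>. If it is not zero, then it is a nonzero multiple of \<open>1 - g\<close>
 or of some \<open>y\<^sub>i\<close>, so the coefficient of the identity in its action is a nonzero multiple of a monomial of degree at
 most one in \<open>w\<^sub>1, w\<^sub>2\<close>. But that coefficient is also a multiple of \<open>w\<^sub>1\<^sup>a w\<^sub>2\<^sup>b\<close>, and the exponents agree modulo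
 \<open>m\<close>; so some monomial in the \<open>m\<close>th powers of \<open>w\<^sub>1\<close> and \<open>w\<^sub>2\<close> lies in \<open>k\<close>. Only the monomial \<open>1\<close> does
 (\<open>wmono_scalar\<close>), whence \<open>a + b \<le> 1\<close>, which is impossible for a relation (\<open>skew_prim_action_zero\<close>).
\<close>

section \<open>Linear algebra\<close>

abbreviation subspace :: "'a set => ('k::field, 'a, 'm) module_scheme => bool" where
 "subspace N M \<equiv> submodule N (fld :: 'k ring) M"

abbreviation "car \<equiv> carrier"

locale kspace = module fld M for M :: "('k::field, 'a, 'm) module_scheme" (structure)
begin

lemma smult_closed' [simp, intro]: "x:car M ==> a\<odot>x:car M"
 by(simp add: ring_of_type_algebra_def)

lemma smult_simps [simp]:
 assumes "x:car M"
 shows "1\<odot>x = x" "0\<odot>x = \<zero>" "a\<odot>(b\<odot>x) = (a * b)\<odot>x"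
  "a\<odot>x\<oplus>b\<odot>x = (a + b)\<odot>x"
 using assms smult_one[of x] smult_l_null[of x] smult_assoc1[of a b x] smult_l_distr[of a b x]
 by(simp_all add: ring_of_type_algebra_def)

lemma smult_add: "[|x:car M; y:car M|] ==> a\<odot>(x\<oplus>y) = a\<odot>x\<oplus>a\<odot>y"
 using smult_r_distr[of a x y] by(simp add: ring_of_type_algebra_def)

lemma smult_zero [simp]: "a\<odot>\<zero> = \<zero>"
 by(simp add: ring_of_type_algebra_def)

lemma neg_eq_smult: "x:car M ==> \<ominus> x = (- 1)\<odot>x"
proof -
 assume x: "x:car M"
 have "(- 1)\<odot>x\<oplus>x = \<zero>"
  using x smult_simps(4)[OF x, of "- 1" 1] by simp
 thus ?thesis
  using x by(metis M.minus_equality smult_closed')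
qed

lemma minus_eq_smult: "[|x:car M; y:car M|] ==> x\<ominus>y = x\<oplus>(- 1)\<odot>y"
 by(simp add: M.minus_eq neg_eq_smult)

lemma smult_eq_zero_iff: "x:car M ==> a\<odot>x = \<zero> \<longleftrightarrow> a = 0 \<or> x = \<zero>"
 by(metis left_inverse smult_simps(1,2,3) smult_zero)

lemma smult_finsum:
 "[|finite I; f:I \<rightarrow> car M|] ==> a\<odot>(\<Oplus>i\<in>I. f i) = (\<Oplus>i\<in>I. a\<odot>f i)"
 using finsum_smult_ldistr[of I a f] by(simp add: ring_of_type_algebra_def)

lemma subI:
 assumes "N \<subseteq> car M" "\<zero>:N" "!!x y. [|x:N; y:N|] ==> x\<oplus>y:N"
  and "!!a x. x:N ==> a\<odot>x:N"
 shows "subspace N M"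
 using assms by(intro submoduleI) (auto simp: neg_eq_smult subset_iff)

lemma subD:
 assumes "subspace N M"
 shows sub_subset: "N \<subseteq> car M"
  and sub_zero: "\<zero>:N"
  and sub_add: "[|x:N; y:N|] ==> x\<oplus>y:N"
  and sub_smult: "x:N ==> a\<odot>x:N"
  and sub_minus: "[|x:N; y:N|] ==> x\<ominus>y:N"
proof -
 note E = submoduleE[OF assms]
 show 1: "N \<subseteq> car M" and add: "!!x y. [|x:N; y:N|] ==> x\<oplus>y:N"
  using E by auto
 show sm: "!!a x. x:N ==> a\<odot>x:N"
  using E(4) by(simp add: ring_of_type_algebra_def)
 obtain z where "z:N" using E(2) by auto
 thus "\<zero>:N" using sm[of z 0] 1 by auto
 show "[|x:N; y:N|] ==> x\<ominus>y:N"
  using add[of x "(-1)\<odot>y"] sm[of y "-1"] subsetD[OF 1] minus_eq_smult[of x y] by simp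
qed

lemma sub_mem: "[|subspace N M; x:N|] ==> x:car M"
 using sub_subset by auto

lemma sub_finsum:
 assumes "subspace N M" "finite I" "!!i. i:I ==> f i:N"
 shows "(\<Oplus>i\<in>I. f i):N"
 using assms(2,3)
proof(induction I rule: finite_induct)
 case empty show ?case using sub_zero[OF assms(1)] by simp
next
 case (insert i I)
 have "f:insert i I \<rightarrow> car M"
  using insert.prems sub_subset[OF assms(1)] by auto
 hence "(\<Oplus>i\<in>insert i I. f i) = f i\<oplus>(\<Oplus>i\<in>I. f i)"
  using insert.hyps by(subst M.finsum_insert) auto
 thus ?case
  using insert by(auto intro!: sub_add[OF assms(1)])
qed

lemma whole_sub: "subspace (car M) M"
 by(rule carrier_is_submodule)

lemma zero_sub: "subspace {\<zero>} M"
 by(rule subI) auto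

lemma lspan_least: "[|subspace N M; B \<subseteq> N|] ==> lspan M B \<subseteq> N"
 unfolding lspan_def by auto

lemma lspan_superset: "B \<subseteq> lspan M B"
 unfolding lspan_def by auto

lemma lspan_sub:
 assumes "B \<subseteq> car M"
 shows "subspace (lspan M B) M"
proof(rule subI)
 show "lspan M B \<subseteq> car M"
  using assms whole_sub by(auto simp: lspan_def)
qed (auto simp: lspan_def sub_zero sub_add sub_smult)

lemma lspan_range_smult:
 assumes "x:car M"
 shows "subspace (range (%a. a\<odot>x)) M"
proof(rule subI)
 show "\<zero>:range (%a. a\<odot>x)"
  using assms by(auto intro!: range_eqI[of _ _ 0])
qed (use assms in auto)

subsection \<open>Linear forms\<close>

lemma linear_formI:
 assumes "!!x y. [|x:car M; y:car M|] ==> f (x\<oplus>y) = f x + f y"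
  and "!!a x. x:car M ==> f (a\<odot>x) = a * f x"
 shows "linear_form M f"
 using assms by(simp add: linear_form_def)

lemma linear_formD:
 assumes "linear_form M f"
 shows lf_add: "[|x:car M; y:car M|] ==> f (x\<oplus>y) = f x + f y"
  and lf_smult: "x:car M ==> f (a\<odot>x) = a * f x"
 using assms by(auto simp: linear_form_def)

lemma lf_zero: "linear_form M f ==> f \<zero> = 0"
 using lf_smult[of f "\<zero>" 0] by simp

lemma lf_minus:
 "[|linear_form M f; x:car M; y:car M|] ==> f (x\<ominus>y) = f x - f y"
 by(simp add: minus_eq_smult lf_add lf_smult)

lemma lf_finsum:
 assumes "linear_form M f" "finite I" "!!i. i:I ==> x i:car M"
 shows "f (\<Oplus>i\<in>I. x i) = (\<Sum>i\<in>I. f (x i))"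
 using assms(2,3)
proof(induction I rule: finite_induct)
 case empty show ?case using lf_zero[OF assms(1)] by simp
next
 case (insert i I)
 thus ?case
  by(subst M.finsum_insert) (auto simp: lf_add[OF assms(1)])
qed

lemma lf_sum:
 "(!!i. i:I ==> linear_form M (f i)) ==> linear_form M (%x. \<Sum>i\<in>I. c i * f i x)"
 by(auto intro!: linear_formI simp: lf_add lf_smult sum.distrib sum_distrib_left algebra_simps)

lemma lf_const: "linear_form M f ==> linear_form M (%x. c * f x)"
 by(auto intro!: linear_formI simp: lf_add lf_smult algebra_simps)

lemma lf_null: "linear_form M (%x. 0)"
 by(auto intro!: linear_formI)

lemma lf_plus: "[|linear_form M f; linear_form M g|] ==> linear_form M (%x. f x + g x)"
 by(auto intro!: linear_formI simp: lf_add lf_smult algebra_simps)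

lemma lf_kernel: "linear_form M f ==> subspace {x:car M. f x = 0} M"
 by(intro subI) (auto simp: lf_zero lf_add lf_smult)

text \<open>Zorn's lemma yields a subspace that is maximal among those that contain \<open>N\<close> and avoid \<open>x\<close>;
 it is a hyperplane, and the coefficient of \<open>x\<close> modulo it is the wanted linear form.\<close>

lemma separating_form:
 assumes N: "subspace N M" and x: "x:car M" "x ~: N"
 shows "EX f. linear_form M f & (ALL y:N. f y = 0) & f x = 1"
proof -
 define A where "A = {P. subspace P M & N \<subseteq> P & x ~: P}"
 have "EX P:A. ALL Q:A. P \<subseteq> Q --> Q = P"
 proof(rule subset_Zorn_nonempty)
  show "A ~= {}" using N x by(auto simp: A_def)
  fix C assume C: "C ~= {}" "subset.chain A C"
  hence CA: "C \<subseteq> A" and chain: "!!P Q. [|P:C; Q:C|] ==> P \<subseteq> Q \<or> Q \<subseteq> P"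
   by(auto simp: subset.chain_def)
  have "subspace (\<Union>C) M"
  proof(rule subI)
   fix y z assume "y:\<Union>C" "z:\<Union>C"
   then obtain P Q where PQ: "P:C" "y:P" "Q:C" "z:Q" by auto
   then consider "z:P" | "y:Q" using chain[of P Q] by auto
   thus "y\<oplus>z:\<Union>C"
    by cases (use PQ CA in \<open>auto simp: A_def intro!: sub_add\<close>)
  qed (use C CA in \<open>auto simp: A_def dest: sub_subset sub_zero sub_smult\<close>)
  thus "\<Union>C\<in>A" using C CA by(auto simp: A_def)
 qed
 then obtain P where P: "subspace P M" "N \<subseteq> P" "x ~: P"
  and max: "!!Q. [|subspace Q M; P \<subseteq> Q; x ~: Q|] ==> Q = P"
  unfolding A_def by auto
 have ex: "EX c. y\<ominus>c\<odot>x:P" if y: "y:car M" for y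
 proof(cases "y:P")
  case True
  thus ?thesis using x by(intro exI[of _ 0]) (simp add: sub_zero[OF P(1)] minus_eq_smult y)
 next
  case False
  define Q where "Q = {p\<oplus>c\<odot>y | p c. p:P}"
  have PM: "p:car M" if "p:P" for p using that sub_subset[OF P(1)] by auto
  have "subspace Q M"
  proof(rule subI)
   show "Q \<subseteq> car M" using y PM by(auto simp: Q_def)
   show "\<zero>:Q"
    unfolding Q_def using y by(auto intro!: exI[of _ "\<zero>"] exI[of _ 0] simp: sub_zero[OF P(1)])
   show "u\<oplus>v:Q" if uv: "u:Q" "v:Q" for u v
   proof -
    obtain p c p' c' where u: "u = p\<oplus>c\<odot>y" "p:P" and v: "v = p'\<oplus>c'\<odot>y" "p':P"
     using uv unfolding Q_def by auto
    have "u\<oplus>v = (p\<oplus>p')\<oplus>(c\<odot>y\<oplus>c'\<odot>y)"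
     using u v y PM by(simp add: M.a_ac del: smult_simps)
    hence "u\<oplus>v = (p\<oplus>p')\<oplus>(c + c')\<odot>y" using y by simp
    thus ?thesis unfolding Q_def using u v sub_add[OF P(1)] by auto
   qed
   show "a\<odot>u:Q" if uQ: "u:Q" for a u
   proof -
    obtain p c where u: "u = p\<oplus>c\<odot>y" "p:P" using uQ unfolding Q_def by auto
    hence "a\<odot>u = a\<odot>p\<oplus>(a * c)\<odot>y" using y PM by(simp add: smult_add)
    thus ?thesis unfolding Q_def using u sub_smult[OF P(1)] by auto
   qed
  qed
  moreover have "P \<subseteq> Q"
  proof
   fix p assume "p:P"
   thus "p:Q" unfolding Q_def
    using y PM by(intro CollectI exI[of _ p] exI[of _ 0]) simp
  qed
  moreover have "y:Q"
   unfolding Q_def using y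
   by(intro CollectI exI[of _ "\<zero>"] exI[of _ 1]) (simp add: sub_zero[OF P(1)])
  ultimately have "x:Q" using max False by auto
  then obtain p c where xp: "x = p\<oplus>c\<odot>y" and p: "p:P" unfolding Q_def by auto
  have c: "c ~= 0" using xp p P(3) y PM by auto
  have "y\<ominus>inverse c\<odot>x = (- inverse c)\<odot>p"
  proof -
   have "inverse c\<odot>x = inverse c\<odot>p\<oplus>y"
    using c y PM[OF p] by(simp add: xp smult_add)
   hence "y\<ominus>inverse c\<odot>x = y\<oplus>((- inverse c)\<odot>p\<oplus>(- 1)\<odot>y)"
    using y PM[OF p] by(simp add: minus_eq_smult smult_add)
   also have "... = (- inverse c)\<odot>p\<oplus>(y\<oplus>(- 1)\<odot>y)"
    using y PM[OF p] by(simp add: M.a_ac del: smult_simps)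
   also have "y\<oplus>(- 1)\<odot>y = \<zero>" using y smult_simps(4)[OF y, of 1 "- 1"] by simp
   finally show ?thesis using PM[OF p] by simp
  qed
  thus ?thesis using sub_smult[OF P(1) p] by metis
 qed
 have uniq: "c = c'" if "y:car M" "y\<ominus>c\<odot>x:P" "y\<ominus>c'\<odot>x:P" for y c c'
 proof(rule ccontr)
  assume ne: "c ~= c'"
  have "(y\<ominus>c'\<odot>x)\<ominus>(y\<ominus>c\<odot>x) = (y\<oplus>(- 1)\<odot>y)\<oplus>((- c')\<odot>x\<oplus>c\<odot>x)"
   using that x by(simp add: minus_eq_smult smult_add M.a_ac del: smult_simps(4))
  also have "y\<oplus>(- 1)\<odot>y = \<zero>" using that smult_simps(4)[of y 1 "- 1"] by simp
  finally have "(y\<ominus>c'\<odot>x)\<ominus>(y\<ominus>c\<odot>x) = (c - c')\<odot>x" using x by simp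
  hence "(c - c')\<odot>x:P" using that sub_minus[OF P(1)] by metis
  hence "inverse (c - c')\<odot>((c - c')\<odot>x):P" by(rule sub_smult[OF P(1)])
  thus False using ne x P(3) by simp
 qed
 define f where "f y = (THE c. y\<ominus>c\<odot>x:P)" for y
 have f: "f y = c" if "y:car M" "y\<ominus>c\<odot>x:P" for y c
  unfolding f_def using that uniq by auto
 have fP: "y\<ominus>f y\<odot>x:P" if "y:car M" for y
  using ex[OF that] f[OF that] by auto
 have "linear_form M f"
 proof(rule linear_formI)
  fix y z assume yz: "y:car M" "z:car M"
  have "(y\<oplus>z)\<ominus>(f y + f z)\<odot>x = (y\<ominus>f y\<odot>x)\<oplus>(z\<ominus>f z\<odot>x)"
   using yz x smult_simps(4)[OF x(1), of "- f y" "- f z"]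
   by(simp add: minus_eq_smult M.a_ac del: smult_simps(4))
  also have "...:P" using fP yz by(intro sub_add[OF P(1)]) auto
  finally show "f (y\<oplus>z) = f y + f z" using yz by(intro f) auto
 next
  fix a y assume y: "y:car M"
  have "a\<odot>y\<ominus>(a * f y)\<odot>x = a\<odot>(y\<ominus>f y\<odot>x)"
   using y x by(simp add: minus_eq_smult smult_add)
  also have "...:P" using fP y by(intro sub_smult[OF P(1)]) auto
  finally show "f (a\<odot>y) = a * f y" using y by(intro f) auto
 qed
 moreover have "f y = 0" if "y:N" for y
  using that P(2) x sub_subset[OF P(1)] by(intro f) (auto simp: minus_eq_smult subset_iff)
 moreover have "f x = 1"
  using x by(intro f) (auto simp: M.minus_eq M.r_neg sub_zero[OF P(1)])
 ultimately show ?thesis by auto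
qed

lemma eq_if_forms_eq:
 assumes "x:car M" "y:car M" "!!f. linear_form M f ==> f x = f y"
 shows "x = y"
proof(rule ccontr)
 assume "x ~= y"
 hence "x\<ominus>y ~: {\<zero>}" using assms(1,2) M.minus_eq by(metis M.a_inv_closed M.add.inv_equality M.add.inv_inv singletonD)
 then obtain f where "linear_form M f" "f (x\<ominus>y) = 1"
  using separating_form[OF zero_sub, of "x\<ominus>y"] assms(1,2) by auto
 thus False using assms(1,2) assms(3)[of f] by(simp add: lf_minus)
qed

lemma mem_if_forms_vanish:
 assumes "subspace N M" "x:car M"
  "!!f. [|linear_form M f; !!y. y:N ==> f y = 0|] ==> f x = 0"
 shows "x:N"
 using separating_form[OF assms(1,2)] assms(3) by fastforce

end

subsection \<open>Dual bases\<close>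

context kspace
begin

definition dual_system :: "'a set => ('a => 'a => 'k) => bool" where
 "dual_system B phi \<longleftrightarrow> finite B & B \<subseteq> car M & (ALL b:B. linear_form M (phi b)) &
   (ALL b:B. ALL c:B. phi b c = (if b = c then 1 else 0))"

definition proj :: "'a set => ('a => 'a => 'k) => 'a => 'a" where
 "proj B phi x = (\<Oplus>b\<in>B. phi b x\<odot>b)"

abbreviation "spans B phi \<equiv> (ALL x:car M. proj B phi x = x)"

lemma dual_systemD:
 assumes "dual_system B phi"
 shows "finite B" "B \<subseteq> car M" "b:B ==> linear_form M (phi b)" "b:B ==> b:car M"
  "[|b:B; c:B|] ==> phi b c = (if b = c then 1 else 0)"
 using assms by(auto simp: dual_system_def)

lemma proj_closed: "dual_system B phi ==> proj B phi x:car M"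
 unfolding proj_def by(rule M.finsum_closed) (auto dest: dual_systemD)

lemma proj_mem:
 assumes "subspace N M" "finite B" "B \<subseteq> N"
 shows "proj B phi x:N"
 unfolding proj_def using assms by(intro sub_finsum sub_smult) auto

lemma lf_proj:
 assumes "dual_system B phi" "linear_form M f"
 shows "f (proj B phi x) = (\<Sum>b\<in>B. phi b x * f b)"
proof -
 have "f (proj B phi x) = (\<Sum>b\<in>B. f (phi b x\<odot>b))"
  unfolding proj_def using dual_systemD[OF assms(1)] by(intro lf_finsum[OF assms(2)]) auto
 also have "... = (\<Sum>b\<in>B. phi b x * f b)"
  using dual_systemD(4)[OF assms(1)] by(intro sum.cong) (auto simp: lf_smult[OF assms(2)])
 finally show ?thesis .
qed

lemma form_proj:
 assumes "dual_system B phi" "b:B"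
 shows "phi b (proj B phi x) = phi b x"
proof -
 have "(\<Sum>c\<in>B. phi c x * phi b c) = (\<Sum>c\<in>B. if c = b then phi c x else 0)"
  using dual_systemD(5)[OF assms(1,2)] by(intro sum.cong) auto
 thus ?thesis
  using lf_proj[OF assms(1) dual_systemD(3)[OF assms]] assms(2) dual_systemD(1)[OF assms(1)] by simp
qed

lemma proj_fixed_sub:
 assumes "dual_system B phi"
 shows "subspace {x:car M. proj B phi x = x} M"
proof(rule subI)
 note D = dual_systemD[OF assms]
 show "\<zero>:{x:car M. proj B phi x = x}"
  using D by(auto simp: proj_def lf_zero intro!: M.add.finprod_one_eqI)
 fix x y assume "x:{x:car M. proj B phi x = x}" "y:{x:car M. proj B phi x = x}"
 hence xy: "x:car M" "proj B phi x = x" "y:car M" "proj B phi y = y" by auto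
 have "proj B phi (x\<oplus>y) = (\<Oplus>b\<in>B. phi b x\<odot>b\<oplus>phi b y\<odot>b)"
  unfolding proj_def using D xy by(intro M.finsum_cong') (auto simp: lf_add)
 also have "... = proj B phi x\<oplus>proj B phi y"
  unfolding proj_def using D by(intro M.finsum_addf) auto
 finally show "x\<oplus>y:{x:car M. proj B phi x = x}" using xy by simp
next
 fix a x assume "x:{x:car M. proj B phi x = x}"
 hence x: "x:car M" "proj B phi x = x" by auto
 note D = dual_systemD[OF assms]
 have "proj B phi (a\<odot>x) = (\<Oplus>b\<in>B. a\<odot>(phi b x\<odot>b))"
  unfolding proj_def using D x by(intro M.finsum_cong') (auto simp: lf_smult)
 also have "... = a\<odot>proj B phi x"
  unfolding proj_def using D by(intro smult_finsum[symmetric]) auto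
 finally show "a\<odot>x:{x:car M. proj B phi x = x}" using x by simp
qed auto

lemma proj_basis_element:
 assumes "dual_system B phi" "b:B"
 shows "proj B phi b = b"
proof(rule eq_if_forms_eq)
 note D = dual_systemD[OF assms(1)]
 fix f assume f: "linear_form M f"
 have "(\<Sum>c\<in>B. phi c b * f c) = (\<Sum>c\<in>B. if c = b then f c else 0)"
  using D(5) assms(2) by(intro sum.cong) auto
 thus "f (proj B phi b) = f b"
  using lf_proj[OF assms(1) f] D(1) assms(2) by simp
qed (use assms proj_closed dual_systemD in auto)

lemma dual_system_extend:
 assumes B: "dual_system B phi" and N: "subspace N M" "B \<subseteq> N"
  and x: "x:N" "proj B phi x ~= x"
 shows "EX y phi'. y:N & y ~: B & dual_system (insert y B) phi' & (ALL b:B. phi' b = phi b)"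
proof -
 note D = dual_systemD[OF B]
 have xM: "x:car M" using sub_mem[OF N(1) x(1)] .
 obtain psi where psi: "linear_form M psi" "!!y. [|y:car M; proj B phi y = y|] ==> psi y = 0" "psi x = 1"
  using separating_form[OF proj_fixed_sub[OF B] xM] x(2) by auto
 define y where "y = x\<ominus>proj B phi x"
 have yN: "y:N" unfolding y_def using x proj_mem[OF N(1) D(1) N(2)] by(intro sub_minus[OF N(1)])
 have psiB: "psi b = 0" if "b:B" for b using psi(2)[of b] that D(4) proj_basis_element[OF B that] by auto
 have "psi (proj B phi x) = 0"
  using lf_proj[OF B psi(1)] psiB by simp
 hence psiy: "psi y = 1" unfolding y_def using psi xM proj_closed[OF B] by(simp add: lf_minus)
 have phiy: "phi b y = 0" if "b:B" for b
  unfolding y_def using form_proj[OF B that] D(3)[OF that] xM proj_closed[OF B] by(simp add: lf_minus)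
 have "y ~: B" using psiy psiB by auto
 moreover have "dual_system (insert y B) (phi(y := psi))"
  unfolding dual_system_def using D psi(1) psiy psiB phiy sub_mem[OF N(1) yN] by auto
 ultimately show ?thesis using yN by(intro exI[of _ y] exI[of _ "phi(y := psi)"]) auto
qed

lemma dual_system_empty: "dual_system {} phi"
 by(simp add: dual_system_def)

end

locale fd_kspace = kspace M for M :: "('k::field, 'a, 'm) module_scheme" (structure) +
 assumes fin_dim: "finite_dimensional M"
begin

text \<open>The coordinate vectors of the elements of a dual system are unit vectors in the space spanned by
 the coordinate vectors of a finite generating set.\<close>

lemma dual_system_bounded: "EX n. ALL B phi. dual_system B phi --> card B <= n"
proof -
 obtain S where S: "finite S" "S \<subseteq> car M" "lspan M S = car M"
  using fin_dim by(auto simp: finite_dimensional_def)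
 interpret V: vector_space "%c (f :: 'a => 'k) x. c * f x"
  by unfold_locales (auto simp: fun_eq_iff algebra_simps)
 have "card B <= card S" if B: "dual_system B phi" for B phi
 proof -
  note D = dual_systemD[OF B]
  define v where "v x = (%b. if b:B then phi b x else 0)" for x
  have "subspace {x:car M. v x:V.span (v ` S)} M"
  proof(rule subI)
   have "v \<zero> = 0" using D(3) by(auto simp: v_def lf_zero)
   thus "\<zero>:{x:car M. v x:V.span (v ` S)}" using V.span_zero by simp
  next
   fix x y assume xy: "x:{x:car M. v x:V.span (v ` S)}" "y:{x:car M. v x:V.span (v ` S)}"
   hence "v (x\<oplus>y) = v x + v y" using D(3) by(auto simp: v_def lf_add)
   thus "x\<oplus>y:{x:car M. v x:V.span (v ` S)}" using xy V.span_add by simp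
  next
   fix a x assume x: "x:{x:car M. v x:V.span (v ` S)}"
   hence "v (a\<odot>x) = (%b. a * v x b)" using D(3) by(auto simp: v_def lf_smult)
   thus "a\<odot>x:{x:car M. v x:V.span (v ` S)}" using x V.span_scale by simp
  qed auto
  hence "lspan M S \<subseteq> {x:car M. v x:V.span (v ` S)}"
   using S(2) by(intro lspan_least) (auto intro: V.span_base)
  hence sub: "v ` B \<subseteq> V.span (v ` S)" using S(3) D(2) by auto
  have vb: "v b = (%c. if c = b then 1 else 0)" if "b:B" for b
   using that D(5) by(auto simp: v_def)
  have inj: "inj_on v B"
  proof(rule inj_onI)
   fix b c assume "b:B" "c:B" "v b = v c"
   thus "b = c" using vb[of b] vb[of c] by(metis zero_neq_one)
  qed
  have "V.independent (v ` B)"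
  proof
   assume "V.dependent (v ` B)"
   then obtain u w where uw: "w:v ` B" "u w ~= 0" "(\<Sum>w\<in>v ` B. (%x. u w * w x)) = 0"
    using V.dependent_finite[of "v ` B"] D(1) by auto
   then obtain b where b: "b:B" "w = v b" by auto
   have sum_fun: "(\<Sum>w\<in>A. h w) b = (\<Sum>w\<in>A. h w b)" for A and h :: "('a => 'k) => 'a => 'k"
    by(induction A rule: infinite_finite_induct) auto
   have "(\<Sum>w\<in>v ` B. (%x. u w * w x)) b = (\<Sum>w\<in>v ` B. u w * w b)"
    by(rule sum_fun)
   also have "... = (\<Sum>c\<in>B. u (v c) * v c b)" using inj by(simp add: sum.reindex)
   also have "... = (\<Sum>c\<in>B. if c = b then u (v c) else 0)"
    by(rule sum.cong) (auto simp: vb)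
   finally show False using uw b D(1) by simp
  qed
  hence "card (v ` B) <= card (v ` S)" using V.independent_span_bound[OF _ _ sub] S(1) by simp
  thus ?thesis using card_image[OF inj] card_image_le[OF S(1), of v] by simp
 qed
 thus ?thesis by auto
qed

definition dm :: "'a set => nat" where
 "dm N = Max {card B |B phi. dual_system B phi & B \<subseteq> N}"

lemma dm_finite: "finite {card B |B phi. dual_system B phi & B \<subseteq> N}"
proof -
 obtain n where "ALL B phi. dual_system B phi --> card B <= n" using dual_system_bounded by auto
 thus ?thesis by(intro finite_subset[OF _ finite_atMost[of n]]) auto
qed

lemma dm_attained: "EX B phi. dual_system B phi & B \<subseteq> N & card B = dm N"
proof -
 have "dm N:{card B |B phi. dual_system B phi & B \<subseteq> N}"
  unfolding dm_def using dual_system_empty by(intro Max_in dm_finite) blast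
 thus ?thesis by auto
qed

lemma dm_ge: "[|dual_system B phi; B \<subseteq> N|] ==> card B <= dm N"
 unfolding dm_def by(rule Max_ge[OF dm_finite]) blast

lemma dm_strict:
 assumes "subspace N M" "subspace N' M" "N \<subset> N'"
 shows "dm N < dm N'"
proof -
 obtain B phi where B: "dual_system B phi" "B \<subseteq> N" "card B = dm N" using dm_attained by blast
 obtain x where x: "x:N'" "x ~: N" using assms(3) by auto
 have "proj B phi x ~= x" using x proj_mem[OF assms(1) dual_systemD(1)[OF B(1)] B(2)] by metis
 then obtain y phi' where y: "y:N'" "y ~: B" "dual_system (insert y B) phi'"
  using dual_system_extend[OF B(1) assms(2) _ x(1)] B(2) assms(3) by auto
 have "card (insert y B) <= dm N'" using y B(2) assms(3) by(intro dm_ge) auto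
 thus ?thesis using B y dual_systemD(1)[OF B(1)] by simp
qed

lemma minimal_sub:
 assumes "P N" "!!N. P N ==> subspace N M"
 shows "EX K. P K & K \<subseteq> N & (ALL K'. P K' & K' \<subseteq> K --> K' = K)"
 using assms(1)
proof(induction "dm N" arbitrary: N rule: less_induct)
 case less
 show ?case
 proof(cases "EX K. P K & K \<subset> N")
  case True
  then obtain K where K: "P K" "K \<subset> N" by auto
  thus ?thesis using less.hyps[of K] dm_strict[of K N] assms(2) less.prems by(meson psubsetE subset_trans)
 next
  case False
  thus ?thesis using less.prems by auto
 qed
qed

lemma dual_system_complete:
 assumes "dual_system B phi" "subspace N M" "B \<subseteq> N"
 shows "EX B' phi'. dual_system B' phi' & B \<subseteq> B' & B' \<subseteq> N & (ALL b:B. phi' b = phi b) & (ALL x:N. proj B' phi' x = x)"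
proof -
 define A where "A = {(B', phi'). dual_system B' phi' & B \<subseteq> B' & B' \<subseteq> N & (ALL b:B. phi' b = phi b)}"
 have "ALL p. p:A --> card (fst p) < Suc (dm N)"
  using dm_ge by(auto simp: A_def le_imp_less_Suc)
 moreover have "(B, phi):A" using assms by(auto simp: A_def)
 ultimately obtain p where p: "p:A" "!!p'. p':A ==> card (fst p') <= card (fst p)"
  using ex_has_greatest_nat[of "%p. p:A" "(B, phi)" "%p. card (fst p)" "Suc (dm N)"] by blast
 obtain B' phi' where B': "p = (B', phi')" by(cases p)
 hence D: "dual_system B' phi'" "B \<subseteq> B'" "B' \<subseteq> N" "ALL b:B. phi' b = phi b" using p by(auto simp: A_def)
 have "proj B' phi' x = x" if xN: "x:N" for x
 proof(rule ccontr)
  assume "proj B' phi' x ~= x"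
  then obtain y phi'' where y: "y:N" "y ~: B'" "dual_system (insert y B') phi''" "ALL b:B'. phi'' b = phi' b"
   using dual_system_extend[OF D(1) assms(2) D(3) xN] by auto
  hence "(insert y B', phi''):A" using D by(auto simp: A_def)
  thus False using p(2)[of "(insert y B', phi'')"] B' y dual_systemD(1)[OF D(1)] by simp
 qed
 thus ?thesis using D by auto
qed

text \<open>A basis adapted to an exhaustive increasing sequence \<open>F\<close> of subspaces; \<open>d b\<close> is the first index at
 which the basis element \<open>b\<close> occurs.\<close>

definition adapted :: "(nat => 'a set) => 'a set => ('a => 'a => 'k) => ('a => nat) => bool" where
 "adapted F B phi d \<longleftrightarrow> dual_system B phi & (spans B phi) &
   (ALL b:B. b:F (d b)) & (ALL n. ALL x:F n. ALL b:B. n < d b --> phi b x = 0)"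

lemma adapted_exists:
 assumes sub: "!!n. subspace (F n) M" and mono: "!!n. F n \<subseteq> F (Suc n)"
  and exh: "F m = car M"
 shows "EX B phi d. adapted F B phi d"
proof -
 have mono': "F i \<subseteq> F j" if "i <= j" for i j using mono lift_Suc_mono_le[of F, OF _ that] by simp
 have "EX B phi d. dual_system B phi & B \<subseteq> F n & (ALL x:F n. proj B phi x = x) &
   (ALL b:B. b:F (d b) & d b <= n) & (ALL k<=n. ALL x:F k. ALL b:B. k < d b --> phi b x = 0)" for n
 proof(induction n)
  case 0
  obtain B phi where "dual_system B phi" "B \<subseteq> F 0" "ALL x:F 0. proj B phi x = x"
   using dual_system_complete[OF dual_system_empty sub[of 0]] by auto
  thus ?case by(intro exI[of _ B] exI[of _ phi] exI[of _ "%_. 0"]) auto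
 next
  case (Suc n)
  then obtain B phi d where B: "dual_system B phi" "B \<subseteq> F n" "ALL x:F n. proj B phi x = x"
   "ALL b:B. b:F (d b) & d b <= n" "ALL k<=n. ALL x:F k. ALL b:B. k < d b --> phi b x = 0" by auto
  obtain B' phi' where B': "dual_system B' phi'" "B \<subseteq> B'" "B' \<subseteq> F (Suc n)" "ALL b:B. phi' b = phi b"
   "ALL x:F (Suc n). proj B' phi' x = x"
   using dual_system_complete[OF B(1) sub[of "Suc n"]] B(2) mono[of n] by blast
  define d' where "d' b = (if b:B then d b else Suc n)" for b
  have "phi' b x = 0" if k: "k <= Suc n" "x:F k" "b:B'" "k < d' b" for k x b
  proof(cases "b:B")
   case True
   hence "k <= n" using k B(4) by(auto simp: d'_def)
   thus ?thesis using True k B(5) B'(4) by(auto simp: d'_def)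
  next
   case False
   hence "x:F n" using k mono'[of k n] by(auto simp: d'_def)
   hence "phi' b x = phi' b (proj B phi x)" using B(3) by simp
   also have "... = (\<Sum>c\<in>B. phi c x * phi' b c)" by(rule lf_proj[OF B(1) dual_systemD(3)[OF B'(1) k(3)]])
   also have "... = 0"
   proof(rule sum.neutral, rule ballI)
    fix c assume "c:B"
    hence "c:B'" "b ~= c" using B'(2) False by auto
    thus "phi c x * phi' b c = 0" using dual_systemD(5)[OF B'(1) k(3), of c] by simp
   qed
   finally show ?thesis .
  qed
  thus ?case using B B' by(intro exI[of _ B'] exI[of _ phi'] exI[of _ d']) (auto simp: d'_def)
 qed
 from this[of m] obtain B phi d where B: "dual_system B phi" "spans B phi"
   "ALL b:B. b:F (d b) & d b <= m" "ALL k<=m. ALL x:F k. ALL b:B. k < d b --> phi b x = 0"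
  using exh by auto
 hence "adapted F B phi d" unfolding adapted_def by(metis le_trans less_imp_le not_le_imp_less)
 thus ?thesis by auto
qed

lemma basis_exists: "EX B phi. dual_system B phi & (spans B phi)"
 using dual_system_complete[OF dual_system_empty whole_sub] by auto

lemma basis_adapted_to_sub:
 assumes "subspace U M"
 shows "EX B phi. dual_system B phi & (spans B phi) & (ALL b:B. b:U \<or> (ALL x:U. phi b x = 0))"
proof -
 define F where "F n = (if n = 0 then U else car M)" for n :: nat
 have "EX B phi d. adapted F B phi d"
  using assms whole_sub sub_subset[OF assms] by(intro adapted_exists[of F 1]) (auto simp: F_def)
 then obtain B phi d where A: "adapted F B phi d" by auto
 hence "b:U \<or> (ALL x:U. phi b x = 0)" if "b:B" for b
  using that unfolding adapted_def F_def by(metis gr0I)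
 thus ?thesis using A by(auto simp: adapted_def)
qed

end

subsection \<open>Tensors and bilinear forms\<close>

lemma bilformD:
 assumes "bilinear_form M N be"
 shows "x:car M ==> linear_form N (be x)" "y:car N ==> linear_form M (%x. be x y)"
 using assms by(auto simp: bilinear_form_def)

lemma tensor_sum_eval:
 "tensor_sum M N ps be = (if bilinear_form M N be then \<Sum>(x, y)\<leftarrow>ps. be x y else 0)"
 by(cases "bilinear_form M N be") (auto simp: tensor_sum_def pure_tensor_def case_prod_unfold)

lemma tensorsE:
 assumes "t:tensors M N P"
 obtains ps where "set ps \<subseteq> P" "t = tensor_sum M N ps"
 using assms by(auto simp: tensors_def)

lemma tensor_off_bilinear: "[|t:tensors M N P; \<not> bilinear_form M N be|] ==> t be = 0"
 by(auto elim!: tensorsE simp: tensor_sum_eval)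

lemma sum_list_sum: "(\<Sum>p\<leftarrow>ps. \<Sum>i\<in>I. f i p) = (\<Sum>i\<in>I. \<Sum>p\<leftarrow>ps. f i p :: 'k::comm_monoid_add)"
 by(induction ps) (auto simp: sum.distrib)

lemma sum_list_zero: "(!!p. p:set ps ==> f p = 0) ==> (\<Sum>p\<leftarrow>ps. f p) = (0 :: 'k::comm_monoid_add)"
 by(induction ps) auto

lemma tensor_vanish:
 assumes "t:tensors M N P" "!!x y. (x, y):P ==> be x y = 0"
 shows "t be = 0"
 using assms by(fastforce elim!: tensorsE simp: tensor_sum_eval intro!: sum_list_zero)

lemma tensor_cong:
 assumes "t:tensors M N P" "bilinear_form M N be" "bilinear_form M N be'"
  and "!!x y. (x, y):P ==> be x y = be' x y"
 shows "t be = t be'"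
 using assms by(fastforce elim!: tensorsE simp: tensor_sum_eval intro!: arg_cong[of _ _ sum_list])

lemma pure_tensor_eval: "bilinear_form M N be ==> pure_tensor M N x y be = be x y"
 by(simp add: pure_tensor_def)

context kspace
begin

lemma bil_add1:
 assumes "bilinear_form M M be" "x:car M" "x':car M" "y:car M"
 shows "be (x\<oplus>x') y = be x y + be x' y"
 by(rule lf_add[OF bilformD(2)[OF assms(1,4)] assms(2,3)])

lemma bil_add2:
 assumes "bilinear_form M M be" "y:car M" "y':car M" "x:car M"
 shows "be x (y\<oplus>y') = be x y + be x y'"
 by(rule lf_add[OF bilformD(1)[OF assms(1,4)] assms(2,3)])

lemma bil_smult1:
 assumes "bilinear_form M M be" "x:car M" "y:car M"
 shows "be (a\<odot>x) y = a * be x y"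
 by(rule lf_smult[OF bilformD(2)[OF assms(1,3)] assms(2)])

lemma bil_smult2:
 assumes "bilinear_form M M be" "x:car M" "y:car M"
 shows "be x (a\<odot>y) = a * be x y"
 by(rule lf_smult[OF bilformD(1)[OF assms(1,2)] assms(3)])

lemma bil_prod: "[|linear_form M f; linear_form M g|] ==> bilinear_form M M (%x y. f x * g y)"
 unfolding bilinear_form_def by(auto intro!: linear_formI simp: lf_add lf_smult algebra_simps)

lemma bil_plus:
 "[|bilinear_form M M be; bilinear_form M M be'|] ==> bilinear_form M M (%x y. be x y + be' x y)"
 unfolding bilinear_form_def by(auto intro!: lf_plus)

lemma bil_const: "bilinear_form M M be ==> bilinear_form M M (%x y. c * be x y)"
 unfolding bilinear_form_def by(auto intro!: lf_const)

lemma bil_sum: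
 "(!!i. i:I ==> bilinear_form M M (be i)) ==> bilinear_form M M (%x y. \<Sum>i\<in>I. c i * be i x y)"
 unfolding bilinear_form_def by(auto intro!: lf_sum)

lemma tensor_plus:
 assumes "t:tensors M M P" "bilinear_form M M be" "bilinear_form M M be'"
 shows "t (%x y. be x y + be' x y) = t be + t be'"
proof -
 obtain ps where "t = tensor_sum M M ps" using assms(1) by(rule tensorsE)
 thus ?thesis using assms(2,3) bil_plus[OF assms(2,3)]
  by(simp add: tensor_sum_eval sum_list_addf case_prod_unfold)
qed

lemma tensor_const:
 assumes "t:tensors M M P" "bilinear_form M M be"
 shows "t (%x y. c * be x y) = c * t be"
proof -
 obtain ps where "t = tensor_sum M M ps" using assms(1) by(rule tensorsE)
 thus ?thesis using assms(2) bil_const[OF assms(2)]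
  by(simp add: tensor_sum_eval sum_list_const_mult case_prod_unfold)
qed

lemma tensor_lincomb:
 assumes "t:tensors M M P" "!!i. i:I ==> bilinear_form M M (be i)"
 shows "t (%x y. \<Sum>i\<in>I. c i * be i x y) = (\<Sum>i\<in>I. c i * t (be i))"
proof -
 obtain ps where "t = tensor_sum M M ps" using assms(1) by(rule tensorsE)
 thus ?thesis using assms(2) bil_sum[of I be c]
  by(simp add: tensor_sum_eval case_prod_unfold sum_list_sum sum_list_const_mult)
qed

lemma expand_form:
 assumes "dual_system B phi" "spans B phi" "linear_form M f" "x:car M"
 shows "f x = (\<Sum>b\<in>B. phi b x * f b)"
 using lf_proj[OF assms(1,3), of x] assms(2,4) by simp

lemma expand_bilinear:
 assumes B: "dual_system B phi" "spans B phi"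
  and C: "dual_system C psi" "spans C psi"
  and be: "bilinear_form M M be" and xy: "x:car M" "y:car M"
 shows "be x y = (\<Sum>(b, c)\<in>B\<times>C. be b c * (phi b x * psi c y))"
proof -
 have "be x y = (\<Sum>b\<in>B. phi b x * be b y)"
  using expand_form[OF B bilformD(2)[OF be xy(2)] xy(1)] .
 also have "... = (\<Sum>b\<in>B. phi b x * (\<Sum>c\<in>C. psi c y * be b c))"
  using expand_form[OF C bilformD(1)[OF be] xy(2)] dual_systemD(4)[OF B(1)] by(intro sum.cong) auto
 finally show ?thesis by(simp add: sum.cartesian_product[symmetric] sum_distrib_left algebra_simps)
qed

lemma tensor_expand:
 assumes B: "dual_system B phi" "spans B phi"
  and C: "dual_system C psi" "spans C psi"
  and t: "t:tensors M M (car M\<times>car M)" and be: "bilinear_form M M be"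
 shows "t be = (\<Sum>(b, c)\<in>B\<times>C. be b c * t (%x y. phi b x * psi c y))"
proof -
 have bil: "bilinear_form M M (%x y. phi (fst p) x * psi (snd p) y)" if "p:B\<times>C" for p
  using that dual_systemD(3)[OF B(1)] dual_systemD(3)[OF C(1)] by(intro bil_prod) auto
 have "t be = t (%x y. \<Sum>p\<in>B\<times>C. be (fst p) (snd p) * (phi (fst p) x * psi (snd p) y))"
  using expand_bilinear[OF B C be]
  by(intro tensor_cong[OF t be bil_sum]) (auto simp: case_prod_unfold intro!: bil_prod
   dual_systemD(3)[OF B(1)] dual_systemD(3)[OF C(1)])
 also have "... = (\<Sum>p\<in>B\<times>C. be (fst p) (snd p) * t (%x y. phi (fst p) x * psi (snd p) y))"
  by(rule tensor_lincomb[OF t bil])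
 finally show ?thesis by(simp add: case_prod_unfold)
qed

text \<open>A tensor lies in the span of the pure tensors of \<open>P\<close> as soon as those of its coordinates that
 belong to pairs of basis elements outside \<open>P\<close> vanish.\<close>

lemma tensor_mem_by_coordinates:
 assumes B: "dual_system B phi" "spans B phi"
  and C: "dual_system C psi" "spans C psi"
  and t: "t:tensors M M (car M\<times>car M)"
  and P: "!!b c. [|b:B; c:C; t (%x y. phi b x * psi c y) ~= 0|] ==> (t (%x y. phi b x * psi c y)\<odot>b, c):P"
 shows "t:tensors M M P"
proof -
 define co where "co p = t (%x y. phi (fst p) x * psi (snd p) y)" for p
 have fin: "finite (B\<times>C)" using B C dual_systemD(1) by simp
 then obtain xs where xs: "set xs = {p:B\<times>C. co p ~= 0}" "distinct xs"
  using finite_distinct_list[of "{p:B\<times>C. co p ~= 0}"] by auto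
 have "t = tensor_sum M M (map (%p. (co p\<odot>fst p, snd p)) xs)"
 proof
  fix be
  show "t be = tensor_sum M M (map (%p. (co p\<odot>fst p, snd p)) xs) be"
  proof(cases "bilinear_form M M be")
   case True
   have "t be = (\<Sum>p\<in>B\<times>C. be (fst p) (snd p) * co p)"
    using tensor_expand[OF B C t True] by(simp add: co_def case_prod_unfold)
   also have "... = (\<Sum>p\<in>{p:B\<times>C. co p ~= 0}. be (fst p) (snd p) * co p)"
    using fin by(intro sum.mono_neutral_right) auto
   also have "... = (\<Sum>p\<leftarrow>xs. be (fst p) (snd p) * co p)"
    by(simp only: sum_list_distinct_conv_sum_set[OF xs(2)] xs(1))
   also have "... = (\<Sum>p\<leftarrow>xs. be (co p\<odot>fst p) (snd p))"
    using xs dual_systemD(4)[OF B(1)] dual_systemD(4)[OF C(1)]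
    by(intro arg_cong[of _ _ sum_list] map_cong) (auto simp: bil_smult1[OF True])
   finally show ?thesis using True by(simp add: tensor_sum_eval o_def)
  next
   case False
   thus ?thesis using tensor_off_bilinear[OF t] by(simp add: tensor_sum_eval)
  qed
 qed
 moreover have "set (map (%p. (co p\<odot>fst p, snd p)) xs) \<subseteq> P"
 proof
  fix r assume "r:set (map (%p. (co p\<odot>fst p, snd p)) xs)"
  then obtain b c where bc: "b:B" "c:C" "co (b, c) ~= 0" and r: "r = (co (b, c)\<odot>b, c)"
   using xs(1) by auto
  show "r:P" unfolding r using P[OF bc(1,2)] bc(3) by(simp add: co_def)
 qed
 ultimately show ?thesis unfolding tensors_def by blast
qed

end

context fd_kspace
begin

lemma tensor_eqI:
 assumes t: "t:tensors M M (car M\<times>car M)" "t':tensors M M (car M\<times>car M)"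
  and eq: "!!f g. [|linear_form M f; linear_form M g|] ==> t (%x y. f x * g y) = t' (%x y. f x * g y)"
 shows "t = t'"
proof
 fix be
 obtain B phi where B: "dual_system B phi" "spans B phi" using basis_exists by auto
 show "t be = t' be"
 proof(cases "bilinear_form M M be")
  case True
  show ?thesis
   unfolding tensor_expand[OF B B t(1) True] tensor_expand[OF B B t(2) True]
   using dual_systemD(3)[OF B(1)] by(intro sum.cong) (auto simp: eq)
 qed (use t tensor_off_bilinear in metis)
qed

lemma tensors_sum_iff:
 assumes X: "subspace U M" and Y: "subspace W M"
  and t: "t:tensors M M (car M\<times>car M)"
 shows "t:tensors M M (U\<times>car M \<union> car M\<times>W) \<longleftrightarrow>
  (ALL f g. linear_form M f & linear_form M g & (ALL x:U. f x = 0) & (ALL y:W. g y = 0) --> t (%x y. f x * g y) = 0)"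
  (is "?L = ?R")
proof
 assume ?L
 thus ?R by(intro allI impI tensor_vanish[of t M M "U\<times>car M \<union> car M\<times>W"]) auto
next
 assume r: ?R
 obtain B phi where B: "dual_system B phi" "spans B phi" "ALL b:B. b:U \<or> (ALL x:U. phi b x = 0)"
  using basis_adapted_to_sub[OF X] by auto
 obtain C psi where C: "dual_system C psi" "spans C psi" "ALL b:C. b:W \<or> (ALL x:W. psi b x = 0)"
  using basis_adapted_to_sub[OF Y] by auto
 show ?L
 proof(rule tensor_mem_by_coordinates[OF B(1,2) C(1,2) t])
  fix b c assume bc: "b:B" "c:C" "t (%x y. phi b x * psi c y) ~= 0"
  hence "b:U \<or> c:W" using r B(3) C(3) dual_systemD(3)[OF B(1)] dual_systemD(3)[OF C(1)] by blast
  thus "(t (%x y. phi b x * psi c y)\<odot>b, c):U\<times>car M \<union> car M\<times>W"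
   using bc dual_systemD(4)[OF B(1)] dual_systemD(4)[OF C(1)] sub_smult[OF X] by auto
 qed
qed

lemma tensors_square_iff:
 assumes X: "subspace U M" and t: "t:tensors M M (car M\<times>car M)"
 shows "t:tensors M M (U\<times>U) \<longleftrightarrow>
  (ALL f g. linear_form M f & linear_form M g & ((ALL x:U. f x = 0) \<or> (ALL y:U. g y = 0)) --> t (%x y. f x * g y) = 0)"
  (is "?L = ?R")
proof
 assume ?L
 thus ?R by(intro allI impI tensor_vanish[of t M M "U\<times>U"]) auto
next
 assume r: ?R
 obtain B phi where B: "dual_system B phi" "spans B phi" "ALL b:B. b:U \<or> (ALL x:U. phi b x = 0)"
  using basis_adapted_to_sub[OF X] by auto
 show ?L
 proof(rule tensor_mem_by_coordinates[OF B(1,2) B(1,2) t])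
  fix b c assume bc: "b:B" "c:B" "t (%x y. phi b x * phi c y) ~= 0"
  hence "b:U & c:U" using r B(3) dual_systemD(3)[OF B(1)] by auto
  thus "(t (%x y. phi b x * phi c y)\<odot>b, c):U\<times>U"
   using sub_smult[OF X] by auto
 qed
qed

end

section \<open>Finite-dimensional bialgebras\<close>

sublocale k_algebra \<subseteq> kspace A
 by unfold_locales

context k_algebra
begin

lemma alg_ring: "ring A"
 by unfold_locales

lemmas alg_r_distr = ring.ring_simprules(23)[OF alg_ring]
 and alg_l_distr = ring.ring_simprules(13)[OF alg_ring]
 and alg_m_assoc = ring.ring_simprules(11)[OF alg_ring]
 and alg_l_one = ring.ring_simprules(12)[OF alg_ring]
 and alg_m_closed = ring.ring_simprules(5)[OF alg_ring]
 and alg_one_closed = ring.ring_simprules(6)[OF alg_ring]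

end

context kspace
begin

lemma lf_cong:
 assumes "linear_form M f" "!!x. x:car M ==> f' x = f x"
 shows "linear_form M f'"
 by(rule linear_formI) (simp_all add: assms(2) linear_formD[OF assms(1)])

lemma bil_cong:
 assumes "bilinear_form M M be" "!!x y. [|x:car M; y:car M|] ==> be' x y = be x y"
 shows "bilinear_form M M be'"
 unfolding bilinear_form_def
proof(intro conjI ballI)
 show "linear_form M (be' x)" if "x:car M" for x
  using lf_cong[OF bilformD(1)[OF assms(1) that], of "be' x"] assms(2) that by simp
 show "linear_form M (%x. be' x y)" if "y:car M" for y
  using lf_cong[OF bilformD(2)[OF assms(1) that], of "%x. be' x y"] assms(2) that by simp
qed

lemma list_sum_closed: "(!!p. p:set ps ==> F p:car M) ==> list_sum M F ps:car M"
 by(induction ps) (auto simp: list_sum_def)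

lemma lf_list_sum:
 assumes "linear_form M f" "!!p. p:set ps ==> F p:car M"
 shows "f (list_sum M F ps) = (\<Sum>p\<leftarrow>ps. f (F p))"
 using assms(2)
proof(induction ps)
 case Nil
 show ?case using lf_zero[OF assms(1)] by(simp add: list_sum_def)
next
 case (Cons p ps)
 hence "f (F p\<oplus>list_sum M F ps) = f (F p) + f (list_sum M F ps)"
  by(intro lf_add[OF assms(1)] list_sum_closed) auto
 with Cons show ?case by(simp add: list_sum_def)
qed

end

locale fd_bialgebra = bialgebra H for H :: "('k::field, 'a, 'm) bialg_scheme" (structure) +
 assumes finite_dimensional: "finite_dimensional H"

sublocale fd_bialgebra \<subseteq> fd_kspace H
 by unfold_locales (rule finite_dimensional)

context bialgebra
begin

abbreviation "gl \<equiv> grouplikes H"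
abbreviation "lf \<equiv> linear_form H"
abbreviation "bil \<equiv> bilinear_form H H"

lemma sweedler_exists: "x:car H ==> EX ps. sweedler H x ps"
 using comult_closed[of x] by(auto simp: sweedler_def elim!: tensorsE)

lemma sweedlerE:
 assumes "x:car H"
 obtains ps where "sweedler H x ps" "set ps \<subseteq> car H\<times>car H"
  "ALL be. bil be --> comult H x be = (\<Sum>(u, v)\<leftarrow>ps. be u v)"
proof -
 obtain ps where "sweedler H x ps" using sweedler_exists[OF assms] by auto
 thus ?thesis using that[of ps] by(simp add: sweedler_def tensor_sum_eval)
qed

lemma comult_linear: "lf (%x. comult H x be)"
 by(rule linear_formI) (auto simp: comult_add comult_smult)

lemma comult_cong:
 assumes "x:car H" "bil be" "bil be'"
  "!!u v. [|u:car H; v:car H|] ==> be u v = be' u v"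
 shows "comult H x be = comult H x be'"
 using tensor_cong[OF comult_closed[OF assms(1)] assms(2,3)] assms(4) by auto

definition linmap :: "('a => 'a) => bool" where
 "linmap T \<longleftrightarrow> (ALL x:car H. T x:car H) &
   (ALL x:car H. ALL y:car H. T (x\<oplus>y) = T x\<oplus>T y) & (ALL a. ALL x:car H. T (a\<odot>x) = a\<odot>T x)"

lemma linmap_id: "linmap (%x. x)"
 by(simp add: linmap_def)

lemma linmap_mult_left: "a:car H ==> linmap (%x. a\<otimes>x)"
 by(simp add: linmap_def alg_r_distr smult_mult_right)

lemma linmap_mult_right: "a:car H ==> linmap (%x. x\<otimes>a)"
 by(simp add: linmap_def alg_l_distr smult_mult_left)

lemma linmap_comp: "[|linmap S; linmap T|] ==> linmap (%x. S (T x))"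
 by(simp add: linmap_def)

lemma lf_comp:
 assumes "lf f" "linmap T"
 shows "lf (%x. f (T x))"
proof(rule linear_formI)
 fix x y assume "x:car H" "y:car H"
 thus "f (T (x\<oplus>y)) = f (T x) + f (T y)"
  using assms(2) lf_add[OF assms(1), of "T x" "T y"] by(simp add: linmap_def)
next
 fix a x assume "x:car H"
 thus "f (T (a\<odot>x)) = a * f (T x)"
  using assms(2) lf_smult[OF assms(1), of "T x"] by(simp add: linmap_def)
qed

lemma bil_comp:
 assumes "bil be" "linmap S" "linmap T"
 shows "bil (%u v. be (S u) (T v))"
 unfolding bilinear_form_def
proof(intro conjI ballI)
 fix x assume "x:car H"
 hence "lf (be (S x))" using assms(2) bilformD(1)[OF assms(1)] by(simp add: linmap_def)
 thus "lf (%v. be (S x) (T v))" using assms(3) by(rule lf_comp)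
next
 fix y assume "y:car H"
 hence "lf (%u. be u (T y))" using assms(3) bilformD(2)[OF assms(1)] by(simp add: linmap_def)
 thus "lf (%u. be (S u) (T y))" using assms(2) by(rule lf_comp)
qed

lemma bil_mult_right: "[|bil be; u:car H; v:car H|] ==> bil (%u' v'. be (u\<otimes>u') (v\<otimes>v'))"
 by(rule bil_comp[OF _ linmap_mult_left linmap_mult_left])

lemma bil_mult_left: "[|bil be; u':car H; v':car H|] ==> bil (%u v. be (u\<otimes>u') (v\<otimes>v'))"
 by(rule bil_comp[OF _ linmap_mult_right linmap_mult_right])

lemma bil_null: "bil (%x y. 0)"
 by(simp add: bilinear_form_def lf_null)

lemma bil_list:
 assumes "!!p. p:set ps ==> bil (be p)"
 shows "bil (%x y. \<Sum>p\<leftarrow>ps. be p x y)"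
 using assms
proof(induction ps)
 case (Cons p ps)
 hence "bil (%x y. be p x y + (\<Sum>p\<leftarrow>ps. be p x y))" by(intro bil_plus) auto
 thus ?case by simp
qed (simp add: bil_null)

lemma bil_comult:
 assumes "y:car H" "bil be"
 shows "bil (%u v. comult H y (%u' v'. be (u\<otimes>u') (v\<otimes>v')))"
proof -
 obtain ps where ps: "sweedler H y ps" "set ps \<subseteq> car H\<times>car H"
  "ALL be. bil be --> comult H y be = (\<Sum>(u, v)\<leftarrow>ps. be u v)"
  using sweedlerE[OF assms(1)] by auto
 have b: "bil (%u v. \<Sum>p\<leftarrow>ps. be (u\<otimes>fst p) (v\<otimes>snd p))"
  using ps(2) by(intro bil_list bil_mult_left assms) auto
 have e: "comult H y (%u' v'. be (u\<otimes>u') (v\<otimes>v')) = (\<Sum>p\<leftarrow>ps. be (u\<otimes>fst p) (v\<otimes>snd p))"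
  if "u:car H" "v:car H" for u v
  using ps(3)[rule_format, OF bil_mult_right[OF assms(2) that]] by(simp add: case_prod_unfold)
 show ?thesis using bil_cong[OF b e] .
qed

lemma sum_list_concat_map: "(\<Sum>r\<leftarrow>concat (map h ps). f r) = (\<Sum>p\<leftarrow>ps. \<Sum>r\<leftarrow>h p. f r)"
 for f :: "'c => 'k"
 by(induction ps) auto

lemma comult_mult_eval:
 assumes "x:car H" "y:car H" "bil be"
 shows "comult H (x\<otimes>y) be = comult H x (%u v. comult H y (%u' v'. be (u\<otimes>u') (v\<otimes>v')))"
proof -
 obtain ps where ps: "sweedler H x ps" "set ps \<subseteq> car H\<times>car H"
  "ALL be. bil be --> comult H x be = (\<Sum>(u, v)\<leftarrow>ps. be u v)"
  using sweedlerE[OF assms(1)] by auto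
 obtain qs where qs: "sweedler H y qs" "set qs \<subseteq> car H\<times>car H"
  "ALL be. bil be --> comult H y be = (\<Sum>(u, v)\<leftarrow>qs. be u v)"
  using sweedlerE[OF assms(2)] by auto
 have "comult H (x\<otimes>y) be = (\<Sum>p\<leftarrow>ps. \<Sum>q\<leftarrow>qs. be (fst p\<otimes>fst q) (snd p\<otimes>snd q))"
  unfolding comult_mult[OF assms(1,2) ps(1) qs(1)]
  using assms(3) by(simp add: tensor_sum_eval case_prod_unfold sum_list_concat_map o_def)
 also have "... = (\<Sum>p\<leftarrow>ps. comult H y (%u' v'. be (fst p\<otimes>u') (snd p\<otimes>v')))"
 proof(intro arg_cong[of _ _ sum_list] map_cong refl)
  fix p assume "p:set ps"
  hence "fst p:car H" "snd p:car H" using ps(2) by auto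
  thus "(\<Sum>q\<leftarrow>qs. be (fst p\<otimes>fst q) (snd p\<otimes>snd q)) = comult H y (%u' v'. be (fst p\<otimes>u') (snd p\<otimes>v'))"
   using qs(3)[rule_format, OF bil_mult_right[OF assms(3)]] by(simp add: case_prod_unfold)
 qed
 also have "... = comult H x (%u v. comult H y (%u' v'. be (u\<otimes>u') (v\<otimes>v')))"
  using ps(3)[rule_format, OF bil_comult[OF assms(2,3)]] by(simp add: case_prod_unfold)
 finally show ?thesis .
qed

subsection \<open>The dual algebra and its actions\<close>

definition conv :: "('a => 'k) => ('a => 'k) => 'a => 'k" (infixl \<open>\<star>\<close> 70) where
 "(f \<star> g) x = comult H x (%u v. f u * g v)"

lemma conv_lf [simp]: "lf (f \<star> g)"
 using comult_linear unfolding conv_def by simp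

lemma counit_lf [simp]: "lf (counit H)"
 by(rule counit_linear)

lemma conv_assoc:
 assumes "lf f" "lf g" "lf h" "x:car H"
 shows "((f \<star> g) \<star> h) x = (f \<star> (g \<star> h)) x"
proof -
 have "trilinear_form H (%u v w. f u * g v * h w)"
  unfolding trilinear_form_def bilinear_form_def
 proof(intro conjI ballI)
  fix u v assume "u:car H" "v:car H"
  show "lf (%w. f u * g v * h w)" by(rule lf_const[OF assms(3)])
  show "lf (%w. f u * g w * h v)" using lf_const[OF assms(2), of "f u * h v"] by(simp add: mult_ac)
  show "lf (%w. f w * g u * h v)" using lf_const[OF assms(1), of "g u * h v"] by(simp add: mult_ac)
 qed
 from coassoc[OF assms(4) this]
 have "comult H x (%u v. comult H u (%y z. f y * g z * h v)) = comult H x (%u v. comult H v (%y z. f u * g y * h z))" .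
 moreover have "comult H x (%u v. comult H u (%y z. f y * g z * h v)) = comult H x (%u v. comult H u (%y z. f y * g z) * h v)"
 proof -
  have e: "comult H u (%y z. f y * g z * h v) = comult H u (%y z. f y * g z) * h v" if "u:car H" for u v
   using tensor_const[OF comult_closed[OF that] bil_prod[OF assms(1,2)], of "h v"] by(simp add: mult.commute)
  have b: "bil (%u v. comult H u (%y z. f y * g z) * h v)" by(intro bil_prod comult_linear assms)
  show ?thesis by(rule comult_cong[OF assms(4) bil_cong[OF b e] b e])
 qed
 moreover have "comult H x (%u v. comult H v (%y z. f u * g y * h z)) = comult H x (%u v. f u * comult H v (%y z. g y * h z))"
 proof -
  have e: "comult H v (%y z. f u * g y * h z) = f u * comult H v (%y z. g y * h z)" if "v:car H" for u v
   using tensor_const[OF comult_closed[OF that] bil_prod[OF assms(2,3)], of "f u"] by(simp add: mult.assoc)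
  have b: "bil (%u v. f u * comult H v (%y z. g y * h z))" by(intro bil_prod comult_linear assms)
  show ?thesis by(rule comult_cong[OF assms(4) bil_cong[OF b e] b e])
 qed
 ultimately show ?thesis by(simp add: conv_def[abs_def])
qed

text \<open>As a function of \<open>g\<close>, the value \<open>(f \<star> g) x\<close> is a linear form on the dual of \<open>H\<close>, hence an evaluation.\<close>

lemma contract_left_ex:
 assumes "lf f" "x:car H"
 shows "EX y:car H. ALL g. lf g --> g y = (f \<star> g) x"
proof -
 obtain ps where ps: "sweedler H x ps" "set ps \<subseteq> car H\<times>car H"
  "ALL be. bil be --> comult H x be = (\<Sum>(u, v)\<leftarrow>ps. be u v)"
  using sweedlerE[OF assms(2)] by auto
 let ?y = "list_sum H (%(u, v). f u\<odot>v) ps"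
 have "g ?y = (f \<star> g) x" if "lf g" for g
  unfolding conv_def ps(3)[rule_format, OF bil_prod[OF assms(1) that]] using ps(2)
  by(subst lf_list_sum[OF that]) (auto intro!: arg_cong[of _ _ sum_list] map_cong simp: lf_smult[OF that])
 moreover have "?y:car H" using ps(2) by(intro list_sum_closed) auto
 ultimately show ?thesis by auto
qed

lemma contract_right_ex:
 assumes "lf g" "x:car H"
 shows "EX y:car H. ALL f. lf f --> f y = (f \<star> g) x"
proof -
 obtain ps where ps: "sweedler H x ps" "set ps \<subseteq> car H\<times>car H"
  "ALL be. bil be --> comult H x be = (\<Sum>(u, v)\<leftarrow>ps. be u v)"
  using sweedlerE[OF assms(2)] by auto
 let ?y = "list_sum H (%(u, v). g v\<odot>u) ps"
 have "f ?y = (f \<star> g) x" if "lf f" for f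
  unfolding conv_def ps(3)[rule_format, OF bil_prod[OF that assms(1)]] using ps(2)
  by(subst lf_list_sum[OF that]) (auto intro!: arg_cong[of _ _ sum_list] map_cong simp: lf_smult[OF that] mult.commute)
 moreover have "?y:car H" using ps(2) by(intro list_sum_closed) auto
 ultimately show ?thesis by auto
qed

text \<open>\<open>hitl f x\<close> is \<open>\<Sum> f(x\<^sub>1) x\<^sub>2\<close> and \<open>hitr g x\<close> is \<open>\<Sum> g(x\<^sub>2) x\<^sub>1\<close>. Both are characterized by
 the values of linear forms on them, which are values of convolution products.\<close>

definition hitl :: "('a => 'k) => 'a => 'a" where
 "hitl f x = (SOME y. y:car H & (ALL g. lf g --> g y = (f \<star> g) x))"

definition hitr :: "('a => 'k) => 'a => 'a" where
 "hitr g x = (SOME y. y:car H & (ALL f. lf f --> f y = (f \<star> g) x))"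

lemma hitl:
 assumes "lf f" "x:car H"
 shows hitl_closed [simp]: "hitl f x:car H" and hitl_eval: "lf g ==> g (hitl f x) = (f \<star> g) x"
proof -
 have "EX y. y:car H & (ALL g. lf g --> g y = (f \<star> g) x)" using contract_left_ex[OF assms] by auto
 from someI_ex[OF this] show "hitl f x:car H" "lf g ==> g (hitl f x) = (f \<star> g) x"
  unfolding hitl_def by blast+
qed

lemma hitr:
 assumes "lf g" "x:car H"
 shows hitr_closed [simp]: "hitr g x:car H" and hitr_eval: "lf f ==> f (hitr g x) = (f \<star> g) x"
proof -
 have "EX y. y:car H & (ALL f. lf f --> f y = (f \<star> g) x)" using contract_right_ex[OF assms] by auto
 from someI_ex[OF this] show "hitr g x:car H" "lf f ==> f (hitr g x) = (f \<star> g) x"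
  unfolding hitr_def by blast+
qed

lemma conv_counit_left: "[|lf g; x:car H|] ==> (counit H \<star> g) x = g x"
proof -
 assume g: "lf g" and x: "x:car H"
 obtain ps where ps: "sweedler H x ps" "set ps \<subseteq> car H\<times>car H"
  "ALL be. bil be --> comult H x be = (\<Sum>(u, v)\<leftarrow>ps. be u v)"
  using sweedlerE[OF x] by auto
 have "g x = g (list_sum H (%(u, v). counit H u\<odot>v) ps)" using counit_left[OF x ps(1)] by simp
 also have "... = (\<Sum>(u, v)\<leftarrow>ps. counit H u * g v)"
  using ps(2) by(subst lf_list_sum[OF g]) (auto intro!: arg_cong[of _ _ sum_list] map_cong simp: lf_smult[OF g])
 finally show ?thesis unfolding conv_def ps(3)[rule_format, OF bil_prod[OF counit_lf g]] by simp
qed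

lemma conv_counit_right: "[|lf f; x:car H|] ==> (f \<star> counit H) x = f x"
proof -
 assume g: "lf f" and x: "x:car H"
 obtain ps where ps: "sweedler H x ps" "set ps \<subseteq> car H\<times>car H"
  "ALL be. bil be --> comult H x be = (\<Sum>(u, v)\<leftarrow>ps. be u v)"
  using sweedlerE[OF x] by auto
 have "f x = f (list_sum H (%(u, v). counit H v\<odot>u) ps)" using counit_right[OF x ps(1)] by simp
 also have "... = (\<Sum>(u, v)\<leftarrow>ps. f u * counit H v)"
  using ps(2) by(subst lf_list_sum[OF g]) (auto intro!: arg_cong[of _ _ sum_list] map_cong simp: lf_smult[OF g] mult.commute)
 finally show ?thesis unfolding conv_def ps(3)[rule_format, OF bil_prod[OF g counit_lf]] by simp
qed

lemma hitl_add: "[|lf f; x:car H; y:car H|] ==> hitl f (x\<oplus>y) = hitl f x\<oplus>hitl f y"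
 by(rule eq_if_forms_eq) (auto simp: hitl_eval lf_add)

lemma hitl_smult: "[|lf f; x:car H|] ==> hitl f (a\<odot>x) = a\<odot>hitl f x"
 by(rule eq_if_forms_eq) (auto simp: hitl_eval lf_smult)

lemma hitr_add: "[|lf f; x:car H; y:car H|] ==> hitr f (x\<oplus>y) = hitr f x\<oplus>hitr f y"
 by(rule eq_if_forms_eq) (auto simp: hitr_eval lf_add)

lemma hitr_smult: "[|lf f; x:car H|] ==> hitr f (a\<odot>x) = a\<odot>hitr f x"
 by(rule eq_if_forms_eq) (auto simp: hitr_eval lf_smult)

lemma hitl_zero: "lf f ==> hitl f \<zero> = \<zero>"
 by(rule eq_if_forms_eq) (auto simp: hitl_eval lf_zero)

lemma hitr_zero: "lf f ==> hitr f \<zero> = \<zero>"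
 by(rule eq_if_forms_eq) (auto simp: hitr_eval lf_zero)

lemma hit_commute: "[|lf f; lf g; x:car H|] ==> hitl f (hitr g x) = hitr g (hitl f x)"
 by(rule eq_if_forms_eq) (auto simp: hitl_eval hitr_eval conv_assoc)

lemma hitr_hitr: "[|lf f; lf g; x:car H|] ==> hitr f (hitr g x) = hitr (f \<star> g) x"
 by(rule eq_if_forms_eq) (auto simp: hitr_eval conv_assoc)

lemma hitr_counit: "x:car H ==> hitr (counit H) x = x"
 by(rule eq_if_forms_eq) (auto simp: hitr_eval conv_counit_right)

definition annihilates :: "('a => 'k) => 'a set => bool" where
 "annihilates f U \<longleftrightarrow> lf f & (ALL x:U. f x = 0)"

lemma annihilatesD: "annihilates f U ==> lf f" "[|annihilates f U; x:U|] ==> f x = 0"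
 by(auto simp: annihilates_def)

lemma mem_if_annihilated:
 assumes "subspace N H" "x:car H" "!!f. annihilates f N ==> f x = 0"
 shows "x:N"
 using mem_if_forms_vanish[OF assms(1,2)] assms(3) by(auto simp: annihilates_def)

subsection \<open>Group-like elements\<close>

lemma glD:
 assumes "g:grouplikes H"
 shows gl_carrier: "g:car H" and grouplike_nonzero: "g ~= \<zero>"
  and gl_comult: "bil be ==> comult H g be = be g g"
  and gl_conv: "[|lf f; lf h|] ==> (f \<star> h) g = f g * h g"
  and gl_sweedler: "sweedler H g [(g, g)]"
 using assms by(auto simp: grouplikes_def pure_tensor_eval conv_def bil_prod sweedler_def tensor_sum_def)

lemma hitl_gl: "[|g:grouplikes H; lf f|] ==> hitl f g = f g\<odot>g"
 by(rule eq_if_forms_eq) (auto simp: gl_carrier hitl_eval gl_conv lf_smult)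

lemma hitr_gl: "[|g:grouplikes H; lf f|] ==> hitr f g = f g\<odot>g"
 by(rule eq_if_forms_eq) (auto simp: gl_carrier hitr_eval gl_conv lf_smult)

lemma counit_gl:
 assumes "g:grouplikes H"
 shows "counit H g = 1"
proof -
 obtain f where f: "lf f" "f g = 1"
  using separating_form[OF zero_sub gl_carrier[OF assms]] grouplike_nonzero[OF assms] by auto
 have "counit H g * f g = f g"
  using conv_counit_left[OF f(1) gl_carrier[OF assms]] gl_conv[OF assms counit_lf f(1)] by simp
 thus ?thesis using f by simp
qed

lemma one_gl: "\<one>:grouplikes H"
proof -
 have "\<one> ~= \<zero>"
 proof
  assume "\<one> = \<zero>"
  hence "counit H \<one> = 0" using lf_zero[OF counit_lf] by simp
  thus False by(simp add: counit_one)
 qed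
 thus ?thesis by(simp add: grouplikes_def comult_one)
qed

lemma gl_mult:
 assumes "g:grouplikes H" "h:grouplikes H"
 shows "g\<otimes>h:grouplikes H"
proof -
 note C = gl_carrier[OF assms(1)] gl_carrier[OF assms(2)]
 have "counit H (g\<otimes>h) = 1" using C counit_gl assms by(simp add: counit_mult)
 hence nz: "g\<otimes>h ~= \<zero>" using lf_zero[OF counit_lf] by auto
 have "comult H (g\<otimes>h) = pure_tensor H H (g\<otimes>h) (g\<otimes>h)"
  unfolding comult_mult[OF C gl_sweedler[OF assms(1)] gl_sweedler[OF assms(2)]]
  by(auto simp: tensor_sum_def)
 thus ?thesis using C nz by(simp add: grouplikes_def)
qed

end

section \<open>The coradical filtration of a pointed bialgebra\<close>

context fd_bialgebra
begin

definition left_coideal :: "'a set => bool" where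
 "left_coideal N \<longleftrightarrow> subspace N H & (ALL f x. lf f --> x:N --> hitl f x:N)"

lemma left_coidealD:
 assumes "left_coideal N"
 shows "subspace N H" "N \<subseteq> car H" "[|lf f; x:N|] ==> hitl f x:N"
 using assms sub_subset by(auto simp: left_coideal_def)

lemma subcoalgebra_iff:
 "subcoalgebra H C \<longleftrightarrow> left_coideal C & (ALL f x. lf f --> x:C --> hitr f x:C)"
proof(cases "subspace C H")
 case True
 have "comult H x:tensors H H (C\<times>C) \<longleftrightarrow> (ALL f. lf f --> hitl f x:C & hitr f x:C)" if x: "x:C" for x
 proof -
  have xH: "x:car H" using sub_mem[OF True x] .
  note iff = tensors_square_iff[OF True comult_closed[OF xH], folded conv_def]
  show ?thesis
  proof
   assume "comult H x:tensors H H (C\<times>C)"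
   hence z: "(f \<star> g) x = 0" if "lf f" "lf g" "annihilates f C \<or> annihilates g C" for f g
    using iff that by(auto simp: annihilates_def)
   show "ALL f. lf f --> hitl f x:C & hitr f x:C"
   proof(intro allI impI conjI)
    fix f assume f: "lf f"
    show "hitl f x:C"
     using z[OF f] f xH by(intro mem_if_annihilated[OF True]) (auto simp: annihilates_def hitl_eval)
    show "hitr f x:C"
     using z[OF _ f] f xH by(intro mem_if_annihilated[OF True]) (auto simp: annihilates_def hitr_eval)
   qed
  next
   assume h: "ALL f. lf f --> hitl f x:C & hitr f x:C"
   have "(f \<star> g) x = 0" if "lf f" "lf g" "(ALL y:C. f y = 0) \<or> (ALL y:C. g y = 0)" for f g
    using h that hitl_eval[OF that(1) xH that(2)] hitr_eval[OF that(2) xH that(1)] by auto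
   thus "comult H x:tensors H H (C\<times>C)" using iff by simp
  qed
 qed
 thus ?thesis by(auto simp: subcoalgebra_def left_coideal_def)
qed (auto simp: subcoalgebra_def left_coideal_def)

lemma line_subcoalgebra:
 assumes "g:grouplikes H"
 shows "subcoalgebra H (range (%a. a\<odot>g))"
 unfolding subcoalgebra_iff left_coideal_def
 using lspan_range_smult[OF gl_carrier[OF assms]] gl_carrier[OF assms]
 by(auto simp: hitl_smult hitr_smult hitl_gl[OF assms] hitr_gl[OF assms])

lemma line_simple:
 assumes "g:grouplikes H"
 shows "simple_subcoalgebra H (range (%a. a\<odot>g))"
 unfolding simple_subcoalgebra_def
proof(intro conjI allI impI)
 note g = gl_carrier[OF assms]
 show "subcoalgebra H (range (%a. a\<odot>g))" by(rule line_subcoalgebra[OF assms])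
 have "g:range (%a. a\<odot>g)" using g by(auto intro: range_eqI[of _ _ 1])
 thus "range (%a. a\<odot>g) ~= {\<zero>}" using grouplike_nonzero[OF assms] by auto
 fix D assume D: "subcoalgebra H D & D \<subseteq> range (%a. a\<odot>g)"
 hence sub: "subspace D H" by(simp add: subcoalgebra_def)
 show "D = {\<zero>} \<or> D = range (%a. a\<odot>g)"
 proof(cases "D \<subseteq> {\<zero>}")
  case True
  thus ?thesis using sub_zero[OF sub] by auto
 next
  case False
  then obtain a where a: "a\<odot>g:D" "a\<odot>g ~= \<zero>" using D by auto
  hence "a ~= 0" using g by auto
  have "b\<odot>g:D" for b
   using sub_smult[OF sub a(1), of "b * inverse a"] \<open>a \<noteq> 0\<close> g by(simp add: mult.assoc)
  thus ?thesis using D by auto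
 qed
qed

end

locale pointed_fd_bialgebra = fd_bialgebra H for H :: "('k::field, 'a, 'm) bialg_scheme" (structure) +
 assumes is_pointed: "pointed H"
begin

lemma simple_subcoalgebra_line:
 assumes "simple_subcoalgebra H C"
 shows "EX g:grouplikes H. C = range (%a. a\<odot>g)"
proof -
 obtain x where x: "x:car H" "x ~= \<zero>" "C = range (%a. a\<odot>x)"
  using assms is_pointed by(auto simp: pointed_def one_dimensional_def)
 have xC: "x:C" using x by(auto intro: range_eqI[of _ _ 1])
 have sub: "subcoalgebra H C" using assms by(simp add: simple_subcoalgebra_def)
 hence "comult H x:tensors H H (C\<times>C)" using xC by(simp add: subcoalgebra_def)
 then obtain ps where ps: "set ps \<subseteq> C\<times>C" "comult H x = tensor_sum H H ps" by(rule tensorsE)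
 have "EX c. ALL be. bil be --> (\<Sum>(u, v)\<leftarrow>ps. be u v) = c * be x x"
  using ps(1)
 proof(induction ps)
  case Nil
  show ?case by(intro exI[of _ 0]) simp
 next
  case (Cons p ps)
  then obtain c where c: "ALL be. bil be --> (\<Sum>(u, v)\<leftarrow>ps. be u v) = c * be x x" by auto
  obtain a b where p: "p = (a\<odot>x, b\<odot>x)" using Cons.prems x(3) by auto
  have "be (a\<odot>x) (b\<odot>x) = a * b * be x x" if "bil be" for be
   using bil_smult1[OF that x(1), of "b\<odot>x" a] bil_smult2[OF that x(1) x(1), of b] x(1) by simp
  thus ?case using c by(intro exI[of _ "a * b + c"]) (auto simp: p algebra_simps)
 qed
 then obtain c where c: "ALL be. bil be --> comult H x be = c * be x x"
  using ps(2) by(auto simp: tensor_sum_eval)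
 obtain f where f: "lf f" "f x = 1"
  using separating_form[OF zero_sub x(1)] x(2) by auto
 have "1 = c * (counit H x * f x)"
  using conv_counit_left[OF f(1) x(1)] c bil_prod[OF counit_lf f(1)] f(2) by(simp add: conv_def)
 hence "c ~= 0" by auto
 define g where "g = c\<odot>x"
 have "comult H g = pure_tensor H H g g"
 proof
  fix be
  show "comult H g be = pure_tensor H H g g be"
  proof(cases "bil be")
   case True
   have "be g g = c * (c * be x x)" unfolding g_def
    using bil_smult1[OF True x(1), of "c\<odot>x" c] bil_smult2[OF True x(1) x(1), of c] x(1) by simp
   thus ?thesis using c True x(1) by(simp add: g_def pure_tensor_def comult_smult)
  next
   case False
   thus ?thesis using tensor_off_bilinear[OF comult_closed[of g]] x(1) by(simp add: g_def pure_tensor_def)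
  qed
 qed
 hence "g:grouplikes H"
  using x \<open>c \<noteq> 0\<close> by(auto simp: grouplikes_def g_def smult_eq_zero_iff)
 moreover have "C = range (%a. a\<odot>g)"
 proof
  show "range (%a. a\<odot>g) \<subseteq> C" using x by(auto simp: g_def)
  show "C \<subseteq> range (%a. a\<odot>g)"
  proof
   fix y assume "y:C"
   then obtain a where "y = a\<odot>x" using x by auto
   hence "y = (a * inverse c)\<odot>g" using x \<open>c \<noteq> 0\<close> by(simp add: g_def mult.assoc)
   thus "y:range (%a. a\<odot>g)" by simp
  qed
 qed
 ultimately show ?thesis by auto
qed

lemma coradical_eq: "coradical H = lspan H (grouplikes H)"
proof
 have G: "grouplikes H \<subseteq> car H" using gl_carrier by auto
 note S = lspan_sub[OF G]
 have "C \<subseteq> lspan H (grouplikes H)" if "simple_subcoalgebra H C" for C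
  using simple_subcoalgebra_line[OF that] lspan_superset[of "grouplikes H"] by(auto intro: sub_smult[OF S])
 thus "coradical H \<subseteq> lspan H (grouplikes H)"
  unfolding coradical_def by(intro lspan_least[OF S]) blast
 have sub: "\<Union>{C. simple_subcoalgebra H C} \<subseteq> car H"
  using sub_subset by(auto simp: simple_subcoalgebra_def subcoalgebra_def)
 have "g:\<Union>{C. simple_subcoalgebra H C}" if "g:grouplikes H" for g
  using line_simple[OF that] gl_carrier[OF that] by(auto intro!: exI[of _ "range (%a. a\<odot>g)"] range_eqI[of _ _ 1])
 hence "grouplikes H \<subseteq> coradical H" unfolding coradical_def using lspan_superset by blast
 thus "lspan H (grouplikes H) \<subseteq> coradical H"
  unfolding coradical_def by(rule lspan_least[OF lspan_sub[OF sub]])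
qed

lemma coradical_sub: "subspace (coradical H) H"
 unfolding coradical_eq using gl_carrier by(intro lspan_sub) blast

lemma gl_coradical: "g:grouplikes H ==> g:coradical H"
 unfolding coradical_eq using lspan_superset by auto

lemma coradical_induct:
 assumes "subspace N H" "!!g. g:grouplikes H ==> g:N"
 shows "coradical H \<subseteq> N"
 unfolding coradical_eq using assms by(intro lspan_least) auto

lemma hit_preimage_sub:
 assumes "subspace N H" "lf f"
 shows "subspace {x:car H. hitl f x:N} H"
  "subspace {x:car H. hitr f x:N} H"
 using assms(2) by(auto intro!: subI sub_add[OF assms(1)] sub_smult[OF assms(1)] sub_zero[OF assms(1)]
  simp: hitl_add hitr_add hitl_smult hitr_smult hitl_zero hitr_zero)

lemma coradical_subcoalgebra: "lf f ==> x:coradical H ==> hitl f x:coradical H & hitr f x:coradical H"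
proof -
 assume f: "lf f" and x: "x:coradical H"
 have "coradical H \<subseteq> {x:car H. hitl f x:coradical H}"
  by(rule coradical_induct[OF hit_preimage_sub(1)[OF coradical_sub f]])
   (auto simp: hitl_gl f gl_carrier gl_coradical intro!: sub_smult[OF coradical_sub])
 moreover have "coradical H \<subseteq> {x:car H. hitr f x:coradical H}"
  by(rule coradical_induct[OF hit_preimage_sub(2)[OF coradical_sub f]])
   (auto simp: hitr_gl f gl_carrier gl_coradical intro!: sub_smult[OF coradical_sub])
 ultimately show ?thesis using x by auto
qed

lemma filt_sub: "subspace (corad_filt H n) H"
proof(cases n)
 case 0
 thus ?thesis using coradical_sub by simp
next
 case (Suc m)
 let ?T = "tensors H H (car H\<times>corad_filt H m \<union> coradical H\<times>car H)"
 have "subspace {x:car H. comult H x:?T} H"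
 proof(rule subI)
  have "comult H \<zero> = tensor_sum H H []"
   using comult_smult[of "\<zero>" 0] by(auto simp: tensor_sum_def)
  thus "\<zero>:{x:car H. comult H x:?T}"
   by(auto simp: tensors_def intro!: exI[of _ "[]"])
 next
  fix x y assume "x:{x:car H. comult H x:?T}" "y:{x:car H. comult H x:?T}"
  hence xy: "x:car H" "y:car H" "comult H x:?T" "comult H y:?T" by auto
  obtain ps where ps: "set ps \<subseteq> car H\<times>corad_filt H m \<union> coradical H\<times>car H" "comult H x = tensor_sum H H ps"
   using xy(3) by(rule tensorsE)
  obtain qs where qs: "set qs \<subseteq> car H\<times>corad_filt H m \<union> coradical H\<times>car H" "comult H y = tensor_sum H H qs"
   using xy(4) by(rule tensorsE)
  have "comult H (x\<oplus>y) = tensor_sum H H (ps @ qs)"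
   using xy ps(2) qs(2) by(simp add: comult_add tensor_sum_def)
  thus "x\<oplus>y:{x:car H. comult H x:?T}"
   using xy ps(1) qs(1) by(auto simp: tensors_def intro!: exI[of _ "ps @ qs"])
 next
  fix a x assume "x:{x:car H. comult H x:?T}"
  hence x: "x:car H" "comult H x:?T" by auto
  have sub: "corad_filt H m \<subseteq> car H" "coradical H \<subseteq> car H"
   using sub_subset[OF coradical_sub] by(cases m; auto)+
  obtain ps where ps: "set ps \<subseteq> car H\<times>corad_filt H m \<union> coradical H\<times>car H" "comult H x = tensor_sum H H ps"
   using x(2) by(rule tensorsE)
  have "comult H (a\<odot>x) = tensor_sum H H (map (%(u, v). (a\<odot>u, v)) ps)"
  proof
   fix be
   show "comult H (a\<odot>x) be = tensor_sum H H (map (%(u, v). (a\<odot>u, v)) ps) be"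
   proof(cases "bil be")
    case True
    have "set ps \<subseteq> car H\<times>car H" using ps(1) sub by auto
    hence "(\<Sum>p\<leftarrow>ps. be (a\<odot>fst p) (snd p)) = (\<Sum>p\<leftarrow>ps. a * be (fst p) (snd p))"
     by(intro arg_cong[of _ _ sum_list] map_cong) (auto intro!: bil_smult1[OF True])
    thus ?thesis
     using x ps(2) by(simp add: comult_smult tensor_sum_eval case_prod_unfold o_def sum_list_const_mult)
   next
    case False
    thus ?thesis using x ps(2) by(simp add: comult_smult tensor_sum_eval)
   qed
  qed
  moreover have "set (map (%(u, v). (a\<odot>u, v)) ps) \<subseteq> car H\<times>corad_filt H m \<union> coradical H\<times>car H"
  proof
   fix p assume "p:set (map (%(u, v). (a\<odot>u, v)) ps)"
   then obtain u v where uv: "(u, v):set ps" "p = (a\<odot>u, v)" by auto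
   hence "(u, v):car H\<times>corad_filt H m \<union> coradical H\<times>car H" using ps(1) by auto
   thus "p:car H\<times>corad_filt H m \<union> coradical H\<times>car H"
    using uv(2) sub_smult[OF coradical_sub] by auto
  qed
  ultimately show "a\<odot>x:{x:car H. comult H x:?T}"
   using x(1) unfolding tensors_def by blast
 qed auto
 thus ?thesis using Suc by simp
qed

lemma filt_closed: "x:corad_filt H n ==> x:car H"
 using sub_subset[OF filt_sub] by auto

lemma filt_Suc_iff:
 "x:corad_filt H (Suc n) \<longleftrightarrow> x:car H &
   (ALL f g. annihilates f (coradical H) & annihilates g (corad_filt H n) --> (f \<star> g) x = 0)"
proof(cases "x:car H")
 case True
 show ?thesis
  using tensors_sum_iff[OF coradical_sub filt_sub[of n] comult_closed[OF True]] by(auto simp: Un_commute annihilates_def conv_def)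
qed simp

lemma below_sub: "subspace (corad_below H n) H"
 using zero_sub filt_sub by(cases n) (auto simp: corad_below_def)

lemma below_simps [simp]: "corad_below H 0 = {\<zero>}" "corad_below H (Suc n) = corad_filt H n"
 by(auto simp: corad_below_def)

lemma below_closed: "x:corad_below H n ==> x:car H"
 using sub_subset[OF below_sub] by auto

lemma filt_hit: "[|lf f; x:corad_filt H n|] ==> hitl f x:corad_filt H n & hitr f x:corad_filt H n"
proof(induction n arbitrary: f x)
 case 0
 thus ?case using coradical_subcoalgebra by simp
next
 case (Suc n)
 have x: "x:car H" using filt_closed[OF Suc.prems(2)] .
 have z: "(f' \<star> g') x = 0" if "annihilates f' (coradical H)" "annihilates g' (corad_filt H n)" for f' g'
  using Suc.prems(2) that unfolding filt_Suc_iff by simp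
 have "(f' \<star> g') (hitl f x) = 0" if fg: "annihilates f' (coradical H)" "annihilates g' (corad_filt H n)" for f' g'
 proof -
  note l = Suc.prems(1) annihilatesD(1)[OF fg(1)] annihilatesD(1)[OF fg(2)]
  have "annihilates (f \<star> f') (coradical H)"
   unfolding annihilates_def
  proof(intro conjI ballI)
   fix y assume y: "y:coradical H"
   hence "y:car H" using filt_closed[of y 0] by simp
   hence "(f \<star> f') y = f' (hitl f y)" using hitl_eval[OF l(1) _ l(2)] by simp
   thus "(f \<star> f') y = 0" using annihilatesD(2)[OF fg(1)] coradical_subcoalgebra[OF l(1) y] by simp
  qed simp
  from z[OF this fg(2)] have "((f \<star> f') \<star> g') x = 0" .
  thus ?thesis using hitl_eval[OF l(1) x, of "f' \<star> g'"] conv_assoc[OF l x] by simp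
 qed
 moreover have "(f' \<star> g') (hitr f x) = 0" if fg: "annihilates f' (coradical H)" "annihilates g' (corad_filt H n)" for f' g'
 proof -
  note l = annihilatesD(1)[OF fg(1)] annihilatesD(1)[OF fg(2)] Suc.prems(1)
  have "annihilates (g' \<star> f) (corad_filt H n)"
   unfolding annihilates_def
  proof(intro conjI ballI)
   fix y assume y: "y:corad_filt H n"
   have "(g' \<star> f) y = g' (hitr f y)" using hitr_eval[OF l(3) filt_closed[OF y] l(2)] by simp
   thus "(g' \<star> f) y = 0" using annihilatesD(2)[OF fg(2)] Suc.IH[OF l(3) y] by simp
  qed simp
  from z[OF fg(1) this] have "(f' \<star> (g' \<star> f)) x = 0" .
  thus ?thesis using hitr_eval[OF l(3) x, of "f' \<star> g'"] conv_assoc[OF l x] by simp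
 qed
 ultimately show ?case using x Suc.prems(1) unfolding filt_Suc_iff by auto
qed

lemma below_hit: "[|lf f; x:corad_below H n|] ==> hitl f x:corad_below H n & hitr f x:corad_below H n"
 using filt_hit by(cases n) (auto simp: hitl_zero hitr_zero)

lemma filt_mono_Suc: "corad_filt H n \<subseteq> corad_filt H (Suc n)"
proof
 fix x assume x: "x:corad_filt H n"
 have "(f \<star> g) x = 0" if "annihilates f (coradical H)" "annihilates g (corad_filt H n)" for f g
  using hitl_eval[OF annihilatesD(1)[OF that(1)] filt_closed[OF x] annihilatesD(1)[OF that(2)]]
   filt_hit[OF annihilatesD(1)[OF that(1)] x] annihilatesD(2)[OF that(2)] by simp
 thus "x:corad_filt H (Suc n)" unfolding filt_Suc_iff using filt_closed[OF x] by simp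
qed

lemma filt_mono: "i <= j ==> corad_filt H i \<subseteq> corad_filt H j"
 by(rule lift_Suc_mono_le[of "corad_filt H"]) (use filt_mono_Suc in auto)

lemma below_subset: "corad_below H n \<subseteq> corad_filt H n"
 using filt_mono_Suc sub_zero[OF filt_sub[of 0]] by(cases n) auto

text \<open>Indices are those of \<open>corad_below\<close>: the annihilators of \<open>H\<^sub>i\<^sub>-\<^sub>1\<close> and \<open>H\<^sub>j\<^sub>-\<^sub>1\<close> multiply into that
 of \<open>H\<^sub>i\<^sub>+\<^sub>j\<^sub>-\<^sub>1\<close>, because they are the \<open>i\<close>th and \<open>j\<close>th power of the annihilator of the coradical.\<close>

lemma conv_annihilators:
 "[|annihilates f (corad_below H i); annihilates g (corad_below H j); x:corad_below H (i + j)|] ==> (f \<star> g) x = 0"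
proof(induction i arbitrary: f g j x)
 case 0
 note l = annihilatesD(1)[OF 0(1)] annihilatesD(1)[OF 0(2)]
 have "(f \<star> g) x = g (hitl f x)" using hitl_eval[OF l(1) below_closed[OF 0(3)] l(2)] by simp
 thus ?case using annihilatesD(2)[OF 0(2)] below_hit[OF l(1), of x j] 0(3) by simp
next
 case (Suc i)
 note l = annihilatesD(1)[OF Suc.prems(1)] annihilatesD(1)[OF Suc.prems(2)]
 have x: "x:car H" using below_closed[OF Suc.prems(3)] .
 have base: "(f' \<star> g') y = 0" if "annihilates f' (coradical H)" "annihilates g' (corad_below H (Suc k))"
   "y:corad_below H (Suc (Suc k))" for f' g' k y
  using that filt_Suc_iff by simp
 show ?case
 proof(cases j)
  case 0
  hence "hitr g x:corad_below H (Suc i)" using below_hit[OF l(2), of x "Suc i"] Suc.prems(3) by simp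
  thus ?thesis using annihilatesD(2)[OF Suc.prems(1)] hitr_eval[OF l(2) x l(1)] by simp
 next
  case j: (Suc j')
  show ?thesis
  proof(cases i)
   case 0
   thus ?thesis using base[of f g j' x] Suc.prems j by simp
  next
   case i: (Suc i')
   have "hitr g x:corad_filt H i"
    unfolding i filt_Suc_iff
   proof(intro conjI allI impI)
    show "hitr g x:car H" using l x by simp
    fix f' h assume "annihilates f' (coradical H) & annihilates h (corad_filt H i')"
    hence fh: "annihilates f' (coradical H)" "annihilates h (corad_filt H i')" by auto
    note l' = annihilatesD(1)[OF fh(1)] annihilatesD(1)[OF fh(2)]
    have y: "hitl f' x:corad_below H (i + j)"
    proof(rule mem_if_annihilated[OF below_sub])
     show "hitl f' x:car H" using l' x by simp
     fix g' assume g': "annihilates g' (corad_below H (i + j))"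
     have "(f' \<star> g') x = 0"
      using base[OF fh(1), of g' "i + j'" x] g' Suc.prems(3) by(simp add: j)
     thus "g' (hitl f' x) = 0" using hitl_eval[OF l'(1) x annihilatesD(1)[OF g']] by simp
    qed
    have "(h \<star> g) (hitl f' x) = 0"
     using Suc.IH[of h g j "hitl f' x"] fh(2) Suc.prems(2) y by(simp add: i)
    thus "(f' \<star> h) (hitr g x) = 0"
     using hitr_eval[OF l(2) x, of "f' \<star> h"] hitl_eval[OF l'(1) x, of "h \<star> g"] conv_assoc[OF l' l(2) x] by simp
   qed
   thus ?thesis using annihilatesD(2)[OF Suc.prems(1)] hitr_eval[OF l(2) x l(1)] by simp
  qed
 qed
qed

end

context kspace
begin

lemmas vec_ac = M.a_ac and vec_assoc = M.a_assoc

lemma eq_if_minus_zero: "[|x:car M; y:car M; x\<ominus>y = \<zero>|] ==> x = y"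
proof(rule eq_if_forms_eq)
 fix f assume xy: "x:car M" "y:car M" "x\<ominus>y = \<zero>" and f: "linear_form M f"
 show "f x = f y" using lf_minus[OF f xy(1,2)] lf_zero[OF f] xy(3) by simp
qed

lemma sub_Int:
 "[|subspace N M; subspace N' M|] ==> subspace (N \<inter> N') M"
 by(rule subI) (auto dest: sub_subset simp: sub_zero sub_add sub_smult)

end

context pointed_fd_bialgebra
begin

primrec coeff_sum :: "'a set => ('a => 'k) list => 'a set" where
 "coeff_sum S [] = {\<zero>}"
| "coeff_sum S (psi # psis) = {hitr psi s\<oplus>w |s w. s:S & w:coeff_sum S psis}"

lemma left_coideal_coeff_sum:
 assumes S: "left_coideal S" and "ALL psi:set psis. lf psi"
 shows "left_coideal (coeff_sum S psis)"
 using assms(2)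
proof(induction psis)
 case Nil
 show ?case by(auto simp: left_coideal_def hitl_zero intro: zero_sub)
next
 case (Cons psi psis)
 note S' = left_coidealD[OF S]
 have W: "left_coideal (coeff_sum S psis)" and psi: "lf psi" using Cons by auto
 note W' = left_coidealD[OF W]
 have c: "s:car H" if "s:S" for s using S' that by auto
 have cw: "w:car H" if "w:coeff_sum S psis" for w using W' that by auto
 have "subspace (coeff_sum S (psi # psis)) H"
 proof(rule subI)
  show "coeff_sum S (psi # psis) \<subseteq> car H" using c cw psi by auto
  show "\<zero>:coeff_sum S (psi # psis)"
   using sub_zero[OF S'(1)] sub_zero[OF W'(1)]
   by(auto simp: hitr_zero[OF psi] intro!: exI[of _ "\<zero>"])
 next
  fix x y assume "x:coeff_sum S (psi # psis)" "y:coeff_sum S (psi # psis)"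
  then obtain s w s' w' where xy: "x = hitr psi s\<oplus>w" "s:S" "w:coeff_sum S psis"
   "y = hitr psi s'\<oplus>w'" "s':S" "w':coeff_sum S psis" by auto
  have "x\<oplus>y = hitr psi (s\<oplus>s')\<oplus>(w\<oplus>w')"
   using xy c cw psi by(simp add: hitr_add vec_ac)
  thus "x\<oplus>y:coeff_sum S (psi # psis)"
   using sub_add[OF S'(1) xy(2,5)] sub_add[OF W'(1) xy(3,6)] by auto
 next
  fix a x assume "x:coeff_sum S (psi # psis)"
  then obtain s w where x: "x = hitr psi s\<oplus>w" "s:S" "w:coeff_sum S psis" by auto
  have "a\<odot>x = hitr psi (a\<odot>s)\<oplus>a\<odot>w"
   using x c cw psi by(simp add: hitr_smult smult_add)
  thus "a\<odot>x:coeff_sum S (psi # psis)"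
   using sub_smult[OF S'(1) x(2)] sub_smult[OF W'(1) x(3)] by auto
 qed
 moreover have "hitl f x:coeff_sum S (psi # psis)" if f: "lf f" and xx: "x:coeff_sum S (psi # psis)" for f x
 proof -
  obtain s w where x: "x = hitr psi s\<oplus>w" "s:S" "w:coeff_sum S psis" using xx by auto
  have "hitl f x = hitr psi (hitl f s)\<oplus>hitl f w"
   using x c cw psi f by(simp add: hitl_add hit_commute)
  thus ?thesis using S'(3)[OF f x(2)] W'(3)[OF f x(3)] by auto
 qed
 ultimately show ?case by(auto simp: left_coideal_def)
qed

lemma coeff_sum_append:
 assumes S: "left_coideal S" and "ALL psi:set psis. lf psi" "ALL psi:set psis'. lf psi"
  and "x:coeff_sum S psis" "y:coeff_sum S psis'"
 shows "x\<oplus>y:coeff_sum S (psis @ psis')"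
 using assms(2,4)
proof(induction psis arbitrary: x)
 case Nil
 thus ?case using assms(5) left_coidealD(2)[OF left_coideal_coeff_sum[OF S assms(3)]] by auto
next
 case (Cons psi psis)
 then obtain s w where x: "x = hitr psi s\<oplus>w" "s:S" "w:coeff_sum S psis" by auto
 have "w:car H" "y:car H" "hitr psi s:car H"
  using x Cons.prems assms(5) left_coidealD(2)[OF left_coideal_coeff_sum[OF S assms(3)]]
   left_coidealD(2)[OF left_coideal_coeff_sum[OF S, of psis]] left_coidealD(2)[OF S] by auto
 hence "x\<oplus>y = hitr psi s\<oplus>(w\<oplus>y)" by(simp add: x vec_assoc)
 moreover have "w\<oplus>y:coeff_sum S (psis @ psis')" using Cons x by auto
 ultimately show ?case using x by auto
qed

lemma hitr_coeff_sum:
 assumes S: "left_coideal S" and "ALL psi:set psis. lf psi" "lf f" "x:coeff_sum S psis"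
 shows "hitr f x:coeff_sum S (map (%psi. f \<star> psi) psis)"
 using assms(2,4)
proof(induction psis arbitrary: x)
 case Nil
 thus ?case using assms(3) by(simp add: hitr_zero)
next
 case (Cons psi psis)
 then obtain s w where x: "x = hitr psi s\<oplus>w" "s:S" "w:coeff_sum S psis" by auto
 have c: "w:car H" "s:car H" "lf psi"
  using x Cons.prems left_coidealD(2)[OF left_coideal_coeff_sum[OF S, of psis]] left_coidealD(2)[OF S] by auto
 hence "hitr f x = hitr (f \<star> psi) s\<oplus>hitr f w"
  using assms(3) by(simp add: x hitr_add hitr_hitr)
 thus ?case using Cons x by auto
qed

lemma gl_in_coeff_sum:
 assumes S: "left_coideal S" and min: "!!S'. [|left_coideal S'; S' \<subseteq> S|] ==> S' = {\<zero>} \<or> S' = S"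
  and g: "g:grouplikes H"
 shows "[|ALL psi:set psis. lf psi; g:coeff_sum S psis; lf f; x:S|] ==> hitl f x = f g\<odot>x"
proof(induction psis arbitrary: f x)
 case Nil
 thus ?case using grouplike_nonzero[OF g] by simp
next
 case (Cons psi psis)
 note S' = left_coidealD[OF S] and gH = gl_carrier[OF g]
 have W: "left_coideal (coeff_sum S psis)" and psi: "lf psi"
  using Cons.prems by(auto intro: left_coideal_coeff_sum[OF S])
 note W' = left_coidealD[OF W]
 obtain s w where gs: "g = hitr psi s\<oplus>w" and s: "s:S" and w: "w:coeff_sum S psis" using Cons.prems by auto
 have c: "s:car H" "w:car H" using s w S' W' by auto
 define U where "U = {u:S. hitr psi u:coeff_sum S psis}"
 have "left_coideal U"
  unfolding left_coideal_def
 proof(intro conjI allI impI)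
  show "subspace U H"
  proof -
   have "U = S \<inter> {x:car H. hitr psi x:coeff_sum S psis}" using S'(2) by(auto simp: U_def)
   thus ?thesis using sub_Int[OF S'(1) hit_preimage_sub(2)[OF W'(1) psi]] by simp
  qed
  fix h u assume h: "lf h" and u: "u:U"
  hence "hitr psi (hitl h u) = hitl h (hitr psi u)" using S'(2) psi by(subst hit_commute) (auto simp: U_def)
  thus "hitl h u:U" using u S'(3)[OF h] W'(3)[OF h] by(simp add: U_def)
 qed
 moreover have "U \<subseteq> S" by(auto simp: U_def)
 ultimately consider "U = S" | "U = {\<zero>}" using min by auto
 thus ?case
 proof cases
  case 1
  hence "hitr psi s:coeff_sum S psis" using s by(auto simp: U_def)
  hence "g:coeff_sum S psis" unfolding gs using w by(rule sub_add[OF W'(1)])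
  thus ?thesis using Cons by simp
 next
  case 2
  have eig: "hitl h s = h g\<odot>s" if h: "lf h" for h
  proof -
   have "hitr psi (hitl h s\<ominus>h g\<odot>s) = h g\<odot>w\<ominus>hitl h w"
   proof(rule eq_if_forms_eq)
    fix k assume k: "lf k"
    have "hitl h g = h g\<odot>g" by(rule hitl_gl[OF g h])
    hence "k (hitl h (hitr psi s\<oplus>w)) = h g * k (hitr psi s\<oplus>w)"
     using lf_smult[OF k gH, of "h g"] gs by simp
    hence "k (hitr psi (hitl h s)) + k (hitl h w) = h g * (k (hitr psi s) + k w)"
     using h psi c by(simp add: hitl_add hit_commute lf_add[OF k])
    moreover have "hitr psi (hitl h s\<ominus>h g\<odot>s) = hitr psi (hitl h s)\<oplus>(- h g)\<odot>hitr psi s"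
     using h psi c by(simp add: minus_eq_smult hitr_add hitr_smult)
    ultimately show "k (hitr psi (hitl h s\<ominus>h g\<odot>s)) = k (h g\<odot>w\<ominus>hitl h w)"
     using h psi c by(simp add: lf_add[OF k] lf_smult[OF k] lf_minus[OF k] algebra_simps)
   qed (use h psi c in auto)
   also have "...:coeff_sum S psis"
    by(intro sub_minus[OF W'(1)] sub_smult[OF W'(1)] W'(3)[OF h] w)
   finally have "hitl h s\<ominus>h g\<odot>s:U"
    unfolding U_def using sub_minus[OF S'(1) S'(3)[OF h s] sub_smult[OF S'(1) s]] by simp
   hence "hitl h s\<ominus>h g\<odot>s = \<zero>" using 2 by simp
   thus ?thesis using h c by simp
  qed
  show ?thesis
  proof(cases "s = \<zero>")
   case True
   hence "g = w" using gs c psi by(simp add: hitr_zero)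
   thus ?thesis using w Cons by simp
  next
   case False
   have "left_coideal (range (%a. a\<odot>s))"
    unfolding left_coideal_def using lspan_range_smult[OF c(1)] c by(auto simp: hitl_smult eig)
   moreover have "range (%a. a\<odot>s) \<subseteq> S" using sub_smult[OF S'(1) s] by auto
   moreover have "s:range (%a. a\<odot>s)" using c by(auto intro: range_eqI[of _ _ 1])
   ultimately have "range (%a. a\<odot>s) = S" using min[of "range (%a. a\<odot>s)"] False by auto
   then obtain a where "x = a\<odot>s" using Cons.prems by auto
   thus ?thesis using c Cons.prems by(simp add: hitl_smult eig mult.commute)
  qed
 qed
qed

text \<open>The coefficient coalgebra of a simple left coideal \<open>S\<close> contains a simple subcoalgebra, hence a
 group-like element. All simple left coideals in the coefficient coalgebra are isomorphic to \<open>S\<close>, so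
 that the coalgebra acts on \<open>S\<close> through this group-like element.\<close>

lemma simple_left_coideal:
 assumes S: "left_coideal S" "S ~= {\<zero>}" and min: "!!S'. [|left_coideal S'; S' \<subseteq> S|] ==> S' = {\<zero>} \<or> S' = S"
 shows "EX g:grouplikes H. ALL f x. lf f --> x:S --> hitl f x = f g\<odot>x"
proof -
 define D where "D = {y. EX psis. (ALL psi:set psis. lf psi) & y:coeff_sum S psis}"
 have lc: "left_coideal (coeff_sum S psis)" if "ALL psi:set psis. lf psi" for psis
  by(rule left_coideal_coeff_sum[OF S(1) that])
 have "subcoalgebra H D"
  unfolding subcoalgebra_iff left_coideal_def
 proof(intro conjI allI impI)
  show "subspace D H"
  proof(rule subI)
   show "D \<subseteq> car H" using left_coidealD(2)[OF lc] by(auto simp: D_def)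
   show "\<zero>:D" unfolding D_def by(intro CollectI exI[of _ "[]"]) simp
   show "x\<oplus>y:D" if xy: "x:D" "y:D" for x y
   proof -
    obtain psis psis' where "ALL psi:set psis. lf psi" "x:coeff_sum S psis" "ALL psi:set psis'. lf psi" "y:coeff_sum S psis'"
     using xy by(auto simp: D_def)
    thus ?thesis unfolding D_def using coeff_sum_append[OF S(1), of psis psis' x y]
     by(intro CollectI exI[of _ "psis @ psis'"]) auto
   qed
   show "a\<odot>x:D" if "x:D" for a x
    using that sub_smult[OF left_coidealD(1)[OF lc]] by(auto simp: D_def)
  qed
  show "hitl f x:D" if "lf f" "x:D" for f x
   using that left_coidealD(3)[OF lc] by(auto simp: D_def)
  show "hitr f x:D" if f: "lf f" and x: "x:D" for f x
  proof -
   obtain psis where "ALL psi:set psis. lf psi" "x:coeff_sum S psis" using x by(auto simp: D_def)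
   thus ?thesis unfolding D_def using hitr_coeff_sum[OF S(1) _ f]
    by(intro CollectI exI[of _ "map (%psi. f \<star> psi) psis"]) auto
  qed
 qed
 moreover have "S \<subseteq> D"
 proof
  fix s assume s: "s:S"
  hence "s:car H" using left_coidealD(2)[OF S(1)] by auto
  hence "s = hitr (counit H) s\<oplus>\<zero>" by(simp add: hitr_counit)
  thus "s:D" unfolding D_def using s
   by(intro CollectI exI[of _ "[counit H]"]) auto
 qed
 ultimately have D: "subcoalgebra H D & D ~= {\<zero>}"
  using S(2) sub_zero[OF left_coidealD(1)[OF S(1)]] by auto
 have "EX K. (subcoalgebra H K & K ~= {\<zero>}) & K \<subseteq> D & (ALL K'. (subcoalgebra H K' & K' ~= {\<zero>}) & K' \<subseteq> K --> K' = K)"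
  by(rule minimal_sub[where P = "%K. subcoalgebra H K & K ~= {\<zero>}", OF D]) (simp add: subcoalgebra_def)
 then obtain K where K': "subcoalgebra H K" "K ~= {\<zero>}" "K \<subseteq> D"
  and Kmin: "!!K'. [|subcoalgebra H K'; K' ~= {\<zero>}; K' \<subseteq> K|] ==> K' = K" by auto
 have K: "simple_subcoalgebra H K" "K \<subseteq> D" using K' Kmin by(auto simp: simple_subcoalgebra_def)
 then obtain g where g: "g:grouplikes H" "K = range (%a. a\<odot>g)" using simple_subcoalgebra_line by blast
 hence "g:D" using K(2) gl_carrier[OF g(1)] by(auto intro: range_eqI[of _ _ 1])
 then obtain psis where "ALL psi:set psis. lf psi" "g:coeff_sum S psis" by(auto simp: D_def)
 thus ?thesis using gl_in_coeff_sum[OF S(1) min g(1)] g(1) by auto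
qed

text \<open>Otherwise let \<open>N\<close> be minimal among the left coideals that properly contain \<open>H\<^sub>n\<close>. Contraction with a form that
 vanishes on \<open>H\<^sub>n\<close> but not on \<open>N\<close> maps \<open>N\<close> onto a simple left coideal, on which the coaction is given
 by one group-like element. This forces \<open>N\<close> into \<open>H\<^sub>n\<^sub>+\<^sub>1\<close>.\<close>

lemma filt_stationary:
 assumes "corad_filt H (Suc n) = corad_filt H n"
 shows "corad_filt H n = car H"
proof(rule ccontr)
 define C where "C = corad_filt H n"
 assume "corad_filt H n ~= car H"
 hence ne: "C \<subset> car H" using filt_closed by(auto simp: C_def)
 have C: "subspace C H" and Chit: "!!f x. [|lf f; x:C|] ==> hitl f x:C"
  using filt_sub filt_hit by(auto simp: C_def)
 have lcH: "left_coideal (car H)" using whole_sub by(auto simp: left_coideal_def)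
 have "EX K. (left_coideal K & C \<subset> K) & K \<subseteq> car H & (ALL K'. (left_coideal K' & C \<subset> K') & K' \<subseteq> K --> K' = K)"
 proof(rule minimal_sub[where P = "%K. left_coideal K & C \<subset> K"])
  show "left_coideal (car H) & C \<subset> car H" using lcH ne by simp
 qed (simp add: left_coideal_def)
 then obtain N where N: "left_coideal N" "C \<subset> N" and min: "!!K. [|left_coideal K; C \<subset> K; K \<subseteq> N|] ==> K = N" by metis
 note N' = left_coidealD[OF N(1)]
 obtain x0 where x0: "x0:N" "x0 ~: C" using N(2) by auto
 hence x0H: "x0:car H" using N'(2) by auto
 obtain phi where phi: "lf phi" "ALL y:C. phi y = 0" "phi x0 = 1" using separating_form[OF C x0H x0(2)] by auto
 have TC: "hitr phi x = \<zero>" if "x:C" for x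
 proof(rule eq_if_forms_eq)
  have xH: "x:car H" using that sub_subset[OF C] by auto
  thus "hitr phi x:car H" using phi(1) by simp
  fix f assume f: "lf f"
  have "f (hitr phi x) = phi (hitl f x)" using hitr_eval[OF phi(1) xH f] hitl_eval[OF f xH phi(1)] by simp
  thus "f (hitr phi x) = f \<zero>" using phi(2) Chit[OF f that] lf_zero[OF f] by simp
 qed simp
 define S where "S = hitr phi ` N"
 have NH: "x:car H" if "x:N" for x using that N'(2) by auto
 have S: "left_coideal S"
  unfolding left_coideal_def
 proof(intro conjI allI impI)
  show "subspace S H"
  proof(rule subI)
   show "S \<subseteq> car H" using NH phi(1) by(auto simp: S_def)
   show "\<zero>:S" unfolding S_def using sub_zero[OF N'(1)] by(auto intro!: image_eqI[of _ _ "\<zero>"] simp: hitr_zero[OF phi(1)])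
   show "x\<oplus>y:S" if xy: "x:S" "y:S" for x y
   proof -
    obtain u v where "u:N" "x = hitr phi u" "v:N" "y = hitr phi v" using xy by(auto simp: S_def)
    hence "x\<oplus>y = hitr phi (u\<oplus>v)" "u\<oplus>v:N" using NH phi(1) sub_add[OF N'(1)] by(auto simp: hitr_add)
    thus ?thesis by(auto simp: S_def)
   qed
   show "a\<odot>x:S" if xS: "x:S" for a x
   proof -
    obtain u where "u:N" "x = hitr phi u" using xS by(auto simp: S_def)
    hence "a\<odot>x = hitr phi (a\<odot>u)" "a\<odot>u:N" using NH phi(1) sub_smult[OF N'(1)] by(auto simp: hitr_smult)
    thus ?thesis by(auto simp: S_def)
   qed
  qed
  fix f x assume f: "lf f" and "x:S"
  then obtain u where "u:N" "x = hitr phi u" by(auto simp: S_def)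
  hence "hitl f x = hitr phi (hitl f u)" "hitl f u:N" using NH phi(1) f N'(3) by(auto simp: hit_commute)
  thus "hitl f x:S" by(auto simp: S_def)
 qed
 have preimage: "left_coideal {x:N. hitr phi x:S'}" if S': "left_coideal S'" for S'
  unfolding left_coideal_def
 proof(intro conjI allI impI)
  note S'' = left_coidealD[OF S']
  show "subspace {x:N. hitr phi x:S'} H"
  proof -
   have "{x:N. hitr phi x:S'} = N \<inter> {x:car H. hitr phi x:S'}" using N'(2) by auto
   thus ?thesis using sub_Int[OF N'(1) hit_preimage_sub(2)[OF S''(1) phi(1)]] by simp
  qed
  fix f u assume f: "lf f" and u: "u:{x:N. hitr phi x:S'}"
  hence "hitr phi (hitl f u) = hitl f (hitr phi u)" using NH phi(1) by(subst hit_commute) auto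
  thus "hitl f u:{x:N. hitr phi x:S'}" using u N'(3)[OF f] S''(3)[OF f] by simp
 qed
 have C_sub: "C \<subseteq> {x:N. hitr phi x:S'}" if "left_coideal S'" for S'
  using TC N(2) sub_zero[OF left_coidealD(1)[OF that]] by auto
 have "counit H (hitr phi x0) = 1"
  using hitr_eval[OF phi(1) x0H counit_lf] conv_counit_left[OF phi(1) x0H] phi(3) by simp
 hence Tx0: "hitr phi x0 ~= \<zero>" using lf_zero[OF counit_lf] by auto
 hence S0: "S ~= {\<zero>}" using x0(1) by(auto simp: S_def)
 have kernel: "x:C" if x: "x:N" "hitr phi x = \<zero>" for x
 proof -
  let ?K = "{x:N. hitr phi x:{\<zero>}}"
  have z: "left_coideal {\<zero>}" using zero_sub by(auto simp: left_coideal_def hitl_zero)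
  have "left_coideal ?K" "C \<subseteq> ?K" by(rule preimage[OF z], rule C_sub[OF z])
  moreover have "?K ~= N" using x0(1) Tx0 by auto
  ultimately have "?K = C" using min[of ?K] by auto
  thus ?thesis using x by auto
 qed
 have Smin: "S' = {\<zero>} \<or> S' = S" if S': "left_coideal S'" "S' \<subseteq> S" for S'
 proof(cases "S' \<subseteq> {\<zero>}")
  case True
  thus ?thesis using sub_zero[OF left_coidealD(1)[OF S'(1)]] by auto
 next
  case False
  let ?K = "{x:N. hitr phi x:S'}"
  obtain s where s: "s:S'" "s ~= \<zero>" using False by auto
  then obtain u where u: "u:N" "s = hitr phi u" using S'(2) by(auto simp: S_def)
  hence "u ~: C" using TC s by auto
  hence "C \<subset> ?K" using C_sub[OF S'(1)] u s by auto
  hence "?K = N" using min[OF preimage[OF S'(1)]] by simp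
  thus ?thesis using S'(2) by(auto simp: S_def)
 qed
 obtain g where g: "g:grouplikes H" "!!f x. [|lf f; x:S|] ==> hitl f x = f g\<odot>x"
  using simple_left_coideal[OF S S0 Smin] by auto
 have "N \<subseteq> C"
 proof
  fix x assume x: "x:N"
  have "(f \<star> h) x = 0" if fh: "annihilates f (coradical H)" "annihilates h C" for f h
  proof -
   note f = annihilatesD(1)[OF fh(1)] and h = annihilatesD(1)[OF fh(2)]
   have "hitr phi (hitl f x) = f g\<odot>hitr phi x"
    using g(2)[OF f, of "hitr phi x"] x hit_commute[OF f phi(1) NH[OF x]] by(simp add: S_def)
   also have "... = \<zero>" using annihilatesD(2)[OF fh(1) gl_coradical[OF g(1)]] NH[OF x] phi(1) by simp
   finally have "hitl f x:C" by(intro kernel N'(3)[OF f x])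
   thus ?thesis using annihilatesD(2)[OF fh(2)] hitl_eval[OF f NH[OF x] h] by simp
  qed
  hence "x:corad_filt H (Suc n)" unfolding filt_Suc_iff using NH[OF x] by(auto simp: C_def)
  thus "x:C" unfolding assms C_def .
 qed
 thus False using N(2) by simp
qed

lemma filt_exhaustive: "EX m. corad_filt H m = car H"
proof(rule ccontr)
 assume n: "\<nexists>m. corad_filt H m = car H"
 have "corad_filt H n \<subset> corad_filt H (Suc n)" for n
  using filt_stationary[of n] filt_mono_Suc[of n] n by auto
 hence dm: "dm (corad_filt H n) < dm (corad_filt H (Suc n))" for n
  by(intro dm_strict filt_sub)
 have "n <= dm (corad_filt H n)" for n
 proof(induction n)
  case (Suc n)
  thus ?case using dm[of n] by simp
 qed simp
 moreover obtain b where "ALL B phi. dual_system B phi --> card B <= b" using dual_system_bounded by auto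
 hence "dm N <= b" for N using dm_attained[of N] by auto
 ultimately show False by(meson Suc_n_not_le_n le_trans)
qed

lemma adapted_basis_exists: "EX B phi d. adapted (corad_filt H) B phi d"
proof -
 obtain m where "corad_filt H m = car H" using filt_exhaustive by auto
 thus ?thesis by(intro adapted_exists filt_sub filt_mono_Suc)
qed

lemma adapted_annihilates:
 assumes "adapted (corad_filt H) B phi d" "b:B"
 shows "annihilates (phi b) (corad_below H (d b))"
proof -
 have D: "dual_system B phi" using assms by(simp add: adapted_def)
 show ?thesis
 proof(cases "d b")
  case 0
  thus ?thesis using lf_zero[OF dual_systemD(3)[OF D assms(2)]] dual_systemD(3)[OF D assms(2)]
   by(simp add: annihilates_def)
 next
  case (Suc n)
  thus ?thesis using assms dual_systemD(3)[OF D assms(2)] by(auto simp: annihilates_def adapted_def)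
 qed
qed

lemma adapted_conv_zero:
 assumes "adapted (corad_filt H) B phi d" "b:B" "c:B" "x:corad_filt H n" "n < d b + d c"
 shows "(phi b \<star> phi c) x = 0"
proof -
 obtain k where k: "d b + d c = Suc k" "n <= k" using assms(5) by(cases "d b + d c") auto
 hence "x:corad_below H (d b + d c)" using assms(4) filt_mono[of n k] by auto
 thus ?thesis
  by(rule conv_annihilators[OF adapted_annihilates[OF assms(1,2)] adapted_annihilates[OF assms(1,3)]])
qed

text \<open>In a basis adapted to the filtration the coordinates of \<open>\<Delta>(x)\<close> are convolution products of dual basis elements,
 and \<open>conv_annihilators\<close> kills those of total degree larger than \<open>n\<close>.\<close>

lemma comult_corad_filt:
 assumes x: "x:corad_filt H n"
 shows "comult H x:tensors H H (\<Union>i\<le>n. corad_filt H i\<times>corad_filt H (n - i))"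
proof -
 obtain B phi d where A: "adapted (corad_filt H) B phi d" using adapted_basis_exists by auto
 hence D: "dual_system B phi" "ALL x:car H. proj B phi x = x" by(auto simp: adapted_def)
 show ?thesis
 proof(rule tensor_mem_by_coordinates[OF D D comult_closed[OF filt_closed[OF x]]])
  fix b c assume bc: "b:B" "c:B" "comult H x (%x y. phi b x * phi c y) ~= 0"
  hence "\<not> n < d b + d c" using adapted_conv_zero[OF A bc(1,2) x] by(auto simp: conv_def)
  hence le: "d b + d c <= n" by simp
  have "b:corad_filt H (d b)" "c:corad_filt H (d c)" using A bc by(auto simp: adapted_def)
  moreover have "corad_filt H (d c) \<subseteq> corad_filt H (n - d b)" using le by(intro filt_mono) auto
  ultimately show "(comult H x (%x y. phi b x * phi c y)\<odot>b, c):(\<Union>i\<le>n. corad_filt H i\<times>corad_filt H (n - i))"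
   using le sub_smult[OF filt_sub, of b "d b"] by(intro UN_I[of "d b"]) auto
 qed
qed

lemma mult_preimage_sub:
 assumes "subspace N H" "a:car H"
 shows "subspace {x:car H. a\<otimes>x:N} H"
  "subspace {x:car H. x\<otimes>a:N} H"
proof -
 have z: "a\<otimes>\<zero> = \<zero>" "\<zero> \<otimes> a = \<zero>"
  using ring.ring_simprules(24,25)[OF alg_ring assms(2)] by auto
 show "subspace {x:car H. a\<otimes>x:N} H"
  "subspace {x:car H. x\<otimes>a:N} H"
  using assms(2) by(auto intro!: subI sub_add[OF assms(1)] sub_smult[OF assms(1)] sub_zero[OF assms(1)]
   simp: alg_r_distr alg_l_distr smult_mult_left smult_mult_right)
qed

lemma coradical_mult: "[|x:coradical H; y:coradical H|] ==> x\<otimes>y:coradical H"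
proof -
 assume x: "x:coradical H" and y: "y:coradical H"
 have xH: "x:car H" using filt_closed[of x 0] x by simp
 have 1: "g\<otimes>x:coradical H" if g: "g:grouplikes H" "x:coradical H" for g x
 proof -
  have "coradical H \<subseteq> {x:car H. g\<otimes>x:coradical H}"
   by(rule coradical_induct[OF mult_preimage_sub(1)[OF coradical_sub gl_carrier[OF g(1)]]])
    (auto simp: gl_carrier intro!: gl_coradical gl_mult g)
  thus ?thesis using g by auto
 qed
 have "coradical H \<subseteq> {x:car H. x\<otimes>y:coradical H}"
  by(rule coradical_induct[OF mult_preimage_sub(2)[OF coradical_sub]])
   (use y filt_closed[of y 0] 1 in \<open>auto simp: gl_carrier\<close>)
 thus ?thesis using x by auto
qed

lemma filt_mult:
 "[|x:corad_filt H i; y:corad_filt H j|] ==> x\<otimes>y:corad_filt H (i + j)"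
proof(induction "i + j" arbitrary: i j x y rule: less_induct)
 case less
 note xH = filt_closed[OF less.prems(1)] and yH = filt_closed[OF less.prems(2)]
 show ?case
 proof(cases "i + j")
  case 0
  thus ?thesis using less.prems coradical_mult by simp
 next
  case (Suc n)
  have "(f \<star> g) (x\<otimes>y) = 0" if fg: "annihilates f (coradical H)" "annihilates g (corad_filt H n)" for f g
  proof -
   note l = annihilatesD(1)[OF fg(1)] annihilatesD(1)[OF fg(2)]
   have "(f \<star> g) (x\<otimes>y) = comult H x (%u v. comult H y (%u' v'. f (u\<otimes>u') * g (v\<otimes>v')))"
    unfolding conv_def using comult_mult_eval[OF xH yH bil_prod[OF l]] .
   also have "... = 0"
   proof(rule tensor_vanish[OF comult_corad_filt[OF less.prems(1)]])
    fix u v assume "(u, v):(\<Union>a\<le>i. corad_filt H a\<times>corad_filt H (i - a))"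
    then obtain a where a: "a <= i" "u:corad_filt H a" "v:corad_filt H (i - a)" by auto
    show "comult H y (%u' v'. f (u\<otimes>u') * g (v\<otimes>v')) = 0"
    proof(rule tensor_vanish[OF comult_corad_filt[OF less.prems(2)]])
     fix u' v' assume "(u', v'):(\<Union>a\<le>j. corad_filt H a\<times>corad_filt H (j - a))"
     then obtain b where b: "b <= j" "u':corad_filt H b" "v':corad_filt H (j - b)" by auto
     show "f (u\<otimes>u') * g (v\<otimes>v') = 0"
     proof(cases "a = 0 & b = 0")
      case True
      thus ?thesis using a b coradical_mult annihilatesD(2)[OF fg(1)] by simp
     next
      case False
      have lt: "(i - a) + (j - b) < i + j" using False a(1) b(1) by auto
      have "v\<otimes>v':corad_filt H ((i - a) + (j - b))" by(rule less.hyps[OF lt a(3) b(3)])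
      moreover have "corad_filt H ((i - a) + (j - b)) \<subseteq> corad_filt H n"
       using lt Suc by(intro filt_mono) auto
      ultimately show ?thesis using annihilatesD(2)[OF fg(2)] by auto
     qed
    qed
   qed
   finally show ?thesis .
  qed
  thus ?thesis using xH yH unfolding Suc filt_Suc_iff by auto
 qed
qed

end

section \<open>The associated graded Hopf algebra\<close>

lemma gr_simps [simp]:
 "car (gr H) = car (gr_alg H)" "monoid.mult (gr H) = monoid.mult (gr_alg H)"
 "one (gr H) = one (gr_alg H)" "ring.zero (gr H) = ring.zero (gr_alg H)" "ring.add (gr H) = ring.add (gr_alg H)"
 "module.smult (gr H) = module.smult (gr_alg H)"
 "counit (gr H) = (%c. counit H (rep (c 0)))"
 "comult (gr H) = (%c be. \<Sum>n | c n ~= corad_below H n. gr_comult_hom H n (rep (c n)) be)"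
 by(simp_all add: gr_def module.defs bialg.defs)

lemma bilform_gr: "bilinear_form (gr H) (gr H) = bilinear_form (gr_alg H) (gr_alg H)"
 by(simp add: bilinear_form_def[abs_def] linear_form_def)

context kspace
begin

lemmas vec_finsum_insert = M.finsum_insert
 and vec_finsum_neutral = M.add.finprod_mono_neutral_cong_right

lemma coset_mem_iff:
 assumes "subspace N M" "x:car M" "y:car M"
 shows "y:N +>\<^bsub>M\<^esub> x \<longleftrightarrow> y\<ominus>x:N"
proof
 assume "y:N +>\<^bsub>M\<^esub> x"
 then obtain z where z: "z:N" "y = z\<oplus>x" by(auto simp: a_r_coset_def')
 hence "y\<ominus>x = z" using sub_mem[OF assms(1) z(1)] assms(2)
  by(simp add: M.minus_eq M.a_assoc M.r_neg)
 thus "y\<ominus>x:N" using z by simp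
next
 assume "y\<ominus>x:N"
 moreover have "y = (y\<ominus>x)\<oplus>x" using assms by(simp add: M.minus_eq M.a_assoc M.l_neg)
 ultimately show "y:N +>\<^bsub>M\<^esub> x" by(auto simp: a_r_coset_def')
qed

lemma coset_subset: "[|subspace N M; x:car M; y:N +>\<^bsub>M\<^esub> x|] ==> y:car M"
 using sub_subset by(auto simp: a_r_coset_def')

lemma coset_self: "[|subspace N M; x:car M|] ==> x:N +>\<^bsub>M\<^esub> x"
 by(simp add: coset_mem_iff M.minus_eq M.r_neg sub_zero)

lemma minus_swap: "[|x:car M; y:car M|] ==> y\<ominus>x = (- 1)\<odot>(x\<ominus>y)"
 by(simp add: minus_eq_smult smult_add M.a_comm)

lemma minus_chain: "[|x:car M; y:car M; z:car M|] ==> (x\<ominus>y)\<oplus>(y\<ominus>z) = x\<ominus>z"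
 by(rule eq_if_forms_eq) (auto simp: lf_add lf_minus)

lemma coset_eq_iff:
 assumes N: "subspace N M" and x: "x:car M" "y:car M"
 shows "N +>\<^bsub>M\<^esub> x = N +>\<^bsub>M\<^esub> y \<longleftrightarrow> x\<ominus>y:N"
proof
 assume "N +>\<^bsub>M\<^esub> x = N +>\<^bsub>M\<^esub> y"
 thus "x\<ominus>y:N" using coset_self[OF N x(1)] coset_mem_iff[OF N x(2,1)] by simp
next
 assume xy: "x\<ominus>y:N"
 hence yx: "y\<ominus>x:N" using minus_swap[OF x] sub_smult[OF N] by simp
 have "z:N +>\<^bsub>M\<^esub> x \<longleftrightarrow> z:N +>\<^bsub>M\<^esub> y" if z: "z:car M" for z
  using coset_mem_iff[OF N x(1) z] coset_mem_iff[OF N x(2) z] sub_add[OF N _ xy, of "z\<ominus>x"]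
   sub_add[OF N _ yx, of "z\<ominus>y"] minus_chain[OF z x(1,2)] minus_chain[OF z x(2,1)] by auto
 thus "N +>\<^bsub>M\<^esub> x = N +>\<^bsub>M\<^esub> y" using coset_subset[OF N x(1)] coset_subset[OF N x(2)] by auto
qed

lemma rep_coset:
 assumes N: "subspace N M" and x: "x:car M"
 shows "rep (N +>\<^bsub>M\<^esub> x):car M" "rep (N +>\<^bsub>M\<^esub> x)\<ominus>x:N"
proof -
 have "rep (N +>\<^bsub>M\<^esub> x):N +>\<^bsub>M\<^esub> x"
  unfolding rep_def by(rule someI[where P = "%y. y:N +>\<^bsub>M\<^esub> x"]) (rule coset_self[OF N x])
 thus "rep (N +>\<^bsub>M\<^esub> x):car M" "rep (N +>\<^bsub>M\<^esub> x)\<ominus>x:N"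
  using coset_subset[OF N x] coset_mem_iff[OF N x] by auto
qed

lemma coset_add:
 assumes N: "subspace N M" and x: "x:car M" "y:car M"
 shows "(N +>\<^bsub>M\<^esub> x) <+>\<^bsub>M\<^esub> (N +>\<^bsub>M\<^esub> y) = N +>\<^bsub>M\<^esub> (x\<oplus>y)"
proof
 show "(N +>\<^bsub>M\<^esub> x) <+>\<^bsub>M\<^esub> (N +>\<^bsub>M\<^esub> y) \<subseteq> N +>\<^bsub>M\<^esub> (x\<oplus>y)"
 proof
  fix w assume "w:(N +>\<^bsub>M\<^esub> x) <+>\<^bsub>M\<^esub> (N +>\<^bsub>M\<^esub> y)"
  then obtain a b where ab: "a:N" "b:N" "w = (a\<oplus>x)\<oplus>(b\<oplus>y)"
   by(auto simp: set_add_def' a_r_coset_def')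
  hence "w = (a\<oplus>b)\<oplus>(x\<oplus>y)" using x sub_mem[OF N] by(simp add: M.a_ac)
  thus "w:N +>\<^bsub>M\<^esub> (x\<oplus>y)" using sub_add[OF N ab(1,2)] by(auto simp: a_r_coset_def')
 qed
 show "N +>\<^bsub>M\<^esub> (x\<oplus>y) \<subseteq> (N +>\<^bsub>M\<^esub> x) <+>\<^bsub>M\<^esub> (N +>\<^bsub>M\<^esub> y)"
 proof
  fix w assume "w:N +>\<^bsub>M\<^esub> (x\<oplus>y)"
  then obtain a where a: "a:N" "w = a\<oplus>(x\<oplus>y)" by(auto simp: a_r_coset_def')
  hence "w = (a\<oplus>x)\<oplus>y" using x sub_mem[OF N] by(simp add: M.a_ac)
  moreover have "a\<oplus>x:N +>\<^bsub>M\<^esub> x" using a by(auto simp: a_r_coset_def')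
  ultimately show "w:(N +>\<^bsub>M\<^esub> x) <+>\<^bsub>M\<^esub> (N +>\<^bsub>M\<^esub> y)"
   using coset_self[OF N x(2)] by(auto simp: set_add_def')
 qed
qed

lemma coset_zero: "subspace N M ==> x:N ==> N +>\<^bsub>M\<^esub> x = N"
proof -
 assume N: "subspace N M" and x: "x:N"
 have "N +>\<^bsub>M\<^esub> x = N +>\<^bsub>M\<^esub> \<zero>"
  using x sub_mem[OF N x] by(subst coset_eq_iff[OF N]) (auto simp: minus_eq_smult)
 also have "... = N" using sub_subset[OF N] by simp
 finally show ?thesis .
qed

end

context pointed_fd_bialgebra
begin

abbreviation "gra \<equiv> gr_alg H"
abbreviation gmult (infixl \<open>\<otimes>\<^sub>g\<close> 70) where "a \<otimes>\<^sub>g b \<equiv> a \<otimes>\<^bsub>gra\<^esub> b"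
abbreviation gadd (infixl \<open>\<oplus>\<^sub>g\<close> 65) where "a \<oplus>\<^sub>g b \<equiv> a \<oplus>\<^bsub>gra\<^esub> b"
abbreviation gsmult (infixl \<open>\<odot>\<^sub>g\<close> 70) where "c \<odot>\<^sub>g a \<equiv> c \<odot>\<^bsub>gra\<^esub> a"
abbreviation gzero (\<open>\<zero>\<^sub>g\<close>) where "\<zero>\<^sub>g \<equiv> \<zero>\<^bsub>gra\<^esub>"
abbreviation gone (\<open>\<one>\<^sub>g\<close>) where "\<one>\<^sub>g \<equiv> \<one>\<^bsub>gra\<^esub>"
abbreviation "cl \<equiv> gr_class H"
abbreviation "gh \<equiv> gr_hom H"
abbreviation "Hf \<equiv> corad_filt H"
abbreviation "Kb \<equiv> corad_below H"

lemma cl_eq_iff: "[|x:car H; y:car H|] ==> cl n x = cl n y \<longleftrightarrow> x\<ominus>y:Kb n"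
 unfolding gr_class_def by(rule coset_eq_iff[OF below_sub])

lemma rep_cl: "x:car H ==> rep (cl n x):car H" "x:car H ==> rep (cl n x)\<ominus>x:Kb n"
 unfolding gr_class_def using rep_coset[OF below_sub] by auto

lemma rep_cl_filt: "x:Hf n ==> rep (cl n x):Hf n"
proof -
 assume x: "x:Hf n"
 note xH = filt_closed[OF x]
 have "rep (cl n x) = (rep (cl n x)\<ominus>x)\<oplus>x"
  using rep_cl(1)[OF xH] xH by(intro eq_if_forms_eq) (auto simp: lf_add lf_minus)
 thus ?thesis
  using sub_add[OF filt_sub _ x] rep_cl(2)[OF xH, of n] below_subset[of n] by(metis subsetD)
qed

lemma cl_zero: "x:Kb n ==> cl n x = Kb n"
 unfolding gr_class_def by(rule coset_zero[OF below_sub])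

lemma cl_eq_below_iff: "x:car H ==> cl n x = Kb n \<longleftrightarrow> x:Kb n"
 using cl_zero coset_self[OF below_sub, of x n] by(auto simp: gr_class_def)

lemma cl_rep: "x:car H ==> cl n (rep (cl n x)) = cl n x"
 using cl_eq_iff rep_cl by simp

lemma rep_below: "rep (Kb n):Kb n"
 unfolding rep_def using sub_zero[OF below_sub] by(rule someI)

lemma gr_carrierD:
 assumes "c:car gra"
 shows "rep (c n):Hf n" "c n = cl n (rep (c n))" "finite {n. c n ~= Kb n}"
proof -
 obtain x where x: "x:Hf n" "c n = cl n x" using assms by(auto simp: gr_alg_def)
 thus "rep (c n):Hf n" "c n = cl n (rep (c n))"
  using rep_cl_filt cl_rep[OF filt_closed[OF x(1)]] by auto
 show "finite {n. c n ~= Kb n}" using assms by(auto simp: gr_alg_def)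
qed

lemma gr_carrierI:
 assumes "!!n. x n:Hf n" "!!n. c n = cl n (x n)" "finite {n. c n ~= Kb n}"
 shows "c:car gra"
 using assms by(auto simp: gr_alg_def)

lemma zero_filt: "\<zero>:Hf n"
 by(rule sub_zero[OF filt_sub])

lemma gh_apply: "gh n x n = cl n x" "j ~= n ==> gh n x j = Kb j"
 by(auto simp: gr_hom_def)

lemma gh_closed: "x:Hf n ==> gh n x:car gra"
proof(rule gr_carrierI[where x = "%j. if j = n then x else \<zero>"])
 show "finite {j. gh n x j ~= Kb j}" by(rule finite_subset[of _ "{n}"]) (auto simp: gr_hom_def)
qed (auto simp: gr_hom_def zero_filt cl_zero sub_zero[OF below_sub])

lemma gh_eq_iff: "[|x:Hf n; y:Hf n|] ==> gh n x = gh n y \<longleftrightarrow> x\<ominus>y:Kb n"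
 using cl_eq_iff[OF filt_closed filt_closed] by(auto simp: gr_hom_def fun_eq_iff)

lemma gra_zero: "\<zero>\<^sub>g = Kb"
 by(auto simp: gr_alg_def)

lemma gh_zero_iff: "x:Hf n ==> gh n x = \<zero>\<^sub>g \<longleftrightarrow> x:Kb n"
 using cl_eq_below_iff[OF filt_closed, of x n n] by(auto simp: gr_hom_def fun_eq_iff gra_zero)

lemma below_add: "Kb n <+>\<^bsub>H\<^esub> Kb n = Kb n"
 using coset_add[OF below_sub[of n], of "\<zero>" "\<zero>"]
 by(simp add: coset_zero[OF below_sub] sub_zero[OF below_sub])

lemma gra_add_apply: "(c \<oplus>\<^sub>g c') n = c n <+>\<^bsub>H\<^esub> c' n"
 by(simp add: gr_alg_def)

lemma cl_add: "[|x:car H; y:car H|] ==> cl n x <+>\<^bsub>H\<^esub> cl n y = cl n (x\<oplus>y)"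
 unfolding gr_class_def by(rule coset_add[OF below_sub])

lemma gra_add_closed:
 assumes "c:car gra" "c':car gra"
 shows "c \<oplus>\<^sub>g c':car gra"
proof(rule gr_carrierI[where x = "%n. rep (c n)\<oplus>rep (c' n)"])
 note D = gr_carrierD[OF assms(1)] gr_carrierD[OF assms(2)]
 show "rep (c n)\<oplus>rep (c' n):Hf n" for n using D by(intro sub_add[OF filt_sub])
 show "(c \<oplus>\<^sub>g c') n = cl n (rep (c n)\<oplus>rep (c' n))" for n
  using D(2)[of n] D(5)[of n] cl_add[OF filt_closed[OF D(1)] filt_closed[OF D(4)], of n n n]
  by(simp add: gra_add_apply)
 show "finite {n. (c \<oplus>\<^sub>g c') n ~= Kb n}"
  by(rule finite_subset[OF _ finite_UnI[OF D(3) D(6)]]) (auto simp: gra_add_apply below_add)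
qed

lemma gh_add: "[|x:Hf n; y:Hf n|] ==> gh n x \<oplus>\<^sub>g gh n y = gh n (x\<oplus>y)"
 by(auto simp: fun_eq_iff gra_add_apply gr_hom_def cl_add[OF filt_closed filt_closed] below_add)

lemma gra_smult_apply: "(a \<odot>\<^sub>g c) n = cl n (a\<odot>rep (c n))"
 by(simp add: gr_alg_def)

lemma cl_smult: "x:car H ==> cl n (a\<odot>rep (cl n x)) = cl n (a\<odot>x)"
proof -
 assume x: "x:car H"
 have "a\<odot>rep (cl n x)\<ominus>a\<odot>x = a\<odot>(rep (cl n x)\<ominus>x)"
  using rep_cl(1)[OF x] x by(simp add: minus_eq_smult smult_add)
 thus ?thesis
  using sub_smult[OF below_sub rep_cl(2)[OF x]] rep_cl(1)[OF x] x by(subst cl_eq_iff) auto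
qed

lemma gh_smult: "x:Hf n ==> a \<odot>\<^sub>g gh n x = gh n (a\<odot>x)"
 using cl_smult[OF filt_closed, of x n n a]
 by(auto simp: fun_eq_iff gra_smult_apply gr_hom_def intro!: cl_zero sub_smult[OF below_sub] rep_below)

lemma gra_smult_closed:
 assumes "c:car gra"
 shows "a \<odot>\<^sub>g c:car gra"
proof(rule gr_carrierI[where x = "%n. a\<odot>rep (c n)"])
 note D = gr_carrierD[OF assms]
 show "a\<odot>rep (c n):Hf n" for n using D by(intro sub_smult[OF filt_sub])
 have "(a \<odot>\<^sub>g c) n = Kb n" if "c n = Kb n" for n
  unfolding gra_smult_apply that by(intro cl_zero sub_smult[OF below_sub] rep_below)
 thus "finite {n. (a \<odot>\<^sub>g c) n ~= Kb n}"
  by(intro finite_subset[OF _ D(3)]) auto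
qed (simp add: gra_smult_apply)

lemma below_mult1: "[|x:Hf i; y:Kb j|] ==> x\<otimes>y:Kb (i + j)"
proof(cases j)
 case 0
 assume "x:Hf i" "y:Kb j"
 thus ?thesis using 0 ring.ring_simprules(25)[OF alg_ring filt_closed] sub_zero[OF below_sub] by simp
qed (use filt_mult in auto)

lemma below_mult2: "[|x:Kb i; y:Hf j|] ==> x\<otimes>y:Kb (i + j)"
proof(cases i)
 case 0
 assume "x:Kb i" "y:Hf j"
 thus ?thesis using 0 ring.ring_simprules(24)[OF alg_ring filt_closed] sub_zero[OF below_sub] by simp
qed (use filt_mult in auto)

lemma gra_mult_apply:
 "(c \<otimes>\<^sub>g c') n = cl n (\<Oplus>i\<in>{..n}. rep (c i)\<otimes>rep (c' (n - i)))"
 by(simp add: gr_alg_def)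

lemma gra_mult_closed:
 assumes "c:car gra" "c':car gra"
 shows "c \<otimes>\<^sub>g c':car gra"
proof(rule gr_carrierI[where x = "%n. \<Oplus>i\<in>{..n}. rep (c i)\<otimes>rep (c' (n - i))"])
 note D = gr_carrierD[OF assms(1)] gr_carrierD[OF assms(2)]
 show "(\<Oplus>i\<in>{..n}. rep (c i)\<otimes>rep (c' (n - i))):Hf n" for n
 proof(rule sub_finsum[OF filt_sub])
  fix i assume "i:{..n}"
  thus "rep (c i)\<otimes>rep (c' (n - i)):Hf n"
   using filt_mult[OF D(1)[of i] D(4)[of "n - i"]] by simp
 qed simp
 obtain b where b: "!!n. c n ~= Kb n ==> n <= b" using D(3) unfolding finite_nat_set_iff_bounded_le by auto
 obtain b' where b': "!!n. c' n ~= Kb n ==> n <= b'" using D(6) unfolding finite_nat_set_iff_bounded_le by auto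
 have "(c \<otimes>\<^sub>g c') n = Kb n" if n: "b + b' < n" for n
  unfolding gra_mult_apply
 proof(intro cl_zero sub_finsum[OF below_sub])
  fix i assume i: "i:{..n}"
  then consider "c i = Kb i" | "c' (n - i) = Kb (n - i)" using b[of i] b'[of "n - i"] n by force
  thus "rep (c i)\<otimes>rep (c' (n - i)):Kb n"
  proof cases
   case 1
   thus ?thesis using below_mult2[OF _ D(4)[of "n - i"], of "rep (c i)" i] rep_below[of i] i by simp
  next
   case 2
   thus ?thesis using below_mult1[OF D(1)[of i], of "rep (c' (n - i))" "n - i"] rep_below[of "n - i"] i by simp
  qed
 qed simp
 thus "finite {n. (c \<otimes>\<^sub>g c') n ~= Kb n}"
  by(intro finite_subset[OF _ finite_atMost[of "b + b'"]]) (force simp: not_less)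
qed (simp add: gra_mult_apply)

lemma gh_mult:
 assumes x: "x:Hf i" and y: "y:Hf j"
 shows "gh i x \<otimes>\<^sub>g gh j y = gh (i + j) (x\<otimes>y)"
proof
 fix n
 note xH = filt_closed[OF x] and yH = filt_closed[OF y]
 define t where "t l = rep (gh i x l)\<otimes>rep (gh j y (n - l))" for l
 have gx: "rep (gh i x l):Hf l" and gy: "rep (gh j y l):Hf l" for l
  using gr_carrierD(1)[OF gh_closed[OF x]] gr_carrierD(1)[OF gh_closed[OF y]] by auto
 have tK: "t l:Kb n" if l: "l <= n" "l ~= i \<or> n - l ~= j" for l
  using l(2)
 proof
  assume "l ~= i"
  hence "rep (gh i x l):Kb l" using rep_below by(simp add: gh_apply)
  thus ?thesis using below_mult2[OF _ gy[of "n - l"]] l(1) by(fastforce simp: t_def)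
 next
  assume "n - l ~= j"
  hence "rep (gh j y (n - l)):Kb (n - l)" using rep_below by(simp add: gh_apply)
  thus ?thesis using below_mult1[OF gx[of l]] l(1) by(fastforce simp: t_def)
 qed
 have tH: "t l:car H" for l
  unfolding t_def using gx gy filt_closed by(intro alg_m_closed) auto
 have K: "subspace (Kb n) H" by(rule below_sub)
 show "(gh i x \<otimes>\<^sub>g gh j y) n = gh (i + j) (x\<otimes>y) n"
 proof(cases "n = i + j")
  case False
  hence "l ~= i \<or> n - l ~= j" if "l <= n" for l using that by auto
  hence "(\<Oplus>l\<in>{..n}. t l):Kb n" using tK by(intro sub_finsum[OF K]) auto
  thus ?thesis using False by(simp add: gra_mult_apply gh_apply cl_zero t_def)
 next
  case True
  have rest: "(\<Oplus>l\<in>{..n} - {i}. t l):Kb n" using tK by(intro sub_finsum[OF K]) auto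
  have "{..n} = insert i ({..n} - {i})" using True by auto
  hence "(\<Oplus>l\<in>{..n}. t l) = (\<Oplus>l\<in>insert i ({..n} - {i}). t l)" by simp
  also have "... = t i\<oplus>(\<Oplus>l\<in>{..n} - {i}. t l)" using tH by(intro vec_finsum_insert) auto
  finally have sum: "(\<Oplus>l\<in>{..n}. t l) = t i\<oplus>(\<Oplus>l\<in>{..n} - {i}. t l)" .
  define a b where "a = rep (cl i x)" and "b = rep (cl j y)"
  have ab: "a:Hf i" "b:Hf j" "a\<ominus>x:Kb i" "b\<ominus>y:Kb j"
   using rep_cl_filt[OF x] rep_cl_filt[OF y] rep_cl(2)[OF xH] rep_cl(2)[OF yH] by(auto simp: a_def b_def)
  note abH = filt_closed[OF ab(1)] filt_closed[OF ab(2)]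
  have ti: "t i = a\<otimes>b" using True by(simp add: t_def gh_apply a_def b_def)
  have "(a\<otimes>b\<oplus>(\<Oplus>l\<in>{..n} - {i}. t l))\<ominus>x\<otimes>y
    = (a\<otimes>(b\<ominus>y)\<oplus>(a\<ominus>x)\<otimes>y)\<oplus>(\<Oplus>l\<in>{..n} - {i}. t l)"
  proof(rule eq_if_forms_eq)
   fix f assume f: "lf f"
   have 1: "f (a\<otimes>(b\<ominus>y)) = f (a\<otimes>b) - f (a\<otimes>y)"
    using lf_comp[OF f linmap_mult_left[OF abH(1)]] abH yH by(intro lf_minus[of "%z. f (a\<otimes>z)"]) auto
   have 2: "f ((a\<ominus>x)\<otimes>y) = f (a\<otimes>y) - f (x\<otimes>y)"
    using lf_comp[OF f linmap_mult_right[OF yH]] abH xH by(intro lf_minus[of "%z. f (z\<otimes>y)"]) auto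
   show "f ((a\<otimes>b\<oplus>(\<Oplus>l\<in>{..n} - {i}. t l))\<ominus>x\<otimes>y)
    = f ((a\<otimes>(b\<ominus>y)\<oplus>(a\<ominus>x)\<otimes>y)\<oplus>(\<Oplus>l\<in>{..n} - {i}. t l))"
    using 1 2 abH xH yH sub_mem[OF K rest] by(simp add: lf_add[OF f] lf_minus[OF f])
  qed (use abH xH yH sub_mem[OF K rest] in auto)
  also have "...:Kb n"
   using below_mult1[OF ab(1) ab(4)] below_mult2[OF ab(3) y] rest True by(intro sub_add[OF K]) auto
  finally have "cl n (\<Oplus>l\<in>{..n}. t l) = cl n (x\<otimes>y)"
   using sum ti abH xH yH sub_mem[OF K rest] by(subst cl_eq_iff) auto
  thus ?thesis using True by(simp add: gra_mult_apply gh_apply t_def)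
 qed
qed

lemma gra_one: "\<one>\<^sub>g = gh 0 \<one>"
 by(simp add: gr_alg_def)

subsection \<open>Comultiplication of homogeneous elements\<close>

lemma gra_form_expand:
 assumes A: "adapted Hf B phi d" and F: "linear_form gra F" and u: "u:Hf l"
 shows "F (gh l u) = (\<Sum>b\<in>{b:B. d b = l}. phi b u * F (gh l b))"
proof -
 have D: "dual_system B phi" "proj B phi u = u" using A filt_closed[OF u] by(auto simp: adapted_def)
 note D' = dual_systemD[OF D(1)]
 have Fz: "F (gh l z) = 0" if z: "z:Kb l" for z
 proof -
  have zl: "z:Hf l" using z below_subset by auto
  have "0 \<odot>\<^sub>g gh l z = gh l \<zero>" using gh_smult[OF zl, of 0] filt_closed[OF zl] by simp
  moreover have "gh l \<zero> = gh l z"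
   using gh_zero_iff[OF zl] gh_zero_iff[OF zero_filt[of l]] z sub_zero[OF below_sub[of l]] by simp
  ultimately have "gh l z = 0 \<odot>\<^sub>g gh l z" by simp
  hence "F (gh l z) = 0 * F (gh l z)" using F gh_closed[OF zl] by(metis linear_form_def)
  thus ?thesis by simp
 qed
 have Fadd: "F (gh l (z\<oplus>w)) = F (gh l z) + F (gh l w)" if "z:Hf l" "w:Hf l" for z w
 proof -
  have "F (gh l z \<oplus>\<^sub>g gh l w) = F (gh l z) + F (gh l w)" using F gh_closed that by(simp add: linear_form_def)
  thus ?thesis using gh_add[OF that] by simp
 qed
 have Fsm: "F (gh l (a\<odot>z)) = a * F (gh l z)" if "z:Hf l" for a z
 proof -
  have "F (a \<odot>\<^sub>g gh l z) = a * F (gh l z)" using F gh_closed that by(simp add: linear_form_def)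
  thus ?thesis using gh_smult[OF that] by simp
 qed
 define B' where "B' = {b:B. d b <= l}"
 have B'l: "b:Hf l" if "b:B'" for b
  using that A filt_mono[of "d b" l] by(auto simp: B'_def adapted_def)
 have sum: "F (gh l (\<Oplus>b\<in>C. phi b u\<odot>b)) = (\<Sum>b\<in>C. phi b u * F (gh l b)) & (\<Oplus>b\<in>C. phi b u\<odot>b):Hf l"
  if "finite C" "C \<subseteq> B'" for C
  using that
 proof(induction C rule: finite_induct)
  case empty
  show ?case using Fz[OF sub_zero[OF below_sub]] by(simp add: zero_filt)
 next
  case (insert b C)
  have c: "phi b u\<odot>b:Hf l" using insert.prems B'l by(auto intro: sub_smult[OF filt_sub])
  have "(\<Oplus>b\<in>insert b C. phi b u\<odot>b) = phi b u\<odot>b\<oplus>(\<Oplus>b\<in>C. phi b u\<odot>b)"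
   using insert D'(2) by(intro vec_finsum_insert) (auto simp: B'_def)
  thus ?case
   using insert B'l Fadd[OF c] Fsm[of b] sub_add[OF filt_sub c] by auto
 qed
 have "u = (\<Oplus>b\<in>B. phi b u\<odot>b)" using D(2) by(simp add: proj_def)
 also have "... = (\<Oplus>b\<in>B'. phi b u\<odot>b)"
 proof(rule vec_finsum_neutral)
  show "phi b u\<odot>b = \<zero>" if b: "b:B - B'" for b
  proof -
   have "phi b u = 0" using A u b by(auto simp: adapted_def B'_def)
   thus "phi b u\<odot>b = \<zero>" using b D'(4) by simp
  qed
 qed (use D' in \<open>auto simp: B'_def\<close>)
 finally have "F (gh l u) = (\<Sum>b\<in>B'. phi b u * F (gh l b))"
  using sum[of B'] D'(1) by(simp add: B'_def)
 also have "... = (\<Sum>b\<in>{b:B. d b = l}. phi b u * F (gh l b))"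
 proof(rule sum.mono_neutral_right)
  show "ALL b:B' - {b:B. d b = l}. phi b u * F (gh l b) = 0"
  proof
   fix b assume b: "b:B' - {b:B. d b = l}"
   hence "d b < l" "b:Hf (d b)" using A by(auto simp: B'_def adapted_def)
   hence "b:Kb l" using filt_mono[of "d b" "l - 1"] by(cases l) auto
   thus "phi b u * F (gh l b) = 0" using Fz by simp
  qed
 qed (use D'(1) in \<open>auto simp: B'_def\<close>)
 finally show ?thesis .
qed

definition gr_decomposition :: "nat => 'a => (nat\<times>'a\<times>'a) list => bool" where
 "gr_decomposition n x ps \<longleftrightarrow>
   (ALL (i, u, v):set ps. i <= n & u:Hf i & v:Hf (n - i)) & comult H x = tensor_sum H H (map snd ps)"

definition gr_tensor :: "nat => (nat\<times>'a\<times>'a) list => ('k, nat => 'a set, nat => 'a set) tensor" where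
 "gr_tensor n ps = tensor_sum gra gra (map (%(i, u, v). (gh i u, gh (n - i) v)) ps)"

lemma gr_decomposition_exists:
 assumes "x:Hf n"
 shows "EX ps. gr_decomposition n x ps"
proof -
 obtain qs where qs: "set qs \<subseteq> (\<Union>i\<le>n. Hf i\<times>Hf (n - i))" "comult H x = tensor_sum H H qs"
  using comult_corad_filt[OF assms] by(rule tensorsE)
 define ix where "ix q = (SOME i. i <= n & fst q:Hf i & snd q:Hf (n - i))" for q
 have ix: "ix q <= n & fst q:Hf (ix q) & snd q:Hf (n - ix q)" if "q:set qs" for q
 proof -
  have "q:(\<Union>i\<le>n. Hf i\<times>Hf (n - i))" using that qs(1) by auto
  hence "EX i. i <= n & fst q:Hf i & snd q:Hf (n - i)" by auto
  thus ?thesis unfolding ix_def by(rule someI_ex)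
 qed
 have "gr_decomposition n x (map (%q. (ix q, q)) qs)"
  unfolding gr_decomposition_def using qs(2) ix by(auto simp: o_def)
 thus ?thesis by auto
qed

lemma gr_tensor_eval:
 assumes A: "adapted Hf B phi d" and ps: "gr_decomposition n x ps" and x: "x:car H"
  and be: "bilinear_form gra gra be"
 shows "gr_tensor n ps be =
  (\<Sum>(b, c)\<in>{(b, c):B\<times>B. d b + d c = n}. be (gh (d b) b) (gh (d c) c) * (phi b \<star> phi c) x)"
proof -
 let ?P = "{(b, c):B\<times>B. d b + d c = n}"
 have D: "dual_system B phi" using A by(auto simp: adapted_def)
 note D' = dual_systemD[OF D]
 have fin: "finite ?P" by(rule finite_subset[of _ "B\<times>B"]) (use D'(1) in auto)
 have one: "be (gh l u) (gh (n - l) v) = (\<Sum>(b, c)\<in>?P. be (gh (d b) b) (gh (d c) c) * (phi b u * phi c v))"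
  if l: "l <= n" "u:Hf l" "v:Hf (n - l)" for l u v
 proof -
  have 1: "be (gh l u) (gh (n - l) v) = (\<Sum>b\<in>{b:B. d b = l}. phi b u * be (gh l b) (gh (n - l) v))"
   by(rule gra_form_expand[OF A bilformD(2)[OF be gh_closed[OF l(3)]] l(2)])
  have 2: "be (gh l b) (gh (n - l) v) = (\<Sum>c\<in>{c:B. d c = n - l}. phi c v * be (gh l b) (gh (n - l) c))"
   if "b:B" "d b = l" for b
  proof -
   have "b:Hf l" using A that by(auto simp: adapted_def)
   thus ?thesis by(intro gra_form_expand[OF A _ l(3)] bilformD(1)[OF be] gh_closed)
  qed
  have "be (gh l u) (gh (n - l) v) =
   (\<Sum>b\<in>{b:B. d b = l}. \<Sum>c\<in>{c:B. d c = n - l}. phi b u * (phi c v * be (gh l b) (gh (n - l) c)))"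
   unfolding 1 by(intro sum.cong refl) (simp add: 2 sum_distrib_left)
  also have "... = (\<Sum>(b, c)\<in>{b:B. d b = l}\<times>{c:B. d c = n - l}. be (gh (d b) b) (gh (d c) c) * (phi b u * phi c v))"
   by(subst sum.cartesian_product) (auto intro!: sum.cong simp: algebra_simps)
  also have "... = (\<Sum>(b, c)\<in>?P. be (gh (d b) b) (gh (d c) c) * (phi b u * phi c v))"
  proof(rule sum.mono_neutral_left[OF fin])
   show "{b:B. d b = l}\<times>{c:B. d c = n - l} \<subseteq> ?P" using l(1) by auto
   show "ALL p:?P - {b:B. d b = l}\<times>{c:B. d c = n - l}.
    (case p of (b, c) => be (gh (d b) b) (gh (d c) c) * (phi b u * phi c v)) = 0"
   proof
    fix p assume p: "p:?P - {b:B. d b = l}\<times>{c:B. d c = n - l}"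
    then obtain b c where bc: "p = (b, c)" "b:B" "c:B" "d b + d c = n" "d b ~= l \<or> d c ~= n - l" by auto
    hence "l < d b \<or> n - l < d c" using l(1) by auto
    hence "phi b u = 0 \<or> phi c v = 0" using A l bc by(auto simp: adapted_def)
    thus "(case p of (b, c) => be (gh (d b) b) (gh (d c) c) * (phi b u * phi c v)) = 0" using bc by auto
   qed
  qed
  finally show ?thesis .
 qed
 have valid: "!!p. p:set ps ==> fst p <= n & fst (snd p):Hf (fst p) & snd (snd p):Hf (n - fst p)"
  and com: "comult H x = tensor_sum H H (map snd ps)" using ps by(auto simp: gr_decomposition_def)
 have "gr_tensor n ps be = (\<Sum>p\<leftarrow>ps. be (gh (fst p) (fst (snd p))) (gh (n - fst p) (snd (snd p))))"
  using be by(simp add: gr_tensor_def tensor_sum_eval case_prod_unfold o_def)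
 also have "... = (\<Sum>p\<leftarrow>ps. \<Sum>r\<in>?P. be (gh (d (fst r)) (fst r)) (gh (d (snd r)) (snd r)) * (phi (fst r) (fst (snd p)) * phi (snd r) (snd (snd p))))"
  using one valid by(intro arg_cong[of _ _ sum_list] map_cong refl) (simp add: case_prod_unfold)
 also have "... = (\<Sum>r\<in>?P. be (gh (d (fst r)) (fst r)) (gh (d (snd r)) (snd r)) * (\<Sum>p\<leftarrow>ps. phi (fst r) (fst (snd p)) * phi (snd r) (snd (snd p))))"
  by(simp add: sum_list_sum sum_list_const_mult)
 also have "... = (\<Sum>r\<in>?P. be (gh (d (fst r)) (fst r)) (gh (d (snd r)) (snd r)) * (phi (fst r) \<star> phi (snd r)) x)"
 proof(intro sum.cong refl)
  fix r assume "r:?P"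
  hence "bil (%u v. phi (fst r) u * phi (snd r) v)" using D'(3) by(intro bil_prod) auto
  hence "(phi (fst r) \<star> phi (snd r)) x = (\<Sum>p\<leftarrow>ps. phi (fst r) (fst (snd p)) * phi (snd r) (snd (snd p)))"
   unfolding conv_def com by(simp add: tensor_sum_eval case_prod_unfold o_def)
  thus "be (gh (d (fst r)) (fst r)) (gh (d (snd r)) (snd r)) * (\<Sum>p\<leftarrow>ps. phi (fst r) (fst (snd p)) * phi (snd r) (snd (snd p)))
   = be (gh (d (fst r)) (fst r)) (gh (d (snd r)) (snd r)) * (phi (fst r) \<star> phi (snd r)) x" by simp
 qed
 finally show ?thesis by(simp add: case_prod_unfold)
qed

lemma gr_tensor_unique:
 assumes "gr_decomposition n x ps" "gr_decomposition n x qs" "x:car H"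
 shows "gr_tensor n ps = gr_tensor n qs"
proof
 fix be
 obtain B phi d where A: "adapted Hf B phi d" using adapted_basis_exists by auto
 show "gr_tensor n ps be = gr_tensor n qs be"
 proof(cases "bilinear_form gra gra be")
  case True
  show ?thesis using gr_tensor_eval[OF A assms(1,3) True] gr_tensor_eval[OF A assms(2,3) True] by simp
 qed (simp add: gr_tensor_def tensor_sum_eval)
qed

lemma gr_comult_hom_eq:
 assumes x: "x:Hf n" and ps: "gr_decomposition n x ps"
 shows "gr_comult_hom H n x = gr_tensor n ps"
proof -
 have "gr_comult_hom H n x = (THE t. EX ps. gr_decomposition n x ps & t = gr_tensor n ps)"
  by(simp add: gr_comult_hom_def gr_decomposition_def gr_tensor_def)
 also have "... = gr_tensor n ps"
 proof(rule the_equality)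
  show "EX qs. gr_decomposition n x qs & gr_tensor n ps = gr_tensor n qs" using ps by auto
  fix t assume "EX qs. gr_decomposition n x qs & t = gr_tensor n qs"
  then obtain qs where "gr_decomposition n x qs" "t = gr_tensor n qs" by auto
  thus "t = gr_tensor n ps" using gr_tensor_unique[OF _ ps filt_closed[OF x]] by simp
 qed
 finally show ?thesis .
qed

lemma gr_comult_tensor:
 assumes c: "c:car gra"
 shows "comult (gr H) c:tensors gra gra (car gra\<times>car gra)"
proof -
 have hom: "EX ps. set ps \<subseteq> car gra\<times>car gra & gr_comult_hom H n (rep (c n)) = tensor_sum gra gra ps" for n
 proof -
  note x = gr_carrierD(1)[OF c, of n]
  obtain ps where ps: "gr_decomposition n (rep (c n)) ps" using gr_decomposition_exists[OF x] by auto
  have "set (map (%(i, u, v). (gh i u, gh (n - i) v)) ps) \<subseteq> car gra\<times>car gra"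
   using ps gh_closed by(auto simp: gr_decomposition_def)
  thus ?thesis using gr_comult_hom_eq[OF x ps] unfolding gr_tensor_def by blast
 qed
 have "EX ps. set ps \<subseteq> car gra\<times>car gra & (%be. \<Sum>n\<in>I. gr_comult_hom H n (rep (c n)) be) = tensor_sum gra gra ps"
  if "finite I" for I
  using that
 proof(induction I rule: finite_induct)
  case empty
  thus ?case by(intro exI[of _ "[]"]) (auto simp: tensor_sum_def)
 next
  case (insert n I)
  then obtain ps where ps: "set ps \<subseteq> car gra\<times>car gra"
   "(%be. \<Sum>n\<in>I. gr_comult_hom H n (rep (c n)) be) = tensor_sum gra gra ps" by auto
  obtain qs where qs: "set qs \<subseteq> car gra\<times>car gra" "gr_comult_hom H n (rep (c n)) = tensor_sum gra gra qs"
   using hom by auto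
  have "(%be. \<Sum>n\<in>insert n I. gr_comult_hom H n (rep (c n)) be) = tensor_sum gra gra (qs @ ps)"
   using insert.hyps qs(2) fun_cong[OF ps(2)] by(auto simp: tensor_sum_def)
  thus ?case using ps(1) qs(1) by(intro exI[of _ "qs @ ps"]) auto
 qed
 from this[OF gr_carrierD(3)[OF c]] obtain ps where "set ps \<subseteq> car gra\<times>car gra"
  "comult (gr H) c = tensor_sum gra gra ps" by auto
 thus ?thesis unfolding tensors_def by auto
qed

subsection \<open>Linear forms on the associated graded algebra\<close>

text \<open>A linear form on \<open>H\<^sub>i/H\<^sub>i\<^sub>-\<^sub>1\<close>, seen as a form on \<open>gr(H)\<close>. Such forms separate the tensors over \<open>gr(H)\<close> and translate
 its comultiplication into convolution products in the dual of \<open>H\<close>.\<close>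

definition gr_form :: "('a => 'k) => nat => (nat => 'a set) => 'k" where
 "gr_form f i c = f (rep (c i))"

lemma form_rep_cl: "[|annihilates f (Kb i); x:car H|] ==> f (rep (cl i x)) = f x"
 using rep_cl[of x i] lf_minus[OF annihilatesD(1), of f "Kb i" "rep (cl i x)" x] annihilatesD(2)[of f "Kb i"] by auto

lemma gr_form_gh:
 assumes "annihilates f (Kb i)" "x:Hf l"
 shows "gr_form f i (gh l x) = (if l = i then f x else 0)"
 using form_rep_cl[OF assms(1) filt_closed[OF assms(2)]] annihilatesD(2)[OF assms(1) rep_below]
 by(auto simp: gr_form_def gh_apply)

lemma gr_form_linear:
 assumes f: "annihilates f (Kb i)"
 shows "linear_form gra (gr_form f i)"
 unfolding linear_form_def
proof(intro conjI ballI allI)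
 note l = annihilatesD(1)[OF f]
 fix c assume c: "c:car gra"
 note C = gr_carrierD(1,2)[OF c, of i]
 note CH = filt_closed[OF C(1)]
 show "gr_form f i (a \<odot>\<^sub>g c) = a * gr_form f i c" for a
  unfolding gr_form_def gra_smult_apply using form_rep_cl[OF f, of "a\<odot>rep (c i)"] CH by(simp add: lf_smult[OF l])
 fix c' assume c': "c':car gra"
 note C' = gr_carrierD(1,2)[OF c', of i]
 note CH' = filt_closed[OF C'(1)]
 have "(c \<oplus>\<^sub>g c') i = cl i (rep (c i)\<oplus>rep (c' i))"
  using cl_add[OF CH CH', of i] C(2) C'(2) by(simp add: gra_add_apply)
 thus "gr_form f i (c \<oplus>\<^sub>g c') = gr_form f i c + gr_form f i c'"
  unfolding gr_form_def using form_rep_cl[OF f, of "rep (c i)\<oplus>rep (c' i)"] CH CH' by(simp add: lf_add[OF l])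
qed

lemma gr_form_bilinear:
 assumes "annihilates f (Kb i)" "annihilates g (Kb j)"
 shows "bilinear_form gra gra (%c c'. gr_form f i c * gr_form g j c')"
 using gr_form_linear[OF assms(1)] gr_form_linear[OF assms(2)]
 by(auto simp: bilinear_form_def linear_form_def algebra_simps)

lemma gr_comult_form:
 assumes c: "c:car gra" and f: "annihilates f (Kb i)" and g: "annihilates g (Kb j)"
 shows "comult (gr H) c (%c c'. gr_form f i c * gr_form g j c') = (f \<star> g) (rep (c (i + j)))"
proof -
 note C = gr_carrierD[OF c] and l = annihilatesD(1)[OF f] annihilatesD(1)[OF g]
 have hom: "gr_comult_hom H n (rep (c n)) (%c c'. gr_form f i c * gr_form g j c') =
  (if n = i + j then (f \<star> g) (rep (c n)) else 0)" for n
 proof -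
  obtain ps where ps: "gr_decomposition n (rep (c n)) ps" using gr_decomposition_exists[OF C(1)] by auto
  have valid: "!!p. p:set ps ==> fst p <= n & fst (snd p):Hf (fst p) & snd (snd p):Hf (n - fst p)"
   and com: "comult H (rep (c n)) = tensor_sum H H (map snd ps)" using ps by(auto simp: gr_decomposition_def)
  have "gr_comult_hom H n (rep (c n)) (%c c'. gr_form f i c * gr_form g j c') =
   (\<Sum>p\<leftarrow>ps. gr_form f i (gh (fst p) (fst (snd p))) * gr_form g j (gh (n - fst p) (snd (snd p))))"
   unfolding gr_comult_hom_eq[OF C(1) ps] gr_tensor_def
   using gr_form_bilinear[OF f g] by(simp add: tensor_sum_eval case_prod_unfold o_def)
  also have "... = (\<Sum>p\<leftarrow>ps. if n = i + j then f (fst (snd p)) * g (snd (snd p)) else 0)"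
  proof(intro arg_cong[of _ _ sum_list] map_cong refl)
   fix p assume p: "p:set ps"
   note V = valid[OF p]
   have "f (fst (snd p)) = 0 \<or> g (snd (snd p)) = 0" if n: "n = i + j" "fst p ~= i"
   proof(cases "fst p < i")
    case True
    hence "fst (snd p):Kb i" using V filt_mono[of "fst p" "i - 1"] by(cases i) auto
    thus ?thesis using annihilatesD(2)[OF f] by simp
   next
    case False
    hence "n - fst p < j" using n V by auto
    hence "snd (snd p):Kb j" using V filt_mono[of "n - fst p" "j - 1"] by(cases j) auto
    thus ?thesis using annihilatesD(2)[OF g] by simp
   qed
   thus "gr_form f i (gh (fst p) (fst (snd p))) * gr_form g j (gh (n - fst p) (snd (snd p)))
    = (if n = i + j then f (fst (snd p)) * g (snd (snd p)) else 0)"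
    using V gr_form_gh[OF f] gr_form_gh[OF g] by auto
  qed
  also have "... = (if n = i + j then (f \<star> g) (rep (c n)) else 0)"
   unfolding conv_def com using bil_prod[OF l] by(simp add: tensor_sum_eval case_prod_unfold o_def)
  finally show ?thesis .
 qed
 have "comult (gr H) c (%c c'. gr_form f i c * gr_form g j c') =
  (\<Sum>n | c n ~= Kb n. if n = i + j then (f \<star> g) (rep (c n)) else 0)"
  using hom by simp
 also have "... = (f \<star> g) (rep (c (i + j)))"
 proof(cases "c (i + j) = Kb (i + j)")
  case True
  hence "rep (c (i + j)):Kb (i + j)" using rep_below by simp
  hence "(f \<star> g) (rep (c (i + j))) = 0" by(rule conv_annihilators[OF f g])
  thus ?thesis using C(3) by simp
 next
  case False
  thus ?thesis using C(3) by simp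
 qed
 finally show ?thesis .
qed

end

section \<open>Algebras of finitely supported functions\<close>

lemma fin_suppD: "f:fin_supp Z ==> finite {z. f z ~= 0}" "[|f:fin_supp Z; f z ~= 0|] ==> z:Z"
 by(auto simp: fin_supp_def)

lemma fin_suppI: "[|finite S; !!z. f z ~= 0 ==> z:S; S \<subseteq> Z|] ==> f:fin_supp Z"
 unfolding fin_supp_def by(auto intro: finite_subset)

lemma single_fin_supp: "z:Z ==> single z:fin_supp Z"
 by(rule fin_suppI[of "{z}"]) (auto simp: single_def split: if_splits)

lemma function_space_kspace:
 fixes M :: "('k::field, 'z => 'k, 'm) module_scheme"
 assumes "car M = fin_supp Z" "ring.zero M = (%z. 0)" "ring.add M = (%f h z. f z + h z)"
  "module.smult M = (%a f z. a * f z)"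
 shows "kspace M"
proof -
 have add: "(%z. f z + h z):fin_supp Z" if "f:fin_supp Z" "h:fin_supp Z" for f h :: "'z => 'k"
  by(rule fin_suppI[of "{z. f z ~= 0} \<union> {z. h z ~= 0}"]) (use that fin_suppD in auto)
 have sm: "(%z. a * f z):fin_supp Z" if "f:fin_supp Z" for f :: "'z => 'k" and a
  by(rule fin_suppI[of "{z. f z ~= 0}"]) (use that fin_suppD in auto)
 have "module (fld :: 'k ring) M"
 proof(rule moduleI)
  show "cring (fld :: 'k ring)" by auto
  show "abelian_group M"
  proof(rule abelian_groupI)
   fix f assume f: "f:car M"
   show "EX y:car M. y\<oplus>\<^bsub>M\<^esub>f = \<zero>\<^bsub>M\<^esub>"
    using f sm[of f "-1"] assms by(intro bexI[of _ "%z. (-1) * f z"]) auto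
  qed (use assms add in \<open>auto simp: algebra_simps fin_supp_def\<close>)
 qed (use assms sm in \<open>auto simp: ring_of_type_algebra_def algebra_simps\<close>)
 thus ?thesis by(simp add: kspace_def)
qed

lemma fin_supp_induct [consumes 1, case_names zero basis add smult]:
 fixes f :: "'z => 'k::field"
 assumes "f:fin_supp Z" "P (%z. 0)" "!!z. z:Z ==> P (single z)"
  "!!f h. [|f:fin_supp Z; h:fin_supp Z; P f; P h|] ==> P (%z. f z + h z)"
  "!!a f. [|f:fin_supp Z; P f|] ==> P (%z. a * f z)"
 shows "P f"
proof -
 have "finite S ==> S \<subseteq> Z ==> {z. f z ~= 0} \<subseteq> S ==> P f" for S and f :: "'z => 'k"
 proof(induction S arbitrary: f rule: finite_induct)
  case empty
  hence "f = (%z. 0)" by auto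
  thus ?case using assms(2) by simp
 next
  case (insert s S)
  define h where "h z = (if z = s then 0 else f z)" for z
  have "P h" using insert by(intro insert.IH) (auto simp: h_def)
  moreover have h: "h:fin_supp Z" by(rule fin_suppI[of S]) (use insert in \<open>auto simp: h_def split: if_splits\<close>)
  moreover have s: "(%z. f s * single s z):fin_supp Z"
   by(rule fin_suppI[of "{s}"]) (use insert in \<open>auto simp: single_def split: if_splits\<close>)
  moreover have "P (%z. f s * single s z)" using insert by(intro assms(5,3) single_fin_supp) auto
  ultimately have "P (%z. f s * single s z + h z)" using assms(4) by simp
  moreover have "(%z. f s * single s z + h z) = f" by(auto simp: h_def single_def)
  ultimately show ?case by simp
 qed
 thus ?thesis using fin_suppD[OF assms(1)] by auto
qed

definition words :: "nat list set" where "words = lists {1, 2}"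

lemma words_iff: "w:words \<longleftrightarrow> set w \<subseteq> {1, 2}"
 by(auto simp: words_def)

subsection \<open>The tensor algebra\<close>

abbreviation tamult (infixl \<open>\<otimes>\<^sub>V\<close> 70) where "f \<otimes>\<^sub>V h \<equiv> f \<otimes>\<^bsub>tensor_alg\<^esub> h"

lemma tensor_alg_simps [simp]:
 "car tensor_alg = fin_supp words" "one tensor_alg = single []" "ring.zero tensor_alg = (%w. 0)"
 "ring.add tensor_alg = (%f h w. f w + h w)" "module.smult tensor_alg = (%a f w. a * f w)"
 by(auto simp: tensor_alg_def words_def)

lemma tensor_alg_mult: "(f \<otimes>\<^sub>V h) w = (\<Sum>i\<le>length w. f (take i w) * h (drop i w))"
 by(simp add: tensor_alg_def)

interpretation T: kspace "tensor_alg :: ('k::field, nat list => 'k) module"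
 by(rule function_space_kspace[of _ words]) auto

lemma single_mult_left:
 "(single v \<otimes>\<^sub>V f) w = (if take (length v) w = v then f (drop (length v) w) else 0)"
proof(cases "length v <= length w")
 case True
 have "(single v \<otimes>\<^sub>V f) w
   = (\<Sum>i\<le>length w. if i = length v then (if take (length v) w = v then f (drop (length v) w) else 0) else 0)"
  unfolding tensor_alg_mult by(rule sum.cong) (auto simp: single_def)
 thus ?thesis using True by simp
next
 case False
 hence "take (length v) w ~= v" by auto
 moreover have "(single v \<otimes>\<^sub>V f) w = 0"
  unfolding tensor_alg_mult by(rule sum.neutral) (use False in \<open>auto simp: single_def\<close>)
 ultimately show ?thesis by simp
qed

lemma single_mult_right:
 "(f \<otimes>\<^sub>V single v) w =
  (if length v <= length w & drop (length w - length v) w = v then f (take (length w - length v) w) else 0)"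
proof(cases "length v <= length w")
 case True
 have "(f \<otimes>\<^sub>V single v) w
   = (\<Sum>i\<le>length w. if i = length w - length v then (if drop (length w - length v) w = v then f (take (length w - length v) w) else 0) else 0)"
  unfolding tensor_alg_mult by(rule sum.cong) (use True in \<open>auto simp: single_def\<close>)
 thus ?thesis using True by simp
next
 case False
 have "(f \<otimes>\<^sub>V single v) w = 0"
  unfolding tensor_alg_mult by(rule sum.neutral) (use False in \<open>auto simp: single_def\<close>)
 thus ?thesis using False by simp
qed

section \<open>The ideal of relations of a Nichols algebra\<close>

definition len_part :: "nat => (nat list => 'k::field) => nat list => 'k" where
 "len_part n f = (%w. if length w = n then f w else 0)"

definition one_part :: "nat => (nat list => 'k::field) => nat list => 'k" where
 "one_part a f = (%w. if count_list w 1 = a then f w else 0)"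

text \<open>The automorphism of \<open>T(V)\<close> that rescales the two letters by \<open>s\<close> and \<open>t\<close>.\<close>

definition twist :: "'k::field => 'k => (nat list => 'k) => nat list => 'k" where
 "twist s t f = (%w. s ^ count_list w 1 * t ^ count_list w 2 * f w)"

lemma len_part_closed: "f:fin_supp words ==> len_part a f:fin_supp words"
 by(rule fin_suppI[of "{w. f w ~= 0}"]) (use fin_suppD in \<open>auto simp: len_part_def split: if_splits\<close>)

lemma twist_closed: "f:fin_supp words ==> twist s t f:fin_supp words"
 by(rule fin_suppI[of "{w. f w ~= 0}"]) (use fin_suppD in \<open>auto simp: twist_def\<close>)

lemma len_part_linear:
 "len_part a (%w. f w + h w) = (%w. len_part a f w + len_part a h w)"
 "len_part a (%w. c * f w) = (%w. c * len_part a f w)"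
 by(auto simp: len_part_def)

lemma twist_linear:
 "twist s t (%w. f w + h w) = (%w. twist s t f w + twist s t h w)" "twist s t (%w. c * f w) = (%w. c * twist s t f w)"
 by(auto simp: twist_def algebra_simps)

lemma twist_mult: "twist s t (f \<otimes>\<^sub>V h) = twist s t f \<otimes>\<^sub>V twist s t h"
proof
 fix w :: "nat list"
 have c: "count_list w 1 = count_list (take i w) 1 + count_list (drop i w) 1" "count_list w 2 = count_list (take i w) 2 + count_list (drop i w) 2" for i
  using count_list_append[of "take i w" "drop i w"] by auto
 have "s ^ count_list w 1 * t ^ count_list w 2 * (f (take i w) * h (drop i w)) = twist s t f (take i w) * twist s t h (drop i w)" for i
  by(simp only: twist_def c[of i] power_add mult_ac)
 thus "twist s t (f \<otimes>\<^sub>V h) w = (twist s t f \<otimes>\<^sub>V twist s t h) w"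
  unfolding twist_def[of s t "f \<otimes>\<^sub>V h"] tensor_alg_mult sum_distrib_left by(intro sum.cong) auto
qed

lemma twist_inverse: "[|s ~= 0; t ~= 0|] ==> twist s t (twist (inverse s) (inverse t) f) = f"
 by(simp add: twist_def field_simps)

lemma twist_bilinear:
 assumes "bilinear_form tensor_alg tensor_alg be"
 shows "bilinear_form (tensor_alg :: ('k::field, nat list => 'k) module) tensor_alg (%f h. be (twist s t f) (twist s t h))"
 unfolding bilinear_form_def linear_form_def
 using T.bil_add1[OF assms] T.bil_add2[OF assms] T.bil_smult1[OF assms] T.bil_smult2[OF assms]
 by(simp add: twist_linear twist_closed)

lemma wc_counts:
 "(c, u, v):set (word_comult ga ch w) ==>
  count_list u x + count_list v x = count_list w x & length u + length v = length w &
  set u \<subseteq> set w & set v \<subseteq> set w"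
proof(induction w arbitrary: c u v)
 case (Cons i w)
 then obtain c' u' v' where "(c', u', v'):set (word_comult ga ch w)"
  "(c, u, v) = (c', i # u', v') \<or> (c, u, v) = (c' * word_char ch u' (ga i), u', i # v')" by auto
 with Cons.IH[OF this(1)] show ?case by auto
qed auto

lemma wc_in_W:
 assumes "(c, u, v):set (word_comult ga ch w)" "w:words"
 shows "u:words" "v:words"
 using wc_counts[OF assms(1), of 1] assms(2) by(auto simp: words_iff)

lemma bc_eval:
 assumes f: "f:fin_supp words" and be: "bilinear_form tensor_alg tensor_alg be"
  and S: "finite S" "!!w. f w ~= 0 ==> w:S"
 shows "braided_comult ga ch f be = (\<Sum>w\<in>S. f w * (\<Sum>(c, u, v)\<leftarrow>word_comult ga ch w. c * be (single u) (single v)))"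
proof -
 have "braided_comult ga ch f be = (\<Sum>w | f w ~= 0. f w * (\<Sum>(c, u, v)\<leftarrow>word_comult ga ch w. c * be (single u) (single v)))"
  using be by(simp add: braided_comult_def pure_tensor_def)
 also have "... = (\<Sum>w\<in>S. f w * (\<Sum>(c, u, v)\<leftarrow>word_comult ga ch w. c * be (single u) (single v)))"
  using S by(intro sum.mono_neutral_left) auto
 finally show ?thesis .
qed

lemma bc_linear:
 assumes f: "f:fin_supp words" "h:fin_supp words" and be: "bilinear_form tensor_alg tensor_alg be"
 shows "braided_comult ga ch (%w. f w + h w) be = braided_comult ga ch f be + braided_comult ga ch h be"
  "braided_comult ga ch (%w. a * f w) be = a * braided_comult ga ch f be"
proof -
 let ?S = "{w. f w ~= 0} \<union> {w. h w ~= 0}"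
 have S: "finite ?S" using f fin_suppD by auto
 have fh: "(%w. f w + h w):fin_supp words" "(%w. a * f w):fin_supp words"
  using T.M.a_closed[of f h] T.smult_closed'[of f a] f by auto
 show "braided_comult ga ch (%w. f w + h w) be = braided_comult ga ch f be + braided_comult ga ch h be"
  using S by(subst (1 2 3) bc_eval[OF _ be, of _ ?S]) (auto simp: f fh sum.distrib algebra_simps)
 show "braided_comult ga ch (%w. a * f w) be = a * braided_comult ga ch f be"
  using S by(subst (1 2) bc_eval[OF _ be, of _ ?S]) (auto simp: f fh sum_distrib_left algebra_simps)
qed

lemma bc_twist:
 assumes f: "f:fin_supp words" and be: "bilinear_form tensor_alg tensor_alg be"
 shows "braided_comult ga ch (twist s t f) be = braided_comult ga ch f (%x y. be (twist s t x) (twist s t y))"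
proof -
 let ?S = "{w. f w ~= 0}" and ?c = "%w. s ^ count_list w 1 * t ^ count_list w 2"
 have S: "finite ?S" using fin_suppD[OF f] by simp
 have sm: "be (%w. k * x w) y = k * be x y" "be x (%w. k * y w) = k * be x y" if "x:fin_supp words" "y:fin_supp words" for k x y
  using T.bil_smult1[OF be, of x y k] T.bil_smult2[OF be, of x y k] that by auto
 have single: "twist s t (single u) = (%w. ?c u * single u w)" for u by(auto simp: twist_def single_def)
 have "c * be (twist s t (single u)) (twist s t (single v)) = ?c w * (c * be (single u) (single v))"
  if w: "w:words" and cuv: "(c, u, v):set (word_comult ga ch w)" for w c u v
 proof -
  note uv = wc_in_W[OF cuv w]
  have s: "single u:fin_supp words" "single v:fin_supp words" using uv by(auto intro: single_fin_supp)
  have sc: "(%w. ?c v * single v w):fin_supp words" using s twist_closed[of "single v" s t] by(simp add: single)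
  have "be (twist s t (single u)) (twist s t (single v)) = ?c u * (?c v * be (single u) (single v))"
   unfolding single sm(1)[OF s(1) sc] sm(2)[OF s] ..
  moreover have "?c w = ?c u * ?c v"
   using wc_counts[OF cuv, of 1] wc_counts[OF cuv, of 2] by(simp add: power_add[symmetric] ac_simps)
  ultimately show ?thesis by simp
 qed
 hence key: "(\<Sum>(c, u, v)\<leftarrow>word_comult ga ch w. c * be (twist s t (single u)) (twist s t (single v)))
   = (\<Sum>p\<leftarrow>word_comult ga ch w. ?c w * (case p of (c, u, v) => c * be (single u) (single v)))" if "w:words" for w
  using that by(intro arg_cong[where f=sum_list] map_cong refl) auto
 have e: "twist s t f w * (\<Sum>(c, u, v)\<leftarrow>word_comult ga ch w. c * be (single u) (single v))
   = f w * (\<Sum>(c, u, v)\<leftarrow>word_comult ga ch w. c * be (twist s t (single u)) (twist s t (single v)))" if "w:?S" for w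
  unfolding key[OF fin_suppD(2)[OF f that[simplified]]] by(simp only: sum_list_const_mult twist_def[of s t f] mult_ac)
 have S': "twist s t f w ~= 0 ==> w:?S" "f w ~= 0 ==> w:?S" for w by(auto simp: twist_def)
 have "braided_comult ga ch (twist s t f) be = (\<Sum>w\<in>?S. twist s t f w * (\<Sum>(c, u, v)\<leftarrow>word_comult ga ch w. c * be (single u) (single v)))"
  by(rule bc_eval[OF twist_closed[OF f] be S S'(1)])
 also have "... = (\<Sum>w\<in>?S. f w * (\<Sum>(c, u, v)\<leftarrow>word_comult ga ch w. c * be (twist s t (single u)) (twist s t (single v))))"
  by(rule sum.cong[OF refl e])
 also have "... = braided_comult ga ch f (%x y. be (twist s t x) (twist s t y))"
  by(rule bc_eval[OF f twist_bilinear[OF be] S S'(2), symmetric])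
 finally show ?thesis .
qed

definition nichols_family :: "(nat => 'g) => (nat => 'g => 'k::field) => (nat list => 'k) set set" where
 "nichols_family ga ch = {I. ideal I (tensor_alg :: ('k, nat list => 'k) module) &
   (ALL f:I. ALL n. len_part n f:I) & (ALL f:I. ALL w. length w < 2 --> f w = 0) &
   (ALL f:I. braided_comult ga ch f:tensors tensor_alg tensor_alg (I\<times>car tensor_alg \<union> car tensor_alg\<times>I))}"

lemma NI_eq: "nichols_ideal ga ch = lspan tensor_alg (\<Union>(nichols_family ga ch))"
 by(simp add: nichols_ideal_def nichols_family_def len_part_def)

lemma nichols_family_carrier:
 "\<Union>(nichols_family ga ch) \<subseteq> car (tensor_alg :: ('k::field, nat list => 'k) module)"
proof
 fix f :: "nat list => 'k" assume "f:\<Union>(nichols_family ga ch)"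
 then obtain I where I: "ideal I (tensor_alg :: ('k, nat list => 'k) module)" "f:I"
  by(auto simp: nichols_family_def)
 show "f:car (tensor_alg :: ('k, nat list => 'k) module)" using ideal.Icarr[OF I] by simp
qed

lemma tensor_ideal_sub:
 assumes I: "ideal I (tensor_alg :: ('k::field, nat list => 'k) module)"
 shows "subspace I (tensor_alg :: ('k, nat list => 'k) module)"
proof(rule T.subI)
 interpret I: ideal I "tensor_alg :: ('k, nat list => 'k) module" by(rule I)
 show "I \<subseteq> car tensor_alg" using I.Icarr by auto
 show "\<zero>\<^bsub>tensor_alg\<^esub>:I" using I.zero_closed by simp
 show "x\<oplus>\<^bsub>tensor_alg\<^esub>y:I" if "x:I" "y:I" for x y using I.a_closed that by simp
 show "a\<odot>\<^bsub>tensor_alg\<^esub>x:I" if x: "x:I" for a x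
 proof -
  have "(%w. a * single [] w):car (tensor_alg :: ('k, nat list => 'k) module)"
   using T.smult_closed'[of "single []" a] single_fin_supp[of "[]" words] by(simp add: words_iff)
  hence "(%w. a * single [] w) \<otimes>\<^sub>V x:I" using I.I_l_closed[OF x] by simp
  moreover have "(%w. a * single [] w) \<otimes>\<^sub>V x = (%w. a * (single [] \<otimes>\<^sub>V x) w)"
   by(auto simp: tensor_alg_mult sum_distrib_left algebra_simps)
  ultimately show ?thesis by(simp add: single_mult_left)
 qed
qed

text \<open>Rescaling maps the family of ideals to itself, so that \<open>I(V)\<close> is stable under it.\<close>

lemma twist_family:
 assumes I: "I:nichols_family ga (ch :: nat => 'g => 'k::field)" and st: "s ~= 0" "t ~= 0"
 shows "twist s t ` I:nichols_family ga ch"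
proof -
 let ?T = "tensor_alg :: ('k, nat list => 'k) module"
 have id: "ideal I ?T" and len: "!!f n. f:I ==> len_part n f:I" and short: "!!f w. [|f:I; length w < 2|] ==> f w = 0"
  and com: "!!f. f:I ==> braided_comult ga ch f:tensors ?T ?T (I\<times>carrier ?T \<union> carrier ?T\<times>I)"
  using I by(auto simp: nichols_family_def)
 interpret I: ideal I ?T by(rule id)
 note sub = T.sub_zero[OF tensor_ideal_sub[OF id]] T.sub_add[OF tensor_ideal_sub[OF id]] T.sub_smult[OF tensor_ideal_sub[OF id]]
 have Ic: "h:fin_supp words" if "h:I" for h using I.Icarr that by simp
 have tz: "twist s t (%w. 0) = (%w. 0)" by(simp add: twist_def)
 have sub': "subspace (twist s t ` I) ?T"
 proof(rule T.subI)
  show "\<zero>\<^bsub>?T\<^esub>:twist s t ` I" using sub(1) tz by(auto intro: rev_image_eqI)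
  show "x \<oplus>\<^bsub>?T\<^esub> y:twist s t ` I" if "x:twist s t ` I" "y:twist s t ` I" for x y
   using that sub(2) by(auto simp: twist_linear(1)[symmetric])
  show "a \<odot>\<^bsub>?T\<^esub> x:twist s t ` I" if "x:twist s t ` I" for a x
   using that sub(3) by(auto simp: twist_linear(2)[symmetric])
 qed (use Ic twist_closed in auto)
 have "ideal (twist s t ` I) ?T"
 proof(rule idealI[OF I.ring_axioms])
  show "subgroup (twist s t ` I) (add_monoid ?T)" using sub' by(simp add: submodule_def)
  fix f x assume f: "f:twist s t ` I" and x: "x:carrier ?T"
  then obtain h where h: "h:I" "f = twist s t h" by auto
  define y where "y = twist (inverse s) (inverse t) x"
  have y: "y:carrier ?T" "x = twist s t y" using x twist_closed twist_inverse[OF st] by(simp_all add: y_def)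
  show "x \<otimes>\<^bsub>?T\<^esub> f:twist s t ` I" "f \<otimes>\<^bsub>?T\<^esub> x:twist s t ` I"
   unfolding h(2) y(2) twist_mult[symmetric] by(intro imageI I.I_l_closed[OF h(1) y(1)] I.I_r_closed[OF h(1) y(1)])+
 qed
 moreover have "len_part n f:twist s t ` I" if f: "f:twist s t ` I" for f n
 proof -
  obtain h where h: "h:I" "f = twist s t h" using f by auto
  have "len_part n f = twist s t (len_part n h)" by(auto simp: h(2) len_part_def twist_def)
  thus ?thesis using len[OF h(1)] by simp
 qed
 moreover have "f w = 0" if "f:twist s t ` I" "length w < 2" for f w
  using that short by(auto simp: twist_def)
 moreover have "braided_comult ga ch f:tensors ?T ?T (twist s t ` I\<times>carrier ?T \<union> carrier ?T\<times>twist s t ` I)" if f: "f:twist s t ` I" for f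
 proof -
  obtain h where h: "h:I" "f = twist s t h" using f by auto
  obtain ps where ps: "set ps \<subseteq> I\<times>carrier ?T \<union> carrier ?T\<times>I" "braided_comult ga ch h = tensor_sum ?T ?T ps"
   using com[OF h(1)] by(rule tensorsE)
  let ?q = "map (map_prod (twist s t) (twist s t)) ps"
  have "braided_comult ga ch f be = tensor_sum ?T ?T ?q be" for be
  proof(cases "bilinear_form ?T ?T be")
   case True
   thus ?thesis unfolding h(2) bc_twist[OF Ic[OF h(1)] True] ps(2)
    by(simp add: tensor_sum_eval twist_bilinear[OF True] o_def case_prod_unfold)
  next
   case False
   thus ?thesis by(simp add: tensor_sum_eval braided_comult_def pure_tensor_def case_prod_unfold)
  qed
  moreover have "set ?q \<subseteq> twist s t ` I\<times>carrier ?T \<union> carrier ?T\<times>twist s t ` I" using ps(1) twist_closed by auto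
  ultimately show ?thesis unfolding tensors_def by blast
 qed
 ultimately show ?thesis unfolding nichols_family_def by simp
qed

lemma NI_sub:
 "submodule (nichols_ideal ga ch) (fld :: 'k::field ring) (tensor_alg :: ('k, nat list => 'k) module)"
 unfolding NI_eq by(rule T.lspan_sub[OF nichols_family_carrier])

lemma NI_carrier: "f:nichols_ideal ga ch ==> f:fin_supp words"
 using T.sub_subset[OF NI_sub] by auto

lemma nichols_ideal_closed:
 "(%w. 0):nichols_ideal ga ch"
 "[|f:nichols_ideal ga ch; h:nichols_ideal ga ch|] ==> (%w. f w + h w):nichols_ideal ga ch"
 "f:nichols_ideal ga ch ==> (%w. a * f w):nichols_ideal ga ch"
 using T.sub_zero[OF NI_sub[of ga ch]] T.sub_add[OF NI_sub[of ga ch], of f h]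
  T.sub_smult[OF NI_sub[of ga ch], of f a] by auto

lemma NI_induct:
 assumes "!!I f. [|I:nichols_family ga ch; f:I|] ==> P f" "P (%w. 0)"
  "!!f h. [|f:fin_supp words; h:fin_supp words; P f; P h|] ==> P (%w. f w + h w)"
  "!!a f. [|f:fin_supp words; P f|] ==> P (%w. a * f w)"
  and f: "f:nichols_ideal ga (ch :: nat => 'g => 'k::field)"
 shows "P f"
proof -
 have "subspace {f:car tensor_alg. P f} (tensor_alg :: ('k, nat list => 'k) module)"
 proof(rule T.subI)
  show "\<zero>\<^bsub>tensor_alg\<^esub>:{f:car tensor_alg. P f}" using assms(2) T.M.zero_closed by simp
  show "x\<oplus>\<^bsub>tensor_alg\<^esub>y:{f:car tensor_alg. P f}"
   if "x:{f:car tensor_alg. P f}" "y:{f:car tensor_alg. P f}" for x y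
   using that assms(3) T.M.a_closed[of x y] by simp
  show "a\<odot>\<^bsub>tensor_alg\<^esub>x:{f:car tensor_alg. P f}" if "x:{f:car tensor_alg. P f}" for a x
   using that assms(4) T.smult_closed'[of x a] by simp
 qed auto
 moreover have "\<Union>(nichols_family ga ch) \<subseteq> {f:car tensor_alg. P f}"
  using nichols_family_carrier[of ga ch] assms(1) by auto
 ultimately have "nichols_ideal ga ch \<subseteq> {f:car tensor_alg. P f}"
  unfolding NI_eq by(rule T.lspan_least)
 thus ?thesis using f by auto
qed

lemma family_sub_ideal: "[|I:nichols_family ga ch; f:I|] ==> f:nichols_ideal ga ch"
 unfolding NI_eq using T.lspan_superset by blast

lemma NI_short: "[|f:nichols_ideal ga ch; length w < 2|] ==> f w = 0"
 by(erule NI_induct[rotated 4]) (auto simp: nichols_family_def)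

lemma NI_len: "f:nichols_ideal ga ch ==> len_part n f:nichols_ideal ga ch"
 by(erule NI_induct[rotated 4])
  (auto simp: nichols_ideal_closed len_part_linear nichols_family_def len_part_def[of _ "%w. 0"] intro!: family_sub_ideal[unfolded nichols_family_def])

lemma NI_twist: "[|f:nichols_ideal ga ch; s ~= 0; t ~= 0|] ==> twist s t f:nichols_ideal ga ch"
proof(erule NI_induct[rotated 4])
 fix I f assume "I:nichols_family ga ch" "f:I" "s ~= 0" "t ~= 0"
 thus "twist s t f:nichols_ideal ga ch" using family_sub_ideal[OF twist_family] by blast
qed (auto simp: nichols_ideal_closed twist_linear twist_def[of _ _ "%w. 0"])

text \<open>
 The powers of \<open>2\<close> are distinct in characteristic zero. Hence the component of degree \<open>a\<close> in the first letter
 is obtained by killing the other components, one after the other, with the operators \<open>twist 2 1 - 2\<^sup>b\<close>.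
\<close>

lemma NI_one_part:
 fixes ch :: "nat => 'g => 'k::field_char_0"
 assumes "f:nichols_ideal ga ch"
 shows "one_part a f:nichols_ideal ga ch"
 using assms
proof(induction "card ((%w. count_list w 1) ` {w. f w ~= 0} - {a})" arbitrary: f rule: less_induct)
 case less
 let ?C = "%f :: nat list => 'k. (%w. count_list w 1) ` {w. f w ~= 0} - {a}"
 have fin: "finite (?C f)" using fin_suppD(1)[OF NI_carrier[OF less.prems]] by simp
 show ?case
 proof(cases "?C f = {}")
  case True
  hence "one_part a f = f" by(auto simp: one_part_def fun_eq_iff)
  thus ?thesis using less.prems by simp
 next
  case False
  then obtain b where b: "b:?C f" by auto
  define h where "h = (%w. twist 2 1 f w + (- (2 ^ b)) * f w)"
  have hw: "h w = (2 ^ count_list w 1 - 2 ^ b) * f w" for w by(simp add: h_def twist_def left_diff_distrib)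
  have h: "h:nichols_ideal ga ch"
   unfolding h_def by(rule nichols_ideal_closed(2)[OF NI_twist[OF less.prems] nichols_ideal_closed(3)[OF less.prems]]) simp_all
  have "?C h \<subseteq> ?C f - {b}" by(auto simp: hw)
  hence "?C h \<subset> ?C f" using b by blast
  hence "card (?C h) < card (?C f)" by(rule psubset_card_mono[OF fin])
  from less.hyps[OF this h] have "(%w. inverse (2 ^ a - 2 ^ b) * one_part a h w):nichols_ideal ga ch"
   by(rule nichols_ideal_closed(3))
  moreover have ne: "(2 :: 'k) ^ a - 2 ^ b ~= 0"
  proof -
   have "a ~= b" using b by simp
   hence "(of_nat (2 ^ a) :: 'k) ~= of_nat (2 ^ b)" unfolding of_nat_eq_iff by simp
   thus ?thesis by simp
  qed
  moreover have "one_part a f = (%w. inverse (2 ^ a - 2 ^ b) * one_part a h w)" using ne by(auto simp: one_part_def hw)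
  ultimately show ?thesis by simp
 qed
qed

lemma NI_mult:
 fixes ch :: "nat => 'g => 'k::field"
 assumes v: "v:words"
 shows "f:nichols_ideal ga ch ==> single v \<otimes>\<^sub>V f:nichols_ideal ga ch"
  "f:nichols_ideal ga ch ==> f \<otimes>\<^sub>V single v:nichols_ideal ga ch"
proof -
 have lin: "x \<otimes>\<^sub>V (%w. f w + h w) = (%w. (x \<otimes>\<^sub>V f) w + (x \<otimes>\<^sub>V h) w)"
  "(%w. f w + h w) \<otimes>\<^sub>V x = (%w. (f \<otimes>\<^sub>V x) w + (h \<otimes>\<^sub>V x) w)"
  "x \<otimes>\<^sub>V (%w. a * f w) = (%w. a * (x \<otimes>\<^sub>V f) w)"
  "(%w. a * f w) \<otimes>\<^sub>V x = (%w. a * (f \<otimes>\<^sub>V x) w)"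
  "x \<otimes>\<^sub>V (%w. 0) = (%w. 0)" "(%w. 0) \<otimes>\<^sub>V x = (%w. 0)" for x f h :: "nat list => 'k" and a
  by(auto simp: tensor_alg_mult algebra_simps sum.distrib sum_distrib_left)
 have sv: "single v:car (tensor_alg :: ('k, nat list => 'k) module)" using single_fin_supp[OF v] by simp
 show "f:nichols_ideal ga ch ==> single v \<otimes>\<^sub>V f:nichols_ideal ga ch"
 proof(erule NI_induct[rotated 4])
  fix I f assume I: "I:nichols_family ga ch" "f:I"
  hence "ideal I tensor_alg" by(simp add: nichols_family_def)
  from ideal.I_l_closed[OF this I(2) sv] show "single v \<otimes>\<^sub>V f:nichols_ideal ga ch"
   by(rule family_sub_ideal[OF I(1)])
 qed (auto simp: lin nichols_ideal_closed)
 show "f:nichols_ideal ga ch ==> f \<otimes>\<^sub>V single v:nichols_ideal ga ch"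
 proof(erule NI_induct[rotated 4])
  fix I f assume I: "I:nichols_family ga ch" "f:I"
  hence "ideal I tensor_alg" by(simp add: nichols_family_def)
  from ideal.I_r_closed[OF this I(2) sv] show "f \<otimes>\<^sub>V single v:nichols_ideal ga ch"
   by(rule family_sub_ideal[OF I(1)])
 qed (auto simp: lin nichols_ideal_closed)
qed

lemma NI_coideal:
 assumes f: "f:nichols_ideal ga (ch :: nat => 'g => 'k::field)" and be: "bilinear_form tensor_alg tensor_alg be"
  and z: "!!x y. [|x:nichols_ideal ga ch; y:fin_supp words|] ==> be x y = 0"
   "!!x y. [|x:fin_supp words; y:nichols_ideal ga ch|] ==> be x y = 0"
 shows "braided_comult ga ch f be = 0"
 using f
proof(rule NI_induct[rotated 4])
 fix I f assume I: "I:nichols_family ga ch" "f:I"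
 hence "braided_comult ga ch f:tensors tensor_alg tensor_alg (I\<times>car tensor_alg \<union> car tensor_alg\<times>I)"
  by(simp add: nichols_family_def)
 thus "braided_comult ga ch f be = 0"
  by(rule tensor_vanish) (use z family_sub_ideal[OF I(1)] in auto)
next
 show "braided_comult ga ch (%w. 0) be = 0" by(simp add: braided_comult_def)
next
 fix f h :: "nat list => 'k" and a
 assume fh: "f:fin_supp words" "h:fin_supp words" "braided_comult ga ch f be = 0" "braided_comult ga ch h be = 0"
 thus "braided_comult ga ch (%w. f w + h w) be = 0" using bc_linear(1)[OF fh(1,2) be, of ga ch] by simp
next
 fix f :: "nat list => 'k" and a
 assume f: "f:fin_supp words" "braided_comult ga ch f be = 0"
 thus "braided_comult ga ch (%w. a * f w) be = 0" using bc_linear(2)[OF f(1) f(1) be, of ga ch] by simp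
qed

definition fsum :: "('z => 'k::field) => ('z => 'k) => 'k" where
 "fsum f Q = (\<Sum>z | f z ~= 0. f z * Q z)"

lemma fsum_superset: "[|finite S; !!z. f z ~= 0 ==> z:S|] ==> fsum f Q = (\<Sum>z\<in>S. f z * Q z)"
 unfolding fsum_def by(rule sum.mono_neutral_left) auto

lemma fsum_add:
 assumes "f:fin_supp Z" "h:fin_supp Z"
 shows "fsum (%z. f z + h z) Q = fsum f Q + fsum h Q"
proof -
 let ?S = "{z. f z ~= 0} \<union> {z. h z ~= 0}"
 have "finite ?S" using assms fin_suppD by blast
 thus ?thesis by(subst (1 2 3) fsum_superset[of ?S]) (auto simp: algebra_simps sum.distrib)
qed

lemma fsum_smult:
 assumes "f:fin_supp Z"
 shows "fsum (%z. a * f z) Q = a * fsum f Q"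
proof -
 have "finite {z. f z ~= 0}" using assms fin_suppD by blast
 thus ?thesis by(subst (1 2) fsum_superset[of "{z. f z ~= 0}"]) (auto simp: algebra_simps sum_distrib_left)
qed

lemma fsum_single [simp]: "fsum (single z) Q = Q z"
 by(subst fsum_superset[of "{z}"]) (auto simp: single_def split: if_splits)

lemma fsum_zero [simp]: "fsum (%z. 0) Q = 0"
 by(simp add: fsum_def)

lemma fsum_cong: "(!!z. f z ~= 0 ==> Q z = Q' z) ==> fsum f Q = fsum f Q'"
 unfolding fsum_def by(rule sum.cong) auto

lemma fsum_plus: "fsum f (%z. Q z + Q' z) = fsum f Q + fsum f Q'"
 by(simp add: fsum_def algebra_simps sum.distrib)

lemma fsum_times: "fsum f (%z. a * Q z) = a * fsum f Q"
 by(simp add: fsum_def sum_distrib_left algebra_simps)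

lemma fsum_swap: "fsum f (%z. fsum h (%y. Q z y)) = fsum h (%y. fsum f (%z. Q z y))"
proof -
 have "fsum f (%z. fsum h (%y. Q z y)) = (\<Sum>z | f z ~= 0. \<Sum>y | h y ~= 0. f z * (h y * Q z y))"
  by(simp add: fsum_def sum_distrib_left)
 also have "... = (\<Sum>y | h y ~= 0. \<Sum>z | f z ~= 0. f z * (h y * Q z y))" by(rule sum.swap)
 finally show ?thesis by(simp add: fsum_def sum_distrib_left algebra_simps)
qed

lemma bc_fsum:
 assumes "f:fin_supp words" "bilinear_form tensor_alg tensor_alg be"
 shows "braided_comult ga ch f be = fsum f (%w. \<Sum>(c, u, v)\<leftarrow>word_comult ga ch w. c * be (single u) (single v))"
 using bc_eval[OF assms fin_suppD(1)[OF assms(1)]] by(simp add: fsum_def)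

text \<open>A relation of a Nichols algebra is a sum of bihomogeneous relations.\<close>

lemma nichols_bihomogeneous_induct [consumes 1, case_names homogeneous add]:
 assumes f: "f:nichols_ideal ga (ch :: nat => 'g => 'k::field_char_0)"
  and hom: "!!f a n. [|f:nichols_ideal ga ch; !!w. f w ~= 0 ==> count_list w 1 = a & length w = n|] ==> P f"
  and add: "!!f h. [|f:nichols_ideal ga ch; h:nichols_ideal ga ch; P f; P h|] ==> P (%w. f w + h w)"
 shows "P f"
 using f
proof(induction "card {w. f w ~= 0}" arbitrary: f rule: less_induct)
 case less
 show ?case
 proof(cases "EX w0. f w0 ~= 0")
  case False
  thus ?thesis using hom[OF less.prems] by blast
 next
  case True
  then obtain w0 where w0: "f w0 ~= 0" by blast
  define h where "h = len_part (length w0) (one_part (count_list w0 1) f)"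
  define r where "r = (%w. f w + (- 1) * h w)"
  have h: "h:nichols_ideal ga ch" unfolding h_def by(intro NI_len NI_one_part less.prems)
  have r: "r:nichols_ideal ga ch" unfolding r_def by(intro nichols_ideal_closed less.prems h)
  have rw: "r w = (if length w = length w0 & count_list w 1 = count_list w0 1 then 0 else f w)" for w
   by(auto simp: r_def h_def len_part_def one_part_def)
  have fin: "finite {w. f w ~= 0}" using fin_suppD[OF NI_carrier[OF less.prems]] by blast
  have "card {w. r w ~= 0} < card {w. f w ~= 0}"
   by(rule psubset_card_mono[OF fin]) (use w0 in \<open>auto simp: rw psubset_eq split: if_splits\<close>)
  hence Pr: "P r" using less.hyps r by blast
  have Ph: "P h" by(rule hom[OF h, of "count_list w0 1" "length w0"]) (auto simp: h_def len_part_def one_part_def split: if_splits)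
  have "f = (%w. h w + r w)" by(simp add: r_def)
  thus ?thesis using add[OF h r Ph Pr] by simp
 qed
qed

section \<open>The bosonization of a Nichols algebra\<close>

lemma bos_simps [simp]:
 "car (tensor_bosonization G ga ch) = fin_supp (words\<times>car G)"
 "one (tensor_bosonization G ga ch) = single ([], \<one>\<^bsub>G\<^esub>)"
 "ring.zero (tensor_bosonization G ga ch) = (%z. 0)"
 "ring.add (tensor_bosonization G ga ch) = (%f h z. f z + h z)"
 "module.smult (tensor_bosonization G ga ch) = (%a f z. a * f z)"
 by(simp_all add: tensor_bosonization_def smash_alg_def module.defs bialg.defs words_def)

lemma bos_mult:
 "(f \<otimes>\<^bsub>tensor_bosonization G ga ch\<^esub> h) z
  = fsum f (%(v, g). fsum h (%(w, k). word_char ch w g * single (v @ w, g\<otimes>\<^bsub>G\<^esub>k) z))"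
proof -
 have "monoid.mult (tensor_bosonization G ga ch) = monoid.mult (smash_alg G ch)"
  by(simp add: tensor_bosonization_def smash_alg_def module.defs bialg.defs)
 hence "(f \<otimes>\<^bsub>tensor_bosonization G ga ch\<^esub> h) z
  = (\<Sum>(v, g) | f (v, g) ~= 0. \<Sum>(w, k) | h (w, k) ~= 0.
     f (v, g) * h (w, k) * word_char ch w g * single (v @ w, g\<otimes>\<^bsub>G\<^esub>k) z)"
  by(simp add: smash_alg_def)
 thus ?thesis by(simp add: fsum_def sum_distrib_left mult.assoc case_prod_unfold)
qed

lemma bos_bilinear:
 "bilinear_form (smash_alg G ch) (smash_alg G ch) = bilinear_form (tensor_bosonization G ga ch) (tensor_bosonization G ga ch)"
 by(simp add: bilinear_form_def[abs_def] linear_form_def smash_alg_def words_def)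

lemma bos_comult:
 assumes "bilinear_form (tensor_bosonization G ga ch) (tensor_bosonization G ga ch) be"
 shows "comult (tensor_bosonization G ga ch) f be
  = fsum f (%(w, g). \<Sum>(c, u, v)\<leftarrow>word_comult ga ch w. c * be (single (u, word_deg G ga v\<otimes>\<^bsub>G\<^esub>g)) (single (v, g)))"
proof -
 have b: "bilinear_form (smash_alg G ch) (smash_alg G ch) be"
  using assms bos_bilinear[of G ch ga] by simp
 have "comult (tensor_bosonization G ga ch) f be = (\<Sum>(w, g) | f (w, g) ~= 0. f (w, g) *
    (\<Sum>(c, u, v)\<leftarrow>word_comult ga ch w.
      c * pure_tensor (smash_alg G ch) (smash_alg G ch)
         (single (u, word_deg G ga v\<otimes>\<^bsub>G\<^esub>g)) (single (v, g)) be))"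
  unfolding tensor_bosonization_def by(simp add: module.defs bialg.defs)
 thus ?thesis unfolding pure_tensor_eval[OF b] by(simp add: fsum_def case_prod_unfold)
qed

lemma bos_counit:
 "counit (tensor_bosonization G ga ch) f = fsum f (%(w, g). if w = [] then 1 else 0)"
proof -
 have "counit (tensor_bosonization G ga ch) f = (\<Sum>(w, g) | f (w, g) ~= 0. if w = [] then f (w, g) else 0)"
  by(simp add: tensor_bosonization_def module.defs bialg.defs)
 also have "... = (\<Sum>z | f z ~= 0. f z * (if fst z = [] then 1 else 0))" by(rule sum.cong) (auto split: prod.splits)
 finally show ?thesis by(simp add: fsum_def case_prod_unfold)
qed

locale yd = comm_group G for G :: "('g, 'm) monoid_scheme" (structure) +
 fixes ga :: "nat => 'g" and ch :: "nat => 'g => 'k::field_char_0"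
 assumes yd: "yd_datum G ga ch"
begin

abbreviation "TB \<equiv> tensor_bosonization G ga ch"
abbreviation tbmult (infixl \<open>\<otimes>\<^sub>T\<close> 70) where "x \<otimes>\<^sub>T y \<equiv> x \<otimes>\<^bsub>TB\<^esub> y"
abbreviation "NI \<equiv> nichols_ideal ga ch"
abbreviation "basis \<equiv> words\<times>car G"

lemma ga_closed [simp]: "i:{1, 2} ==> ga i:car G"
 using yd by(auto simp: yd_datum_def)

lemma ch_props:
 assumes "i:{1, 2}"
 shows ch_nonzero: "g:car G ==> ch i g ~= 0"
  and ch_mult: "[|g:car G; h:car G|] ==> ch i (g\<otimes>h) = ch i g * ch i h"
  and ch_one: "ch i \<one> = 1"
proof -
 have "ch i:hom G (mult_of fld)" using yd assms by(auto simp: yd_datum_def)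
 thus nz: "!!g. g:car G ==> ch i g ~= 0"
  and m: "!!g h. [|g:car G; h:car G|] ==> ch i (g\<otimes>h) = ch i g * ch i h"
  by(auto simp: hom_def ring_of_type_algebra_def)
 show "ch i \<one> = 1" using m[of \<one> \<one>] nz[of \<one>] by simp
qed

lemma words_simps: "[]:words" "i # w:words \<longleftrightarrow> i:{1, 2} & w:words"
 "u @ v:words \<longleftrightarrow> u:words & v:words"
 by(auto simp: words_iff)

lemma word_char_simps [simp]: "word_char ch [] g = 1" "word_char ch (i # w) g = ch i g * word_char ch w g"
 "word_char ch (u @ v) g = word_char ch u g * word_char ch v g"
 by(auto simp: word_char_def)

lemma word_char_mult:
 "[|w:words; g:car G; h:car G|] ==> word_char ch w (g\<otimes>h) = word_char ch w g * word_char ch w h"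
 by(induction w) (auto simp: words_simps ch_mult)

lemma word_char_one: "w:words ==> word_char ch w \<one> = 1"
 by(induction w) (auto simp: words_simps ch_one)

lemma count_two: "w:words ==> length w = count_list w 1 + count_list w 2"
 by(induction w) (auto simp: words_simps)

lemma word_char_counts: "w:words ==> word_char ch w g = ch 1 g ^ count_list w 1 * ch 2 g ^ count_list w 2"
 by(induction w) (auto simp: words_simps)

lemma word_deg_simps [simp]: "word_deg G ga [] = \<one>" "word_deg G ga (i # w) = ga i\<otimes>word_deg G ga w"
 by(auto simp: word_deg_def)

lemma word_deg_closed [simp]: "w:words ==> word_deg G ga w:car G"
 by(induction w) (auto simp: words_simps)

lemma word_deg_counts: "w:words ==> word_deg G ga w = ga 1 [^] count_list w 1\<otimes>ga 2 [^] count_list w 2"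
proof(induction w)
 case (Cons i w)
 hence w: "w:words" and i: "i = 1 \<or> i = 2" by(auto simp: words_simps)
 note c = ga_closed[of 1] ga_closed[of 2]
 have "ga 1 [^] Suc n = ga 1\<otimes>ga 1 [^] n" "ga 2 [^] Suc n = ga 2\<otimes>ga 2 [^] n" for n
  using c by(auto simp: nat_pow_Suc m_comm)
 thus ?case using Cons.IH[OF w] i c by(auto simp: m_ac)
qed auto

sublocale TBk: kspace TB
 by(rule function_space_kspace[of _ basis]) auto

lemma single_closed: "[|w:words; g:car G|] ==> single (w, g):car TB"
 by(simp add: single_fin_supp)

lemma TB_form_expand:
 assumes F: "linear_form TB F" and f: "f:car TB"
 shows "F f = fsum f (%z. F (single z))"
proof -
 have "f:fin_supp basis" using f by simp
 thus ?thesis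
 proof(induction f rule: fin_supp_induct)
  case zero
  thus ?case using TBk.lf_zero[OF F] by simp
 next
  case (add f h)
  thus ?case using TBk.lf_add[OF F, of f h] by(simp add: fsum_add)
 next
  case (smult a f)
  thus ?case using TBk.lf_smult[OF F, of f a] by(simp add: fsum_smult)
 qed simp
qed

lemma single_mult_single:
 "single (v, g) \<otimes>\<^sub>T single (w, h) = (%z. word_char ch w g * single (v @ w, g\<otimes>h) z)"
 by(simp add: fun_eq_iff bos_mult)

lemma mult_bilinear:
 assumes "f:car TB" "h:car TB"
 shows "(%z. f z + h z) \<otimes>\<^sub>T x = (%z. (f \<otimes>\<^sub>T x) z + (h \<otimes>\<^sub>T x) z)"
  "x \<otimes>\<^sub>T (%z. f z + h z) = (%z. (x \<otimes>\<^sub>T f) z + (x \<otimes>\<^sub>T h) z)"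
  "(%z. a * f z) \<otimes>\<^sub>T x = (%z. a * (f \<otimes>\<^sub>T x) z)"
  "x \<otimes>\<^sub>T (%z. a * f z) = (%z. a * (x \<otimes>\<^sub>T f) z)"
  "(%z. 0) \<otimes>\<^sub>T x = (%z. 0)" "x \<otimes>\<^sub>T (%z. 0) = (%z. 0)"
 using assms
 by(simp_all add: fun_eq_iff bos_mult fsum_add fsum_smult case_prod_unfold fsum_plus fsum_times)
  (simp_all add: fsum_def)

lemma TB_induct [consumes 1, case_names basis add smult]:
 assumes "f:car TB" "!!w g. [|w:words; g:car G|] ==> P (single (w, g))"
  "!!f h. [|f:car TB; h:car TB; P f; P h|] ==> P (%z. f z + h z)"
  "!!a f. [|f:car TB; P f|] ==> P (%z. a * f z)"
 shows "P f"
proof -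
 have "f:fin_supp basis" using assms(1) by simp
 thus ?thesis
 proof(induction f rule: fin_supp_induct)
  case zero
  show ?case
   using assms(4)[of "single ([], \<one>)" 0] assms(2)[of "[]" \<one>] single_closed[of "[]" \<one>] by(simp add: words_simps)
 next
  case (basis p) thus ?case using assms(2) by(cases p) auto
 next
  case (add f h) thus ?case using assms(3)[of f h] by simp
 next
  case (smult a f) thus ?case using assms(4)[of f a] by simp
 qed
qed

lemma TB_closed:
 "[|f:car TB; h:car TB|] ==> (%z. f z + h z):car TB"
 "f:car TB ==> (%z. a * f z):car TB" "(%z. 0):car TB"
 using TBk.M.a_closed[of f h] TBk.smult_closed'[of f a] TBk.M.zero_closed by simp_all

lemma TB_mult_closed: "[|f:car TB; h:car TB|] ==> f \<otimes>\<^sub>T h:car TB"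
proof(induction f rule: TB_induct)
 case (basis w g)
 from basis(3,1,2) show ?case
 proof(induction h rule: TB_induct)
  case (basis v k)
  thus ?case unfolding single_mult_single by(intro TB_closed(2) single_closed) (auto simp: words_simps)
 next
  case (add x y)
  thus ?case unfolding mult_bilinear(2)[OF add(1,2)] by(intro TB_closed(1)) auto
 next
  case (smult a x)
  thus ?case unfolding mult_bilinear(4)[OF smult(1,1)] by(intro TB_closed(2)) auto
 qed
next
 case (add x y)
 thus ?case unfolding mult_bilinear(1)[OF add(1,2)] by(intro TB_closed(1)) auto
next
 case (smult a x)
 thus ?case unfolding mult_bilinear(3)[OF smult(1,1)] by(intro TB_closed(2)) auto
qed

lemma TB_mult_assoc:
 assumes "f:car TB" "h:car TB" "x:car TB"
 shows "(f \<otimes>\<^sub>T h) \<otimes>\<^sub>T x = f \<otimes>\<^sub>T (h \<otimes>\<^sub>T x)"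
 using assms
proof(induction f rule: TB_induct)
 case (basis u g)
 note ug = basis(1,2)
 from basis(3,4) show ?case
 proof(induction h rule: TB_induct)
  case (basis v k)
  note vk = basis(1,2)
  from basis(3) show ?case
  proof(induction x rule: TB_induct)
   case (basis w l)
   have s: "single (u @ v, g\<otimes>k):car TB" "single (v @ w, k\<otimes>l):car TB"
    using ug vk basis by(auto simp: words_simps intro!: single_closed simp del: bos_simps)
   show ?case
    unfolding single_mult_single mult_bilinear(3)[OF s(1,1)] mult_bilinear(4)[OF s(2,2)]
    using ug vk basis by(simp add: fun_eq_iff m_assoc word_char_mult)
  next
   case (add x y)
   have c: "single (u, g):car TB" "single (v, k):car TB" using ug vk by(intro single_closed; simp)+
   note d = TB_mult_closed[OF c(2) add(1)] TB_mult_closed[OF c(2) add(2)]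
   show ?case unfolding mult_bilinear(2)[OF add(1,2)] mult_bilinear(2)[OF d] add.IH ..
  next
   case (smult a x)
   have c: "single (v, k):car TB" using vk by(intro single_closed; simp)
   note d = TB_mult_closed[OF c smult(1)]
   show ?case unfolding mult_bilinear(4)[OF smult(1,1)] mult_bilinear(4)[OF d d] smult.IH ..
  qed
 next
  case (add h h')
  have c: "single (u, g):car TB" using ug by(intro single_closed; simp)
  note d = TB_mult_closed[OF c add(1)] TB_mult_closed[OF c add(2)]
   TB_mult_closed[OF add(1) add.prems] TB_mult_closed[OF add(2) add.prems]
  show ?case
   unfolding mult_bilinear(2)[OF add(1,2)] mult_bilinear(1)[OF add(1,2)] mult_bilinear(1)[OF d(1,2)] mult_bilinear(2)[OF d(3,4)]
   using add.IH add.prems by simp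
 next
  case (smult a h)
  have c: "single (u, g):car TB" using ug by(intro single_closed; simp)
  note d = TB_mult_closed[OF c smult(1)] TB_mult_closed[OF smult(1) smult.prems]
  show ?case
   unfolding mult_bilinear(4)[OF smult(1,1)] mult_bilinear(3)[OF smult(1,1)] mult_bilinear(3)[OF d(1,1)] mult_bilinear(4)[OF d(2,2)]
   using smult.IH smult.prems by simp
 qed
next
 case (add f f')
 note d = TB_mult_closed[OF add(1) add.prems(1)] TB_mult_closed[OF add(2) add.prems(1)]
 show ?case unfolding mult_bilinear(1)[OF add(1,2)] mult_bilinear(1)[OF d] using add.IH add.prems by simp
next
 case (smult a f)
 note d = TB_mult_closed[OF smult(1) smult.prems(1)]
 show ?case unfolding mult_bilinear(3)[OF smult(1,1)] mult_bilinear(3)[OF d d] using smult.IH smult.prems by simp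
qed

lemma TB_one: "f:car TB ==> single ([], \<one>) \<otimes>\<^sub>T f = f & f \<otimes>\<^sub>T single ([], \<one>) = f"
proof(induction f rule: TB_induct)
 case (basis w g)
 thus ?case by(simp add: single_mult_single word_char_one)
next
 case (add f h)
 thus ?case unfolding mult_bilinear(1)[OF add(1,2)] mult_bilinear(2)[OF add(1,2)] by simp
next
 case (smult a f)
 thus ?case unfolding mult_bilinear(3)[OF smult(1,1)] mult_bilinear(4)[OF smult(1,1)] by simp
qed

lemma TB_ring: "ring TB"
proof(rule ringI)
 show "abelian_group TB" by(rule TBk.M.abelian_group_axioms)
 show "monoid TB"
  by(rule monoidI)
   (use TB_mult_closed TB_mult_assoc TB_one single_closed[of "[]" \<one>] in \<open>simp_all add: words_simps\<close>)
 fix x y z assume "x:car TB" "y:car TB" "z:car TB"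
 thus "(x \<oplus>\<^bsub>TB\<^esub> y) \<otimes>\<^sub>T z = x \<otimes>\<^sub>T z \<oplus>\<^bsub>TB\<^esub> y \<otimes>\<^sub>T z"
  "z \<otimes>\<^sub>T (x \<oplus>\<^bsub>TB\<^esub> y) = z \<otimes>\<^sub>T x \<oplus>\<^bsub>TB\<^esub> z \<otimes>\<^sub>T y"
  using mult_bilinear(1,2)[of x y z] by simp_all
qed

subsection \<open>The kernel of the projection onto the bosonization of the Nichols algebra\<close>

definition slice :: "(nat list\<times>'g => 'k) => 'g => nat list => 'k" where
 "slice f g = (%w. f (w, g))"

definition NK :: "(nat list\<times>'g => 'k) set" where
 "NK = {f:car TB. ALL g:car G. slice f g:NI}"

lemma slice_linear: "slice (%z. f z + h z) g = (%w. slice f g w + slice h g w)"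
 "slice (%z. a * f z) g = (%w. a * slice f g w)" "slice (%z. 0) g = (%w. 0)"
 by(auto simp: slice_def)

lemma NK_sub: "subspace NK TB"
proof(rule TBk.subI)
 show "\<zero>\<^bsub>TB\<^esub>:NK" using TB_closed(3) by(simp add: NK_def slice_linear nichols_ideal_closed)
 show "x \<oplus>\<^bsub>TB\<^esub> y:NK" if "x:NK" "y:NK" for x y
  using that TB_closed(1)[of x y] by(simp add: NK_def slice_linear nichols_ideal_closed)
 show "a \<odot>\<^bsub>TB\<^esub> x:NK" if "x:NK" for a x
  using that TB_closed(2)[of x a] by(simp add: NK_def slice_linear nichols_ideal_closed)
qed (auto simp: NK_def)

lemma NK_D: "f:NK ==> f:car TB" "[|f:NK; g:car G|] ==> slice f g:NI"
 by(auto simp: NK_def)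

text \<open>\<open>G\<close> acts on \<open>T(V)\<close> by rescaling the letters.\<close>

lemma NI_stable:
 assumes g: "g:car G"
 shows "f:NI ==> (%w. word_char ch w g * f w):NI"
proof -
 assume f: "f:NI"
 have "(%w. word_char ch w g * f w) = twist (ch 1 g) (ch 2 g) f"
 proof
  fix w show "word_char ch w g * f w = twist (ch 1 g) (ch 2 g) f w"
   using fin_suppD(2)[OF NI_carrier[OF f], of w] by(cases "f w = 0") (simp_all add: twist_def word_char_counts)
 qed
 thus ?thesis using NI_twist[OF f, of "ch 1 g" "ch 2 g"] ch_nonzero[OF _ g] by simp
qed

lemma single_mult_apply:
 assumes f: "f:car TB" and v: "v:words" and g: "g:car G" and h: "h:car G"
 shows "(single (v, g) \<otimes>\<^sub>T f) (w, h)
   = (if take (length v) w = v then word_char ch (drop (length v) w) g * f (drop (length v) w, inv g\<otimes>h) else 0)" (is ?l)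
  "(f \<otimes>\<^sub>T single (v, g)) (w, h)
   = (if drop (length w - length v) w = v then word_char ch v (h\<otimes>inv g) * f (take (length w - length v) w, h\<otimes>inv g) else 0)" (is ?r)
proof -
 have eq: "g\<otimes>k = h \<longleftrightarrow> k = inv g\<otimes>h" "k\<otimes>g = h \<longleftrightarrow> k = h\<otimes>inv g" if "k:car G" for k
  using that g h inv_solve_left inv_solve_right by(metis, metis)
 note s = single_closed[OF v g]
 show ?l using f
 proof(induction f rule: TB_induct)
  case (basis u k)
  have "single (v @ u, g\<otimes>k) (w, h) = (if take (length v) w = v & u = drop (length v) w & k = inv g\<otimes>h then 1 else (0 :: 'k))"
   unfolding single_def eq(1)[OF basis(2), symmetric] by(auto simp: eq_commute[of w "v @ u"] append_eq_conv_conj)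
  thus ?case unfolding single_mult_single by(auto simp: single_def)
 next
  case (add x y)
  thus ?case unfolding mult_bilinear(2)[OF add(1,2)] by(simp add: algebra_simps)
 next
  case (smult a x)
  thus ?case unfolding mult_bilinear(4)[OF smult(1,1)] by simp
 qed
 show ?r using f
 proof(induction f rule: TB_induct)
  case (basis u k)
  have app: "w = u @ v \<longleftrightarrow> drop (length w - length v) w = v & u = take (length w - length v) w"
   by(rule iffI) (simp, metis append_take_drop_id)
  have "single (u @ v, k\<otimes>g) (w, h) = (if drop (length w - length v) w = v & u = take (length w - length v) w & k = h\<otimes>inv g then 1 else (0 :: 'k))"
   unfolding single_def eq(2)[OF basis(2), symmetric] using app by auto
  thus ?case unfolding single_mult_single by(auto simp: single_def)
 next
  case (add x y)
  thus ?case unfolding mult_bilinear(1)[OF add(1,2)] by(simp add: algebra_simps)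
 next
  case (smult a x)
  thus ?case unfolding mult_bilinear(3)[OF smult(1,1)] by simp
 qed
qed

lemma slice_single_mult:
 assumes "f:car TB" "v:words" "g:car G" "h:car G"
 shows "slice (single (v, g) \<otimes>\<^sub>T f) h
   = single v \<otimes>\<^sub>V (%w. word_char ch w g * slice f (inv g\<otimes>h) w)"
  "slice (f \<otimes>\<^sub>T single (v, g)) h
   = (%w. word_char ch v (h\<otimes>inv g) * (slice f (h\<otimes>inv g) \<otimes>\<^sub>V single v) w)"
 using single_mult_apply[OF assms] by(auto simp: slice_def single_mult_left single_mult_right)

lemma NK_ideal: "ideal NK TB"
proof(rule idealI[OF TB_ring])
 show "subgroup NK (add_monoid TB)" using NK_sub by(simp add: submodule_def)
 fix f x assume f: "f:NK" and x: "x:car TB"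
 note fT = NK_D(1)[OF f]
 from x show "x \<otimes>\<^sub>T f:NK"
 proof(induction x rule: TB_induct)
  case (basis v g)
  have "slice (single (v, g) \<otimes>\<^sub>T f) h:NI" if h: "h:car G" for h
   unfolding slice_single_mult(1)[OF fT basis h]
   by(intro NI_mult(1)[OF basis(1)] NI_stable[OF basis(2)] NK_D(2)[OF f]) (use basis h in auto)
  thus ?case unfolding NK_def using TB_mult_closed[OF single_closed[OF basis] fT] by blast
 next
  case (add x y)
  thus ?case unfolding mult_bilinear(1)[OF add(1,2)] using TBk.sub_add[OF NK_sub] by simp
 next
  case (smult a x)
  thus ?case unfolding mult_bilinear(3)[OF smult(1,1)] using TBk.sub_smult[OF NK_sub] by simp
 qed
 from x show "f \<otimes>\<^sub>T x:NK"
 proof(induction x rule: TB_induct)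
  case (basis v g)
  have "slice (f \<otimes>\<^sub>T single (v, g)) h:NI" if h: "h:car G" for h
   unfolding slice_single_mult(2)[OF fT basis h]
   by(intro nichols_ideal_closed(3) NI_mult(2)[OF basis(1)] NK_D(2)[OF f]) (use basis h in auto)
  thus ?case unfolding NK_def using TB_mult_closed[OF fT single_closed[OF basis]] by blast
 next
  case (add x y)
  thus ?case unfolding mult_bilinear(2)[OF add(1,2)] using TBk.sub_add[OF NK_sub] by simp
 next
  case (smult a x)
  thus ?case unfolding mult_bilinear(4)[OF smult(1,1)] using TBk.sub_smult[OF NK_sub] by simp
 qed
qed

definition emb :: "(nat list => 'k) => 'g => nat list\<times>'g => 'k" where
 "emb x g = (%(w, h). if h = g then x w else 0)"

lemma emb_closed: "[|x:fin_supp words; g:car G|] ==> emb x g:car TB"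
proof -
 assume x: "x:fin_supp words" and g: "g:car G"
 have "emb x g:fin_supp basis"
  by(rule fin_suppI[of "{w. x w ~= 0}\<times>{g}"])
   (use fin_suppD[OF x] g in \<open>auto simp: emb_def split: if_splits\<close>)
 thus ?thesis by simp
qed

lemma emb_NK: "[|x:NI; g:car G|] ==> emb x g:NK"
proof -
 assume x: "x:NI" and g: "g:car G"
 have "slice (emb x g) h = (if h = g then x else (%w. 0))" for h by(auto simp: slice_def emb_def)
 thus ?thesis unfolding NK_def using emb_closed[OF NI_carrier[OF x] g] x nichols_ideal_closed(1) by auto
qed

lemma form_emb:
 assumes "linear_form TB F" "x:fin_supp words" "g:car G"
 shows "F (emb x g) = fsum x (%w. F (single (w, g)))"
proof -
 have fin: "finite {w. x w ~= 0}" using fin_suppD[OF assms(2)] by blast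
 have "F (emb x g) = fsum (emb x g) (%z. F (single z))" by(rule TB_form_expand[OF assms(1) emb_closed[OF assms(2,3)]])
 also have "... = (\<Sum>z\<in>(%w. (w, g)) ` {w. x w ~= 0}. emb x g z * F (single z))"
  by(rule fsum_superset) (use fin in \<open>auto simp: emb_def split: if_splits\<close>)
 also have "... = fsum x (%w. F (single (w, g)))"
  by(subst sum.reindex) (auto simp: inj_on_def emb_def fsum_def)
 finally show ?thesis .
qed

text \<open>On a bihomogeneous relation the degree in \<open>G\<close> of the words is constant, so that the twist by the
 coaction in the comultiplication of the bosonization is harmless.\<close>

lemma NK_coideal:
 assumes be: "bilinear_form TB TB be"
  and z: "!!x y. [|x:NK; y:car TB|] ==> be x y = 0" "!!x y. [|x:car TB; y:NK|] ==> be x y = 0"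
  and f: "f:NK"
 shows "comult TB f be = 0"
proof -
 have slice_zero: "fsum x (%w. \<Sum>(c, u, v)\<leftarrow>word_comult ga ch w. c * be (single (u, word_deg G ga v\<otimes>g)) (single (v, g))) = 0"
  if x: "x:NI" and g: "g:car G" for x g
 proof -
  define be' where "be' p r = fsum p (%u. fsum r (%v. be (single (u, word_deg G ga v\<otimes>g)) (single (v, g))))" for p r
  have bil: "bilinear_form tensor_alg tensor_alg be'"
   unfolding bilinear_form_def linear_form_def be'_def
   by(auto simp: fsum_add fsum_smult fsum_plus fsum_times)
  have "braided_comult ga ch x be' = 0"
  proof(rule NI_coideal[OF x bil])
   fix p r :: "nat list => 'k" assume p: "p:NI" and r: "r:fin_supp words"
   have "be' p r = fsum r (%v. fsum p (%u. be (single (u, word_deg G ga v\<otimes>g)) (single (v, g))))"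
    unfolding be'_def by(rule fsum_swap)
   also have "... = fsum r (%v. 0)"
   proof(rule fsum_cong)
    fix v assume "r v ~= 0"
    hence v: "v:words" using fin_suppD(2)[OF r] by blast
    have d: "word_deg G ga v\<otimes>g:car G" using v g by simp
    have "fsum p (%u. be (single (u, word_deg G ga v\<otimes>g)) (single (v, g))) = be (emb p (word_deg G ga v\<otimes>g)) (single (v, g))"
     using form_emb[OF bilformD(2)[OF be single_closed[OF v g]] NI_carrier[OF p] d] by simp
    thus "fsum p (%u. be (single (u, word_deg G ga v\<otimes>g)) (single (v, g))) = 0"
     using z(1)[OF emb_NK[OF p d] single_closed[OF v g]] by simp
   qed
   finally show "be' p r = 0" by(simp add: fsum_def)
  next
   fix p r :: "nat list => 'k" assume p: "p:fin_supp words" and r: "r:NI"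
   have "fsum r (%v. be (single (u, word_deg G ga v\<otimes>g)) (single (v, g))) = 0" if u: "u:words" for u
    using r
   proof(induction r rule: nichols_bihomogeneous_induct)
    case (homogeneous r a n)
    define d where "d = ga 1 [^] a\<otimes>ga 2 [^] (n - a)"
    have rW: "r:fin_supp words" by(rule NI_carrier[OF homogeneous(1)])
    have d: "d\<otimes>g:car G" using g by(simp add: d_def)
    have "fsum r (%v. be (single (u, word_deg G ga v\<otimes>g)) (single (v, g))) = fsum r (%v. be (single (u, d\<otimes>g)) (single (v, g)))"
    proof(rule fsum_cong)
     fix v assume v: "r v ~= 0"
     hence vW: "v:words" using fin_suppD(2)[OF rW] by blast
     have "count_list v 2 = n - a" using homogeneous(2)[OF v] count_two[OF vW] by linarith
     hence "word_deg G ga v = d" using homogeneous(2)[OF v] vW by(simp add: word_deg_counts d_def)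
     thus "be (single (u, word_deg G ga v\<otimes>g)) (single (v, g)) = be (single (u, d\<otimes>g)) (single (v, g))" by simp
    qed
    also have "... = be (single (u, d\<otimes>g)) (emb r g)"
     using form_emb[OF bilformD(1)[OF be single_closed[OF u d]] rW g] by simp
    also have "... = 0" by(rule z(2)[OF single_closed[OF u d] emb_NK[OF homogeneous(1) g]])
    finally show ?case .
   next
    case (add r r')
    thus ?case by(simp add: fsum_add[OF NI_carrier[OF add(1)] NI_carrier[OF add(2)]])
   qed
   hence "be' p r = fsum p (%u. 0)" unfolding be'_def using fin_suppD(2)[OF p] by(intro fsum_cong) auto
   thus "be' p r = 0" by(simp add: fsum_def)
  qed
  thus ?thesis
   unfolding bc_fsum[OF NI_carrier[OF x] bil] by(simp add: be'_def)
 qed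
 have fT: "f:fin_supp basis" using NK_D(1)[OF f] by simp
 have fin: "finite {z. f z ~= 0}" using fin_suppD[OF fT] by blast
 define A where "A = snd ` {z. f z ~= 0}"
 define B where "B = fst ` {z. f z ~= 0}"
 define Q where "Q w g = (\<Sum>(c, u, v)\<leftarrow>word_comult ga ch w. c * be (single (u, word_deg G ga v\<otimes>g)) (single (v, g)))" for w g
 have AB: "finite A" "finite B" "A \<subseteq> car G" using fin fin_suppD(2)[OF fT] by(auto simp: A_def B_def)
 have "comult TB f be = fsum f (%(w, g). Q w g)" unfolding bos_comult[OF be] Q_def ..
 also have "... = (\<Sum>(w, g)\<in>B\<times>A. f (w, g) * Q w g)"
  by(subst fsum_superset[of "B\<times>A"]) (use AB in \<open>force simp: A_def B_def case_prod_unfold\<close>)+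
 also have "... = (\<Sum>g\<in>A. \<Sum>w\<in>B. slice f g w * Q w g)"
  by(subst sum.cartesian_product[symmetric], subst sum.swap) (simp add: slice_def)
 also have "... = (\<Sum>g\<in>A. fsum (slice f g) (%w. Q w g))"
  by(intro sum.cong refl fsum_superset[symmetric] AB) (force simp: B_def slice_def)
 also have "... = 0"
  using slice_zero NK_D(2)[OF f] AB(3) unfolding Q_def by(intro sum.neutral) auto
 finally show ?thesis .
qed

end

lemma bilinear_pullback:
 assumes be: "bilinear_form N N be" and cl: "!!x. x:car M ==> h x:car N"
  and add: "!!x y. [|x:car M; y:car M|] ==> h (x\<oplus>\<^bsub>M\<^esub>y) = h x\<oplus>\<^bsub>N\<^esub>h y"
  and sm: "!!a x. x:car M ==> h (a\<odot>\<^bsub>M\<^esub>x) = a\<odot>\<^bsub>N\<^esub>h x"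
 shows "bilinear_form M M (%x y. be (h x) (h y))"
 unfolding bilinear_form_def
proof(intro conjI ballI)
 fix x assume x: "x:car M"
 have 1: "linear_form N (be (h x))" by(rule bilformD(1)[OF be cl[OF x]])
 have 2: "linear_form N (%y. be y (h x))" by(rule bilformD(2)[OF be cl[OF x]])
 show "linear_form M (%y. be (h x) (h y))"
  unfolding linear_form_def
 proof(intro conjI ballI allI)
  fix y z assume yz: "y:car M" "z:car M"
  show "be (h x) (h (y\<oplus>\<^bsub>M\<^esub>z)) = be (h x) (h y) + be (h x) (h z)"
   unfolding add[OF yz] using 1 cl[OF yz(1)] cl[OF yz(2)] unfolding linear_form_def by simp
 next
  fix a y assume y: "y:car M"
  show "be (h x) (h (a\<odot>\<^bsub>M\<^esub>y)) = a * be (h x) (h y)"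
   unfolding sm[OF y] using 1 cl[OF y] unfolding linear_form_def by simp
 qed
 show "linear_form M (%y. be (h y) (h x))"
  unfolding linear_form_def
 proof(intro conjI ballI allI)
  fix y z assume yz: "y:car M" "z:car M"
  show "be (h (y\<oplus>\<^bsub>M\<^esub>z)) (h x) = be (h y) (h x) + be (h z) (h x)"
   unfolding add[OF yz] using 2 cl[OF yz(1)] cl[OF yz(2)] unfolding linear_form_def by simp
 next
  fix a y assume y: "y:car M"
  show "be (h (a\<odot>\<^bsub>M\<^esub>y)) (h x) = a * be (h y) (h x)"
   unfolding sm[OF y] using 2 cl[OF y] unfolding linear_form_def by simp
 qed
qed

context yd
begin

abbreviation "D \<equiv> nichols_bosonization G ga ch"

definition cls :: "(nat list\<times>'g => 'k) => (nat list\<times>'g => 'k) set" where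
 "cls x = NK +>\<^bsub>TB\<^esub> x"

lemma D_eq: "D = quotient_bialg TB NK"
proof -
 have "car (smash_alg G ch) = car TB" by(simp add: smash_alg_def words_def)
 thus ?thesis by(simp add: nichols_bosonization_def NK_def slice_def)
qed

lemma D_simps:
 "car D = car (TB Quot NK)" "monoid.mult D = monoid.mult (TB Quot NK)" "one D = one (TB Quot NK)"
 "ring.add D = ring.add (TB Quot NK)" "ring.zero D = ring.zero (TB Quot NK)"
 "module.smult D = (%a C. cls (a \<odot>\<^bsub>TB\<^esub> rep C))" "counit D = (%C. counit TB (rep C))"
 "comult D = (%C. tensor_map (quotient_alg TB NK) cls (comult TB (rep C)))"
 unfolding D_eq cls_def[abs_def]
 by(simp_all add: quotient_bialg_def quotient_alg_def module.defs bialg.defs ring.defs)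

lemma D_bilinear: "bilinear_form D D = bilinear_form (quotient_alg TB NK) (quotient_alg TB NK)"
 unfolding D_eq by(simp add: bilinear_form_def[abs_def] linear_form_def quotient_bialg_def module.defs)

lemma cls_hom: "cls:ring_hom TB (TB Quot NK)"
 using ideal.rcos_ring_hom[OF NK_ideal] by(simp add: cls_def[abs_def])

lemma D_carrier: "car D = cls ` car TB"
 by(auto simp: D_simps(1) FactRing_def A_RCOSETS_def' cls_def)

lemma cls_closed: "x:car TB ==> cls x:car D"
 unfolding D_carrier by simp

lemma cls_mult: "[|x:car TB; y:car TB|] ==> cls (x \<otimes>\<^sub>T y) = cls x\<otimes>\<^bsub>D\<^esub>cls y"
 unfolding D_simps by(rule ring_hom_mult[OF cls_hom])

lemma cls_add: "[|x:car TB; y:car TB|] ==> cls (%z. x z + y z) = cls x\<oplus>\<^bsub>D\<^esub>cls y"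
 unfolding D_simps using ring_hom_add[OF cls_hom, of x y] by simp

lemma cls_one: "cls (single ([], \<one>)) = \<one>\<^bsub>D\<^esub>"
 unfolding D_simps using ring_hom_one[OF cls_hom] by simp

lemma cls_eq_iff: "[|x:car TB; y:car TB|] ==> cls x = cls y \<longleftrightarrow> (%z. x z + (- 1) * y z):NK"
 unfolding cls_def using TBk.coset_eq_iff[OF NK_sub, of x y] by(simp add: TBk.minus_eq_smult)

lemma rep_cls: "x:car TB ==> rep (cls x):car TB"
 "x:car TB ==> (%z. rep (cls x) z + (- 1) * x z):NK"
 unfolding cls_def using TBk.rep_coset[OF NK_sub, of x]
 by(simp_all add: TBk.minus_eq_smult)

lemma cls_smult: "x:car TB ==> cls (%z. a * x z) = a\<odot>\<^bsub>D\<^esub>cls x"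
proof -
 assume x: "x:car TB"
 note r = rep_cls[OF x]
 have "(%z. a * x z + (- 1) * (a * rep (cls x) z)) = (%z. (- a) * (rep (cls x) z + (- 1) * x z))"
  by(simp add: algebra_simps)
 hence "(%z. a * x z + (- 1) * (a * rep (cls x) z)):NK"
  using TBk.sub_smult[OF NK_sub r(2), of "- a"] by simp
 hence "cls (%z. a * x z) = cls (%z. a * rep (cls x) z)"
  using cls_eq_iff[OF TB_closed(2)[OF x] TB_closed(2)[OF r(1)]] by simp
 thus ?thesis by(simp add: D_simps)
qed

lemma D_bilinear_pullback:
 assumes "bilinear_form D D be"
 shows "bilinear_form TB TB (%x y. be (cls x) (cls y))"
 by(rule bilinear_pullback[OF assms]) (use cls_closed cls_add cls_smult in simp_all)

lemma comult_D:
 assumes x: "x:car TB" and be: "bilinear_form D D be"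
 shows "comult D (cls x) be = comult TB x (%u v. be (cls u) (cls v))"
proof -
 let ?be = "%u v. be (cls u) (cls v)"
 note b = D_bilinear_pullback[OF be] and r = rep_cls[OF x]
 have zeroD: "cls u = \<zero>\<^bsub>D\<^esub>" if "u:NK" for u
  unfolding cls_def using TBk.coset_zero[OF NK_sub that] by(simp add: D_simps FactRing_def)
 have zero0: "cls (%z. 0) = \<zero>\<^bsub>D\<^esub>" using zeroD TBk.sub_zero[OF NK_sub] by simp
 have b0: "be \<zero>\<^bsub>D\<^esub> C = 0" "be C \<zero>\<^bsub>D\<^esub> = 0" if C: "C:car D" for C
 proof -
  obtain y where y: "y:car TB" "C = cls y" using C by(auto simp: D_carrier)
  have "?be (%z. 0) y = 0" "?be y (%z. 0) = 0"
   using TBk.lf_zero[OF bilformD(2)[OF b y(1)]] TBk.lf_zero[OF bilformD(1)[OF b y(1)]] by auto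
  thus "be \<zero>\<^bsub>D\<^esub> C = 0" "be C \<zero>\<^bsub>D\<^esub> = 0" using y zero0 by auto
 qed
 have "comult TB (%z. rep (cls x) z + (- 1) * x z) ?be = 0"
 proof(rule NK_coideal[OF b _ _ r(2)])
  show "be (cls u) (cls v) = 0" if "u:NK" "v:car TB" for u v
   unfolding zeroD[OF that(1)] by(rule b0(1)[OF cls_closed[OF that(2)]])
  show "be (cls u) (cls v) = 0" if "u:car TB" "v:NK" for u v
   unfolding zeroD[OF that(2)] by(rule b0(2)[OF cls_closed[OF that(1)]])
 qed
 moreover have "comult TB (%z. rep (cls x) z + (- 1) * x z) ?be = comult TB (rep (cls x)) ?be - comult TB x ?be"
 proof -
  have f: "rep (cls x):fin_supp basis" "x:fin_supp basis" "(%z. (- 1) * x z):fin_supp basis"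
   using r(1) x TB_closed(2)[OF x, of "- 1"] by auto
  show ?thesis
   unfolding bos_comult[OF b] fsum_add[OF f(1,3)] fsum_smult[OF f(2)] by simp
 qed
 ultimately have "comult TB (rep (cls x)) ?be = comult TB x ?be" by simp
 thus ?thesis using be D_bilinear by(simp add: D_simps tensor_map_def)
qed

end

text \<open>The situation of the theorem: the inverse of an isomorphism \<open>F\<close> from \<open>gr(H)\<close> to the bosonization
 of the Nichols algebra, composed with the projection from the bosonization of the tensor algebra.\<close>

locale nichols_type = pointed_fd_bialgebra H
 for H :: "('k::field_char_0, 'a) bialg" (structure) +
 fixes ga :: "nat => 'a" and ch :: "nat => 'a => 'k" and F :: "(nat => 'a set) => (nat list\<times>'a => 'k) set"
 assumes comm_grouplikes: "comm_group (grouplike_group H)"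
  and datum: "yd_datum (grouplike_group H) ga ch"
  and F_iso: "F:ring_iso (gr H) (nichols_bosonization (grouplike_group H) ga ch)"
  and F_smult: "c:car (gr H) ==> F (a \<odot>\<^bsub>gr H\<^esub> c) = a \<odot>\<^bsub>nichols_bosonization (grouplike_group H) ga ch\<^esub> F c"
  and F_comult: "c:car (gr H) ==> comult (nichols_bosonization (grouplike_group H) ga ch) (F c)
   = tensor_map (nichols_bosonization (grouplike_group H) ga ch) F (comult (gr H) c)"
  and F_counit: "c:car (gr H) ==> counit (nichols_bosonization (grouplike_group H) ga ch) (F c) = counit (gr H) c"

sublocale nichols_type \<subseteq> Y: yd "grouplike_group H" ga ch
 by(intro yd.intro comm_grouplikes yd_axioms.intro datum)

context nichols_type
begin

abbreviation "G \<equiv> grouplike_group H"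

lemma G_simps [simp]: "car G = grouplikes H" "monoid.mult G = monoid.mult H" "one G = \<one>"
 by(simp_all add: grouplike_group_def)

lemma F_bij: "bij_betw F (car gra) (car Y.D)"
 using F_iso by(simp add: ring_iso_def)

lemma F_hom: "[|c:car gra; c':car gra|] ==> F (c \<otimes>\<^sub>g c') = F c\<otimes>\<^bsub>Y.D\<^esub>F c'"
 "[|c:car gra; c':car gra|] ==> F (c \<oplus>\<^sub>g c') = F c\<oplus>\<^bsub>Y.D\<^esub>F c'"
 "F \<one>\<^sub>g = \<one>\<^bsub>Y.D\<^esub>"
 using F_iso by(auto simp: ring_iso_def ring_hom_def)

definition kap :: "(nat list\<times>'a => 'k) => nat => 'a set" where
 "kap x = inv_into (car gra) F (Y.cls x)"

lemma kap_closed: "x:car Y.TB ==> kap x:car gra"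
 unfolding kap_def using F_bij Y.cls_closed[of x] by(metis bij_betw_imp_surj_on inv_into_into)

lemma F_kap: "x:car Y.TB ==> F (kap x) = Y.cls x"
 unfolding kap_def using F_bij Y.cls_closed[of x] by(metis bij_betw_inv_into_right)

lemma kap_eqI: "[|x:car Y.TB; c:car gra; F c = Y.cls x|] ==> kap x = c"
 using F_bij F_kap[of x] kap_closed[of x] by(metis bij_betw_imp_inj_on inj_onD)

lemma kap_mult: "[|x:car Y.TB; y:car Y.TB|] ==> kap (x\<otimes>\<^bsub>Y.TB\<^esub>y) = kap x \<otimes>\<^sub>g kap y"
 by(rule kap_eqI) (simp_all add: F_hom F_kap kap_closed Y.cls_mult Y.TB_mult_closed gra_mult_closed del: bos_simps)

lemma kap_add: "[|x:car Y.TB; y:car Y.TB|] ==> kap (%z. x z + y z) = kap x \<oplus>\<^sub>g kap y"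
 by(rule kap_eqI) (simp_all add: F_hom F_kap kap_closed Y.cls_add Y.TB_closed gra_add_closed del: bos_simps)

lemma kap_smult: "x:car Y.TB ==> kap (%z. a * x z) = a \<odot>\<^sub>g kap x"
 by(rule kap_eqI) (use F_smult kap_closed in \<open>simp_all add: F_kap Y.cls_smult Y.TB_closed gra_smult_closed del: bos_simps\<close>)

lemma kap_one: "kap (single ([], \<one>)) = \<one>\<^sub>g"
proof(rule kap_eqI)
 show "single ([], \<one>):car Y.TB" using Y.single_closed[of "[]" \<one>] Y.words_simps one_gl by simp
 show "\<one>\<^sub>g:car gra" unfolding gra_one using gl_coradical[OF one_gl] by(intro gh_closed) simp
 show "F \<one>\<^sub>g = Y.cls (single ([], \<one>))" using Y.cls_one F_hom(3) by simp
qed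

lemma kap_eq_iff: "[|x:car Y.TB; y:car Y.TB|] ==> kap x = kap y \<longleftrightarrow> (%z. x z + (- 1) * y z):Y.NK"
 using Y.cls_eq_iff[of x y] F_kap[of x] F_kap[of y] kap_def by metis

lemma kap_zero: "kap (%z. 0) = \<zero>\<^sub>g"
proof -
 have z: "(%z. 0):car Y.TB" by(rule Y.TB_closed(3))
 have "kap (%z. 0) n = Kb n" for n
 proof -
  have "kap (%z. 0) = 0 \<odot>\<^sub>g kap (%z. 0)" using kap_smult[OF z, of 0] by simp
  hence "kap (%z. 0) n = cl n (0\<odot>rep (kap (%z. 0) n))" by(metis gra_smult_apply)
  also have "0\<odot>rep (kap (%z. 0) n) = \<zero>"
   using filt_closed[OF gr_carrierD(1)[OF kap_closed[OF z]]] by simp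
  finally show ?thesis by(simp add: cl_zero sub_zero[OF below_sub])
 qed
 thus ?thesis by(auto simp: gra_zero)
qed

lemma kap_zero_iff: "x:car Y.TB ==> kap x = \<zero>\<^sub>g \<longleftrightarrow> x:Y.NK"
 using kap_eq_iff[of x "%z. 0"] Y.TB_closed(3) by(simp add: kap_zero)

lemma kap_surj: "c:car gra ==> EX x:car Y.TB. c = kap x"
proof -
 assume c: "c:car gra"
 hence "F c:car Y.D" using F_bij by(rule bij_betwE[rule_format, rotated])
 then obtain x where x: "x:car Y.TB" "F c = Y.cls x" unfolding Y.D_carrier by auto
 thus ?thesis using kap_eqI[OF x(1) c x(2)] by auto
qed

lemma F_bilinear:
 assumes be: "bilinear_form gra gra be"
 shows "bilinear_form Y.D Y.D (%C C'. be (inv_into (car gra) F C) (inv_into (car gra) F C'))"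
proof -
 let ?E = "inv_into (car gra) F"
 have add: "?E (C\<oplus>\<^bsub>Y.D\<^esub>C') = ?E C \<oplus>\<^sub>g ?E C'" and sm: "?E (a\<odot>\<^bsub>Y.D\<^esub>C) = a \<odot>\<^sub>g ?E C"
  and cl: "?E C:car gra" if CC: "C:car Y.D" "C':car Y.D" for C C' a
 proof -
  obtain x y where "x:car Y.TB" "C = Y.cls x" "y:car Y.TB" "C' = Y.cls y"
   using CC unfolding Y.D_carrier by auto
  thus "?E (C\<oplus>\<^bsub>Y.D\<^esub>C') = ?E C \<oplus>\<^sub>g ?E C'" "?E (a\<odot>\<^bsub>Y.D\<^esub>C) = a \<odot>\<^sub>g ?E C" "?E C:car gra"
   using kap_add[of x y] kap_smult[of x a] kap_closed[of x] Y.cls_add[of x y] Y.cls_smult[of x a]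
   by(simp_all add: kap_def del: bos_simps)
 qed
 show ?thesis
 proof(rule bilinear_pullback[OF be])
  show "?E C:car gra" if "C:car Y.D" for C by(rule cl[OF that that])
  show "?E (C\<oplus>\<^bsub>Y.D\<^esub>C') = ?E C \<oplus>\<^sub>g ?E C'" if "C:car Y.D" "C':car Y.D" for C C' by(rule add[OF that])
  show "?E (a\<odot>\<^bsub>Y.D\<^esub>C) = a \<odot>\<^sub>g ?E C" if "C:car Y.D" for a C by(rule sm[OF that that])
 qed
qed

lemma kap_comult:
 assumes x: "x:car Y.TB" and be: "bilinear_form gra gra be"
 shows "comult (gr H) (kap x) be = comult Y.TB x (%u v. be (kap u) (kap v))"
proof -
 let ?E = "inv_into (car gra) F"
 let ?b = "%C C'. be (?E C) (?E C')"
 have EF: "?E (F c) = c" if "c:car gra" for c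
  using F_bij that by(meson bij_betw_imp_inj_on inv_into_f_f)
 note b = F_bilinear[OF be] and t = gr_comult_tensor[OF kap_closed[OF x]]
 have "comult Y.D (Y.cls x) ?b = tensor_map Y.D F (comult (gr H) (kap x)) ?b"
  using F_comult[of "kap x"] kap_closed[OF x] F_kap[OF x] by simp
 also have "... = comult (gr H) (kap x) (%c c'. ?b (F c) (F c'))" using b by(simp add: tensor_map_def)
 also have "... = comult (gr H) (kap x) be"
 proof(rule tensor_cong[OF t _ be])
  show "bilinear_form gra gra (%c c'. ?b (F c) (F c'))"
   by(rule bilinear_pullback[OF be]) (simp_all add: EF gra_add_closed gra_smult_closed)
 qed (use EF in auto)
 finally show ?thesis using Y.comult_D[OF x b] by(simp add: kap_def)
qed

end

section \<open>Lifting group-like and skew-primitive elements\<close>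

context fd_bialgebra
begin

lemma gl_in_span:
 assumes B: "dual_system B phi" "B \<subseteq> grouplikes H" and h: "h:grouplikes H" "proj B phi h = h"
 shows "h:B"
proof -
 note D = dual_systemD[OF B(1)] and hH = gl_carrier[OF h(1)]
 have expand: "f h = (\<Sum>d\<in>B. phi d h * f d)" if "lf f" for f
  using lf_proj[OF B(1) that, of h] h(2) by simp
 have prod: "phi b h * phi c h = (if b = c then phi b h else 0)" if bc: "b:B" "c:B" for b c
 proof -
  have "phi b h * phi c h = (phi b \<star> phi c) h" using gl_conv[OF h(1) D(3)[OF bc(1)] D(3)[OF bc(2)]] by simp
  also have "... = (\<Sum>d\<in>B. phi d h * (phi b \<star> phi c) d)" by(rule expand) simp
  also have "... = (\<Sum>d\<in>B. if d = b then (if b = c then phi b h else 0) else 0)"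
  proof(rule sum.cong[OF refl])
   fix d assume d: "d:B"
   have "(phi b \<star> phi c) d = phi b d * phi c d" using d B(2) by(intro gl_conv D(3) bc) auto
   thus "phi d h * (phi b \<star> phi c) d = (if d = b then (if b = c then phi b h else 0) else 0)"
    using D(5)[OF bc(1) d] D(5)[OF bc(2) d] by auto
  qed
  finally show ?thesis using bc(1) D(1) by simp
 qed
 have "EX b:B. phi b h ~= 0"
 proof(rule ccontr)
  assume "\<not> (EX b:B. phi b h ~= 0)"
  hence "counit H h = 0" using expand[OF counit_lf] by simp
  thus False using counit_gl[OF h(1)] by simp
 qed
 then obtain b where b: "b:B" "phi b h ~= 0" by auto
 have one: "phi b h = 1" using prod[OF b(1) b(1)] b(2) by simp
 have zero: "phi c h = 0" if "c:B" "c ~= b" for c using prod[OF b(1) that(1)] one that(2) by auto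
 have "h = b"
 proof(rule eq_if_forms_eq[OF hH D(4)[OF b(1)]])
  fix f assume f: "lf f"
  have "(\<Sum>d\<in>B. phi d h * f d) = (\<Sum>d\<in>B. if d = b then f b else 0)"
   by(rule sum.cong) (use one zero in auto)
  thus "f h = f b" using expand[OF f] b(1) D(1) by simp
 qed
 thus ?thesis using b(1) by simp
qed

lemma gls_independent: "[|finite B; B \<subseteq> grouplikes H|] ==> EX phi. dual_system B phi"
proof(induction B rule: finite_induct)
 case empty
 show ?case using dual_system_empty by simp
next
 case (insert h B)
 then obtain phi where phi: "dual_system B phi" by auto
 note D = dual_systemD[OF phi]
 have h: "h:grouplikes H" "h:car H" using insert.prems gl_carrier by auto
 have "B \<subseteq> grouplikes H" using insert.prems by simp
 hence "proj B phi h ~= h" using gl_in_span[OF phi _ h(1)] insert.hyps(2) by auto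
 then obtain psi where psi: "lf psi" "!!y. [|y:car H; proj B phi y = y|] ==> psi y = 0" "psi h = 1"
  using separating_form[OF proj_fixed_sub[OF phi] h(2)] by auto
 have psiB: "psi b = 0" if "b:B" for b using psi(2)[OF D(4)[OF that]] proj_basis_element[OF phi that] by simp
 define phi' where "phi' b = (if b = h then psi else (%x. phi b x + (- phi b h) * psi x))" for b
 have "lf (phi' b)" if "b:insert h B" for b
 proof(cases "b = h")
  case False
  thus ?thesis using that lf_plus[OF D(3)[of b] lf_const[OF psi(1), of "- phi b h"]] by(simp add: phi'_def)
 qed (simp add: phi'_def psi(1))
 moreover have "phi' b c = (if b = c then 1 else 0)" if "b:insert h B" "c:insert h B" for b c
  using that D(5) psi(3) psiB by(auto simp: phi'_def)
 moreover have "finite (insert h B)" "insert h B \<subseteq> car H" using D(1,2) h(2) by auto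
 ultimately have "dual_system (insert h B) phi'" unfolding dual_system_def by(intro conjI ballI) simp_all
 thus ?case by auto
qed

lemma finite_gls: "finite (grouplikes H)"
proof(rule ccontr)
 assume inf: "infinite (grouplikes H)"
 obtain n where n: "ALL B phi. dual_system B phi --> card B <= n" using dual_system_bounded by auto
 obtain B where B: "finite B" "card B = Suc n" "B \<subseteq> grouplikes H" using infinite_arbitrarily_large[OF inf] by auto
 obtain phi where "dual_system B phi" using gls_independent[OF B(1,3)] by(elim exE)
 hence "card B <= n" using n[rule_format, of B phi] by simp
 thus False using B(2) by simp
qed

end

context bialgebra
begin

lemma conv_plus_left: "[|lf f; lf f'; lf g; x:car H|] ==> ((%x. f x + f' x) \<star> g) x = (f \<star> g) x + (f' \<star> g) x"
 unfolding conv_def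
 using tensor_plus[OF comult_closed bil_prod[of f g] bil_prod[of f' g]] by(simp add: distrib_right)

lemma conv_plus_right: "[|lf f; lf g; lf g'; x:car H|] ==> (f \<star> (%x. g x + g' x)) x = (f \<star> g) x + (f \<star> g') x"
 unfolding conv_def
 using tensor_plus[OF comult_closed bil_prod[of f g] bil_prod[of f g']] by(simp add: distrib_left)

end

context pointed_fd_bialgebra
begin

text \<open>The component of largest degree \<open>n\<close> of a group-like element \<open>c\<close> would produce one of degree \<open>2n\<close> in
 its comultiplication \<open>c \<otimes> c\<close>; so \<open>n = 0\<close>.\<close>

lemma gr_gl:
 assumes c: "c:car gra" "c ~= \<zero>\<^sub>g"
  and com: "!!be. bilinear_form gra gra be ==> comult (gr H) c be = be c c"
 shows "EX g:grouplikes H. c = gh 0 g"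
proof -
 note C = gr_carrierD[OF c(1)]
 have form: "(f \<star> g) (rep (c (i + j))) = gr_form f i c * gr_form g j c"
  if "annihilates f (Kb i)" "annihilates g (Kb j)" for f g i j
  using gr_comult_form[OF c(1) that] com[OF gr_form_bilinear[OF that]] by simp
 let ?S = "{n. c n ~= Kb n}"
 have "?S ~= {}" using c(2) by(auto simp: gra_zero)
 define n where "n = Max ?S"
 have n: "c n ~= Kb n" using Max_in[OF C(3) \<open>?S \<noteq> {}\<close>] by(simp add: n_def)
 have above: "c j = Kb j" if "n < j" for j
 proof(rule ccontr)
  assume "c j ~= Kb j"
  hence "j <= n" unfolding n_def by(intro Max_ge C(3)) simp
  thus False using that by simp
 qed
 have rn: "rep (c n) ~: Kb n" using C(2)[of n] n cl_zero by auto
 obtain f where f: "lf f" "ALL y:Kb n. f y = 0" "f (rep (c n)) = 1"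
  using separating_form[OF below_sub filt_closed[OF C(1)] rn] by auto
 hence fa: "annihilates f (Kb n)" by(simp add: annihilates_def)
 have "n = 0"
 proof(rule ccontr)
  assume "n ~= 0"
  hence "rep (c (n + n)):Kb (n + n)" using above[of "n + n"] rep_below by simp
  hence "(f \<star> f) (rep (c (n + n))) = 0" by(rule conv_annihilators[OF fa fa])
  thus False using form[OF fa fa] f(3) by(simp add: gr_form_def)
 qed
 define g where "g = rep (c 0)"
 have gH: "g:car H" "g:Hf 0" using C(1)[of 0] filt_closed[OF C(1)[of 0]] by(simp_all add: g_def)
 have cg: "c = gh 0 g"
 proof
  fix j show "c j = gh 0 g j" using C(2)[of 0] above[of j] \<open>n = 0\<close> by(cases "j = 0") (auto simp: gh_apply g_def)
 qed
 have ann0: "annihilates f (Kb 0)" if "lf f" for f using that lf_zero[OF that] by(simp add: annihilates_def)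
 have "comult H g = pure_tensor H H g g"
 proof(rule tensor_eqI[OF comult_closed[OF gH(1)]])
  show "pure_tensor H H g g:tensors H H (car H\<times>car H)"
   unfolding tensors_def using gH by(auto intro!: exI[of _ "[(g, g)]"] simp: tensor_sum_def fun_eq_iff)
  fix f h assume fh: "lf f" "lf h"
  show "comult H g (%x y. f x * h y) = pure_tensor H H g g (%x y. f x * h y)"
   using form[OF ann0[OF fh(1)] ann0[OF fh(2)]] bil_prod[OF fh]
   by(simp add: pure_tensor_eval gr_form_def g_def conv_def)
 qed
 moreover have "g ~= \<zero>" using rn \<open>n = 0\<close> by(simp add: g_def)
 ultimately show ?thesis using cg gH by(auto simp: grouplikes_def)
qed

lemma gr_skew_prim:
 assumes c: "c:car gra" and e: "e:grouplikes H"
  and com: "!!be. bilinear_form gra gra be ==> comult (gr H) c be = be (gh 0 e) c + be c (gh 0 \<one>)"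
 shows "2 <= n ==> c n = Kb n"
  and "[|lf f; annihilates g (coradical H)|] ==> (f \<star> g) (rep (c 1)) = f e * g (rep (c 1))"
  and "[|annihilates f (coradical H); lf g|] ==> (f \<star> g) (rep (c 1)) = f (rep (c 1)) * g \<one>"
proof -
 note C = gr_carrierD[OF c]
 have eH: "e:Hf 0" "\<one>:Hf 0" using gl_coradical[OF e] gl_coradical[OF one_gl] by auto
 have form: "(f \<star> g) (rep (c (i + j))) = (if i = 0 then f e else 0) * g (rep (c j)) + f (rep (c i)) * (if j = 0 then g \<one> else 0)"
  if fg: "annihilates f (Kb i)" "annihilates g (Kb j)" for f g i j
  using gr_comult_form[OF c fg] com[OF gr_form_bilinear[OF fg]] gr_form_gh[OF fg(1) eH(1)] gr_form_gh[OF fg(2) eH(2)]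
  by(simp add: gr_form_def)
 have ann0: "annihilates f (Kb 0)" if "lf f" for f using that lf_zero[OF that] by(simp add: annihilates_def)
 show "c n = Kb n" if n: "2 <= n"
 proof -
  obtain k where k: "n = Suc (Suc k)" using n by(metis One_nat_def Suc_1 Suc_le_D Suc_le_mono)
  have "rep (c n):Hf (Suc k)"
   unfolding filt_Suc_iff
  proof(intro conjI allI impI)
   show "rep (c n):car H" using filt_closed[OF C(1)] .
   fix f g assume "annihilates f (coradical H) & annihilates g (Hf k)"
   hence "(f \<star> g) (rep (c (1 + Suc k))) = 0" using form[of f 1 g "Suc k"] by simp
   thus "(f \<star> g) (rep (c n)) = 0" by(simp add: k)
  qed
  thus ?thesis using C(2)[of n] cl_zero[of "rep (c n)" n] k by simp
 qed
 show "(f \<star> g) (rep (c 1)) = f e * g (rep (c 1))" if "lf f" "annihilates g (coradical H)"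
  using form[of f 0 g 1] that ann0 by simp
 show "(f \<star> g) (rep (c 1)) = f (rep (c 1)) * g \<one>" if "annihilates f (coradical H)" "lf g"
  using form[of f 1 g 0] that ann0 by simp
qed

lemma gra_sum_inj:
 assumes "x:Hf 0" "x':Hf 0" "z:Hf 1" "z':Hf 1"
  "gh 0 x \<oplus>\<^sub>g gh 1 z = gh 0 x' \<oplus>\<^sub>g gh 1 z'"
 shows "x = x'" "z\<ominus>z':coradical H"
proof -
 note H = filt_closed[OF assms(1)] filt_closed[OF assms(2)] filt_closed[OF assms(3)] filt_closed[OF assms(4)]
 have cl0: "cl n \<zero> = Kb n" for n by(simp add: cl_zero sub_zero[OF below_sub])
 have ev: "(gh 0 a \<oplus>\<^sub>g gh 1 b) 0 = cl 0 a" "(gh 0 a \<oplus>\<^sub>g gh 1 b) 1 = cl 1 b"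
  if ab: "a:car H" "b:car H" for a b
  using cl_add[OF ab(1), of \<zero> 0] cl_add[OF _ ab(2), of \<zero> 1] ab by(simp_all add: gra_add_apply gh_apply cl0)
 have "cl 0 x = cl 0 x'" "cl 1 z = cl 1 z'"
  using ev(1)[OF H(1,3)] ev(1)[OF H(2,4)] ev(2)[OF H(1,3)] ev(2)[OF H(2,4)] assms(5) by auto
 thus "x = x'" "z\<ominus>z':coradical H"
  using cl_eq_iff[OF H(1,2), of 0] cl_eq_iff[OF H(3,4), of 1] eq_if_minus_zero[OF H(1,2)] by auto
qed

lemma gra_sum_decompose:
 assumes c: "c:car gra" and "!!n. 2 <= n ==> c n = Kb n"
 shows "c = gh 0 (rep (c 0)) \<oplus>\<^sub>g gh 1 (rep (c 1))"
proof
 fix n :: nat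
 note C = gr_carrierD[OF c]
 have cl0: "cl n \<zero> = Kb n" for n by(simp add: cl_zero sub_zero[OF below_sub])
 have r: "rep (c m):car H" for m using filt_closed[OF C(1)] .
 consider "n = 0" | "n = 1" | "2 <= n" by linarith
 thus "c n = (gh 0 (rep (c 0)) \<oplus>\<^sub>g gh 1 (rep (c 1))) n"
 proof cases
  case 1
  thus ?thesis using C(2)[of 0] cl_add[OF r, of \<zero> 0 0] r by(simp add: gra_add_apply gh_apply cl0)
 next
  case 2
  thus ?thesis using C(2)[of 1] cl_add[OF _ r, of \<zero> 1 1] r by(simp add: gra_add_apply gh_apply cl0)
 next
  case 3
  thus ?thesis using assms(2) by(simp add: gra_add_apply gh_apply below_add)
 qed
qed

lemma comult_conjugate:
 assumes "a:grouplikes H" "b:grouplikes H" "x:car H" "bil be"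
 shows "comult H (a\<otimes>x\<otimes>b) be = comult H x (%u v. be (a\<otimes>u\<otimes>b) (a\<otimes>v\<otimes>b))"
proof -
 note A = gl_carrier[OF assms(1)] and B = gl_carrier[OF assms(2)]
 have b1: "bil (%u v. be (u\<otimes>b) (v\<otimes>b))" by(rule bil_mult_left[OF assms(4) B B])
 have b2: "bil (%u v. be (a\<otimes>u\<otimes>b) (a\<otimes>v\<otimes>b))" using bil_mult_right[OF b1 A A] by simp
 have "comult H (a\<otimes>x\<otimes>b) be = comult H (a\<otimes>x) (%u v. comult H b (%u' v'. be (u\<otimes>u') (v\<otimes>v')))"
  using A assms(3) by(intro comult_mult_eval B assms(4)) auto
 also have "... = comult H (a\<otimes>x) (%u v. be (u\<otimes>b) (v\<otimes>b))"
  using A assms(3) by(intro comult_cong b1 bil_comult[OF B assms(4)] gl_comult[OF assms(2)] bil_mult_right[OF assms(4)]) auto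
 also have "... = comult H a (%u v. comult H x (%u' v'. be (u\<otimes>u'\<otimes>b) (v\<otimes>v'\<otimes>b)))"
  by(rule comult_mult_eval[OF A assms(3) b1])
 also have "... = comult H x (%u v. be (a\<otimes>u\<otimes>b) (a\<otimes>v\<otimes>b))"
  by(rule gl_comult[OF assms(1) bil_comult[OF assms(3) b1]])
 finally show ?thesis .
qed

end

context nichols_type
begin

lemma G_carrier: "g:grouplikes H ==> single ([], g):car Y.TB"
 using Y.single_closed[of "[]" g] Y.words_simps by simp

lemma single_not_in_NK: "[|x:Y.NK; length w < 2; g:grouplikes H|] ==> x (w, g) = 0"
 using NI_short[OF Y.NK_D(2), of x g w] by(simp add: Y.slice_def)

lemma al_exists:
 assumes g: "g:grouplikes H"
 shows "EX a. a:grouplikes H & kap (single ([], g)) = gh 0 a"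
proof -
 note s = G_carrier[OF g]
 have "EX a:grouplikes H. kap (single ([], g)) = gh 0 a"
 proof(rule gr_gl[OF kap_closed[OF s]])
  show "kap (single ([], g)) ~= \<zero>\<^sub>g"
   using kap_zero_iff[OF s] single_not_in_NK[of "single ([], g)" "[]" g] g by(auto simp: single_def)
  fix be assume be: "bilinear_form gra gra be"
  have b: "bilinear_form Y.TB Y.TB (%u v. be (kap u) (kap v))"
   by(rule bilinear_pullback[OF be]) (use kap_closed kap_add kap_smult in simp_all)
  show "comult (gr H) (kap (single ([], g))) be = be (kap (single ([], g))) (kap (single ([], g)))"
   using kap_comult[OF s be] g bos_comult[OF b, of "single ([], g)"] gl_carrier[OF g] by simp
 qed
 thus ?thesis by auto
qed

definition al :: "'a => 'a" where
 "al g = (SOME a. a:grouplikes H & kap (single ([], g)) = gh 0 a)"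

lemma al:
 assumes "g:grouplikes H"
 shows al_gl: "al g:grouplikes H" and kap_al: "kap (single ([], g)) = gh 0 (al g)"
 using someI_ex[OF al_exists[OF assms]] by(auto simp: al_def)

lemma al_carrier: "g:grouplikes H ==> al g:car H" "g:grouplikes H ==> al g:Hf 0"
 using gl_carrier[OF al_gl] gl_coradical[OF al_gl] by auto

lemma gh0_inj: "[|x:Hf 0; y:Hf 0; gh 0 x = gh 0 y|] ==> x = y"
 using gh_eq_iff[of x 0 y] filt_closed[of x 0] filt_closed[of y 0] by simp

lemma al_mult:
 assumes "g:grouplikes H" "h:grouplikes H"
 shows "al (g\<otimes>h) = al g\<otimes>al h"
proof(rule gh0_inj)
 have gh': "g\<otimes>h:grouplikes H" by(rule gl_mult[OF assms])
 show "al (g\<otimes>h):Hf 0" by(rule al_carrier[OF gh'])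
 show "al g\<otimes>al h:Hf 0" using filt_mult[OF al_carrier(2)[OF assms(1)] al_carrier(2)[OF assms(2)]] by simp
 have "single ([], g)\<otimes>\<^bsub>Y.TB\<^esub>single ([], h) = single ([], g\<otimes>h)"
  by(simp add: Y.single_mult_single)
 hence "gh 0 (al (g\<otimes>h)) = kap (single ([], g)) \<otimes>\<^sub>g kap (single ([], h))"
  using kap_al[OF gh'] kap_mult[OF G_carrier[OF assms(1)] G_carrier[OF assms(2)]] by simp
 also have "... = gh 0 (al g\<otimes>al h)"
  using gh_mult[OF al_carrier(2)[OF assms(1)] al_carrier(2)[OF assms(2)]] kap_al assms by simp
 finally show "gh 0 (al (g\<otimes>h)) = gh 0 (al g\<otimes>al h)" .
qed

lemma al_one: "al \<one> = \<one>"
proof(rule gh0_inj)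
 show "al \<one>:Hf 0" "\<one>:Hf 0" using al_carrier[OF one_gl] gl_coradical[OF one_gl] by auto
 show "gh 0 (al \<one>) = gh 0 \<one>" using kap_al[OF one_gl] kap_one by(simp add: gra_one)
qed

lemma al_inj: "inj_on al (grouplikes H)"
proof(rule inj_onI)
 fix g h assume gh: "g:grouplikes H" "h:grouplikes H" "al g = al h"
 hence "kap (single ([], g)) = kap (single ([], h))" by(simp add: kap_al)
 hence "(%z. single ([], g) z + (- 1) * single ([], h) z):Y.NK"
  using kap_eq_iff[OF G_carrier[OF gh(1)] G_carrier[OF gh(2)]] by simp
 from single_not_in_NK[OF this, of "[]" g] gh(1) show "g = h" by(auto simp: single_def split: if_splits)
qed

lemma ann_Kb0: "lf f ==> annihilates f (Kb 0)"
 using lf_zero[of f] by(simp add: annihilates_def)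

abbreviation inv_G :: "'a => 'a" where "inv_G g \<equiv> inv\<^bsub>G\<^esub> g"

lemma inv_G: "g:grouplikes H ==> inv_G g:grouplikes H" "g:grouplikes H ==> g\<otimes>inv_G g = \<one>"
 "g:grouplikes H ==> inv_G g\<otimes>g = \<one>"
 using Y.inv_closed[of g] Y.r_inv[of g] Y.l_inv[of g] by auto

lemma al_inv: "g:grouplikes H ==> al g\<otimes>al (inv_G g) = \<one>" "g:grouplikes H ==> al (inv_G g)\<otimes>al g = \<one>"
 using al_mult[of g "inv_G g"] al_mult[of "inv_G g" g] inv_G al_one by auto

lemma G_comm: "[|g:grouplikes H; h:grouplikes H|] ==> g\<otimes>h = h\<otimes>g"
 using Y.m_comm[of g h] by simp

lemma coradical_commute:
 assumes "g:grouplikes H" "x:coradical H"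
 shows "g\<otimes>x = x\<otimes>g"
proof -
 note g = gl_carrier[OF assms(1)]
 have "subspace {x:car H. g\<otimes>x = x\<otimes>g} H"
 proof(rule subI)
  have "g\<otimes>\<zero> = \<zero>" "\<zero> \<otimes> g = \<zero>" using ring.ring_simprules(24,25)[OF alg_ring g] by auto
  thus "\<zero>:{x:car H. g\<otimes>x = x\<otimes>g}" by simp
 qed (use g in \<open>auto simp: alg_r_distr alg_l_distr smult_mult_left smult_mult_right\<close>)
 hence "coradical H \<subseteq> {x:car H. g\<otimes>x = x\<otimes>g}"
  by(rule coradical_induct) (auto simp: gl_carrier G_comm[OF assms(1)])
 thus ?thesis using assms(2) by auto
qed

lemma gra_distrib:
 assumes "c:car gra" "d:car gra" "e:car gra"
 shows "c \<otimes>\<^sub>g (d \<oplus>\<^sub>g e) = c \<otimes>\<^sub>g d \<oplus>\<^sub>g c \<otimes>\<^sub>g e"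
  "(d \<oplus>\<^sub>g e) \<otimes>\<^sub>g c = d \<otimes>\<^sub>g c \<oplus>\<^sub>g e \<otimes>\<^sub>g c"
  "a \<odot>\<^sub>g (d \<oplus>\<^sub>g e) = a \<odot>\<^sub>g d \<oplus>\<^sub>g a \<odot>\<^sub>g e"
proof -
 obtain x y z where xyz: "x:car Y.TB" "c = kap x" "y:car Y.TB" "d = kap y" "z:car Y.TB" "e = kap z"
  using kap_surj[OF assms(1)] kap_surj[OF assms(2)] kap_surj[OF assms(3)] by auto
 note c = Y.TB_mult_closed[OF xyz(1,3)] Y.TB_mult_closed[OF xyz(1,5)] Y.TB_mult_closed[OF xyz(3,1)] Y.TB_mult_closed[OF xyz(5,1)]
  Y.TB_closed(1)[OF xyz(3,5)]
 show "c \<otimes>\<^sub>g (d \<oplus>\<^sub>g e) = c \<otimes>\<^sub>g d \<oplus>\<^sub>g c \<otimes>\<^sub>g e"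
  unfolding xyz(2,4,6) kap_add[OF xyz(3,5), symmetric] kap_mult[OF xyz(1) c(5), symmetric] kap_mult[OF xyz(1,3), symmetric]
   kap_mult[OF xyz(1,5), symmetric] kap_add[OF c(1,2), symmetric] Y.mult_bilinear(2)[OF xyz(3,5)] ..
 show "(d \<oplus>\<^sub>g e) \<otimes>\<^sub>g c = d \<otimes>\<^sub>g c \<oplus>\<^sub>g e \<otimes>\<^sub>g c"
  unfolding xyz(2,4,6) kap_add[OF xyz(3,5), symmetric] kap_mult[OF c(5) xyz(1), symmetric] kap_mult[OF xyz(3,1), symmetric]
   kap_mult[OF xyz(5,1), symmetric] kap_add[OF c(3,4), symmetric] Y.mult_bilinear(1)[OF xyz(3,5)] ..
 show "a \<odot>\<^sub>g (d \<oplus>\<^sub>g e) = a \<odot>\<^sub>g d \<oplus>\<^sub>g a \<odot>\<^sub>g e"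
  unfolding xyz(4,6) kap_add[OF xyz(3,5), symmetric] kap_smult[OF c(5), symmetric] kap_smult[OF xyz(3), symmetric]
   kap_smult[OF xyz(5), symmetric] kap_add[OF Y.TB_closed(2)[OF xyz(3)] Y.TB_closed(2)[OF xyz(5)], symmetric]
  by(simp add: algebra_simps)
qed

end

locale nontrivial_nichols_type = nichols_type H ga ch F
 for H :: "('k::field_char_0, 'a) bialg" (structure) and ga ch F +
 assumes nontrivial: "i:{1, 2} ==> ch i (ga i) ~= 1"
begin

lemma ga_gl: "i:{1, 2} ==> ga i:grouplikes H"
 using Y.ga_closed[of i] by simp

text \<open>The image of \<open>x\<^sub>i\<close> has no component of degree zero: conjugation by \<open>g\<^sub>i\<close> multiplies such a component by
 \<open>\<chi>\<^sub>i(g\<^sub>i) \<noteq> 1\<close>, although the coradical is commutative.\<close>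

lemma generator_lift:
 assumes i: "i:{1, 2}"
 shows "EX z. z:Hf 1 & kap (single ([i], \<one>)) = gh 1 z &
  (ALL g:grouplikes H. al g\<otimes>z\<ominus>ch i g\<odot>(z\<otimes>al g):coradical H) &
  (ALL f g. lf f --> annihilates g (coradical H) --> (f \<star> g) z = f (al (ga i)) * g z) &
  (ALL f g. annihilates f (coradical H) --> lf g --> (f \<star> g) z = f z * g \<one>)"
proof -
 define c where "c = kap (single ([i], \<one>))"
 have iW: "[i]:words" using i by(auto simp: words_iff)
 have s: "single ([i], \<one>):car Y.TB" using Y.single_closed[OF iW, of \<one>] one_gl by simp
 note gai = ga_gl[OF i]
 have c: "c:car gra" unfolding c_def by(rule kap_closed[OF s])
 note C = gr_carrierD[OF c]
 have com: "comult (gr H) c be = be (gh 0 (al (ga i))) c + be c (gh 0 \<one>)" if be: "bilinear_form gra gra be" for be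
 proof -
  have b: "bilinear_form Y.TB Y.TB (%u v. be (kap u) (kap v))"
   by(rule bilinear_pullback[OF be]) (use kap_closed kap_add kap_smult in simp_all)
  have "comult (gr H) c be = be (kap (single ([i], \<one>))) (kap (single ([], \<one>)))
    + be (kap (single ([], ga i))) (kap (single ([i], \<one>)))"
   unfolding c_def using kap_comult[OF s be] bos_comult[OF b, of "single ([i], \<one>)"]
    gl_carrier[OF gai] by simp
  thus ?thesis using kap_al[OF gai] kap_one by(simp add: c_def gra_one)
 qed
 define x z where "x = rep (c 0)" and "z = rep (c 1)"
 have x: "x:Hf 0" "x:car H" and z: "z:Hf 1" "z:car H"
  using C(1)[of 0] C(1)[of 1] filt_closed[OF C(1)[of 0]] by(simp_all add: x_def z_def)
 note sk = gr_skew_prim[OF c al_gl[OF gai] com]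
 have dec: "c = gh 0 x \<oplus>\<^sub>g gh 1 z" unfolding x_def z_def by(rule gra_sum_decompose[OF c sk(1)])
 have weight: "al g\<otimes>x = ch i g\<odot>(x\<otimes>al g) & al g\<otimes>z\<ominus>ch i g\<odot>(z\<otimes>al g):coradical H"
  if g: "g:grouplikes H" for g
 proof -
  note a = al_carrier[OF g] and gs = G_carrier[OF g]
  have m: "single ([], g)\<otimes>\<^bsub>Y.TB\<^esub>single ([i], \<one>) = (%z. ch i g * (single ([i], \<one>)\<otimes>\<^bsub>Y.TB\<^esub>single ([], g)) z)"
   using gl_carrier[OF g] by(simp add: Y.single_mult_single)
  have "gh 0 (al g) \<otimes>\<^sub>g c = ch i g \<odot>\<^sub>g (c \<otimes>\<^sub>g gh 0 (al g))"
   unfolding c_def kap_al[OF g, symmetric] kap_mult[OF gs s, symmetric] kap_mult[OF s gs, symmetric]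
    m kap_smult[OF Y.TB_mult_closed[OF s gs]] ..
  moreover have "gh 0 (al g) \<otimes>\<^sub>g c = gh 0 (al g\<otimes>x) \<oplus>\<^sub>g gh 1 (al g\<otimes>z)"
   unfolding dec using gra_distrib(1)[OF gh_closed[OF a(2)] gh_closed[OF x(1)] gh_closed[OF z(1)]]
    gh_mult[OF a(2) x(1)] gh_mult[OF a(2) z(1)] by simp
  moreover have "ch i g \<odot>\<^sub>g (c \<otimes>\<^sub>g gh 0 (al g)) = gh 0 (ch i g\<odot>(x\<otimes>al g)) \<oplus>\<^sub>g gh 1 (ch i g\<odot>(z\<otimes>al g))"
  proof -
   have xa: "x\<otimes>al g:Hf 0" "z\<otimes>al g:Hf 1"
    using filt_mult[OF x(1) a(2)] filt_mult[OF z(1) a(2)] by auto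
   have "c \<otimes>\<^sub>g gh 0 (al g) = gh 0 (x\<otimes>al g) \<oplus>\<^sub>g gh 1 (z\<otimes>al g)"
    unfolding dec using gra_distrib(2)[OF gh_closed[OF a(2)] gh_closed[OF x(1)] gh_closed[OF z(1)]]
     gh_mult[OF x(1) a(2)] gh_mult[OF z(1) a(2)] by simp
   thus ?thesis using gra_distrib(3)[OF c gh_closed[OF xa(1)] gh_closed[OF xa(2)]] gh_smult[OF xa(1)] gh_smult[OF xa(2)] by simp
  qed
  ultimately have eq: "gh 0 (al g\<otimes>x) \<oplus>\<^sub>g gh 1 (al g\<otimes>z) = gh 0 (ch i g\<odot>(x\<otimes>al g)) \<oplus>\<^sub>g gh 1 (ch i g\<odot>(z\<otimes>al g))" by simp
  have mem: "al g\<otimes>x:Hf 0" "ch i g\<odot>(x\<otimes>al g):Hf 0" "al g\<otimes>z:Hf 1" "ch i g\<odot>(z\<otimes>al g):Hf 1"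
   using filt_mult[OF x(1) a(2)] filt_mult[OF z(1) a(2)] filt_mult[OF a(2) x(1)] filt_mult[OF a(2) z(1)]
    sub_smult[OF filt_sub, of "x\<otimes>al g" 0] sub_smult[OF filt_sub, of "z\<otimes>al g" 1] by auto
  show ?thesis using gra_sum_inj[OF mem eq] by simp
 qed
 have "x = \<zero>"
 proof -
  let ?a = "al (ga i)"
  note a = al_carrier[OF gai]
  have eq: "?a\<otimes>x = ch i (ga i)\<odot>(?a\<otimes>x)"
   using weight[OF gai] coradical_commute[OF al_gl[OF gai], of x] x by simp
  have ax: "?a\<otimes>x:car H" using a(1) x(2) by simp
  have "?a\<otimes>x = \<zero>"
  proof(rule eq_if_forms_eq[OF ax sub_zero[OF whole_sub]])
   fix f assume f: "lf f"
   have "f (?a\<otimes>x) = ch i (ga i) * f (?a\<otimes>x)" using lf_smult[OF f ax] eq by metis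
   hence "(1 - ch i (ga i)) * f (?a\<otimes>x) = 0" by auto
   thus "f (?a\<otimes>x) = f \<zero>" using nontrivial[OF i] lf_zero[OF f] by simp
  qed
  hence "al (inv_G (ga i))\<otimes>(?a\<otimes>x) = al (inv_G (ga i))\<otimes>\<zero>" by simp
  thus ?thesis
   using al_inv(2)[OF gai] a(1) x(2) al_carrier(1)[OF inv_G(1)[OF gai]] by(simp add: alg_m_assoc[symmetric])
 qed
 hence "c 0 = Kb 0" using C(2)[of 0] by(simp add: x_def cl_zero)
 have "c = gh 1 z"
 proof
  fix n :: nat
  consider "n = 0" | "n = 1" | "2 <= n" by linarith
  thus "c n = gh 1 z n"
   using \<open>c 0 = Kb 0\<close> C(2)[of 1] sk(1)[of n] by cases (simp_all add: gh_apply z_def)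
 qed
 thus ?thesis using z weight sk(2,3) unfolding c_def z_def by auto
qed

text \<open>The weight is corrected by averaging \<open>\<chi>\<^sub>i(g)\<^sup>-\<^sup>1 g z g\<^sup>-\<^sup>1\<close> over the finite group \<open>G\<close>.\<close>

lemma averaged_generator:
 assumes i: "i:{1, 2}" and z: "z:Hf 1"
  and weight: "!!g. g:grouplikes H ==> al g\<otimes>z\<ominus>ch i g\<odot>(z\<otimes>al g):coradical H"
 shows "EX y:Hf 1. y\<ominus>z:coradical H & (ALL g:grouplikes H. al g\<otimes>y = ch i g\<odot>(y\<otimes>al g))"
proof -
 let ?G = "grouplikes H"
 define t where "t g = al g\<otimes>z\<otimes>al (inv_G g)" for g
 define c where "c g = inverse (ch i g) * inverse (of_nat (card ?G))" for g
 have fin: "finite ?G" by(rule finite_gls)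
 have card: "of_nat (card ?G) ~= (0 :: 'k)" using fin one_gl by auto
 note zH = filt_closed[OF z]
 have tH: "t g:car H" "t g:Hf 1" if g: "g:?G" for g
 proof -
  have "al g\<otimes>z:Hf (0 + 1)" by(rule filt_mult[OF al_carrier(2)[OF g] z])
  hence "al g\<otimes>z\<otimes>al (inv_G g):Hf (0 + 1 + 0)"
   by(rule filt_mult[OF _ al_carrier(2)[OF inv_G(1)[OF g]]])
  thus "t g:Hf 1" by(simp add: t_def)
  thus "t g:car H" by simp
 qed
 define y where "y = (\<Oplus>g\<in>?G. c g\<odot>t g)"
 have y1: "y:Hf 1" unfolding y_def
  by(rule sub_finsum[OF filt_sub fin]) (rule sub_smult[OF filt_sub tH(2)])
 note yH = filt_closed[OF y1]
 have fy: "f y = (\<Sum>g\<in>?G. c g * f (t g))" if f: "lf f" for f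
 proof -
  have "f y = (\<Sum>g\<in>?G. f (c g\<odot>t g))" unfolding y_def
   by(rule lf_finsum[OF f fin]) (use tH(1) in simp)
  thus ?thesis using lf_smult[OF f tH(1)] by simp
 qed
 have "y\<ominus>z:coradical H"
 proof(rule mem_if_annihilated[OF coradical_sub])
  show "y\<ominus>z:car H" using yH zH by simp
  fix f assume f: "annihilates f (coradical H)"
  note lf = annihilatesD(1)[OF f]
  have "c g * f (t g) = inverse (of_nat (card ?G)) * f z" if g: "g:?G" for g
  proof -
   note a = al_carrier[OF g] and a' = al_carrier[OF inv_G(1)[OF g]]
   have "(al g\<otimes>z\<ominus>ch i g\<odot>(z\<otimes>al g))\<otimes>al (inv_G g):coradical H"
    using coradical_mult[OF weight[OF g]] a'(2) by simp
   moreover have "(al g\<otimes>z\<ominus>ch i g\<odot>(z\<otimes>al g))\<otimes>al (inv_G g) = t g\<ominus>ch i g\<odot>z"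
   proof -
    have "z\<otimes>al g\<otimes>al (inv_G g) = z" using zH a a' al_inv(1)[OF g] by(simp add: alg_m_assoc)
    thus ?thesis unfolding t_def using zH a a'
     by(simp add: minus_eq_smult alg_l_distr smult_mult_left)
   qed
   ultimately have "f (t g\<ominus>ch i g\<odot>z) = 0" using annihilatesD(2)[OF f] by simp
   hence "f (t g) = ch i g * f z" using lf_minus[OF lf tH(1)[OF g], of "ch i g\<odot>z"] lf_smult[OF lf zH] zH by simp
   thus ?thesis using Y.ch_nonzero[of i g] i g by(simp add: c_def)
  qed
  hence "f y = f z" using fy[OF lf] card by simp
  thus "f (y\<ominus>z) = 0" using lf_minus[OF lf yH zH] by simp
 qed
 moreover have "al h\<otimes>y = ch i h\<odot>(y\<otimes>al h)" if h: "h:?G" for h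
 proof(rule eq_if_forms_eq)
  note a = al_carrier[OF h]
  show "al h\<otimes>y:car H" "ch i h\<odot>(y\<otimes>al h):car H" using a yH by auto
  fix f assume f: "lf f"
  have t': "t (h\<otimes>g)\<otimes>al h = al h\<otimes>t g" if g: "g:?G" for g
  proof -
   have i: "inv_G (h\<otimes>g) = inv_G g\<otimes>inv_G h" using Y.inv_mult_group[of h g] h g by simp
   have "al (inv_G (h\<otimes>g))\<otimes>al h = al (inv_G g)"
    unfolding i using al_mult[OF inv_G(1)[OF g] inv_G(1)[OF h]] al_inv(2)[OF h] al_carrier(1) h g inv_G(1)
    by(simp add: alg_m_assoc)
   thus ?thesis unfolding t_def using al_mult[OF h g] al_carrier(1) inv_G(1)[OF g] inv_G(1)[OF gl_mult[OF h g]] h g zH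
    by(simp add: alg_m_assoc)
  qed
  have c': "ch i h * c (h\<otimes>g) = c g" if g: "g:?G" for g
   using Y.ch_mult[of i h g] Y.ch_nonzero[of i h] i h g by(simp add: c_def)
  have bij: "bij_betw (%g. h\<otimes>g) ?G ?G"
  proof(rule bij_betwI[where g="%g. inv_G h\<otimes>g"])
   show "(%g. h\<otimes>g):?G \<rightarrow> ?G" "(%g. inv_G h\<otimes>g):?G \<rightarrow> ?G"
    using gl_mult h inv_G(1)[OF h] by auto
   show "inv_G h\<otimes>(h\<otimes>g) = g" "h\<otimes>(inv_G h\<otimes>g) = g" if "g:?G" for g
    using that h inv_G[OF h] gl_carrier by(simp_all add: alg_m_assoc[symmetric])
  qed
  have "f (al h\<otimes>y) = (\<Sum>g\<in>?G. c g * f (al h\<otimes>t g))"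
   by(rule fy[OF lf_comp[OF f linmap_mult_left[OF a(1)]]])
  also have "... = (\<Sum>g\<in>?G. ch i h * (c (h\<otimes>g) * f (t (h\<otimes>g)\<otimes>al h)))"
   by(rule sum.cong[OF refl]) (simp add: t' c'[symmetric])
  also have "... = ch i h * (\<Sum>g\<in>?G. c g * f (t g\<otimes>al h))"
   unfolding sum_distrib_left[symmetric] by(simp only: sum.reindex_bij_betw[OF bij, of "%g. c g * f (t g\<otimes>al h)"])
  also have "... = ch i h * f (y\<otimes>al h)"
   using fy[OF lf_comp[OF f linmap_mult_right[OF a(1)]]] by simp
  finally show "f (al h\<otimes>y) = f (ch i h\<odot>(y\<otimes>al h))" using lf_smult[OF f] yH a(1) by simp
 qed
 ultimately show ?thesis using y1 by auto
qed

text \<open>The deviation of \<open>\<Delta>(y)\<close> from \<open>g\<^sub>i \<otimes> y + y \<otimes> 1\<close> lies in the square of the coradical and is therefore invariant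
 under conjugation by \<open>g\<^sub>i\<close>; on the other hand it is multiplied by \<open>\<chi>\<^sub>i(g\<^sub>i) \<noteq> 1\<close>.\<close>

lemma exact_generator:
 assumes i: "i:{1, 2}"
 shows "EX y. y:Hf 1 & kap (single ([i], \<one>)) = gh 1 y &
  (ALL g:grouplikes H. al g\<otimes>y = ch i g\<odot>(y\<otimes>al g)) &
  (ALL be. bil be --> comult H y be = be (al (ga i)) y + be y \<one>)"
proof -
 obtain z where z: "z:Hf 1" "kap (single ([i], \<one>)) = gh 1 z"
  and w: "!!g. g:grouplikes H ==> al g\<otimes>z\<ominus>ch i g\<odot>(z\<otimes>al g):coradical H"
  and z1: "!!f g. [|lf f; annihilates g (coradical H)|] ==> (f \<star> g) z = f (al (ga i)) * g z"
  and z2: "!!f g. [|annihilates f (coradical H); lf g|] ==> (f \<star> g) z = f z * g \<one>"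
  using generator_lift[OF i] by auto
 obtain y where y: "y:Hf 1" "y\<ominus>z:coradical H"
  and wt: "!!g. g:grouplikes H ==> al g\<otimes>y = ch i g\<odot>(y\<otimes>al g)"
  using averaged_generator[OF i z(1) w] by auto
 note yH = filt_closed[OF y(1)] and zH = filt_closed[OF z(1)] and gai = ga_gl[OF i]
 let ?a = "al (ga i)" and ?b = "al (inv_G (ga i))"
 note a = al_carrier[OF gai] and b = al_carrier[OF inv_G(1)[OF gai]]
 have onH: "\<one>:car H" by simp
 have yz: "f y = f z" if f: "annihilates f (coradical H)" for f
  using annihilatesD(2)[OF f y(2)] lf_minus[OF annihilatesD(1)[OF f] yH zH] by simp
 have co: "(f \<star> g) y = (f \<star> g) z" if "lf f" "lf g" "annihilates f (coradical H) \<or> annihilates g (coradical H)" for f g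
 proof -
  have "(f \<star> g) (y\<ominus>z) = 0"
   using that conv_annihilators[of f 0 g 1] conv_annihilators[of f 1 g 0] y(2) ann_Kb0 by auto
  thus ?thesis using lf_minus[OF conv_lf yH zH] by simp
 qed
 define t where "t f g = (f \<star> g) y - f ?a * g y - f y * g \<one>" for f g
 have t1: "t f g = 0" if "lf f" "annihilates g (coradical H)" for f g
  using co[of f g] z1[of f g] yz[of g] that annihilatesD(1)[OF that(2)] annihilatesD(2)[OF that(2) gl_coradical[OF one_gl]]
  by(simp add: t_def)
 have t2: "t f g = 0" if "annihilates f (coradical H)" "lf g" for f g
  using co[of f g] z2[of f g] yz[of f] that annihilatesD(1)[OF that(1)] annihilatesD(2)[OF that(1)] a(2)
  by(simp add: t_def)
 have zero: "t f g = 0" if fg: "lf f" "lf g" for f g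
 proof -
  define cj where "cj u = ?a\<otimes>u\<otimes>?b" for u
  have lin: "linmap cj" unfolding cj_def by(rule linmap_comp[OF linmap_mult_right[OF b(1)] linmap_mult_left[OF a(1)]])
  have cj0: "cj u = u" if u: "u:coradical H" for u
  proof -
   have uH: "u:car H" using filt_closed[of u 0] u by simp
   show ?thesis unfolding cj_def using coradical_commute[OF al_gl[OF gai] u] uH a b al_inv(1)[OF gai]
    by(simp add: alg_m_assoc)
  qed
  have cjy: "cj y = ch i (ga i)\<odot>y"
   unfolding cj_def wt[OF gai] using yH a b al_inv(1)[OF gai] by(simp add: smult_mult_left alg_m_assoc)
  define k where "k f u = f (cj u) + (- 1) * f u" for f :: "'a => 'k" and u
  have k: "annihilates (k f) (coradical H)" if f: "lf f" for f
   unfolding annihilates_def k_def using lf_plus[OF lf_comp[OF f lin] lf_const[OF f, of "-1"]] cj0 by simp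
  have fk: "(%u. f (cj u)) = (%u. f u + k f u)" for f by(simp add: k_def)
  note kl = annihilatesD(1)[OF k]
  have "t (%u. f u + k f u) (%u. g u + k g u) = t f g + t (k f) g + t (%u. f u + k f u) (k g)"
   unfolding t_def using conv_plus_left[OF fg(1) kl[OF fg(1)] fg(2) yH]
    conv_plus_right[OF lf_plus[OF fg(1) kl[OF fg(1)]] fg(2) kl[OF fg(2)] yH]
   by(simp add: algebra_simps)
  hence same: "t (%u. f (cj u)) (%u. g (cj u)) = t f g"
   unfolding fk using t1[OF lf_plus[OF fg(1) kl[OF fg(1)]] k[OF fg(2)]] t2[OF k[OF fg(1)] fg(2)] by simp
  have "((%u. f (cj u)) \<star> (%u. g (cj u))) y = (f \<star> g) (cj y)"
   unfolding conv_def cj_def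
   using comult_conjugate[OF al_gl[OF gai] al_gl[OF inv_G(1)[OF gai]] yH bil_prod[OF fg]] by simp
  hence "t (%u. f (cj u)) (%u. g (cj u)) = ch i (ga i) * t f g"
   using cj0[OF a(2)[simplified]] cj0[OF gl_coradical[OF one_gl]] cjy
    lf_smult[OF conv_lf yH] lf_smult[OF fg(1) yH] lf_smult[OF fg(2) yH]
   by(simp add: t_def algebra_simps)
  hence "(1 - ch i (ga i)) * t f g = 0" using same by auto
  thus ?thesis using nontrivial[OF i] by simp
 qed
 have "comult H y = tensor_sum H H [(?a, y), (y, \<one>)]"
 proof(rule tensor_eqI[OF comult_closed[OF yH]])
  show "tensor_sum H H [(?a, y), (y, \<one>)]:tensors H H (car H\<times>car H)"
   unfolding tensors_def using a(1) yH by force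
  fix f g assume fg: "lf f" "lf g"
  show "comult H y (%x y. f x * g y) = tensor_sum H H [(?a, y), (y, \<one>)] (%x y. f x * g y)"
   using zero[OF fg] bil_prod[OF fg] by(simp add: t_def conv_def tensor_sum_eval algebra_simps)
 qed
 hence com: "comult H y be = be ?a y + be y \<one>" if "bil be" for be
  using that by(simp add: tensor_sum_eval)
 have "gh 1 y = gh 1 z" using gh_eq_iff[OF y(1) z(1)] y(2) by simp
 thus ?thesis using y(1) z(2) wt com by auto
qed

definition yy :: "nat => 'a" where
 "yy i = (SOME y. y:Hf 1 & kap (single ([i], \<one>)) = gh 1 y &
  (ALL g:grouplikes H. al g\<otimes>y = ch i g\<odot>(y\<otimes>al g)) &
  (ALL be. bil be --> comult H y be = be (al (ga i)) y + be y \<one>))"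

lemma yy:
 assumes "i:{1, 2}"
 shows "yy i:Hf 1" "kap (single ([i], \<one>)) = gh 1 (yy i)"
  "g:grouplikes H ==> al g\<otimes>yy i = ch i g\<odot>(yy i\<otimes>al g)"
  "bil be ==> comult H (yy i) be = be (al (ga i)) (yy i) + be (yy i) \<one>"
 using someI_ex[OF exact_generator[OF assms]] unfolding yy_def[symmetric] by blast+

end

section \<open>The presentation of \<open>H\<close> by \<open>T(V) # kG\<close>\<close>

context nontrivial_nichols_type
begin

definition ymono :: "nat list\<times>'a => 'a" where
 "ymono = (%(w, g). foldr (%i s. yy i\<otimes>s) w (al g))"

lemma ymono_simps: "ymono ([], g) = al g" "ymono (i # w, g) = yy i\<otimes>ymono (w, g)"
 by(simp_all add: ymono_def)

lemma yy_carrier: "i:{1, 2} ==> yy i:car H"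
 by(rule filt_closed[OF yy(1)])

lemma ymono_filt: "[|w:words; g:grouplikes H|] ==> ymono (w, g):Hf (length w)"
proof(induction w)
 case Nil
 thus ?case using al_carrier(2) by(simp add: ymono_simps)
next
 case (Cons i w)
 hence "i:{1, 2}" "w:words" by(auto simp: Y.words_simps)
 thus ?case using filt_mult[OF yy(1) Cons.IH] Cons.prems by(simp add: ymono_simps del: corad_filt.simps)
qed

lemma ymono_carrier: "[|w:words; g:grouplikes H|] ==> ymono (w, g):car H"
 by(rule filt_closed[OF ymono_filt])

lemma al_ymono:
 "[|w:words; g:grouplikes H; h:grouplikes H|] ==> al g\<otimes>ymono (w, h) = word_char ch w g\<odot>ymono (w, g\<otimes>h)"
proof(induction w)
 case Nil
 thus ?case using al_mult al_carrier(1)[OF gl_mult] by(simp add: ymono_simps)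
next
 case (Cons i w)
 hence i: "i:{1, 2}" and w: "w:words" by(auto simp: Y.words_simps)
 note c = al_carrier(1)[OF Cons.prems(2)] yy_carrier[OF i] ymono_carrier[OF w Cons.prems(3)]
  ymono_carrier[OF w gl_mult[OF Cons.prems(2,3)]]
 have "al g\<otimes>(yy i\<otimes>ymono (w, h)) = ch i g\<odot>(yy i\<otimes>(al g\<otimes>ymono (w, h)))"
  using yy(3)[OF i Cons.prems(2)] c by(simp add: alg_m_assoc[symmetric] smult_mult_left)
 also have "... = (ch i g * word_char ch w g)\<odot>(yy i\<otimes>ymono (w, g\<otimes>h))"
  using Cons.IH[OF w Cons.prems(2,3)] c by(simp add: smult_mult_right)
 finally show ?case by(simp add: ymono_simps)
qed

lemma ymono_mult:
 assumes "w:words" "g:grouplikes H" "h:grouplikes H"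
 shows "v:words ==> ymono (v, g)\<otimes>ymono (w, h) = word_char ch w g\<odot>ymono (v @ w, g\<otimes>h)"
proof(induction v)
 case Nil
 show ?case using al_ymono[OF assms] by(simp add: ymono_simps)
next
 case (Cons i v)
 hence i: "i:{1, 2}" and v: "v:words" by(auto simp: Y.words_simps)
 have vw: "v @ w:words" using v assms(1) by(simp add: Y.words_simps)
 note c = yy_carrier[OF i] ymono_carrier[OF v assms(2)] ymono_carrier[OF assms(1,3)] ymono_carrier[OF vw gl_mult[OF assms(2,3)]]
 show ?case using Cons.IH[OF v] c by(simp add: ymono_simps alg_m_assoc smult_mult_right)
qed

lemma ymono_comult:
 assumes g: "g:grouplikes H"
 shows "[|w:words; bil be|] ==> comult H (ymono (w, g)) be
  = (\<Sum>(c, u, v)\<leftarrow>word_comult ga ch w. c * be (ymono (u, word_deg G ga v\<otimes>g)) (ymono (v, g)))"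
proof(induction w arbitrary: be)
 case Nil
 thus ?case using gl_comult[OF al_gl[OF g]] gl_carrier[OF g] by(simp add: ymono_simps)
next
 case (Cons i w)
 hence i: "i:{1, 2}" and w: "w:words" by(auto simp: Y.words_simps)
 note c = yy_carrier[OF i] ymono_carrier[OF w g] al_carrier(1)[OF ga_gl[OF i]] gl_carrier[OF one_gl]
 note b = bil_mult_right[OF Cons.prems(2) c(3,1)] bil_mult_right[OF Cons.prems(2) c(1,4)]
 have step: "be (al (ga i)\<otimes>ymono (u, word_deg G ga v\<otimes>g)) (yy i\<otimes>ymono (v, g))
   = word_char ch u (ga i) * be (ymono (u, word_deg G ga (i # v)\<otimes>g)) (ymono (i # v, g)) & \<one> \<otimes> ymono (v, g) = ymono (v, g)"
  if cuv: "(c', u, v):set (word_comult ga ch w)" for c' u v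
 proof -
  note uv = wc_in_W[OF cuv w]
  have d: "word_deg G ga v:grouplikes H" using Y.word_deg_closed[OF uv(2)] by simp
  note dg = gl_mult[OF d g]
  have m: "ymono (i # v, g):car H" using ymono_carrier[of "i # v" g] i uv(2) g by(simp add: Y.words_simps)
  have "ga i\<otimes>(word_deg G ga v\<otimes>g) = word_deg G ga (i # v)\<otimes>g"
   using gl_carrier[OF ga_gl[OF i]] gl_carrier[OF d] gl_carrier[OF g] by(simp add: alg_m_assoc)
  thus ?thesis
   using al_ymono[OF uv(1) ga_gl[OF i] dg] bil_smult1[OF Cons.prems(2) ymono_carrier[OF uv(1) gl_mult[OF ga_gl[OF i] dg]] m]
    ymono_carrier[OF uv(2) g]
   by(simp add: ymono_simps)
 qed
 have "comult H (ymono (i # w, g)) be = comult H (yy i) (%u v. comult H (ymono (w, g)) (%u' v'. be (u\<otimes>u') (v\<otimes>v')))"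
  unfolding ymono_simps by(rule comult_mult_eval[OF c(1,2) Cons.prems(2)])
 also have "... = comult H (ymono (w, g)) (%u' v'. be (al (ga i)\<otimes>u') (yy i\<otimes>v'))
   + comult H (ymono (w, g)) (%u' v'. be (yy i\<otimes>u') (\<one> \<otimes> v'))"
  by(rule yy(4)[OF i bil_comult[OF c(2) Cons.prems(2)]])
 also have "... = (\<Sum>(c, u, v)\<leftarrow>word_comult ga ch w. c * (word_char ch u (ga i) * be (ymono (u, word_deg G ga (i # v)\<otimes>g)) (ymono (i # v, g))))
   + (\<Sum>(c, u, v)\<leftarrow>word_comult ga ch w. c * be (ymono (i # u, word_deg G ga v\<otimes>g)) (ymono (v, g)))"
  unfolding Cons.IH[OF w b(1)] Cons.IH[OF w b(2)]
  by(intro arg_cong2[where f="(+)"] arg_cong[where f=sum_list] map_cong refl) (auto simp: step ymono_simps)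
 also have "... = (\<Sum>(c, u, v)\<leftarrow>word_comult ga ch (i # w). c * be (ymono (u, word_deg G ga v\<otimes>g)) (ymono (v, g)))"
 proof -
  have "(\<Sum>(c, u, v)\<leftarrow>xs. c * (word_char ch u (ga i) * P u (i # v))) + (\<Sum>(c, u, v)\<leftarrow>xs. c * P (i # u) v)
   = (\<Sum>(c, u, v)\<leftarrow>concat (map (%(c, u, v). [(c, i # u, v), (c * word_char ch u (ga i), u, i # v)]) xs). c * P u v)"
   for P :: "nat list => nat list => 'k" and xs
   by(induction xs) (auto simp: algebra_simps)
  from this[of "%u v. be (ymono (u, word_deg G ga v\<otimes>g)) (ymono (v, g))" "word_comult ga ch w"] show ?thesis by simp
 qed
 finally show ?case .
qed

lemma kap_ymono: "[|w:words; g:grouplikes H|] ==> kap (single (w, g)) = gh (length w) (ymono (w, g))"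
proof(induction w)
 case Nil
 thus ?case using kap_al by(simp add: ymono_simps)
next
 case (Cons i w)
 hence i: "i:{1, 2}" and w: "w:words" by(auto simp: Y.words_simps)
 have s: "single ([i], \<one>):car Y.TB" "single (w, g):car Y.TB"
  using Y.single_closed[of "[i]" \<one>] Y.single_closed[OF w, of g] i one_gl Cons.prems(2) by(simp_all add: Y.words_simps)
 have "single (i # w, g) = single ([i], \<one>)\<otimes>\<^bsub>Y.TB\<^esub>single (w, g)"
  using Y.word_char_one[OF w] gl_carrier[OF Cons.prems(2)] by(simp add: Y.single_mult_single)
 hence "kap (single (i # w, g)) = gh 1 (yy i) \<otimes>\<^sub>g gh (length w) (ymono (w, g))"
  using kap_mult[OF s] yy(2)[OF i] Cons.IH[OF w Cons.prems(2)] by simp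
 thus ?case using gh_mult[OF yy(1)[OF i] ymono_filt[OF w Cons.prems(2)]] by(simp add: ymono_simps)
qed

definition Phi :: "(nat list\<times>'a => 'k) => 'a" where
 "Phi x = (\<Oplus>z\<in>{z. x z ~= 0}. x z\<odot>ymono z)"

lemma TB_supp: "[|x:car Y.TB; x (w, g) ~= 0|] ==> w:words & g:grouplikes H"
 using fin_suppD(2)[of x "words\<times>grouplikes H" "(w, g)"] by simp

lemma TB_finite: "x:car Y.TB ==> finite {z. x z ~= 0}"
 by(rule fin_suppD(1)) simp

lemma ymono_supp: "[|x:car Y.TB; x z ~= 0|] ==> ymono z:car H"
 using TB_supp[of x "fst z" "snd z"] ymono_carrier[of "fst z" "snd z"] by simp

lemma Phi_mem:
 "[|x:car Y.TB; subspace N H; !!w g. x (w, g) ~= 0 ==> ymono (w, g):N|] ==> Phi x:N"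
 unfolding Phi_def by(rule sub_finsum[OF _ TB_finite]) (auto intro: sub_smult)

lemma Phi_closed: "x:car Y.TB ==> Phi x:car H"
 by(rule Phi_mem[OF _ whole_sub ymono_supp])

lemma lf_Phi:
 assumes x: "x:car Y.TB" and f: "lf f"
 shows "f (Phi x) = fsum x (%z. f (ymono z))"
proof -
 have "f (Phi x) = (\<Sum>z\<in>{z. x z ~= 0}. f (x z\<odot>ymono z))"
  unfolding Phi_def by(rule lf_finsum[OF f TB_finite[OF x]]) (use ymono_supp[OF x] in simp)
 also have "... = (\<Sum>z\<in>{z. x z ~= 0}. x z * f (ymono z))"
  by(rule sum.cong[OF refl]) (use lf_smult[OF f ymono_supp[OF x]] in simp)
 finally show ?thesis by(simp add: fsum_def)
qed

lemma Phi_eqI: "[|x:car Y.TB; h:car H; !!f. lf f ==> fsum x (%z. f (ymono z)) = f h|] ==> Phi x = h"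
 by(rule eq_if_forms_eq[OF Phi_closed]) (simp_all add: lf_Phi)

lemma Phi_add: "[|x:car Y.TB; y:car Y.TB|] ==> Phi (%z. x z + y z) = Phi x\<oplus>Phi y"
 by(rule Phi_eqI[OF Y.TB_closed(1)]) (use fsum_add[of x "words\<times>grouplikes H" y] in \<open>simp_all add: Phi_closed lf_add lf_Phi\<close>)

lemma Phi_smult: "x:car Y.TB ==> Phi (%z. a * x z) = a\<odot>Phi x"
 by(rule Phi_eqI[OF Y.TB_closed(2)]) (use fsum_smult[of x "words\<times>grouplikes H" a] in \<open>simp_all add: Phi_closed lf_smult lf_Phi\<close>)

lemma Phi_single: "[|w:words; g:grouplikes H|] ==> Phi (single (w, g)) = ymono (w, g)"
 by(rule Phi_eqI) (use Y.single_closed[of w g] in \<open>simp_all add: ymono_carrier\<close>)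

lemma Phi_zero: "Phi (%z. 0) = \<zero>"
 by(rule Phi_eqI) (use Y.TB_closed(3) in \<open>simp_all add: lf_zero\<close>)

lemma Phi_one: "Phi (single ([], \<one>)) = \<one>"
 using Phi_single[of "[]" \<one>] one_gl by(simp add: ymono_simps al_one Y.words_simps)

lemma Phi_mult:
 assumes x: "x:car Y.TB" and y: "y:car Y.TB"
 shows "Phi (x\<otimes>\<^bsub>Y.TB\<^esub>y) = Phi x\<otimes>Phi y"
 using x
proof(induction rule: Y.TB_induct)
 case b1: (basis v g)
 note s = Y.single_closed[OF b1]
 show ?case using y
 proof(induction rule: Y.TB_induct)
  case (basis w h)
  have "Phi (single (v @ w, g\<otimes>h)) = ymono (v @ w, g\<otimes>h)"
   using b1 basis gl_mult by(intro Phi_single) (auto simp: Y.words_simps)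
  moreover have "single (v @ w, g\<otimes>h):car Y.TB"
   using Y.single_closed[of "v @ w" "g\<otimes>h"] b1 basis gl_mult by(simp add: Y.words_simps)
  ultimately show ?case
   using b1 basis by(simp add: Y.single_mult_single Phi_smult Phi_single ymono_mult del: bos_simps)
 next
  case (add f h)
  thus ?case using Y.mult_bilinear(2)[OF add(1,2)] Phi_add Y.TB_mult_closed[OF s] Phi_closed[OF s] Phi_closed
   by(simp add: alg_r_distr del: bos_simps)
 next
  case (smult a f)
  thus ?case using Y.mult_bilinear(4)[OF smult(1,1)] Phi_smult Y.TB_mult_closed[OF s] Phi_closed[OF s] Phi_closed
   by(simp add: smult_mult_right del: bos_simps)
 qed
next
 case (add f h)
 thus ?case using Y.mult_bilinear(1)[OF add(1,2)] Phi_add Y.TB_mult_closed[OF _ y] Phi_closed[OF y] Phi_closed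
  by(simp add: alg_l_distr del: bos_simps)
next
 case (smult a f)
 thus ?case using Y.mult_bilinear(3)[OF smult(1,1)] Phi_smult Y.TB_mult_closed[OF _ y] Phi_closed[OF y] Phi_closed
  by(simp add: smult_mult_left del: bos_simps)
qed

lemma Phi_bilinear: "bil be ==> bilinear_form Y.TB Y.TB (%u v. be (Phi u) (Phi v))"
 by(rule bilinear_pullback) (use Phi_closed Phi_add Phi_smult in simp_all)

lemma Phi_comult:
 assumes x: "x:car Y.TB" and be: "bil be"
 shows "comult H (Phi x) be = comult Y.TB x (%u v. be (Phi u) (Phi v))"
proof -
 have "comult H (Phi x) be = fsum x (%z. comult H (ymono z) be)" by(rule lf_Phi[OF x comult_linear])
 also have "... = fsum x (%(w, g). \<Sum>(c, u, v)\<leftarrow>word_comult ga ch w.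
   c * be (Phi (single (u, word_deg G ga v\<otimes>g))) (Phi (single (v, g))))"
 proof(rule fsum_cong, clarify)
  fix w g assume "x (w, g) ~= 0"
  hence wg: "w:words" "g:grouplikes H" using TB_supp[OF x] by auto
  have "Phi (single (u, word_deg G ga v\<otimes>g)) = ymono (u, word_deg G ga v\<otimes>g) & Phi (single (v, g)) = ymono (v, g)"
   if "(c, u, v):set (word_comult ga ch w)" for c u v
   using wc_in_W[OF that wg(1)] Y.word_deg_closed[of v] gl_mult wg(2) by(simp add: Phi_single)
  thus "comult H (ymono (w, g)) be = (\<Sum>(c, u, v)\<leftarrow>word_comult ga ch w.
   c * be (Phi (single (u, word_deg G ga v\<otimes>g))) (Phi (single (v, g))))"
   unfolding ymono_comult[OF wg(2,1) be] by(intro arg_cong[where f=sum_list] map_cong refl) auto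
 qed
 also have "... = comult Y.TB x (%u v. be (Phi u) (Phi v))"
  using bos_comult[OF Phi_bilinear[OF be], of x] by simp
 finally show ?thesis .
qed

lemma counit_yy: "i:{1, 2} ==> counit H (yy i) = 0"
proof -
 assume i: "i:{1, 2}"
 have "counit H (yy i) = (counit H \<star> counit H) (yy i)" using conv_counit_left[OF counit_lf yy_carrier[OF i]] by simp
 also have "... = counit H (yy i) + counit H (yy i)"
  unfolding conv_def using yy(4)[OF i bil_prod[OF counit_lf counit_lf]] counit_gl[OF al_gl[OF ga_gl[OF i]]]
  by(simp add: counit_one)
 finally show ?thesis by simp
qed

lemma Phi_counit: "x:car Y.TB ==> counit H (Phi x) = counit Y.TB x"
proof -
 assume x: "x:car Y.TB"
 have "counit H (ymono (w, g)) = (if w = [] then 1 else 0)" if "w:words" "g:grouplikes H" for w g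
 proof(cases w)
  case (Cons i v)
  thus ?thesis using that ymono_carrier[of v g] yy_carrier[of i] counit_yy[of i]
   by(simp add: ymono_simps counit_mult Y.words_simps)
 qed (simp add: ymono_simps counit_gl al_gl that)
 hence "fsum x (%z. counit H (ymono z)) = fsum x (%(w, g). if w = [] then 1 else 0)"
  using TB_supp[OF x] by(intro fsum_cong) auto
 thus ?thesis using lf_Phi[OF x counit_lf] by(simp add: bos_counit)
qed

end

context nontrivial_nichols_type
begin

lemma fsum_point: "finite {z. x z ~= 0} ==> fsum x (%z. if z = p then a else 0) = x p * (a :: 'k)"
proof -
 assume f: "finite {z. x z ~= 0}"
 have "fsum x (%z. if z = p then a else 0) = (\<Sum>z\<in>{z. x z ~= 0}. if z = p then x p * a else 0)"
  unfolding fsum_def by(rule sum.cong) auto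
 thus ?thesis using f by simp
qed

definition cut :: "(nat => bool) => (nat list\<times>'a => 'k) => nat list\<times>'a => 'k" where
 "cut P x = (%z. if P (length (fst z)) then x z else 0)"

lemma cut_closed: "x:car Y.TB ==> cut P x:car Y.TB"
proof -
 assume "x:car Y.TB"
 hence x: "x:fin_supp Y.basis" by simp
 have "cut P x:fin_supp Y.basis"
  by(rule fin_suppI[of "{z. x z ~= 0}"]) (use fin_suppD[OF x] in \<open>auto simp: cut_def split: if_splits\<close>)
 thus ?thesis by simp
qed

lemma cut_linear: "cut P (%z. x z + y z) = (%z. cut P x z + cut P y z)" "cut P (%z. a * x z) = (%z. a * cut P x z)"
 by(auto simp: cut_def)

lemma cut_single: "cut P (single (w, g)) = (if P (length w) then single (w, g) else (%z. 0))"
 by(auto simp: cut_def single_def fun_eq_iff)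

lemma cut_NK: "x:Y.NK ==> cut (%l. l = n) x:Y.NK"
proof -
 assume x: "x:Y.NK"
 have "Y.slice (cut (%l. l = n) x) g = len_part n (Y.slice x g)" for g
  by(auto simp: cut_def Y.slice_def len_part_def)
 thus ?thesis using cut_closed[OF Y.NK_D(1)[OF x]] Y.NK_D(2)[OF x] by(simp add: Y.NK_def NI_len)
qed

lemma NK_add: "[|x:Y.NK; y:Y.NK|] ==> (%z. x z + y z):Y.NK"
 using Y.TBk.sub_add[OF Y.NK_sub] by simp

lemma NK_zero: "(%z. 0):Y.NK"
 using Y.TBk.sub_zero[OF Y.NK_sub] by simp

lemma cut_NK_below: "x:Y.NK ==> cut (%l. l < n) x:Y.NK"
proof(induction n)
 case 0
 have "cut (%l. l < 0) x = (%z. 0)" by(auto simp: cut_def)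
 thus ?case using NK_zero by simp
next
 case (Suc n)
 have "cut (%l. l < Suc n) x = (%z. cut (%l. l < n) x z + cut (%l. l = n) x z)" by(auto simp: cut_def fun_eq_iff)
 thus ?case using NK_add[OF Suc.IH[OF Suc.prems] cut_NK[OF Suc.prems, of n]] by simp
qed

lemma kap_component:
 assumes x: "x:car Y.TB"
 shows "kap x n = cl n (Phi (cut (%l. l = n) x))"
 using x
proof(induction rule: Y.TB_induct)
 case (basis w g)
 thus ?case using kap_ymono[of w g] Phi_single[of w g]
  by(auto simp: cut_single gh_apply Phi_zero cl_zero sub_zero[OF below_sub])
next
 case (add f h)
 thus ?case
  using cl_add[OF Phi_closed[OF cut_closed[OF add(1)]] Phi_closed[OF cut_closed[OF add(2)]]]
  by(simp add: kap_add gra_add_apply cut_linear Phi_add cut_closed del: bos_simps)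
next
 case (smult a f)
 thus ?case using cl_smult[OF Phi_closed[OF cut_closed[OF smult(1)]]]
  by(simp add: kap_smult gra_smult_apply cut_linear Phi_smult cut_closed del: bos_simps)
qed

lemma Phi_filt:
 assumes x: "x:car Y.TB" and l: "!!w g. x (w, g) ~= 0 ==> length w <= n"
 shows "Phi x:Hf n"
proof(rule Phi_mem[OF x filt_sub])
 fix w g assume "x (w, g) ~= 0"
 hence "ymono (w, g):Hf (length w)" "length w <= n" using l TB_supp[OF x] ymono_filt by auto
 thus "ymono (w, g):Hf n" using filt_mono[of "length w" n] by blast
qed

lemma TB_diff: "[|x:car Y.TB; y:car Y.TB|] ==> (%z. x z + (- 1) * y z):car Y.TB"
 using Y.TB_closed(1)[OF _ Y.TB_closed(2)] .

lemma Phi_diff: "[|x:car Y.TB; y:car Y.TB|] ==> Phi (%z. x z + (- 1) * y z) = Phi x\<ominus>Phi y"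
 using Phi_add[OF _ Y.TB_closed(2), of x y "-1"] Phi_smult[of y "-1"] Phi_closed by(simp add: minus_eq_smult del: bos_simps)

text \<open>The component of degree \<open>n\<close> of \<open>kap x\<close> is the class of the image of the words of length \<open>n\<close>
 (\<open>kap_component\<close>). If \<open>Phi x\<close> lies in \<open>H\<^sub>n\<^sub>-\<^sub>1\<close>, this class is zero, and then so is the image of these words under \<open>kap\<close>.\<close>

lemma leading_part:
 assumes x: "x:car Y.TB" and b: "Phi x:Kb n" and l: "!!w g. x (w, g) ~= 0 ==> length w <= n"
 shows "cut (%l. l = n) x:Y.NK"
proof -
 let ?p = "cut (%l. l = n) x" and ?r = "cut (%l. l < n) x"
 note pc = cut_closed[OF x, of "%l. l = n"] and rc = cut_closed[OF x, of "%l. l < n"]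
 have "Phi ?r:Kb n"
 proof(cases n)
  case 0
  hence "?r = (%z. 0)" by(auto simp: cut_def)
  thus ?thesis using 0 by(simp add: Phi_zero)
 next
  case (Suc k)
  have "length w <= k" if "?r (w, g) ~= 0" for w g using that Suc by(simp add: cut_def split: if_splits)
  hence "Phi ?r:Hf k" by(rule Phi_filt[OF rc])
  thus ?thesis using Suc by simp
 qed
 moreover have "?p = (%z. x z + (- 1) * ?r z)"
  using l by(fastforce simp: cut_def fun_eq_iff not_less order_antisym)
 ultimately have top: "Phi ?p:Kb n"
  using Phi_diff[OF x rc] b sub_minus[OF below_sub] by metis
 have "kap ?p j = Kb j" for j
 proof(cases "j = n")
  case True
  have "cut (%l. l = n) ?p = ?p" by(simp add: cut_def fun_eq_iff)
  thus ?thesis using kap_component[OF pc, of n] top True by(simp add: cl_zero)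
 next
  case False
  hence "cut (%l. l = j) ?p = (%z. 0)" by(auto simp: cut_def)
  thus ?thesis using kap_component[OF pc, of j] by(simp add: Phi_zero cl_zero sub_zero[OF below_sub])
 qed
 hence "kap ?p = \<zero>\<^sub>g" by(simp add: gra_zero fun_eq_iff)
 thus ?thesis using kap_zero_iff[OF pc] by simp
qed

lemma Phi_surj_filt: "h:Hf n ==> EX x:car Y.TB. Phi x = h & (ALL w g. x (w, g) ~= 0 --> length w <= n)"
proof(induction n arbitrary: h rule: less_induct)
 case (less n)
 note hH = filt_closed[OF less.prems]
 obtain y where y: "y:car Y.TB" "gh n h = kap y" using kap_surj[OF gh_closed[OF less.prems]] by blast
 let ?p = "cut (%l. l = n) y"
 note pc = cut_closed[OF y(1), of "%l. l = n"]
 have "cl n h = cl n (Phi ?p)" using kap_component[OF y(1), of n] y(2) gh_apply(1) by metis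
 hence d: "h\<ominus>Phi ?p:Kb n" using cl_eq_iff[OF hH Phi_closed[OF pc]] by simp
 have "EX x:car Y.TB. Phi x = h\<ominus>Phi ?p & (ALL w g. x (w, g) ~= 0 --> length w <= n)"
 proof(cases n)
  case 0
  hence "h\<ominus>Phi ?p = \<zero>" using d by simp
  thus ?thesis using Phi_zero Y.TB_closed(3) by(intro bexI[of _ "%z. 0"]) simp_all
 next
  case (Suc k)
  hence k: "k < n" "h\<ominus>Phi ?p:Hf k" using d by simp_all
  obtain x where x: "x:car Y.TB" "Phi x = h\<ominus>Phi ?p" "ALL w g. x (w, g) ~= 0 --> length w <= k"
   using less.IH[OF k] by blast
  thus ?thesis using Suc le_SucI by blast
 qed
 then obtain x where x: "x:car Y.TB" "Phi x = h\<ominus>Phi ?p" "ALL w g. x (w, g) ~= 0 --> length w <= n" by blast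
 have "Phi (%z. x z + ?p z) = h"
 proof(rule eq_if_forms_eq[OF Phi_closed[OF Y.TB_closed(1)[OF x(1) pc]] hH])
  fix f assume f: "lf f"
  show "f (Phi (%z. x z + ?p z)) = f h"
   using Phi_add[OF x(1) pc] x(2) lf_minus[OF f hH Phi_closed[OF pc]] lf_add[OF f Phi_closed[OF x(1)] Phi_closed[OF pc]] by simp
 qed
 moreover have "length w <= n" if "x (w, g) + ?p (w, g) ~= 0" for w g
 proof(cases "x (w, g) = 0")
  case True
  thus ?thesis using that by(simp add: cut_def split: if_splits)
 qed (use x(3) in blast)
 ultimately show ?case using Y.TB_closed(1)[OF x(1) pc] by blast
qed

lemma Phi_surj: "h:car H ==> EX x:car Y.TB. Phi x = h"
 using filt_exhaustive Phi_surj_filt by blast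

lemma Phi_inj_short:
 assumes x: "x:car Y.TB" and l: "!!w g. x (w, g) ~= 0 ==> length w <= 1" and z: "Phi x = \<zero>"
 shows "x = (%z. 0)"
proof -
 have vanish: "x (w, g) = 0" if "cut (%l. l = n) x:Y.NK" "length w = n" "n <= 1" for w g n
 proof(rule ccontr)
  assume "x (w, g) ~= 0"
  hence "g:grouplikes H" using TB_supp[OF x] by blast
  thus False using single_not_in_NK[OF that(1), of w g] that(2,3) \<open>x (w, g) \<noteq> 0\<close> by(simp add: cut_def)
 qed
 have "Phi x:Kb n" for n using z sub_zero[OF below_sub] by simp
 have "cut (%l. l = 1) x:Y.NK" by(rule leading_part[OF x \<open>\<And>n. Phi x \<in> Kb n\<close> l])
 hence 1: "x (w, g) = 0" if "length w = 1" for w g by(rule vanish[OF _ that order_refl])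
 have l0: "length w <= 0" if "x (w, g) ~= 0" for w g using l[OF that] 1[of w g] that by linarith
 have "cut (%l. l = 0) x:Y.NK" by(rule leading_part[OF x \<open>\<And>n. Phi x \<in> Kb n\<close> l0])
 hence 0: "x (w, g) = 0" if "length w = 0" for w g by(rule vanish[OF _ that zero_le_one])
 show ?thesis
 proof
  fix p show "x p = 0" using l0[of "fst p" "snd p"] 0[of "fst p" "snd p"] by(cases p) auto
 qed
qed

text \<open>The images of the words of length at most one, times group-likes, are linearly independent;
 hence the coordinates of the elements of \<open>H\<^sub>1\<close> with respect to them are linear forms on \<open>H\<close>.\<close>

lemma coordinate_form:
 assumes p: "w:words" "g:grouplikes H" "length w <= 1"
 shows "EX phi. lf phi & (ALL x:car Y.TB. phi (Phi (cut (%l. l <= 1) x)) = x (w, g))"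
proof -
 let ?K = "%x. Phi (cut (%l. l <= 1) x)" and ?p = "(w, g)"
 let ?N = "?K ` {x:car Y.TB. x ?p = 0}"
 note s = Y.single_closed[of w g, simplified G_simps, OF p(1,2)]
 have K: "?K (%z. x z + c * y z) = ?K x\<oplus>c\<odot>?K y" if "x:car Y.TB" "y:car Y.TB" for x y c
  using that Phi_add[OF cut_closed cut_closed[OF Y.TB_closed(2)], of x y] Phi_smult[OF cut_closed]
  by(simp add: cut_linear del: bos_simps)
 have N: "subspace ?N H"
 proof(rule subI)
  show "?N \<subseteq> car H" using Phi_closed cut_closed by blast
  show "\<zero>:?N" using Phi_zero Y.TB_closed(3) by(intro image_eqI[of _ _ "%z. 0"]) (simp_all add: cut_def)
  fix a assume "a:?N"
  then obtain x where x: "x:car Y.TB" "x ?p = 0" "a = ?K x" by blast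
  show "c\<odot>a:?N" for c
   using x Y.TB_closed(2)[OF x(1)] Phi_smult[OF cut_closed[OF x(1)]]
   by(intro image_eqI[of _ _ "%z. c * x z"]) (simp_all add: cut_linear del: bos_simps)
  fix b assume "b:?N"
  then obtain y where y: "y:car Y.TB" "y ?p = 0" "b = ?K y" by blast
  show "a\<oplus>b:?N"
   using x y Y.TB_closed(1)[OF x(1) y(1)] Phi_add[OF cut_closed[OF x(1)] cut_closed[OF y(1)]]
   by(intro image_eqI[of _ _ "%z. x z + y z"]) (simp_all add: cut_linear del: bos_simps)
 qed
 have dec: "(%z. x z + c * single ?p z):car Y.TB" if "x:car Y.TB" for x c
  using Y.TB_closed(1)[OF that Y.TB_closed(2)[OF s]] .
 have "?K (single ?p) ~: ?N"
 proof
  assume "?K (single ?p):?N"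
  then obtain x where x: "x:car Y.TB" "x ?p = 0" "?K (single ?p) = ?K x" by blast
  have "?K x\<oplus>(- 1)\<odot>?K x = \<zero>"
   using Phi_closed[OF cut_closed[OF x(1)]] smult_simps(4)[of "?K x" 1 "- 1"] by simp
  hence "?K (%z. x z + (- 1) * single ?p z) = \<zero>" using K[OF x(1) s] x(3) by(simp only:)
  have short: "length v <= 1" if "cut (%l. l <= 1) y (v, k) ~= 0" for y v k
   using that by(simp add: cut_def split: if_splits)
  have "cut (%l. l <= 1) (%z. x z + (- 1) * single ?p z) = (%z. 0)"
   by(rule Phi_inj_short[OF cut_closed[OF dec[OF x(1)]]]) (erule short, fact)
  from fun_cong[OF this, of ?p] show False using x(2) p(3) by(simp add: cut_def single_def)
 qed
 from separating_form[OF N Phi_closed[OF cut_closed[OF s]] this] obtain phi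
  where phi: "lf phi" "ALL y:?N. phi y = 0" "phi (?K (single ?p)) = 1" by(elim exE conjE)
 have "phi (?K x) = x ?p" if x: "x:car Y.TB" for x
 proof -
  have m: "?K (%z. x z + (- x ?p) * single ?p z):?N" by(rule imageI) (use dec[OF x, of "- x ?p"] in \<open>simp add: single_def del: bos_simps\<close>)
  have "phi (?K x\<oplus>(- x ?p)\<odot>?K (single ?p)) = 0" using bspec[OF phi(2) m] unfolding K[OF x s] .
  thus ?thesis using lf_add[OF phi(1)] lf_smult[OF phi(1)] Phi_closed[OF cut_closed] x s phi(3) by simp
 qed
 thus ?thesis using phi(1) by blast
qed

lemma single_gl_mult:
 assumes x: "x:car Y.TB" and g: "g:grouplikes H" and h: "h:grouplikes H"
 shows "(single ([], g)\<otimes>\<^bsub>Y.TB\<^esub>x) (w, h) = word_char ch w g * x (w, inv_G g\<otimes>h)"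
  "(x\<otimes>\<^bsub>Y.TB\<^esub>single ([], g)) (w, h) = x (w, inv_G g\<otimes>h)"
proof -
 have c: "[]:words" "g:car G" "h:car G" using g h by(simp_all add: Y.words_simps)
 show "(single ([], g)\<otimes>\<^bsub>Y.TB\<^esub>x) (w, h) = word_char ch w g * x (w, inv_G g\<otimes>h)"
  using fun_cong[OF Y.slice_single_mult(1)[OF x c], of w] by(simp add: Y.slice_def single_mult_left)
 show "(x\<otimes>\<^bsub>Y.TB\<^esub>single ([], g)) (w, h) = x (w, inv_G g\<otimes>h)"
  using fun_cong[OF Y.slice_single_mult(2)[OF x c], of w] G_comm[OF h inv_G(1)[OF g]]
  by(simp add: Y.slice_def single_mult_right word_char_def)
qed

text \<open>The comultiplication of \<open>z = \<Phi>(x)\<close> is compared coordinate by coordinate with \<open>e \<otimes> z + z \<otimes> 1\<close>; the statement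
 about characters follows from the injectivity of \<open>\<Phi>\<close> on short words.\<close>

lemma skew_prim_form:
 assumes z: "z:Hf 1" and e: "e:grouplikes H"
  and com: "!!be. bil be ==> comult H z be = be (al e) z + be z \<one>"
  and weight: "!!g. g:grouplikes H ==> al g\<otimes>z = psi g\<odot>(z\<otimes>al g)"
 shows "EX x:car Y.TB. z = Phi x &
  (ALL w h. x (w, h) ~= 0 --> length w <= 1 & (ALL g:grouplikes H. psi g = word_char ch w g)) &
  (ALL i h. x ([i], h) ~= 0 --> h = \<one> & e = ga i) &
  (ALL h. x ([], h) ~= 0 --> h = \<one> \<or> h = e) & x ([], \<one>) + x ([], e) = 0"
proof -
 obtain x where x: "x:car Y.TB" "Phi x = z" and l: "!!w g. x (w, g) ~= 0 ==> length w <= 1"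
  using Phi_surj_filt[OF z] by blast
 note fin = TB_finite[OF x(1)]
 let ?ok = "%(w, g). w:words & g:grouplikes H & length w <= 1"
 have supp: "?ok p" if "x p ~= 0" for p using l[of "fst p" "snd p"] TB_supp[OF x(1), of "fst p" "snd p"] that by auto
 have "ALL p. EX phi. ?ok p --> lf phi & (ALL x:car Y.TB. phi (Phi (cut (%l. l <= 1) x)) = x p)"
  using coordinate_form by(simp add: split_paired_all)
 from choice[OF this] obtain \<Phi> where \<Phi>: "!!p. ?ok p ==> lf (\<Phi> p)"
  and co: "!!p x. [|?ok p; x:car Y.TB|] ==> \<Phi> p (Phi (cut (%l. l <= 1) x)) = x p" by blast
 have "cut (%l. l <= 1) x = x" using l by(auto simp: cut_def fun_eq_iff)
 hence \<Phi>z: "\<Phi> p z = x p" if "?ok p" for p using co[OF that x(1)] x(2) by simp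
 have \<Phi>m: "\<Phi> p (ymono q) = (if q = p then 1 else 0)" if "?ok p" "?ok q" for p q
 proof -
  have "\<Phi> p (ymono q) = single q p"
   using co[OF that(1), of "single q"] that(2) Phi_single Y.single_closed[of "fst q" "snd q"] by(cases q) (simp add: cut_single)
  thus ?thesis by(auto simp: single_def)
 qed
 have \<Phi>a: "\<Phi> p (al h) = (if p = ([], h) then 1 else 0)" if "?ok p" "h:grouplikes H" for p h
  using \<Phi>m[OF that(1), of "([], h)"] that(2) by(auto simp: ymono_simps Y.words_simps)
 let ?T = "%p q (w, g). if w = [] then if p = ([], g) & q = ([], g) then 1 else 0
  else (if p = (w, g) & q = ([], g) then 1 else 0) + (if p = ([], ga (hd w)\<otimes>g) & q = (w, g) then 1 else 0 :: 'k)"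
 have eq: "(if p = ([], e) then 1 else 0) * x q + x p * (if q = ([], \<one>) then 1 else 0)
  = fsum x (?T p q)"
  if pq: "?ok p" "?ok q" for p q
 proof -
  note b = bil_prod[OF \<Phi>[OF pq(1)] \<Phi>[OF pq(2)]]
  have "comult H z (%u v. \<Phi> p u * \<Phi> q v) = fsum x (%r. comult H (ymono r) (%u v. \<Phi> p u * \<Phi> q v))"
   using lf_Phi[OF x(1) comult_linear] x(2) by simp
  also have "... = fsum x (?T p q)"
  proof(rule fsum_cong)
   fix t assume nz: "x t ~= 0"
   obtain w g where t: "t = (w, g)" by(cases t)
   have r: "w:words" "g:grouplikes H" "length w <= 1" using supp[OF nz] t by auto
   show "comult H (ymono t) (%u v. \<Phi> p u * \<Phi> q v) = ?T p q t"
   proof(cases w)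
    case Nil
    thus ?thesis using r \<Phi>a pq gl_comult[OF al_gl[OF r(2)]] b by(simp add: t ymono_simps)
   next
    case (Cons i v)
    hence i: "w = [i]" "i:{1, 2}" using r by(auto simp: Y.words_simps)
    note gg = gl_mult[OF ga_gl[OF i(2)] r(2)]
    show ?thesis
     using ymono_comult[OF r(2,1) b] i(1) \<Phi>m[OF pq(1), of "(w, g)"] \<Phi>m[OF pq(2), of "(w, g)"] \<Phi>a[OF pq(1) gg] \<Phi>a[OF pq(2) r(2)] r
      gl_carrier[OF r(2)] gl_carrier[OF ga_gl[OF i(2)]]
     by(simp add: t ymono_simps)
   qed
  qed
  finally show ?thesis using com[OF b] \<Phi>a[OF pq(1) e] \<Phi>a[OF pq(2) one_gl] \<Phi>z pq al_one by simp
 qed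
 have val: "(if p = ([], e) then 1 else 0) * x q + x p * (if q = ([], \<one>) then 1 else 0) = x r * c"
  if ok: "?ok p" "?ok q" and T: "!!w g. [|w:words; g:grouplikes H|] ==> ?T p q (w, g) = (if (w, g) = r then c else 0)" for p q r c
 proof -
  have "fsum x (?T p q) = fsum x (%p. if p = r then c else 0)" by(rule fsum_cong) (use T supp in auto)
  thus ?thesis using eq[OF ok] fsum_point[OF fin] by simp
 qed
 have deg0: "(if h = e then 1 else 0) * x ([], h') + x ([], h) * (if h' = \<one> then 1 else 0) = x ([], h) * (if h = h' then 1 else 0)"
  if "h:grouplikes H" "h':grouplikes H" for h h'
  using val[of "([], h)" "([], h')" "([], h)" "if h = h' then 1 else 0"] that by(auto simp: Y.words_simps)
 have B: "h = \<one> & e = ga i" if nz: "x ([i], h) ~= 0" for i h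
 proof -
  have i: "i:{1, 2}" "h:grouplikes H" using supp[OF nz] by(auto simp: Y.words_simps)
  note gi = ga_gl[OF i(1)]
  note gh = gl_mult[OF gi i(2)]
  have cancel: "ga i\<otimes>h = ga i\<otimes>g \<longleftrightarrow> h = g" if "g:grouplikes H" for g
   using Y.l_cancel[of "ga i" h g] that i gi by auto
  have "(if ([i], h) = ([], e) then 1 else 0) * x ([], h) + x ([i], h) * (if ([], h) = ([] :: nat list, \<one>) then 1 else 0) = x ([i], h) * 1"
   by(rule val[of "([i], h)" "([], h)" "([i], h)" 1]) (use i in \<open>auto simp: Y.words_simps\<close>)
  hence "h = \<one>" using nz by(simp split: if_splits)
  moreover have "(if ([] :: nat list, ga i\<otimes>h) = ([], e) then 1 else 0) * x ([i], h) + x ([], ga i\<otimes>h) * (if ([i], h) = ([], \<one>) then 1 else 0) = x ([i], h) * 1"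
   by(rule val[of "([], ga i\<otimes>h)" "([i], h)" "([i], h)" 1]) (use i gh cancel in \<open>auto simp: Y.words_simps\<close>)
  hence "ga i\<otimes>h = e" using nz by(simp split: if_splits)
  ultimately show ?thesis using gl_carrier[OF gi] by simp
 qed
 have wt: "psi g = word_char ch w g" if nz: "x (w, h) ~= 0" and g: "g:grouplikes H" for w h g
 proof -
  let ?s = "single ([], g) :: nat list\<times>'a => 'k"
  have s: "?s:car Y.TB" using Y.single_closed[of "[]" g] g by(simp add: Y.words_simps del: bos_simps)
  note c = Y.TB_mult_closed[OF s x(1)] Y.TB_mult_closed[OF x(1) s]
  let ?d = "%p. (?s\<otimes>\<^bsub>Y.TB\<^esub>x) p + (- psi g) * (x\<otimes>\<^bsub>Y.TB\<^esub>?s) p"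
  have d: "?d:car Y.TB" using Y.TB_closed(1)[OF c(1) Y.TB_closed(2)[OF c(2)]] .
  have val: "?d (v, k) = (word_char ch v g - psi g) * x (v, inv_G g\<otimes>k)" if "k:grouplikes H" for v k
   using single_gl_mult[OF x(1) g that] by(simp add: algebra_simps)
  have "length v <= 1" if "?d (v, k) ~= 0" for v k
   using l[of v] val[of k v] TB_supp[OF d that] that by(auto simp del: bos_simps)
  moreover have "Phi (?s\<otimes>\<^bsub>Y.TB\<^esub>x) = psi g\<odot>Phi (x\<otimes>\<^bsub>Y.TB\<^esub>?s)"
   using Phi_mult[OF s x(1)] Phi_mult[OF x(1) s] Phi_single[of "[]" g] g x(2) weight[OF g] by(simp add: ymono_simps Y.words_simps)
  hence "psi g\<odot>Phi (x\<otimes>\<^bsub>Y.TB\<^esub>?s)\<oplus>(- psi g)\<odot>Phi (x\<otimes>\<^bsub>Y.TB\<^esub>?s) = \<zero>" "Phi ?d = psi g\<odot>Phi (x\<otimes>\<^bsub>Y.TB\<^esub>?s)\<oplus>(- psi g)\<odot>Phi (x\<otimes>\<^bsub>Y.TB\<^esub>?s)"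
   using smult_simps(4)[OF Phi_closed[OF c(2)], of "psi g" "- psi g"] Phi_closed[OF c(2)]
   by(simp, simp only: Phi_add[OF c(1) Y.TB_closed(2)[OF c(2)]] Phi_smult[OF c(2)])
  hence "Phi ?d = \<zero>" by(simp only:)
  ultimately have "?d = (%p. 0)" using Phi_inj_short[OF d] by blast
  hence "?d (w, g\<otimes>h) = 0" by(rule fun_cong)
  moreover have h: "h:grouplikes H" using TB_supp[OF x(1) nz] by blast
  moreover have "inv_G g\<otimes>(g\<otimes>h) = h" using Y.inv_solve_left[of h g "g\<otimes>h"] g h gl_mult[OF g h] by simp
  ultimately show ?thesis using val[of "g\<otimes>h" w] nz gl_mult[OF g] by simp
 qed
 have "x ([], \<one>) + x ([], e) = 0"
  using deg0[OF e one_gl] deg0[OF one_gl one_gl] by(auto split: if_splits)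
 moreover have "h = \<one> \<or> h = e" if "x ([], h) ~= 0" for h
  using deg0[of h h] that supp[OF that] by(auto split: if_splits)
 ultimately show ?thesis using x l wt B by blast
qed

end

section \<open>Skew-primitive elements and inner faithful actions\<close>

context fd_bialgebra
begin

lemma counit_skew_prim:
 assumes g: "g:grouplikes H" and y: "y:car H" and com: "!!be. bil be ==> comult H y be = be g y + be y \<one>"
 shows "counit H y = 0"
proof -
 have "counit H y = counit H y + counit H y"
  using conv_counit_left[OF counit_lf y] com[OF bil_prod[OF counit_lf counit_lf]] counit_gl[OF g]
  by(simp add: conv_def counit_one)
 thus ?thesis by(simp only: add_cancel_right_right)
qed

lemma antipode_linmap: "is_antipode H S ==> linmap S"
 by(auto simp: is_antipode_def linmap_def)

lemma comult_null: "x:car H ==> comult H x (%u v. 0) = 0"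
 using tensor_const[OF comult_closed bil_null, of x 0] by simp

lemma linmap_plus: "[|linmap T; linmap T'|] ==> linmap (%x. T x\<oplus>T' x)"
 unfolding linmap_def by(simp add: smult_add vec_ac)

lemma linmap_scale: "linmap T ==> linmap (%x. a\<odot>T x)"
 unfolding linmap_def by(simp add: smult_add mult.commute)

lemma bil_of_mult: "lf h ==> bil (%u v. h (u\<otimes>v))"
 unfolding bilinear_form_def
proof(intro conjI ballI)
 fix x assume h: "lf h" and x: "x:car H"
 show "lf (%v. h (x\<otimes>v))" by(rule lf_comp[OF h linmap_mult_left[OF x]])
 show "lf (%u. h (u\<otimes>x))" by(rule lf_comp[OF h linmap_mult_right[OF x]])
qed

lemma antipode_eval:
 assumes S: "is_antipode H S" and x: "x:car H" and h: "lf h"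
 shows "comult H x (%u v. h (S u\<otimes>v)) = counit H x * h \<one>" "comult H x (%u v. h (u\<otimes>S v)) = counit H x * h \<one>"
proof -
 obtain ps where ps: "sweedler H x ps" "set ps \<subseteq> car H\<times>car H"
  "ALL be. bil be --> comult H x be = (\<Sum>(u, v)\<leftarrow>ps. be u v)" using sweedlerE[OF x] .
 have Sc: "S u:car H" if "u:car H" for u using antipode_linmap[OF S] that by(simp add: linmap_def)
 have m: "bil (%u v. h (u\<otimes>v))"
  by(rule bil_of_mult[OF h])
 have b: "bil (%u v. h (S u\<otimes>v))" "bil (%u v. h (u\<otimes>S v))"
  using bil_comp[OF m antipode_linmap[OF S] linmap_id] bil_comp[OF m linmap_id antipode_linmap[OF S]] by auto
 have ax: "list_sum H (%(u, v). S u\<otimes>v) ps = counit H x\<odot>\<one>" "list_sum H (%(u, v). u\<otimes>S v) ps = counit H x\<odot>\<one>"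
  using S x ps(1) by(auto simp: is_antipode_def)
 have "h (list_sum H (%(u, v). S u\<otimes>v) ps) = (\<Sum>p\<leftarrow>ps. h (case p of (u, v) => S u\<otimes>v))"
  by(rule lf_list_sum[OF h]) (use ps(2) Sc in \<open>auto intro!: alg_m_closed\<close>)
 thus "comult H x (%u v. h (S u\<otimes>v)) = counit H x * h \<one>"
  using ps(3)[rule_format, OF b(1)] ax(1) lf_smult[OF h alg_one_closed] by(simp add: case_prod_unfold)
 have "h (list_sum H (%(u, v). u\<otimes>S v) ps) = (\<Sum>p\<leftarrow>ps. h (case p of (u, v) => u\<otimes>S v))"
  by(rule lf_list_sum[OF h]) (use ps(2) Sc in \<open>auto intro!: alg_m_closed\<close>)
 thus "comult H x (%u v. h (u\<otimes>S v)) = counit H x * h \<one>"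
  using ps(3)[rule_format, OF b(2)] ax(2) lf_smult[OF h alg_one_closed] by(simp add: case_prod_unfold)
qed

text \<open>Convolution with the identity can be cancelled on the right, because the antipode is its inverse.\<close>

lemma convolution_cancel:
 assumes S: "is_antipode H S" and T: "linmap T"
  and z: "!!x h. [|x:car H; lf h|] ==> comult H x (%u v. h (T u\<otimes>v)) = 0" and x: "x:car H"
 shows "T x = \<zero>"
proof(rule eq_if_forms_eq)
 have Tc: "T u:car H" if "u:car H" for u using T that by(simp add: linmap_def)
 have Sc: "S u:car H" if "u:car H" for u using antipode_linmap[OF S] that by(simp add: linmap_def)
 show "T x:car H" "\<zero>:car H" using Tc[OF x] by auto
 fix f assume f: "lf f"
 let ?\<tau> = "%u p q. f (T u\<otimes>(p\<otimes>S q))"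
 have tri: "trilinear_form H ?\<tau>"
  unfolding trilinear_form_def
 proof(intro conjI ballI)
  fix u assume u: "u:car H"
  note g = lf_comp[OF f linmap_mult_left[OF Tc[OF u]]]
  have m: "bil (%p q. f (T u\<otimes>(p\<otimes>q)))"
   by(rule bil_of_mult[OF g])
  show "bil (?\<tau> u)" using bil_comp[OF m linmap_id antipode_linmap[OF S]] by simp
 next
  fix p q assume "p:car H" "q:car H"
  hence "p\<otimes>S q:car H" using Sc by simp
  from lf_comp[OF lf_comp[OF f linmap_mult_right[OF this]] T] show "lf (%u. ?\<tau> u p q)" .
 qed
 have fT: "lf (%u. f (T u))" by(rule lf_comp[OF f T])
 have e: "comult H v (?\<tau> u) = f (T u) * counit H v" if "u:car H" "v:car H" for u v
  using antipode_eval(2)[OF S that(2) lf_comp[OF f linmap_mult_left[OF Tc[OF that(1)]]]] Tc[OF that(1)]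
  by simp
 have "f (T x) = ((%u. f (T u)) \<star> counit H) x" using conv_counit_right[OF fT x] by simp
 also have "... = comult H x (%u v. comult H v (?\<tau> u))"
  unfolding conv_def by(rule comult_cong[OF x bil_prod[OF fT counit_lf] bil_cong[OF bil_prod[OF fT counit_lf]]]) (simp_all add: e)
 also have "... = comult H x (%u v. comult H u (%p q. ?\<tau> p q v))" by(rule coassoc[OF x tri, symmetric])
 also have "... = comult H x (%u v. 0)"
 proof -
  have "comult H u (%p q. ?\<tau> p q v) = 0" if uv: "u:car H" "v:car H" for u v
  proof -
   note g = lf_comp[OF f linmap_mult_right[OF Sc[OF uv(2)]]]
   have m: "bil (%p q. f (p\<otimes>q\<otimes>S v))" by(rule bil_of_mult[OF g])
   have b: "bil (%p q. f (T p\<otimes>q\<otimes>S v))" using bil_comp[OF m T linmap_id] by simp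
   have "comult H u (%p q. ?\<tau> p q v) = comult H u (%p q. f (T p\<otimes>q\<otimes>S v))"
    using Tc Sc[OF uv(2)] by(intro comult_cong[OF uv(1) bil_cong[OF b] b]) (simp_all add: alg_m_assoc)
   thus ?thesis using z[OF uv(1) g] by simp
  qed
  thus ?thesis by(intro comult_cong[OF x bil_cong[OF bil_null] bil_null]) simp_all
 qed
 also have "... = 0" by(rule comult_null[OF x])
 finally show "f (T x) = f \<zero>" using lf_zero[OF f] by simp
qed

lemma convolution_cancel':
 assumes S: "is_antipode H S" and T: "linmap T" "linmap T'"
  and eq: "!!x h. [|x:car H; lf h|] ==> comult H x (%u v. h (T u\<otimes>v)) = comult H x (%u v. h (T' u\<otimes>v))"
  and x: "x:car H"
 shows "T x = T' x"
proof(rule eq_if_minus_zero)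
 have Tc: "T u:car H" "T' u:car H" if "u:car H" for u using T that by(simp_all add: linmap_def)
 show "T x:car H" "T' x:car H" using Tc[OF x] by auto
 have "T x\<oplus>(- 1)\<odot>T' x = \<zero>"
 proof(rule convolution_cancel[OF S _ _ x])
  show "linmap (%x. T x\<oplus>(- 1)\<odot>T' x)" by(rule linmap_plus[OF T(1) linmap_scale[OF T(2)]])
  fix x h assume x: "x:car H" and h: "lf h"
  note m = bil_of_mult[OF h]
  have b: "bil (%u v. h (T u\<otimes>v))" "bil (%u v. h (T' u\<otimes>v))"
   using bil_comp[OF m T(1) linmap_id] bil_comp[OF m T(2) linmap_id] by auto
  note b' = bil_plus[OF b(1) bil_const[OF b(2), of "-1"]]
  have e: "h ((T u\<oplus>(- 1)\<odot>T' u)\<otimes>v) = h (T u\<otimes>v) + (- 1) * h (T' u\<otimes>v)" if uv: "u:car H" "v:car H" for u v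
   using Tc[OF uv(1)] uv(2) lf_add[OF h, of "T u\<otimes>v" "(- 1)\<odot>(T' u\<otimes>v)"] lf_smult[OF h, of "T' u\<otimes>v" "-1"]
   by(simp add: alg_l_distr smult_mult_left)
  have "comult H x (%u v. h ((T u\<oplus>(- 1)\<odot>T' u)\<otimes>v)) = comult H x (%u v. h (T u\<otimes>v) + (- 1) * h (T' u\<otimes>v))"
   by(rule comult_cong[OF x bil_cong[OF b' e] b' e])
  also have "... = comult H x (%u v. h (T u\<otimes>v)) + (- 1) * comult H x (%u v. h (T' u\<otimes>v))"
   unfolding tensor_plus[OF comult_closed[OF x] b(1) bil_const[OF b(2)]] tensor_const[OF comult_closed[OF x] b(2)] ..
  finally show "comult H x (%u v. h ((T u\<oplus>(- 1)\<odot>T' u)\<otimes>v)) = 0" using eq[OF x h] by simp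
 qed
 thus "T x\<ominus>T' x = \<zero>" using Tc[OF x] by(simp add: minus_eq_smult)
qed

lemma antipode_gl_mult:
 assumes S: "is_antipode H S" and g: "g:grouplikes H" and x: "x:car H"
 shows "S (g\<otimes>x)\<otimes>g = S x"
proof -
 note gc = gl_carrier[OF g] and lS = antipode_linmap[OF S]
 have Sc: "S u:car H" if "u:car H" for u using lS that by(simp add: linmap_def)
 let ?T1 = "%x. S (g\<otimes>x)\<otimes>g"
 have T1: "linmap ?T1" by(rule linmap_comp[OF linmap_mult_right[OF gc] linmap_comp[OF lS linmap_mult_left[OF gc]]])
 show ?thesis
 proof(rule convolution_cancel'[OF S T1 lS _ x])
  fix x h assume x: "x:car H" and h: "lf h"
  note m = bil_of_mult[OF h]
  have b: "bil (%u v. h (?T1 u\<otimes>v))" "bil (%u v. h (S u\<otimes>v))"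
   using bil_comp[OF m T1 linmap_id] bil_comp[OF m lS linmap_id] by auto
  have "comult H x (%u v. h (?T1 u\<otimes>v)) = comult H x (%u v. h (S (g\<otimes>u)\<otimes>(g\<otimes>v)))"
   using gc Sc by(intro comult_cong[OF x b(1) bil_mult_right[OF b(2) gc gc]]) (simp add: alg_m_assoc alg_m_closed)
  also have "... = comult H (g\<otimes>x) (%u v. h (S u\<otimes>v))"
   using comult_mult_eval[OF gc x b(2)] gl_comult[OF g bil_comult[OF x b(2)]] by simp
  finally show "comult H x (%u v. h (?T1 u\<otimes>v)) = comult H x (%u v. h (S u\<otimes>v))"
   using antipode_eval(1)[OF S x h] antipode_eval(1)[OF S _ h, of "g\<otimes>x"] gc x counit_mult[OF gc x] counit_gl[OF g]
   by simp
 qed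
qed

text \<open>As functions of \<open>x\<close>, both sides have the same convolution product with the identity. This special case of the
 antimultiplicativity of the antipode suffices, since the \<open>y\<^sub>i\<close> and the group-likes generate \<open>H\<close>.\<close>

lemma antipode_skew_mult:
 assumes S: "is_antipode H S" and g: "g:grouplikes H" and y: "y:car H"
  and com: "!!be. bil be ==> comult H y be = be g y + be y \<one>" and x: "x:car H"
 shows "S (y\<otimes>x) = (- 1)\<odot>(S (g\<otimes>x)\<otimes>y)"
proof -
 note gc = gl_carrier[OF g] and lS = antipode_linmap[OF S]
 have Sc: "S u:car H" if "u:car H" for u using lS that by(simp add: linmap_def)
 have e0: "counit H y = 0" by(rule counit_skew_prim[OF g y com])
 let ?T1 = "%x. S (y\<otimes>x)" and ?T2 = "%x. S (g\<otimes>x)\<otimes>y"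
 have T1: "linmap ?T1" by(rule linmap_comp[OF lS linmap_mult_left[OF y]])
 have T2: "linmap ?T2" by(rule linmap_comp[OF linmap_mult_right[OF y] linmap_comp[OF lS linmap_mult_left[OF gc]]])
 show ?thesis
 proof(rule convolution_cancel'[OF S T1 linmap_scale[OF T2] _ x])
  fix x h assume x: "x:car H" and h: "lf h"
  note m = bil_of_mult[OF h]
  have b: "bil (%u v. h (?T1 u\<otimes>v))" "bil (%u v. h (?T2 u\<otimes>v))" "bil (%u v. h (S u\<otimes>v))"
   using bil_comp[OF m T1 linmap_id] bil_comp[OF m T2 linmap_id] bil_comp[OF m lS linmap_id] by auto
  have "comult H (y\<otimes>x) (%u v. h (S u\<otimes>v)) = comult H x (%u v. h (S (g\<otimes>u)\<otimes>(y\<otimes>v))) + comult H x (%u v. h (S (y\<otimes>u)\<otimes>(\<one> \<otimes> v)))"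
   using comult_mult_eval[OF y x b(3)] com[OF bil_comult[OF x b(3)]] by simp
  moreover have "comult H x (%u v. h (S (g\<otimes>u)\<otimes>(y\<otimes>v))) = comult H x (%u v. h (?T2 u\<otimes>v))"
   using gc y Sc by(intro comult_cong[OF x bil_mult_right[OF b(3) gc y] b(2)]) (simp add: alg_m_assoc alg_m_closed)
  moreover have "comult H x (%u v. h (S (y\<otimes>u)\<otimes>(\<one> \<otimes> v))) = comult H x (%u v. h (?T1 u\<otimes>v))"
   by(intro comult_cong[OF x bil_mult_right[OF b(3) y alg_one_closed] b(1)]) (simp add: alg_l_one)
  moreover have "comult H (y\<otimes>x) (%u v. h (S u\<otimes>v)) = 0"
   using antipode_eval(1)[OF S _ h] y x counit_mult[OF y x] e0 by simp
  moreover have "comult H x (%u v. h (((- 1)\<odot>?T2 u)\<otimes>v)) = (- 1) * comult H x (%u v. h (?T2 u\<otimes>v))"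
  proof -
   note b' = bil_const[OF b(2), of "-1"]
   have e: "h (((- 1)\<odot>?T2 u)\<otimes>v) = (- 1) * h (?T2 u\<otimes>v)" if "u:car H" "v:car H" for u v
    using lf_smult[OF h, of "?T2 u\<otimes>v" "-1"] Sc gc y that by(simp add: smult_mult_left)
   show ?thesis using comult_cong[OF x bil_cong[OF b' e] b' e] tensor_const[OF comult_closed[OF x] b(2), of "-1"] by simp
  qed
  ultimately have s: "comult H x (%u v. h (?T2 u\<otimes>v)) + comult H x (%u v. h (?T1 u\<otimes>v)) = 0"
   and t: "comult H x (%u v. h (((- 1)\<odot>?T2 u)\<otimes>v)) = - comult H x (%u v. h (?T2 u\<otimes>v))" by auto
  show "comult H x (%u v. h (?T1 u\<otimes>v)) = comult H x (%u v. h (((- 1)\<odot>?T2 u)\<otimes>v))"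
   unfolding t using s by(simp add: add_eq_0_iff)
 qed
qed

end

context nontrivial_nichols_type
begin

lemma antipode_mult_exists:
 assumes S: "is_antipode H S"
 shows "a:car H ==> EX s:car H. ALL x:car H. S (a\<otimes>x) = S x\<otimes>s"
proof -
 note lS = antipode_linmap[OF S]
 have Sc: "S u:car H" if "u:car H" for u using lS that by(simp add: linmap_def)
 let ?N = "{a:car H. EX s:car H. ALL x:car H. S (a\<otimes>x) = S x\<otimes>s}"
 have N: "subspace ?N H"
 proof(rule subI)
  show "\<zero>:?N"
  proof(intro CollectI conjI bexI ballI)
   show z: "\<zero>:car H" "\<zero>:car H" by auto
   fix x assume x: "x:car H"
   have "S \<zero> = \<zero>" using lS smult_simps(2)[OF z(1)] smult_simps(2)[OF Sc[OF z(1)]] z(1) unfolding linmap_def by metis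
   thus "S (\<zero> \<otimes> x) = S x\<otimes>\<zero>" using x Sc[OF x] by simp
  qed
 next
  fix a b assume "a:?N" "b:?N"
  then obtain s t where st: "a:car H" "b:car H" "s:car H" "t:car H"
   "ALL x:car H. S (a\<otimes>x) = S x\<otimes>s" "ALL x:car H. S (b\<otimes>x) = S x\<otimes>t" by auto
  hence "ALL x:car H. S ((a\<oplus>b)\<otimes>x) = S x\<otimes>(s\<oplus>t)"
   using lS by(simp add: linmap_def alg_l_distr alg_r_distr)
  thus "a\<oplus>b:?N" using st by auto
 next
  fix c a assume "a:?N"
  then obtain s where s: "a:car H" "s:car H" "ALL x:car H. S (a\<otimes>x) = S x\<otimes>s" by auto
  hence "ALL x:car H. S ((c\<odot>a)\<otimes>x) = S x\<otimes>(c\<odot>s)"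
   using lS by(simp add: linmap_def smult_mult_left smult_mult_right)
  thus "c\<odot>a:?N" using s by auto
 qed auto
 have g: "ALL x:car H. S (al g\<otimes>x) = S x\<otimes>al (inv_G g)" if g: "g:grouplikes H" for g
 proof
  fix x assume x: "x:car H"
  note c = al_carrier(1)[OF g] al_carrier(1)[OF inv_G(1)[OF g]]
  have "S (al g\<otimes>x)\<otimes>al g\<otimes>al (inv_G g) = S x\<otimes>al (inv_G g)"
   using antipode_gl_mult[OF S al_gl[OF g] x] by simp
  thus "S (al g\<otimes>x) = S x\<otimes>al (inv_G g)"
   using c x Sc al_inv(1)[OF g] by(simp add: alg_m_assoc)
 qed
 have m: "ymono (w, g):?N" if g': "g:grouplikes H" and "w:words" for w g
  using that(2)
 proof(induction w)
  case Nil
  show ?case using g[OF g'] al_carrier(1)[OF g'] al_carrier(1)[OF inv_G(1)[OF g']] by(auto simp: ymono_simps)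
 next
  case (Cons i w)
  hence i: "i:{1, 2}" and w: "w:words" by(auto simp: Y.words_simps)
  obtain s where s: "s:car H" "ALL x:car H. S (ymono (w, g)\<otimes>x) = S x\<otimes>s" using Cons.IH[OF w] by auto
  note c = ymono_carrier[OF w g'] yy_carrier[OF i] al_carrier(1)[OF ga_gl[OF i]] al_carrier(1)[OF inv_G(1)[OF ga_gl[OF i]]]
  let ?t = "s\<otimes>((- 1)\<odot>(al (inv_G (ga i))\<otimes>yy i))"
  have "S (ymono (i # w, g)\<otimes>x) = S x\<otimes>?t" if x: "x:car H" for x
  proof -
   have mx: "ymono (w, g)\<otimes>x:car H" using c x by simp
   have "S (yy i\<otimes>(ymono (w, g)\<otimes>x)) = (- 1)\<odot>(S (al (ga i)\<otimes>(ymono (w, g)\<otimes>x))\<otimes>yy i)"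
    by(rule antipode_skew_mult[OF S al_gl[OF ga_gl[OF i]] c(2) yy(4)[OF i] mx])
   also have "S (al (ga i)\<otimes>(ymono (w, g)\<otimes>x)) = S x\<otimes>s\<otimes>al (inv_G (ga i))"
    using g[OF ga_gl[OF i]] mx s(2) x by simp
   finally show ?thesis using c x s(1) Sc[OF x] by(simp add: ymono_simps alg_m_assoc smult_mult_right)
  qed
  moreover have "?t:car H" using c s(1) by simp
  moreover have "ymono (i # w, g):car H" using c by(simp add: ymono_simps)
  ultimately show ?case by auto
 qed
 assume "a:car H"
 then obtain x where x: "x:car Y.TB" "Phi x = a" using Phi_surj by auto
 have "Phi x:?N" by(rule Phi_mem[OF x(1) N]) (use TB_supp[OF x(1)] m in blast)
 thus ?thesis using x(2) by simp
qed

text \<open>Stability under the antipode holds because \<open>S(a x) = S(x) s\<close> with \<open>s\<close> depending only on \<open>a\<close>, and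
 \<open>S(z b) = - S(g b) z\<close> again contains the factor \<open>z\<close>.\<close>

lemma hopf_ideal_skew_prim:
 assumes g: "g:grouplikes H" and z: "z:car H" and com: "!!be. bil be ==> comult H z be = be g z + be z \<one>"
 shows "hopf_ideal H (lspan H {a\<otimes>z\<otimes>b | a b. a:car H & b:car H})"
proof -
 let ?B = "{a\<otimes>z\<otimes>b | a b. a:car H & b:car H}"
 let ?I = "lspan H ?B"
 have B: "?B \<subseteq> car H" using z by auto
 note I = lspan_sub[OF B] and gc = gl_carrier[OF g]
 have ind: "?I \<subseteq> N" if "subspace N H" "!!a b. [|a:car H; b:car H|] ==> a\<otimes>z\<otimes>b:N" for N
  by(rule lspan_least[OF that(1)]) (use that(2) in blast)
 have gen: "a\<otimes>z\<otimes>b:?I" if "a:car H" "b:car H" for a b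
  by(rule subsetD[OF lspan_superset]) (use that in blast)
 have IH: "x:car H" if "x:?I" for x using sub_mem[OF I that] .
 have pre: "subspace {x:car H. T x:?I} H" if T: "linmap T" for T
 proof(rule subI)
  have "T \<zero> = \<zero>"
   using T smult_simps(2)[OF sub_zero[OF whole_sub]] smult_simps(2)[of "T \<zero>"] sub_zero[OF whole_sub]
   unfolding linmap_def by metis
  thus "\<zero>:{x:car H. T x:?I}" using sub_zero[OF I] by simp
 qed (use T sub_add[OF I] sub_smult[OF I] in \<open>auto simp: linmap_def\<close>)
 have "ideal ?I H"
 proof(rule idealI[OF alg_ring])
  show "subgroup ?I (add_monoid H)" using I by(simp add: submodule_def)
  fix x c assume x: "x:?I" and c: "c:car H"
  have "a\<otimes>z\<otimes>b:{x:car H. c\<otimes>x:?I}" if ab: "a:car H" "b:car H" for a b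
  proof -
   have "c\<otimes>(a\<otimes>z\<otimes>b) = c\<otimes>a\<otimes>z\<otimes>b" using ab c z by(simp add: alg_m_assoc)
   thus ?thesis using gen[of "c\<otimes>a" b] ab c z by simp
  qed
  from ind[OF pre[OF linmap_mult_left[OF c]] this] x show "c\<otimes>x:?I" by auto
  have "a\<otimes>z\<otimes>b:{x:car H. x\<otimes>c:?I}" if ab: "a:car H" "b:car H" for a b
  proof -
   have "a\<otimes>z\<otimes>b\<otimes>c = a\<otimes>z\<otimes>(b\<otimes>c)" using ab c z by(simp add: alg_m_assoc)
   thus ?thesis using gen[of a "b\<otimes>c"] ab c z by simp
  qed
  from ind[OF pre[OF linmap_mult_right[OF c]] this] x show "x\<otimes>c:?I" by auto
 qed
 moreover have "comult H x:tensors H H (?I\<times>car H \<union> car H\<times>?I)" if x: "x:?I" for x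
  unfolding tensors_sum_iff[OF I I comult_closed[OF IH[OF x]]]
 proof(intro allI impI)
  fix f h assume fh: "lf f & lf h & (ALL x:?I. f x = 0) & (ALL y:?I. h y = 0)"
  hence f: "lf f" "!!a b. [|a:car H; b:car H|] ==> f (a\<otimes>z\<otimes>b) = 0"
   and h: "lf h" "!!a b. [|a:car H; b:car H|] ==> h (a\<otimes>z\<otimes>b) = 0" using gen by auto
  note fb = bil_prod[OF f(1) h(1)]
  have "(f \<star> h) (a\<otimes>z\<otimes>b) = 0" if ab: "a:car H" "b:car H" for a b
  proof -
   have inner: "comult H z (%u' v'. comult H b (%p q. f (u\<otimes>u'\<otimes>p) * h (v\<otimes>v'\<otimes>q))) = 0"
    if uv: "u:car H" "v:car H" for u v
   proof -
    note b2 = bil_comult[OF ab(2) fb]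
    have "comult H z (%u' v'. comult H b (%p q. f (u\<otimes>u'\<otimes>p) * h (v\<otimes>v'\<otimes>q)))
     = comult H b (%p q. f (u\<otimes>g\<otimes>p) * h (v\<otimes>z\<otimes>q)) + comult H b (%p q. f (u\<otimes>z\<otimes>p) * h (v\<otimes>\<one> \<otimes> q))"
     using com[OF bil_mult_right[OF b2 uv]] by simp
    moreover have "comult H b (%p q. f (u\<otimes>g\<otimes>p) * h (v\<otimes>z\<otimes>q)) = comult H b (%p q. 0)"
     by(rule comult_cong[OF ab(2) bil_cong[OF bil_null] bil_null]) (simp_all add: h(2) uv)
    moreover have "comult H b (%p q. f (u\<otimes>z\<otimes>p) * h (v\<otimes>\<one> \<otimes> q)) = comult H b (%p q. 0)"
     by(rule comult_cong[OF ab(2) bil_cong[OF bil_null] bil_null]) (simp_all add: f(2) uv)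
    ultimately show ?thesis using comult_null[OF ab(2)] by simp
   qed
   have az: "a\<otimes>z:car H" using ab z by simp
   have "(f \<star> h) (a\<otimes>z\<otimes>b) = comult H a (%u v. comult H z (%u' v'. comult H b (%p q. f (u\<otimes>u'\<otimes>p) * h (v\<otimes>v'\<otimes>q))))"
    unfolding conv_def comult_mult_eval[OF az ab(2) fb] comult_mult_eval[OF ab(1) z bil_comult[OF ab(2) fb]] ..
   also have "... = comult H a (%u v. 0)"
    by(rule comult_cong[OF ab(1) bil_cong[OF bil_null] bil_null]) (simp_all add: inner)
   finally show ?thesis using comult_null[OF ab(1)] by simp
  qed
  hence "?I \<subseteq> {x:car H. (f \<star> h) x = 0}"
   by(intro ind lf_kernel conv_lf) (use z in \<open>auto simp: alg_m_closed\<close>)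
  thus "comult H x (%x y. f x * h y) = 0" using x unfolding conv_def by auto
 qed
 moreover have "counit H x = 0" if x: "x:?I" for x
 proof -
  have "?I \<subseteq> {x:car H. counit H x = 0}"
   by(intro ind lf_kernel counit_lf)
    (use z counit_skew_prim[OF g z com] in \<open>simp_all add: alg_m_closed counit_mult\<close>)
  thus ?thesis using x by auto
 qed
 moreover have "S ` ?I \<subseteq> ?I" if S: "is_antipode H S" for S
 proof -
  have Sc: "S u:car H" if "u:car H" for u using antipode_linmap[OF S] that by(simp add: linmap_def)
  have "a\<otimes>z\<otimes>b:{x:car H. S x:?I}" if ab: "a:car H" "b:car H" for a b
  proof -
   obtain s where s: "s:car H" "ALL x:car H. S (a\<otimes>x) = S x\<otimes>s" using antipode_mult_exists[OF S ab(1)] by auto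
   have zb: "z\<otimes>b:car H" "S (g\<otimes>b):car H" using z ab gc Sc by auto
   have "S (a\<otimes>z\<otimes>b) = S (z\<otimes>b)\<otimes>s" using s(2) ab z by(simp add: alg_m_assoc)
   also have "S (z\<otimes>b) = (- 1)\<odot>(S (g\<otimes>b)\<otimes>z)" by(rule antipode_skew_mult[OF S g z com ab(2)])
   finally have "S (a\<otimes>z\<otimes>b) = (- 1)\<odot>(S (g\<otimes>b)\<otimes>z\<otimes>s)" using zb s(1) z by(simp add: smult_mult_left)
   thus ?thesis using sub_smult[OF I gen[OF zb(2) s(1)]] ab z by simp
  qed
  from ind[OF pre[OF antipode_linmap[OF S]] this] show ?thesis by auto
 qed
 ultimately show ?thesis unfolding hopf_ideal_def by simp
qed

end

section \<open>The action on a field\<close>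

locale field_action = nontrivial_nichols_type H ga ch F
 for H :: "('k::field_char_0, 'a) bialg" (structure) and ga ch F +
 fixes L :: "('k, 'l) module" and act :: "'a => 'l => 'l"
 assumes L_field: "field L" and action: "module_algebra H L act" and inner: "inner_faithful H L act"

sublocale field_action \<subseteq> LF: field L
 by(rule L_field)

sublocale field_action \<subseteq> LA: k_algebra L
 using action by(simp add: module_algebra_def)

context field_action
begin

abbreviation lmult (infixl \<open>\<bullet>\<close> 70) where "a \<bullet> b \<equiv> a \<otimes>\<^bsub>L\<^esub> b"
abbreviation ladd (infixl \<open>\<oplus>\<^sub>L\<close> 65) where "a \<oplus>\<^sub>L b \<equiv> a \<oplus>\<^bsub>L\<^esub> b"
abbreviation lminus (infixl \<open>\<ominus>\<^sub>L\<close> 65) where "a \<ominus>\<^sub>L b \<equiv> a \<ominus>\<^bsub>L\<^esub> b"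
abbreviation lsmult (infixl \<open>\<odot>\<^sub>L\<close> 70) where "c \<odot>\<^sub>L a \<equiv> c \<odot>\<^bsub>L\<^esub> a"
abbreviation lzero (\<open>\<zero>\<^sub>L\<close>) where "\<zero>\<^sub>L \<equiv> \<zero>\<^bsub>L\<^esub>"
abbreviation lone (\<open>\<one>\<^sub>L\<close>) where "\<one>\<^sub>L \<equiv> \<one>\<^bsub>L\<^esub>"

lemma act_closed: "[|h:car H; a:car L|] ==> act h a:car L"
 using action by(simp add: module_algebra_def)

lemma act_simps:
 assumes "h:car H" "a:car L"
 shows "h':car H ==> act (h\<oplus>h') a = act h a \<oplus>\<^sub>L act h' a"
  "h':car H ==> act (h\<otimes>h') a = act h (act h' a)"
  "b:car L ==> act h (a \<oplus>\<^sub>L b) = act h a \<oplus>\<^sub>L act h b"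
  "act (c\<odot>h) a = c \<odot>\<^sub>L act h a" "act h (c \<odot>\<^sub>L a) = c \<odot>\<^sub>L act h a" "act \<one> a = a"
  "act h \<one>\<^sub>L = counit H h \<odot>\<^sub>L \<one>\<^sub>L"
 using action assms by(simp_all add: module_algebra_def)

lemma act_product:
 "[|h:car H; a:car L; b:car L; sweedler H h ps|] ==>
  act h (a\<bullet>b) = list_sum L (%(u, v). act u a\<bullet>act v b) ps"
 using action by(simp add: module_algebra_def)

lemma sweedlerI:
 assumes "x:car H" "set ps \<subseteq> car H\<times>car H" "!!be. bil be ==> comult H x be = (\<Sum>(u, v)\<leftarrow>ps. be u v)"
 shows "sweedler H x ps"
proof -
 have "comult H x = tensor_sum H H ps"
 proof(rule tensor_eqI[OF comult_closed[OF assms(1)]])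
  show "tensor_sum H H ps:tensors H H (car H\<times>car H)" unfolding tensors_def using assms(2) by auto
  fix f g assume "lf f" "lf g"
  from bil_prod[OF this] show "comult H x (%x y. f x * g y) = tensor_sum H H ps (%x y. f x * g y)"
   using assms(3)[of "%x y. f x * g y"] by(simp add: tensor_sum_eval)
 qed
 thus ?thesis using assms(2) by(simp add: sweedler_def)
qed

definition sig :: "'a => 'l => 'l" where "sig g a = act (al g) a"

lemma sig_closed [simp]: "[|g:grouplikes H; a:car L|] ==> sig g a:car L"
 unfolding sig_def by(rule act_closed[OF al_carrier(1)])

lemma sig_simps:
 assumes g: "g:grouplikes H" and a: "a:car L"
 shows "b:car L ==> sig g (a \<oplus>\<^sub>L b) = sig g a \<oplus>\<^sub>L sig g b"
  "b:car L ==> sig g (a\<bullet>b) = sig g a\<bullet>sig g b"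
  "sig g (c \<odot>\<^sub>L a) = c \<odot>\<^sub>L sig g a" "sig g \<one>\<^sub>L = \<one>\<^sub>L" "sig \<one> a = a"
  "h:grouplikes H ==> sig g (sig h a) = sig (g\<otimes>h) a"
proof -
 note c = al_carrier(1)[OF g]
 show "b:car L ==> sig g (a \<oplus>\<^sub>L b) = sig g a \<oplus>\<^sub>L sig g b" "sig g (c \<odot>\<^sub>L a) = c \<odot>\<^sub>L sig g a" for c
  unfolding sig_def using act_simps(3,5)[OF c a] by auto
 show "sig \<one> a = a" unfolding sig_def al_one using act_simps(6)[OF c a] .
 show "sig g \<one>\<^sub>L = \<one>\<^sub>L"
  unfolding sig_def using act_simps(7)[OF c a] counit_gl[OF al_gl[OF g]] by simp
 show "sig g (sig h a) = sig (g\<otimes>h) a" if h: "h:grouplikes H"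
  unfolding sig_def using act_simps(2)[OF c a al_carrier(1)[OF h]] al_mult[OF g h] by simp
 show "sig g (a\<bullet>b) = sig g a\<bullet>sig g b" if b: "b:car L"
 proof -
  have s: "sweedler H (al g) [(al g, al g)]"
   using c gl_comult[OF al_gl[OF g]] by(intro sweedlerI) simp_all
  show ?thesis unfolding sig_def using act_product[OF c a b s] act_closed[OF c a] act_closed[OF c b] by(simp add: list_sum_def)
 qed
qed

lemma sig_zero: "g:grouplikes H ==> sig g \<zero>\<^sub>L = \<zero>\<^sub>L"
 using sig_simps(3)[of g "\<zero>\<^sub>L" 0] by simp

lemma sig_minus: "[|g:grouplikes H; a:car L; b:car L|] ==> sig g (a \<ominus>\<^sub>L b) = sig g a \<ominus>\<^sub>L sig g b"
 using sig_simps(1)[of g a "(- 1) \<odot>\<^sub>L b"] sig_simps(3)[of g b "-1"] by(simp add: LA.minus_eq_smult)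

lemma sig_inverse: "[|g:grouplikes H; a:car L|] ==> sig g (sig (inv_G g) a) = a"
 using sig_simps(6)[of g a "inv_G g"] inv_G[of g] sig_simps(5)[of g a] by simp

lemma skew_leibniz:
 assumes i: "i:{1, 2}" and a: "a:car L" and b: "b:car L"
 shows "act (yy i) (a\<bullet>b) = sig (ga i) a\<bullet>act (yy i) b \<oplus>\<^sub>L act (yy i) a\<bullet>b"
proof -
 note c = yy_carrier[OF i] and c' = al_carrier(1)[OF ga_gl[OF i]]
 have "sweedler H (yy i) [(al (ga i), yy i), (yy i, \<one>)]"
  using c c' alg_one_closed yy(4)[OF i] by(intro sweedlerI) simp_all
 from act_product[OF c a b this] show ?thesis
  using act_closed[OF c a] act_simps(6)[OF c b] b by(simp add: list_sum_def sig_def)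
qed

lemma skew_prim_faithful:
 assumes g: "g:grouplikes H" and z: "z:car H" and com: "!!be. bil be ==> comult H z be = be g z + be z \<one>"
  and null: "!!a. a:car L ==> act z a = \<zero>\<^sub>L"
 shows "z = \<zero>"
proof -
 let ?B = "{a\<otimes>z\<otimes>b | a b. a:car H & b:car H}"
 have "subspace {x:car H. ALL a:car L. act x a = \<zero>\<^sub>L} H"
 proof(rule subI)
  show "\<zero>:{x:car H. ALL a:car L. act x a = \<zero>\<^sub>L}"
   using act_simps(4)[OF z, of _ 0] smult_simps(2)[OF z] act_closed[OF z] by simp
 qed (use act_simps(1,4) LA.smult_eq_zero_iff in auto)
 moreover have "a\<otimes>z\<otimes>b:car H & (ALL c:car L. act (a\<otimes>z\<otimes>b) c = \<zero>\<^sub>L)"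
  if ab: "a:car H" "b:car H" for a b
 proof(intro conjI ballI)
  have az: "a\<otimes>z:car H" using ab z by simp
  show "a\<otimes>z\<otimes>b:car H" using az ab by simp
  fix c assume c: "c:car L"
  have "act (a\<otimes>z\<otimes>b) c = act a (act z (act b c))"
   using act_simps(2)[OF az c ab(2)] act_simps(2)[OF ab(1) act_closed[OF ab(2) c] z] by simp
  also have "... = \<zero>\<^sub>L"
   using null[OF act_closed[OF ab(2) c]] act_simps(5)[OF ab(1), of "\<zero>\<^sub>L" 0] act_closed[OF ab(1), of "\<zero>\<^sub>L"] by simp
  finally show "act (a\<otimes>z\<otimes>b) c = \<zero>\<^sub>L" .
 qed
 ultimately have "lspan H ?B \<subseteq> {x:car H. ALL a:car L. act x a = \<zero>\<^sub>L}"
  by(intro lspan_least) auto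
 hence "ALL h:lspan H ?B. ALL a:car L. act h a = \<zero>\<^sub>L" by auto
 hence triv: "lspan H ?B = {\<zero>}"
  using inner hopf_ideal_skew_prim[OF g z com] unfolding inner_faithful_def by(elim allE impE) (rule conjI)
 have "\<one> \<otimes> z\<otimes>\<one>:lspan H ?B" by(rule subsetD[OF lspan_superset]) (use alg_one_closed in blast)
 thus ?thesis using triv z by simp
qed

text \<open>If \<open>g\<close> acts trivially, then the skew-primitive element \<open>1 - g\<close> acts by zero.\<close>

lemma sig_faithful:
 assumes g: "g:grouplikes H" and fixed: "!!a. a:car L ==> sig g a = a"
 shows "g = \<one>"
proof -
 note c = al_carrier(1)[OF g]
 let ?z = "\<one> \<oplus> (- 1)\<odot>al g"
 have z: "?z:car H" using c by simp
 have "?z = \<zero>"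
 proof(rule skew_prim_faithful[OF al_gl[OF g] z])
  fix be assume b: "bil be"
  have "comult H ?z be = be \<one> \<one> - be (al g) (al g)"
   using c gl_comult[OF al_gl[OF g] b] gl_comult[OF one_gl b] comult_add[of \<one> "(- 1)\<odot>al g"] comult_smult[OF c, of "-1"] by simp
  moreover have "be (al g) ?z = be (al g) \<one> - be (al g) (al g)" "be ?z \<one> = be \<one> \<one> - be (al g) \<one>"
   using c bil_add1[OF b] bil_add2[OF b] bil_smult1[OF b] bil_smult2[OF b] by auto
  ultimately show "comult H ?z be = be (al g) ?z + be ?z \<one>" by simp
 next
  fix a assume a: "a:car L"
  have "act ?z a = a \<oplus>\<^sub>L (- 1) \<odot>\<^sub>L a"
   using act_simps(1)[OF alg_one_closed a, of "(- 1)\<odot>al g"] act_simps(4)[OF c a, of "-1"] act_simps(6)[OF c a] fixed[OF a] c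
   by(simp add: sig_def)
  thus "act ?z a = \<zero>\<^sub>L" using a LA.smult_simps(4)[OF a, of 1 "-1"] by simp
 qed
 hence "\<one> = al g" using eq_if_minus_zero[of \<one> "al g"] c by(simp add: minus_eq_smult)
 thus ?thesis using inj_onD[OF al_inj, of g \<one>] g one_gl al_one by simp
qed

lemma ga_nontrivial: "i:{1, 2} ==> ga i ~= \<one>"
 using nontrivial[of i] Y.ch_one[of i] by auto

lemma yy_nonzero: "i:{1, 2} ==> yy i ~= \<zero>"
proof
 assume i: "i:{1, 2}" and z: "yy i = \<zero>"
 have w: "[i]:words" using i by(simp add: Y.words_simps)
 have "Phi (single ([i], \<one>)) = \<zero>"
  using Phi_single[OF w one_gl] z al_one by(simp add: ymono_simps)
 moreover have "single ([i], \<one>):car Y.TB" using Y.single_closed[OF w, of \<one>] one_gl by simp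
 ultimately have "single ([i], \<one>) = (%z. 0 :: 'k)" by(intro Phi_inj_short) (auto simp: single_def split: if_splits)
 from fun_cong[OF this, of "([i], \<one>)"] show False by(simp add: single_def)
qed

text \<open>Expanding \<open>y\<^sub>i(ab) = y\<^sub>i(ba)\<close> shows that \<open>y\<^sub>i(a) / (a - \<sigma>(a))\<close> with \<open>\<sigma> = \<sigma>\<^sub>g, g = g\<^sub>i\<close>, does not depend on \<open>a\<close>;
 this quotient is \<open>w\<close>.\<close>

lemma weight_exists:
 assumes i: "i:{1, 2}"
 shows "EX w:car L. w ~= \<zero>\<^sub>L & (ALL a:car L. act (yy i) a = w\<bullet>(a \<ominus>\<^sub>L sig (ga i) a)) &
  (ALL g:grouplikes H. sig g w = ch i g \<odot>\<^sub>L w)"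
proof -
 note gai = ga_gl[OF i] and yc = yy_carrier[OF i]
 obtain b where b: "b:car L" "sig (ga i) b ~= b" using sig_faithful[OF gai] ga_nontrivial[OF i] by auto
 let ?s = "sig (ga i)" and ?y = "act (yy i)"
 define d where "d = b \<ominus>\<^sub>L ?s b"
 have d: "d:car L" "d ~= \<zero>\<^sub>L" using b gai by(auto simp: d_def)
 have y: "?y a:car L" if "a:car L" for a using act_closed[OF yc that] .
 have di: "inv\<^bsub>L\<^esub> d:car L" "d\<bullet>inv\<^bsub>L\<^esub> d = \<one>\<^sub>L" using d LF.field_Units by auto
 define w where "w = ?y b\<bullet>inv\<^bsub>L\<^esub> d"
 have w: "w:car L" using y[OF b(1)] di by(simp add: w_def)
 have yw: "?y a = w\<bullet>(a \<ominus>\<^sub>L ?s a)" if a: "a:car L" for a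
 proof -
  note c = y[OF a] y[OF b(1)] sig_closed[OF gai a] sig_closed[OF gai b(1)] a b(1) d(1) di(1)
  have "?s a\<bullet>?y b \<oplus>\<^sub>L ?y a\<bullet>b = ?s b\<bullet>?y a \<oplus>\<^sub>L ?y b\<bullet>a"
   using skew_leibniz[OF i a b(1)] skew_leibniz[OF i b(1) a] LF.m_comm[OF a b(1)] by simp
  moreover have "?y a\<bullet>d = (?s a\<bullet>?y b \<oplus>\<^sub>L ?y a\<bullet>b) \<ominus>\<^sub>L (?s a\<bullet>?y b \<oplus>\<^sub>L ?s b\<bullet>?y a)" unfolding d_def using c by algebra
  moreover have "?y b\<bullet>(a \<ominus>\<^sub>L ?s a) = (?s b\<bullet>?y a \<oplus>\<^sub>L ?y b\<bullet>a) \<ominus>\<^sub>L (?s a\<bullet>?y b \<oplus>\<^sub>L ?s b\<bullet>?y a)" using c by algebra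
  ultimately have "?y a\<bullet>d = ?y b\<bullet>(a \<ominus>\<^sub>L ?s a)" by simp
  hence "?y a\<bullet>d\<bullet>inv\<^bsub>L\<^esub> d = ?y b\<bullet>(a \<ominus>\<^sub>L ?s a)\<bullet>inv\<^bsub>L\<^esub> d" by simp
  moreover have "?y a\<bullet>d\<bullet>inv\<^bsub>L\<^esub> d = ?y a" using c di(2) by(simp add: LF.m_assoc)
  moreover have "?y b\<bullet>(a \<ominus>\<^sub>L ?s a)\<bullet>inv\<^bsub>L\<^esub> d = w\<bullet>(a \<ominus>\<^sub>L ?s a)" unfolding w_def using c by algebra
  ultimately show ?thesis by simp
 qed
 have "w ~= \<zero>\<^sub>L"
 proof
  assume "w = \<zero>\<^sub>L"
  hence "?y a = \<zero>\<^sub>L" if "a:car L" for a using yw[OF that] that gai by simp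
  from skew_prim_faithful[OF al_gl[OF gai] yc yy(4)[OF i] this] show False using yy_nonzero[OF i] by simp
 qed
 moreover have "sig g w = ch i g \<odot>\<^sub>L w" if g: "g:grouplikes H" for g
 proof -
  define a where "a = sig (inv_G g) b"
  have a: "a:car L" "sig g a = b" using b(1) sig_inverse[OF g b(1)] inv_G(1)[OF g] by(simp_all add: a_def)
  have sc: "sig g (?s a) = ?s b" using sig_simps(6)[OF g a(1) gai] sig_simps(6)[OF gai a(1) g] G_comm[OF g gai] a(2) by simp
  have "sig g (?y a) = sig g w\<bullet>d"
   using yw[OF a(1)] sig_simps(2)[OF g w, of "a \<ominus>\<^sub>L ?s a"] sig_minus[OF g a(1), of "?s a"] a gai sc by(simp add: d_def)
  moreover have "sig g (?y a) = ch i g \<odot>\<^sub>L ?y b"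
  proof -
   have "sig g (?y a) = act (al g\<otimes>yy i) a" unfolding sig_def using act_simps(2)[OF al_carrier(1)[OF g] a(1) yc] by simp
   also have "... = ch i g \<odot>\<^sub>L act (yy i\<otimes>al g) a"
    unfolding yy(3)[OF i g] by(rule act_simps(4)) (use yc al_carrier(1)[OF g] a in \<open>simp_all add: alg_m_closed\<close>)
   also have "act (yy i\<otimes>al g) a = ?y b" using act_simps(2)[OF yc a(1) al_carrier(1)[OF g]] a(2) by(simp add: sig_def)
   finally show ?thesis .
  qed
  ultimately have "sig g w\<bullet>d = (ch i g \<odot>\<^sub>L w)\<bullet>d"
   using yw[OF b(1)] w d(1) by(simp add: d_def[symmetric] LA.smult_mult_left)
  thus ?thesis using LF.m_rcancel[of d "sig g w" "ch i g \<odot>\<^sub>L w"] d w g by simp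
 qed
 ultimately show ?thesis using w yw by auto
qed

definition ww :: "nat => 'l" where
 "ww i = (SOME w. w:car L & w ~= \<zero>\<^sub>L & (ALL a:car L. act (yy i) a = w\<bullet>(a \<ominus>\<^sub>L sig (ga i) a)) &
  (ALL g:grouplikes H. sig g w = ch i g \<odot>\<^sub>L w))"

lemma ww:
 assumes "i:{1, 2}"
 shows "ww i:car L" "ww i ~= \<zero>\<^sub>L" "a:car L ==> act (yy i) a = ww i\<bullet>(a \<ominus>\<^sub>L sig (ga i) a)"
  "g:grouplikes H ==> sig g (ww i) = ch i g \<odot>\<^sub>L ww i"
 using someI_ex[OF weight_exists[OF assms, unfolded Bex_def]] unfolding ww_def[symmetric] by blast+

end

context field_action
begin

text \<open>Dedekind's lemma: the automorphisms of \<open>L\<close> by which the group-likes act are linearly independent.\<close>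

lemma sig_independent:
 "[|finite S; S \<subseteq> grouplikes H; !!g. g:S ==> c g:car L;
  !!a. a:car L ==> (\<Oplus>\<^bsub>L\<^esub>g\<in>S. c g\<bullet>sig g a) = \<zero>\<^sub>L; g:S|] ==> c g = \<zero>\<^sub>L"
proof(induction S arbitrary: c g rule: finite_induct)
 case (insert h S)
 have c: "c h:car L" "!!g. g:S ==> c g:car L" using insert.prems(2) by auto
 have h: "h:grouplikes H" and S: "!!g. g:S ==> g:grouplikes H" using insert.prems(1) by auto
 have split: "(\<Oplus>\<^bsub>L\<^esub>g\<in>insert h S. c g\<bullet>sig g a) = c h\<bullet>sig h a \<oplus>\<^sub>L (\<Oplus>\<^bsub>L\<^esub>g\<in>S. c g\<bullet>sig g a)"
  if a: "a:car L" for a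
  by(rule LF.finsum_insert[OF insert.hyps]) (use c h S a in auto)
 have zero: "c g = \<zero>\<^sub>L" if g: "g:S" for g
 proof(rule ccontr)
  assume nz: "c g ~= \<zero>\<^sub>L"
  have gh: "inv_G h\<otimes>g ~= \<one>"
  proof
   assume "inv_G h\<otimes>g = \<one>"
   hence "h\<otimes>(inv_G h\<otimes>g) = h" using gl_carrier[OF h] by simp
   hence "g = h" using inv_G(2)[OF h] gl_carrier[OF h] gl_carrier[OF S[OF g]] gl_carrier[OF inv_G(1)[OF h]]
    by(simp add: alg_m_assoc[symmetric])
   thus False using g insert.hyps(2) by simp
  qed
  have ihg: "inv_G h\<otimes>g:grouplikes H" by(rule gl_mult[OF inv_G(1)[OF h] S[OF g]])
  obtain b where b: "b:car L" "sig (inv_G h\<otimes>g) b ~= b" using sig_faithful[OF ihg] gh by auto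
  have ne: "sig g b ~= sig h b"
  proof
   assume "sig g b = sig h b"
   hence "sig (inv_G h) (sig g b) = sig (inv_G h) (sig h b)" by simp
   thus False using b sig_simps(6)[OF inv_G(1)[OF h] b(1)] S[OF g] h inv_G(3)[OF h] sig_simps(5)[OF h b(1)] by simp
  qed
  have sb: "sig g b:car L" if "g:S" for g using S[OF that] b(1) by simp
  have shb: "sig h b:car L" using h b(1) by simp
  define d where "d g = c g\<bullet>(sig g b \<ominus>\<^sub>L sig h b)" for g
  have d: "d g:car L" if "g:S" for g using c(2)[OF that] sb[OF that] shb by(simp add: d_def)
  have sum: "(\<Oplus>\<^bsub>L\<^esub>g\<in>S. d g\<bullet>sig g a) = \<zero>\<^sub>L" if a: "a:car L" for a
  proof -
   have ba: "b\<bullet>a:car L" using a b by simp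
   let ?s = "%g. c g\<bullet>sig g a"
   have s: "?s g:car L" if "g:S" for g using c(2)[OF that] S[OF that] a by simp
   have cs: "(%g. sig g b\<bullet>?s g):S \<rightarrow> car L" "?s:S \<rightarrow> car L" using s sb by auto
   define A B where "A = (\<Oplus>\<^bsub>L\<^esub>g\<in>S. sig g b\<bullet>?s g)" and "B = (\<Oplus>\<^bsub>L\<^esub>g\<in>S. ?s g)"
   have AB: "A:car L" "B:car L" using cs by(auto simp: A_def B_def intro: LF.finsum_closed)
   have "(\<Oplus>\<^bsub>L\<^esub>g\<in>S. c g\<bullet>sig g (b\<bullet>a)) = A" unfolding A_def
   proof(rule LF.finsum_cong'[OF refl cs(1)])
    fix g assume g: "g:S"
    have "sig g a:car L" using S[OF g] a by simp
    thus "c g\<bullet>sig g (b\<bullet>a) = sig g b\<bullet>?s g"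
     using sig_simps(2)[OF S[OF g] b(1) a] c(2)[OF g] sb[OF g] by(simp add: LF.m_lcomm)
   qed
   hence e1: "c h\<bullet>(sig h b\<bullet>sig h a) \<oplus>\<^sub>L A = \<zero>\<^sub>L"
    using insert.prems(3)[OF ba] split[OF ba] sig_simps(2)[OF h b(1) a] by simp
   have e2: "c h\<bullet>sig h a \<oplus>\<^sub>L B = \<zero>\<^sub>L"
    using insert.prems(3)[OF a] split[OF a] by(simp add: B_def)
   have "(\<Oplus>\<^bsub>L\<^esub>g\<in>S. d g\<bullet>sig g a) = (\<Oplus>\<^bsub>L\<^esub>g\<in>S. sig g b\<bullet>?s g \<oplus>\<^sub>L (\<ominus>\<^bsub>L\<^esub> sig h b)\<bullet>?s g)"
   proof(rule LF.finsum_cong'[OF refl])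
    show "(%g. sig g b\<bullet>?s g \<oplus>\<^sub>L (\<ominus>\<^bsub>L\<^esub> sig h b)\<bullet>?s g):S \<rightarrow> car L" using cs shb by auto
    fix g assume g: "g:S"
    have "sig g a:car L" using S[OF g] a by simp
    thus "d g\<bullet>sig g a = sig g b\<bullet>?s g \<oplus>\<^sub>L (\<ominus>\<^bsub>L\<^esub> sig h b)\<bullet>?s g"
     unfolding d_def using c(2)[OF g] sb[OF g] shb by algebra
   qed
   also have "... = A \<oplus>\<^sub>L (\<Oplus>\<^bsub>L\<^esub>g\<in>S. (\<ominus>\<^bsub>L\<^esub> sig h b)\<bullet>?s g)" unfolding A_def
    by(rule LF.finsum_addf[OF cs(1)]) (use s shb in auto)
   also have "(\<Oplus>\<^bsub>L\<^esub>g\<in>S. (\<ominus>\<^bsub>L\<^esub> sig h b)\<bullet>?s g) = (\<ominus>\<^bsub>L\<^esub> sig h b)\<bullet>B" unfolding B_def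
    by(rule LF.finsum_rdistr[symmetric, OF insert.hyps(1) _ cs(2)]) (use shb in simp)
   also have "A \<oplus>\<^sub>L (\<ominus>\<^bsub>L\<^esub> sig h b)\<bullet>B = (c h\<bullet>(sig h b\<bullet>sig h a) \<oplus>\<^sub>L A) \<ominus>\<^sub>L sig h b\<bullet>(c h\<bullet>sig h a \<oplus>\<^sub>L B)"
   proof -
    have "sig h a:car L" using h a by simp
    thus ?thesis using AB shb c(1) by algebra
   qed
   also have "... = \<zero>\<^sub>L" using e1 e2 shb by simp
   finally show ?thesis .
  qed
  have "S \<subseteq> grouplikes H" using S by auto
  from insert.IH[OF this d sum g] have "d g = \<zero>\<^sub>L" by simp
  thus False using nz ne c(2)[OF g] sb[OF g] shb LF.integral[of "c g" "sig g b \<ominus>\<^sub>L sig h b"] by(auto simp: d_def)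
 qed
 have "(\<Oplus>\<^bsub>L\<^esub>g\<in>S. c g\<bullet>sig g \<one>\<^sub>L) = (\<Oplus>\<^bsub>L\<^esub>g\<in>S. \<zero>\<^sub>L)"
  by(rule LF.finsum_cong') (use zero S in auto)
 hence "c h = \<zero>\<^sub>L" using insert.prems(3)[OF LF.one_closed] split[OF LF.one_closed] sig_simps(4)[OF h LF.one_closed] c(1) by simp
 thus ?case using insert.prems(4) zero by auto
qed simp

text \<open>
 Every element of \<open>H\<close> acts as a linear combination over \<open>L\<close> of the automorphisms \<^term>\<open>sig g\<close>.
\<close>

definition operator :: "'a => ('a => 'l) => bool" where
 "operator h C \<longleftrightarrow> h:car H & C:grouplikes H \<rightarrow> car L &
  (ALL a:car L. act h a = (\<Oplus>\<^bsub>L\<^esub>g\<in>grouplikes H. C g\<bullet>sig g a))"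

lemma operatorD:
 assumes "operator h C"
 shows "h:car H" "g:grouplikes H ==> C g:car L"
  "a:car L ==> act h a = (\<Oplus>\<^bsub>L\<^esub>g\<in>grouplikes H. C g\<bullet>sig g a)"
 using assms by(auto simp: operator_def)

lemma operator_plus:
 assumes C: "operator h C" and D: "operator k D"
 shows "operator (h\<oplus>k) (%g. C g \<oplus>\<^sub>L D g)"
 unfolding operator_def
proof(intro conjI ballI)
 note c = operatorD[OF C] and d = operatorD[OF D]
 show "h\<oplus>k:car H" using c(1) d(1) by simp
 show "(%g. C g \<oplus>\<^sub>L D g):grouplikes H \<rightarrow> car L" using c(2) d(2) by auto
 fix a assume a: "a:car L"
 have "(\<Oplus>\<^bsub>L\<^esub>g\<in>grouplikes H. (C g \<oplus>\<^sub>L D g)\<bullet>sig g a) = (\<Oplus>\<^bsub>L\<^esub>g\<in>grouplikes H. C g\<bullet>sig g a \<oplus>\<^sub>L D g\<bullet>sig g a)"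
  by(rule LF.finsum_cong') (use c(2) d(2) a in \<open>auto simp: LF.l_distr\<close>)
 also have "... = act h a \<oplus>\<^sub>L act k a"
  unfolding c(3)[OF a] d(3)[OF a] by(rule LF.finsum_addf) (use c(2) d(2) a in auto)
 finally show "act (h\<oplus>k) a = (\<Oplus>\<^bsub>L\<^esub>g\<in>grouplikes H. (C g \<oplus>\<^sub>L D g)\<bullet>sig g a)"
  using act_simps(1)[OF c(1) a d(1)] by simp
qed

lemma operator_scale:
 assumes C: "operator h C"
 shows "operator (r\<odot>h) (%g. r \<odot>\<^sub>L C g)"
 unfolding operator_def
proof(intro conjI ballI)
 note c = operatorD[OF C]
 show "r\<odot>h:car H" using c(1) by simp
 show "(%g. r \<odot>\<^sub>L C g):grouplikes H \<rightarrow> car L" using c(2) by auto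
 fix a assume a: "a:car L"
 have "(\<Oplus>\<^bsub>L\<^esub>g\<in>grouplikes H. (r \<odot>\<^sub>L C g)\<bullet>sig g a) = (\<Oplus>\<^bsub>L\<^esub>g\<in>grouplikes H. r \<odot>\<^sub>L (C g\<bullet>sig g a))"
  by(rule LF.finsum_cong') (use c(2) a in \<open>auto simp: LA.smult_mult_left\<close>)
 also have "... = r \<odot>\<^sub>L act h a"
  unfolding c(3)[OF a] by(rule LA.smult_finsum[symmetric, OF finite_gls]) (use c(2) a in auto)
 finally show "act (r\<odot>h) a = (\<Oplus>\<^bsub>L\<^esub>g\<in>grouplikes H. (r \<odot>\<^sub>L C g)\<bullet>sig g a)"
  using act_simps(4)[OF c(1) a] by simp
qed

lemma operator_al:
 assumes h: "h:grouplikes H"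
 shows "operator (al h) (%g. if g = h then \<one>\<^sub>L else \<zero>\<^sub>L)"
 unfolding operator_def
proof(intro conjI ballI)
 show "al h:car H" by(rule al_carrier(1)[OF h])
 show "(%g. if g = h then \<one>\<^sub>L else \<zero>\<^sub>L):grouplikes H \<rightarrow> car L" by auto
 fix a assume a: "a:car L"
 have "(\<Oplus>\<^bsub>L\<^esub>g\<in>grouplikes H. (if g = h then \<one>\<^sub>L else \<zero>\<^sub>L)\<bullet>sig g a) = (\<Oplus>\<^bsub>L\<^esub>g\<in>grouplikes H. if h = g then sig g a else \<zero>\<^sub>L)"
  by(rule LF.finsum_cong') (use a in auto)
 also have "... = sig h a" by(rule LF.finsum_singleton[OF h finite_gls]) (use a in auto)
 finally show "act (al h) a = (\<Oplus>\<^bsub>L\<^esub>g\<in>grouplikes H. (if g = h then \<one>\<^sub>L else \<zero>\<^sub>L)\<bullet>sig g a)"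
  by(simp add: sig_def)
qed

lemma sig_finsum:
 assumes "g:grouplikes H"
 shows "[|finite S; f:S \<rightarrow> car L|] ==> sig g (\<Oplus>\<^bsub>L\<^esub>s\<in>S. f s) = (\<Oplus>\<^bsub>L\<^esub>s\<in>S. sig g (f s))"
proof(induction S rule: finite_induct)
 case empty
 show ?case using sig_zero[OF assms] by simp
next
 case (insert s S)
 hence f: "f s:car L" "f:S \<rightarrow> car L" by auto
 have "(%s. sig g (f s)):S \<rightarrow> car L" using sig_closed[OF assms] f(2) by auto
 thus ?case using insert assms by(simp add: sig_simps(1))
qed

lemma operator_yy:
 assumes i: "i:{1, 2}" and C: "operator h C"
 shows "operator (yy i\<otimes>h) (%g. ww i\<bullet>(C g \<ominus>\<^sub>L sig (ga i) (C (inv_G (ga i)\<otimes>g))))"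
 unfolding operator_def
proof(intro conjI ballI)
 let ?G = "grouplikes H" and ?s = "sig (ga i)" and ?w = "ww i"
 let ?E = "%g. ?s (C (inv_G (ga i)\<otimes>g))"
 note c = operatorD[OF C] and gai = ga_gl[OF i] and w = ww[OF i] and fin = finite_gls
 have ig: "inv_G (ga i)\<otimes>g:?G" if "g:?G" for g using gl_mult[OF inv_G(1)[OF gai] that] .
 have E: "?E g:car L" if "g:?G" for g using c(2)[OF ig[OF that]] gai by simp
 show "yy i\<otimes>h:car H" using yy_carrier[OF i] c(1) by simp
 show "(%g. ?w\<bullet>(C g \<ominus>\<^sub>L ?E g)):?G \<rightarrow> car L" using c(2) E w(1) by auto
 fix a assume a: "a:car L"
 have sa: "sig g a:car L" if "g:?G" for g using that a by simp
 have f: "(%g. C g\<bullet>sig g a):?G \<rightarrow> car L" "(%g. ?E g\<bullet>sig g a):?G \<rightarrow> car L" using c(2) E sa by auto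
 have bij: "bij_betw (%g. ga i\<otimes>g) ?G ?G"
 proof(rule bij_betwI[where g="%g. inv_G (ga i)\<otimes>g"])
  show "(%g. ga i\<otimes>g):?G \<rightarrow> ?G" "(%g. inv_G (ga i)\<otimes>g):?G \<rightarrow> ?G" using gl_mult gai ig by auto
  show "inv_G (ga i)\<otimes>(ga i\<otimes>g) = g" "ga i\<otimes>(inv_G (ga i)\<otimes>g) = g" if "g:?G" for g
   using that gai inv_G[OF gai] gl_carrier by(simp_all add: alg_m_assoc[symmetric])
 qed
 have "?s (act h a) = (\<Oplus>\<^bsub>L\<^esub>g\<in>?G. ?s (C g\<bullet>sig g a))" unfolding c(3)[OF a] by(rule sig_finsum[OF gai fin f(1)])
 also have "... = (\<Oplus>\<^bsub>L\<^esub>g\<in>?G. ?E (ga i\<otimes>g)\<bullet>sig (ga i\<otimes>g) a)"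
 proof(rule LF.finsum_cong'[OF refl])
  show "(%g. ?E (ga i\<otimes>g)\<bullet>sig (ga i\<otimes>g) a):?G \<rightarrow> car L" using E sa gl_mult[OF gai] by auto
  fix g assume g: "g:?G"
  have "inv_G (ga i)\<otimes>(ga i\<otimes>g) = g" using g gai inv_G[OF gai] gl_carrier by(simp add: alg_m_assoc[symmetric])
  thus "?s (C g\<bullet>sig g a) = ?E (ga i\<otimes>g)\<bullet>sig (ga i\<otimes>g) a"
   using sig_simps(2)[OF gai c(2)[OF g] sa[OF g]] sig_simps(6)[OF gai a g] by simp
 qed
 also have "... = (\<Oplus>\<^bsub>L\<^esub>g\<in>?G. ?E g\<bullet>sig g a)"
 proof -
  have inj: "inj_on (%g. ga i\<otimes>g) ?G" and im: "(%g. ga i\<otimes>g) ` ?G = ?G" using bij by(simp_all add: bij_betw_def)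
  show ?thesis using LF.finsum_reindex[OF _ inj, of "%g. ?E g\<bullet>sig g a"] f(2) by(simp add: im)
 qed
 finally have s: "?s (act h a) = (\<Oplus>\<^bsub>L\<^esub>g\<in>?G. ?E g\<bullet>sig g a)" .
 have ha: "act h a:car L" by(rule act_closed[OF c(1) a])
 have m: "(%g. (\<ominus>\<^bsub>L\<^esub> ?w)\<bullet>(?E g\<bullet>sig g a)):?G \<rightarrow> car L" "(%g. ?w\<bullet>(C g\<bullet>sig g a)):?G \<rightarrow> car L"
  using f w(1) by auto
 have "(\<Oplus>\<^bsub>L\<^esub>g\<in>?G. ?w\<bullet>(C g \<ominus>\<^sub>L ?E g)\<bullet>sig g a)
  = (\<Oplus>\<^bsub>L\<^esub>g\<in>?G. ?w\<bullet>(C g\<bullet>sig g a) \<oplus>\<^sub>L (\<ominus>\<^bsub>L\<^esub> ?w)\<bullet>(?E g\<bullet>sig g a))"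
 proof(rule LF.finsum_cong'[OF refl])
  show "(%g. ?w\<bullet>(C g\<bullet>sig g a) \<oplus>\<^sub>L (\<ominus>\<^bsub>L\<^esub> ?w)\<bullet>(?E g\<bullet>sig g a)):?G \<rightarrow> car L" using m by auto
  fix g assume g: "g:?G"
  show "?w\<bullet>(C g \<ominus>\<^sub>L ?E g)\<bullet>sig g a = ?w\<bullet>(C g\<bullet>sig g a) \<oplus>\<^sub>L (\<ominus>\<^bsub>L\<^esub> ?w)\<bullet>(?E g\<bullet>sig g a)"
   using w(1) c(2)[OF g] E[OF g] sa[OF g] by algebra
 qed
 also have "... = ?w\<bullet>act h a \<oplus>\<^sub>L (\<ominus>\<^bsub>L\<^esub> ?w)\<bullet>?s (act h a)"
  unfolding LF.finsum_addf[OF m(2,1)] c(3)[OF a] s[unfolded c(3)[OF a]]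
  using LF.finsum_rdistr[OF fin w(1) f(1)] LF.finsum_rdistr[OF fin _ f(2), of "\<ominus>\<^bsub>L\<^esub> ?w"] w(1) by simp
 also have "... = act (yy i) (act h a)"
 proof -
  have "?s (act h a):car L" using ha gai by simp
  thus ?thesis unfolding w(3)[OF ha] using w(1) ha by algebra
 qed
 finally show "act (yy i\<otimes>h) a = (\<Oplus>\<^bsub>L\<^esub>g\<in>?G. ?w\<bullet>(C g \<ominus>\<^sub>L ?E g)\<bullet>sig g a)"
  using act_simps(2)[OF yy_carrier[OF i] a c(1)] by simp
qed

lemma operator_unique:
 assumes C: "operator h C" and D: "operator h D" and g: "g:grouplikes H"
 shows "C g = D g"
proof -
 note c = operatorD[OF C] and d = operatorD[OF D]
 have "operator (h\<oplus>(- 1)\<odot>h) (%g. C g \<oplus>\<^sub>L (- 1) \<odot>\<^sub>L D g)" by(rule operator_plus[OF C operator_scale[OF D]])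
 note e = operatorD[OF this]
 have "act (h\<oplus>(- 1)\<odot>h) a = \<zero>\<^sub>L" if a: "a:car L" for a
  using act_simps(1)[OF c(1) a, of "(- 1)\<odot>h"] act_simps(4)[OF c(1) a, of "-1"] act_closed[OF c(1) a] c(1)
   LA.smult_simps(4)[OF act_closed[OF c(1) a], of 1 "-1"] by simp
 hence "C g \<oplus>\<^sub>L (- 1) \<odot>\<^sub>L D g = \<zero>\<^sub>L"
  using e(3) by(intro sig_independent[OF finite_gls subset_refl e(2) _ g]) simp_all
 thus ?thesis using LA.eq_if_minus_zero[OF c(2)[OF g] d(2)[OF g]] c(2)[OF g] d(2)[OF g] by(simp add: LA.minus_eq_smult)
qed

end

context field_action
begin

lemma operator_exists:
 assumes h: "h:car H"
 shows "EX C. operator h C"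
proof -
 have N: "subspace {h:car H. EX C. operator h C} H"
 proof(rule subI)
  have "operator (0\<odot>al \<one>) (%g. 0 \<odot>\<^sub>L (if g = \<one> then \<one>\<^sub>L else \<zero>\<^sub>L))"
   by(rule operator_scale[OF operator_al[OF one_gl]])
  thus "\<zero>:{h:car H. EX C. operator h C}"
   using smult_simps(2)[OF al_carrier(1)[OF one_gl]] by auto
 qed (use operator_plus operator_scale in blast)+
 obtain x where x: "x:car Y.TB" "Phi x = h" using Phi_surj[OF h] by auto
 have m: "EX C. operator (ymono (w, g)) C" if g: "g:grouplikes H" and "w:words" for w g
  using that(2)
 proof(induction w)
  case Nil
  show ?case using operator_al[OF g] by(auto simp: ymono_simps)
 next
  case (Cons i w)
  hence "i:{1, 2}" "w:words" by(auto simp: Y.words_simps)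
  thus ?case using Cons.IH operator_yy[of i] unfolding ymono_simps by auto
 qed
 have "Phi x:{h:car H. EX C. operator h C}"
  by(rule Phi_mem[OF x(1) N]) (use TB_supp[OF x(1)] m ymono_carrier in blast)
 thus ?thesis using x(2) by simp
qed

definition cf :: "'a => 'a => 'l" where "cf h = (SOME C. operator h C)"

lemma cf_operator: "h:car H ==> operator h (cf h)"
 unfolding cf_def using operator_exists by(rule someI_ex)

lemma cf_simps:
 assumes g: "g:grouplikes H" and h: "h:car H"
 shows cf_closed: "cf h g:car L"
  and cf_plus: "k:car H ==> cf (h\<oplus>k) g = cf h g \<oplus>\<^sub>L cf k g"
  and cf_scale: "cf (r\<odot>h) g = r \<odot>\<^sub>L cf h g"
  and cf_yy: "i:{1, 2} ==> cf (yy i\<otimes>h) g = ww i\<bullet>(cf h g \<ominus>\<^sub>L sig (ga i) (cf h (inv_G (ga i)\<otimes>g)))"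
 using operatorD(2)[OF cf_operator[OF h] g]
  operator_unique[OF cf_operator operator_plus[OF cf_operator[OF h] cf_operator] g, of k]
  operator_unique[OF cf_operator operator_scale[OF cf_operator[OF h], of r] g]
  operator_unique[OF cf_operator operator_yy[OF _ cf_operator[OF h], of i] g] h yy_carrier[of i]
 by auto

lemma cf_al: "[|g:grouplikes H; h:grouplikes H|] ==> cf (al h) g = (if g = h then \<one>\<^sub>L else \<zero>\<^sub>L)"
 using operator_unique[OF cf_operator[OF al_carrier(1)] operator_al] by auto

definition wmono :: "nat => nat => 'l" where
 "wmono a b = ww 1 [^]\<^bsub>L\<^esub> a\<bullet>ww 2 [^]\<^bsub>L\<^esub> b"

lemma ww_closed: "ww 1:car L" "ww 2:car L"
 using ww(1)[of 1] ww(1)[of 2] by auto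

lemma pow_nonzero: "[|x:car L; x ~= \<zero>\<^sub>L|] ==> x [^]\<^bsub>L\<^esub> (n :: nat) ~= \<zero>\<^sub>L"
 by(induction n) (use LF.integral in \<open>auto simp: LF.nat_pow_Suc\<close>)

lemma wmono_closed [simp]: "wmono a b:car L"
 using ww_closed by(simp add: wmono_def)

lemma wmono_nonzero: "wmono a b ~= \<zero>\<^sub>L"
 using pow_nonzero[of "ww 1" a] pow_nonzero[of "ww 2" b] ww(1,2)[of 1] ww(1,2)[of 2] LF.integral[of "ww 1 [^]\<^bsub>L\<^esub> a" "ww 2 [^]\<^bsub>L\<^esub> b"]
 by(auto simp: wmono_def)

lemma wmono_add: "wmono (a + a') (b + b') = wmono a b\<bullet>wmono a' b'"
 using ww_closed by(simp add: wmono_def LF.nat_pow_mult[symmetric] LF.m_ac)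

lemma wmono_pow: "wmono (n * a) (n * b) = wmono a b [^]\<^bsub>L\<^esub> n"
 by(induction n) (use ww_closed in \<open>simp_all add: wmono_add LF.m_comm, simp add: wmono_def\<close>)

lemma wmono_simps: "wmono 0 0 = \<one>\<^sub>L" "wmono 1 0 = ww 1" "wmono 0 1 = ww 2"
 "wmono (Suc a) b = ww 1\<bullet>wmono a b" "wmono a (Suc b) = ww 2\<bullet>wmono a b"
 using ww_closed by(simp_all add: wmono_def LF.m_ac)

lemma sig_pow: "[|g:grouplikes H; x:car L; sig g x = c \<odot>\<^sub>L x|] ==> sig g (x [^]\<^bsub>L\<^esub> (n :: nat)) = c ^ n \<odot>\<^sub>L x [^]\<^bsub>L\<^esub> n"
proof(induction n)
 case 0
 show ?case using sig_simps(4)[OF 0(1) LF.one_closed] by simp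
next
 case (Suc n)
 thus ?case using sig_simps(2)[OF Suc.prems(1), of "x [^]\<^bsub>L\<^esub> n" x]
  by(simp add: LA.smult_mult_left LA.smult_mult_right)
qed

lemma sig_wmono: "g:grouplikes H ==> sig g (wmono a b) = (ch 1 g ^ a * ch 2 g ^ b) \<odot>\<^sub>L wmono a b"
 using sig_pow[of g "ww 1" "ch 1 g" a] sig_pow[of g "ww 2" "ch 2 g" b] ww(4)[of 1 g] ww(4)[of 2 g] ww_closed
  sig_simps(2)[of g "ww 1 [^]\<^bsub>L\<^esub> a" "ww 2 [^]\<^bsub>L\<^esub> b"]
 by(simp add: wmono_def LA.smult_mult_left LA.smult_mult_right mult.commute)

definition wm :: "nat list => 'l" where "wm w = wmono (count_list w 1) (count_list w 2)"

lemma wm_simps: "wm [] = \<one>\<^sub>L" "i:{1, 2} ==> wm (i # w) = ww i\<bullet>wm w"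
 by(auto simp: wm_def wmono_simps)

lemma wm_closed [simp]: "wm w:car L"
 by(simp add: wm_def)

lemma sig_wm: "[|w:words; g:grouplikes H|] ==> sig g (wm w) = word_char ch w g \<odot>\<^sub>L wm w"
 unfolding wm_def by(simp add: sig_wmono Y.word_char_counts)

lemma cf_word: "[|w:words; g:grouplikes H|] ==> EX c. cf (ymono (w, \<one>)) g = c \<odot>\<^sub>L wm w"
proof(induction w arbitrary: g)
 case Nil
 have "(if g = \<one> then \<one>\<^sub>L else \<zero>\<^sub>L) = (if g = \<one> then 1 else 0) \<odot>\<^sub>L \<one>\<^sub>L" by simp
 thus ?case using cf_al[OF Nil(2) one_gl] unfolding ymono_simps wm_simps by metis
next
 case (Cons i w)
 hence i: "i:{1, 2}" and w: "w:words" by(auto simp: Y.words_simps)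
 note gai = ga_gl[OF i] and m = ymono_carrier[OF w one_gl]
 have ig: "inv_G (ga i)\<otimes>g:grouplikes H" by(rule gl_mult[OF inv_G(1)[OF gai] Cons.prems(2)])
 obtain c d where cd: "cf (ymono (w, \<one>)) g = c \<odot>\<^sub>L wm w" "cf (ymono (w, \<one>)) (inv_G (ga i)\<otimes>g) = d \<odot>\<^sub>L wm w"
  using Cons.IH[OF w Cons.prems(2)] Cons.IH[OF w ig] by auto
 have "cf (ymono (i # w, \<one>)) g = ww i\<bullet>(c \<odot>\<^sub>L wm w \<ominus>\<^sub>L sig (ga i) (d \<odot>\<^sub>L wm w))"
  unfolding ymono_simps cf_yy[OF Cons.prems(2) m i] cd ..
 also have "... = (c + (- 1) * (d * word_char ch w (ga i))) \<odot>\<^sub>L wm (i # w)"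
  using sig_simps(3)[OF gai wm_closed, of d w] sig_wm[OF w gai] ww(1)[OF i] wm_simps(2)[OF i]
  by(simp add: LA.minus_eq_smult LA.smult_mult_right del: mult_minus1)
 finally show ?case by auto
qed

text \<open>
 The coefficient of \<^term>\<open>sig g\<close> can only be nonzero if \<open>g\<close> is the degree of a subword, and then the characters
 have the corresponding value at \<open>g\<close>.
\<close>

lemma cf_word_support:
 "[|w:words; g:grouplikes H; cf (ymono (w, \<one>)) g ~= \<zero>\<^sub>L|] ==>
  EX a<=count_list w 1. EX b<=count_list w 2. ALL j:{1, 2}. ch j g = ch j (ga 1) ^ a * ch j (ga 2) ^ b"
proof(induction w arbitrary: g)
 case Nil
 hence "g = \<one>" using cf_al[OF Nil(2) one_gl] by(auto simp: ymono_simps split: if_splits)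
 thus ?case using Y.ch_one by auto
next
 case (Cons i w)
 hence i: "i:{1, 2}" and w: "w:words" by(auto simp: Y.words_simps)
 note gai = ga_gl[OF i] and m = ymono_carrier[OF w one_gl]
 have ig: "inv_G (ga i)\<otimes>g:grouplikes H" by(rule gl_mult[OF inv_G(1)[OF gai] Cons.prems(2)])
 show ?case
 proof(cases "cf (ymono (w, \<one>)) g = \<zero>\<^sub>L")
  case False
  then obtain a b where "a <= count_list w 1" "b <= count_list w 2" "ALL j:{1, 2}. ch j g = ch j (ga 1) ^ a * ch j (ga 2) ^ b"
   using Cons.IH[OF w Cons.prems(2)] by auto
  moreover have "count_list w x <= count_list (i # w) x" for x by simp
  ultimately show ?thesis using order_trans by blast
 next
  case True
  have "cf (ymono (w, \<one>)) (inv_G (ga i)\<otimes>g) ~= \<zero>\<^sub>L"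
   using Cons.prems(3) True sig_zero[OF gai] ww(1)[OF i] unfolding ymono_simps cf_yy[OF Cons.prems(2) m i] by(auto simp: LF.minus_eq)
  then obtain a b where ab: "a <= count_list w 1" "b <= count_list w 2"
   "ALL j:{1, 2}. ch j (inv_G (ga i)\<otimes>g) = ch j (ga 1) ^ a * ch j (ga 2) ^ b"
   using Cons.IH[OF w ig] by auto
  have g: "ga i\<otimes>(inv_G (ga i)\<otimes>g) = g"
   using gai inv_G[OF gai] gl_carrier Cons.prems(2) by(simp add: alg_m_assoc[symmetric])
  have j: "ch j g = ch j (ga i) * (ch j (ga 1) ^ a * ch j (ga 2) ^ b)" if "j:{1, 2}" for j
   using Y.ch_mult[OF that, of "ga i" "inv_G (ga i)\<otimes>g"] gai ig g bspec[OF ab(3) that] by simp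
  show ?thesis
  proof(cases "i = 1")
   case True
   thus ?thesis using ab(1,2) j by(intro exI[of _ "Suc a"] conjI exI[of _ b]) auto
  next
   case False
   hence "i = 2" using i by simp
   thus ?thesis using ab(1,2) j by(intro exI[of _ a] conjI exI[of _ "Suc b"]) auto
  qed
 qed
qed

text \<open>By hypothesis the characters are not both trivial at a nontrivial degree, so that only the leading term of the
 product contributes to the coefficient of the identity.\<close>

lemma cf_word_one:
 assumes gen: "!!a b. [|a <= count_list w 1; b <= count_list w 2; ALL j:{1, 2}. ch j (ga 1) ^ a * ch j (ga 2) ^ b = 1|] ==> a = 0 & b = 0"
  and w: "w:words"
 shows "cf (ymono (w, \<one>)) \<one> = wm w"
 using w gen
proof(induction w)
 case Nil
 show ?case using cf_al[OF one_gl one_gl] by(simp add: ymono_simps wm_simps)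
next
 case (Cons i w)
 hence i: "i:{1, 2}" and w: "w:words" by(auto simp: Y.words_simps)
 note gai = ga_gl[OF i] and m = ymono_carrier[OF w one_gl] and ii = inv_G(1)[OF ga_gl[OF i]]
 have le: "count_list w x <= count_list (i # w) x" for x by simp
 have IH: "cf (ymono (w, \<one>)) \<one> = wm w"
  by(rule Cons.IH[OF w]) (rule Cons.prems(2)[OF order_trans[OF _ le] order_trans[OF _ le]])
 have "cf (ymono (w, \<one>)) (inv_G (ga i)) = \<zero>\<^sub>L"
 proof(rule ccontr)
  assume "cf (ymono (w, \<one>)) (inv_G (ga i)) ~= \<zero>\<^sub>L"
  then obtain a b where ab: "a <= count_list w 1" "b <= count_list w 2"
   "ALL j:{1, 2}. ch j (inv_G (ga i)) = ch j (ga 1) ^ a * ch j (ga 2) ^ b"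
   using cf_word_support[OF w ii] by auto
  have j: "ch j (ga i) * (ch j (ga 1) ^ a * ch j (ga 2) ^ b) = 1" if "j:{1, 2}" for j
   using Y.ch_mult[OF that, of "ga i" "inv_G (ga i)"] gai ii inv_G(2)[OF gai] bspec[OF ab(3) that] Y.ch_one[OF that] by simp
  show False
  proof(cases "i = 1")
   case True
   thus False using Cons.prems(2)[of "Suc a" b] ab(1,2) j by(simp add: mult.assoc)
  next
   case False
   hence "i = 2" using i by simp
   thus False using Cons.prems(2)[of a "Suc b"] ab(1,2) j by(simp add: mult.left_commute)
  qed
 qed
 hence "cf (ymono (i # w, \<one>)) \<one> = ww i\<bullet>(wm w \<ominus>\<^sub>L \<zero>\<^sub>L)"
  unfolding ymono_simps cf_yy[OF one_gl m i] IH using gl_carrier[OF ii] sig_zero[OF gai] by simp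
 thus ?case using wm_simps(2)[OF i] by(simp add: LF.minus_eq)
qed

end

subsection \<open>Algebraic elements\<close>

context field_action
begin

definition poly_value :: "'l => 'k poly => 'l" where
 "poly_value u p = fold_coeffs (%c s. c \<odot>\<^sub>L \<one>\<^sub>L \<oplus>\<^sub>L u\<bullet>s) p \<zero>\<^sub>L"

lemma poly_value_simps:
 assumes u: "u:car L"
 shows poly_value_0: "poly_value u 0 = \<zero>\<^sub>L"
  and poly_value_pCons: "poly_value u (pCons c p) = c \<odot>\<^sub>L \<one>\<^sub>L \<oplus>\<^sub>L u\<bullet>poly_value u p"
 using u by(cases "c = 0 & p = 0"; auto simp: poly_value_def)+

lemma poly_value_closed: "u:car L ==> poly_value u p:car L"
 by(induction p) (simp_all add: poly_value_0 poly_value_pCons)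

lemma poly_value_add:
 assumes u: "u:car L"
 shows "poly_value u (p + q) = poly_value u p \<oplus>\<^sub>L poly_value u q"
proof(induction p q rule: poly_induct2)
 case (pCons a p b q)
 have "(a + b) \<odot>\<^sub>L \<one>\<^sub>L = a \<odot>\<^sub>L \<one>\<^sub>L \<oplus>\<^sub>L b \<odot>\<^sub>L \<one>\<^sub>L" by simp
 thus ?case using pCons u poly_value_closed[OF u, of p] poly_value_closed[OF u, of q]
  by(simp add: poly_value_pCons LF.r_distr LF.a_ac del: LA.smult_simps)
qed (simp add: poly_value_0 u)

lemma poly_value_smult: "u:car L ==> poly_value u (smult c p) = c \<odot>\<^sub>L poly_value u p"
proof(induction p)
 case (pCons a p)
 thus ?case using poly_value_closed[of u p] by(simp add: poly_value_pCons LA.smult_add LA.smult_mult_right)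
qed (simp add: poly_value_0)

lemma poly_value_monom: "u:car L ==> poly_value u (Polynomial.monom 1 n) = u [^]\<^bsub>L\<^esub> n"
 by(induction n) (simp_all add: poly_value_0 poly_value_pCons Polynomial.monom_0 Polynomial.monom_Suc LF.m_comm)

end

locale field_action_closed = field_action H ga ch F L act
 for H :: "('k::{alg_closed_field, field_char_0}, 'a) bialg" (structure) and ga ch F and L :: "('k, 'l) module" and act
begin

text \<open>A polynomial splits into linear factors over the algebraically closed ground field, and \<open>L\<close> is a domain.\<close>

lemma algebraic_scalar:
 assumes u: "u:car L"
 shows "[|p ~= 0; poly_value u p = \<zero>\<^sub>L|] ==> EX d. u = d \<odot>\<^sub>L \<one>\<^sub>L"
proof(induction "degree p" arbitrary: p)
 case 0
 then obtain c where c: "p = [:c:]" using degree_eq_zeroE by auto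
 hence "c = 0" using 0(3) u LA.smult_eq_zero_iff[OF LF.one_closed, of c] by(simp add: poly_value_pCons poly_value_0)
 thus ?case using 0(2) c by simp
next
 case (Suc n)
 obtain r where "poly p r = 0" using alg_closed_imp_poly_has_root[of p] Suc(2) by auto
 then obtain p' where p': "p = [:- r, 1:] * p'" by(metis poly_eq_0_iff_dvd dvdE)
 have nz: "p' ~= 0" using p' Suc.prems(1) by auto
 have d: "n = degree p'" using Suc(2) nz degree_mult_eq[of "[:- r, 1:]" p'] by(simp add: p')
 note v = poly_value_closed[OF u, of p']
 have "poly_value u p = (u \<ominus>\<^sub>L r \<odot>\<^sub>L \<one>\<^sub>L)\<bullet>poly_value u p'"
 proof -
  have e: "p = smult (- r) p' + pCons 0 p'" by(simp add: p')
  have "poly_value u p = (- r) \<odot>\<^sub>L poly_value u p' \<oplus>\<^sub>L u\<bullet>poly_value u p'"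
   unfolding e poly_value_add[OF u] poly_value_smult[OF u] poly_value_pCons[OF u] using u v by simp
  also have "... = (u \<oplus>\<^sub>L (- r) \<odot>\<^sub>L \<one>\<^sub>L)\<bullet>poly_value u p'"
   using u v by(simp add: LF.l_distr LA.smult_mult_left LF.a_comm)
  finally show ?thesis using u by(simp add: LA.minus_eq_smult)
 qed
 hence "u \<ominus>\<^sub>L r \<odot>\<^sub>L \<one>\<^sub>L = \<zero>\<^sub>L \<or> poly_value u p' = \<zero>\<^sub>L"
  using Suc.prems(2) u v LF.integral by simp
 thus ?case using Suc(1)[OF d nz] LA.eq_if_minus_zero[OF u, of "r \<odot>\<^sub>L \<one>\<^sub>L"] by auto
qed

lemma root_scalar:
 fixes n :: nat
 assumes u: "u:car L" and n: "0 < n" and pow: "u [^]\<^bsub>L\<^esub> n = c \<odot>\<^sub>L \<one>\<^sub>L"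
 shows "EX d. u = d \<odot>\<^sub>L \<one>\<^sub>L"
proof(rule algebraic_scalar[OF u])
 let ?p = "Polynomial.monom 1 n + [:- c:] :: 'k poly"
 have "Polynomial.coeff ?p n = 1" using n by(cases n) simp_all
 thus "?p ~= 0" by(metis Polynomial.coeff_0 zero_neq_one)
 have "poly_value u [:- c:] = (- c) \<odot>\<^sub>L \<one>\<^sub>L" using u by(simp add: poly_value_pCons poly_value_0)
 hence "poly_value u ?p = c \<odot>\<^sub>L \<one>\<^sub>L \<oplus>\<^sub>L (- c) \<odot>\<^sub>L \<one>\<^sub>L"
  using poly_value_add[OF u, of "Polynomial.monom 1 n" "[:- c:]"] poly_value_monom[OF u, of n] pow by simp
 thus "poly_value u ?p = \<zero>\<^sub>L" by simp
qed

end

section \<open>The quantum Serre relation\<close>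

locale cartan_action = field_action_closed H ga ch F L act
 for H :: "('k::{alg_closed_field, field_char_0}, 'a) bialg" (structure) and ga ch F and L :: "('k, 'l) module" and act +
 fixes m :: nat
 assumes m: "odd m" "1 < m"
  and order1: "ch 1 (ga 1) ^ n = 1 \<longleftrightarrow> m dvd n" and order2: "ch 2 (ga 2) ^ n = 1 \<longleftrightarrow> m dvd n"
  and cartan: "ch 1 (ga 1) * ch 2 (ga 1) * ch 1 (ga 2) = 1"
  and generic: "ch 1 (ga 1) ^ 2 * ch 2 (ga 2) ~= 1"
begin

abbreviation "q11 \<equiv> ch 1 (ga 1)"
abbreviation "q12 \<equiv> ch 2 (ga 1)"
abbreviation "q21 \<equiv> ch 1 (ga 2)"
abbreviation "q22 \<equiv> ch 2 (ga 2)"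

lemma gl12: "ga 1:grouplikes H" "ga 2:grouplikes H"
 using ga_gl[of 1] ga_gl[of 2] by auto

lemma q_facts: "q11 ~= 1" "q11 ^ 2 ~= 1" "q22 ~= 1"
proof -
 have "\<not> m dvd 1" using m by simp
 moreover have "\<not> m dvd 2" using m dvd_imp_le[of m 2] by(cases "m = 2") auto
 ultimately show "q11 ~= 1" "q11 ^ 2 ~= 1" "q22 ~= 1" using order1[of 1] order1[of 2] order2[of 1] by auto
qed

lemma degrees_nontrivial:
 assumes "a <= 2" "b <= 1" and e: "q11 ^ a * q21 ^ b = 1" "q12 ^ a * q22 ^ b = 1"
 shows "a = 0 & b = 0"
proof -
 have "a = 0 \<or> a = 1 \<or> a = 2" "b = 0 \<or> b = 1" using assms(1,2) by auto
 then consider "a = 0" "b = 0" | "a = 0" "b = 1" | "a = 1" "b = 0" | "a = 1" "b = 1" | "a = 2" "b = 0" | "a = 2" "b = 1" by auto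
 thus ?thesis
 proof cases
  case 4
  hence "q11 * q21 = 1" "q12 * q22 = 1" using e by auto
  moreover have "q22 = (q11 * q21) * (q12 * q22)" using arg_cong[OF cartan, of "%x. x * q22"] by(simp add: ac_simps)
  ultimately have "q22 = 1" by simp
  thus ?thesis using q_facts by simp
 next
  case 6
  hence "q11 ^ 2 * q21 = 1" "q12 ^ 2 * q22 = 1" using e by auto
  moreover have "q11 ^ 2 * q22 = (q11 ^ 2 * q21) ^ 2 * (q12 ^ 2 * q22)"
   using arg_cong[OF cartan, of "%x. x ^ 2 * (q11 ^ 2 * q22)"] by(simp add: power2_eq_square ac_simps)
  ultimately have "q11 ^ 2 * q22 = 1" by simp
  thus ?thesis using generic by simp
 qed (use e q_facts in simp_all)
qed

lemma skew_prim_filt: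
 assumes z: "z:car H" and e: "e:grouplikes H" and com: "!!be. bil be ==> comult H z be = be (al e) z + be z \<one>"
 shows "z:Hf 1"
proof -
 have "z:Hf (Suc 0)"
  unfolding filt_Suc_iff
 proof(intro conjI allI impI)
  fix f g assume fg: "annihilates f (coradical H) & annihilates g (Hf 0)"
  hence "f (al e) = 0" "g \<one> = 0"
   using annihilatesD(2)[of f "coradical H" "al e"] annihilatesD(2)[of g "Hf 0" \<one>] al_carrier(2)[OF e] gl_coradical[OF one_gl]
   by auto
  thus "(f \<star> g) z = 0" unfolding conv_def using com[OF bil_prod[OF annihilatesD(1) annihilatesD(1)], of f "coradical H" g "Hf 0"] fg by simp
 qed (rule z)
 thus ?thesis by simp
qed

lemma Phi_weight:
 assumes x: "x:car Y.TB" and w: "!!w h. x (w, h) ~= 0 ==> h = \<one> & word_char ch w g = c" and g: "g:grouplikes H"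
 shows "al g\<otimes>Phi x = c\<odot>(Phi x\<otimes>al g)"
proof(rule eq_if_forms_eq)
 note a = al_carrier(1)[OF g] and P = Phi_closed[OF x]
 show "al g\<otimes>Phi x:car H" "c\<odot>(Phi x\<otimes>al g):car H" using a P by auto
 fix f assume f: "lf f"
 have "f (al g\<otimes>Phi x) = fsum x (%z. f (al g\<otimes>ymono z))" by(rule lf_Phi[OF x lf_comp[OF f linmap_mult_left[OF a]]])
 also have "... = fsum x (%z. c * f (ymono z\<otimes>al g))"
 proof(rule fsum_cong)
  fix z assume z: "x z ~= 0"
  obtain v h where vh: "z = (v, h)" by(cases z)
  have v: "v:words" "h = \<one>" "word_char ch v g = c" using TB_supp[OF x, of v h] w[of v h] z vh by auto
  have "al g\<otimes>ymono z = c\<odot>ymono (v, g)" using al_ymono[OF v(1) g one_gl] v vh gl_carrier[OF g] by simp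
  moreover have "ymono z\<otimes>al g = ymono (v, g)"
   using ymono_mult[OF _ one_gl g v(1), of "[]"] v vh gl_carrier[OF g] ymono_carrier[OF v(1) g]
   by(simp add: ymono_simps Y.words_simps)
  ultimately show "f (al g\<otimes>ymono z) = c * f (ymono z\<otimes>al g)" using lf_smult[OF f ymono_carrier[OF v(1) g]] by simp
 qed
 also have "... = c * f (Phi x\<otimes>al g)"
  using lf_Phi[OF x lf_comp[OF f linmap_mult_right[OF a]]] by(simp add: fsum_times)
 finally show "f (al g\<otimes>Phi x) = f (c\<odot>(Phi x\<otimes>al g))" using lf_smult[OF f] a P by simp
qed

definition serre :: "nat list\<times>'a => 'k" where
 "serre = (%z. (single ([1, 1, 2], \<one>) z + (- (q12 + q11 * q12)) * single ([1, 2, 1], \<one>) z) + (q11 * q12 ^ 2) * single ([2, 1, 1], \<one>) z)"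

lemma serre_closed: "serre:car Y.TB"
 unfolding serre_def
 by(intro Y.TB_closed(1,2) Y.single_closed) (simp_all add: Y.words_simps one_gl)

lemma serre_words: "[1, 1, 2]:words" "[1, 2, 1]:words" "[2, 1, 1]:words"
 by(simp_all add: Y.words_simps)

lemma Phi_serre: "Phi serre = ymono ([1, 1, 2], \<one>)\<oplus>(- (q12 + q11 * q12))\<odot>ymono ([1, 2, 1], \<one>)\<oplus>(q11 * q12 ^ 2)\<odot>ymono ([2, 1, 1], \<one>)"
proof -
 have s: "single (w, \<one>):car Y.TB" if "w:words" for w using Y.single_closed[OF that, of \<one>] one_gl by simp
 note s3 = s[OF serre_words(1)] s[OF serre_words(2)] s[OF serre_words(3)]
 show ?thesis
  unfolding serre_def Phi_add[OF Y.TB_closed(1)[OF s3(1) Y.TB_closed(2)[OF s3(2)]] Y.TB_closed(2)[OF s3(3)]]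
   Phi_add[OF s3(1) Y.TB_closed(2)[OF s3(2)]] Phi_smult[OF s3(2)] Phi_smult[OF s3(3)]
   Phi_single[OF serre_words(1) one_gl] Phi_single[OF serre_words(2) one_gl] Phi_single[OF serre_words(3) one_gl] ..
qed

text \<open>The expansion of the comultiplication of \<open>y\<^sub>1\<^sup>2 y\<^sub>2 - (1 + q\<^sub>1\<^sub>1) q\<^sub>1\<^sub>2 y\<^sub>1 y\<^sub>2 y\<^sub>1 + q\<^sub>1\<^sub>1 q\<^sub>1\<^sub>2\<^sup>2 y\<^sub>2 y\<^sub>1\<^sup>2\<close> with \<open>Q = q\<^sub>1\<^sub>1\<close>, \<open>P = q\<^sub>1\<^sub>2\<close>, \<open>R = q\<^sub>2\<^sub>1\<close>:
 all mixed terms carry the factor \<open>1 - QPR\<close>.\<close>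

lemma serre_identity:
 fixes Q P R :: "'b :: field"
 shows "(x + P * P * b2 + (1 + Q) * b1 + (1 + Q) * P * b12 + b11 + e)
  + (- (P + Q * P)) * (x' + P * b2 + b1' + Q * R * b1 + b12 + Q * P * b21 + R * b11 + e')
  + (Q * P ^ 2) * (x'' + b2 + R * (1 + Q) * b1' + (1 + Q) * b21 + R * R * b11 + e'')
  = (e + (- (P + Q * P)) * e' + (Q * P ^ 2) * e'') + (x + (- (P + Q * P)) * x' + (Q * P ^ 2) * x'')
   + (1 - Q * P * R) * ((1 + Q) * b1 + (1 - P * R) * b11 - (1 + Q) * P * b1')"
 by(simp add: algebra_simps power2_eq_square)

lemma comult_serre:
 assumes be: "bil be"
 shows "comult H (Phi serre) be = be (al (ga 1\<otimes>(ga 1\<otimes>ga 2))) (Phi serre) + be (Phi serre) \<one>"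
proof -
 note G = gl12 and Gc = gl_carrier[OF gl12(1)] gl_carrier[OF gl12(2)]
 note M = ymono_carrier[OF serre_words(1) one_gl] ymono_carrier[OF serre_words(2) one_gl] ymono_carrier[OF serre_words(3) one_gl]
 have e: "ga 1\<otimes>(ga 2\<otimes>ga 1) = ga 1\<otimes>(ga 1\<otimes>ga 2)" "ga 2\<otimes>(ga 1\<otimes>ga 1) = ga 1\<otimes>(ga 1\<otimes>ga 2)"
  using G_comm[OF G(2) G(1)] G_comm[OF G(2) gl_mult[OF G(1) G(1)]] Gc by(simp_all add: alg_m_assoc)
 have ec: "al (ga 1\<otimes>(ga 1\<otimes>ga 2)):car H" using al_carrier(1)[OF gl_mult[OF G(1) gl_mult[OF G(1,2)]]] .
 define B where "B u d v = be (ymono (u, d)) (ymono (v, \<one>))" for u d v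
 have m0: "ymono ([], d) = al d" for d by(simp add: ymono_simps)
 have comw: "comult H (ymono (w, \<one>)) be = (\<Sum>(c, u, v)\<leftarrow>word_comult ga ch w. c * B u (word_deg G ga v\<otimes>\<one>) v)" if "w:words" for w
  unfolding B_def by(rule ymono_comult[OF one_gl that be])
 have R1: "be (al (ga 1\<otimes>(ga 1\<otimes>ga 2))) (ymono (w, \<one>)) = B [] (ga 1\<otimes>(ga 1\<otimes>ga 2)) w"
  and R2: "be (ymono (w, \<one>)) \<one> = B w \<one> []" for w
  by(simp_all add: B_def m0 al_one)
 have z: "comult H (Phi serre) be = comult H (ymono ([1, 1, 2], \<one>)) be + (- (q12 + q11 * q12)) * comult H (ymono ([1, 2, 1], \<one>)) be
   + (q11 * q12 ^ 2) * comult H (ymono ([2, 1, 1], \<one>)) be"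
  unfolding Phi_serre using M by(simp add: comult_add comult_smult)
 have e1: "be (al (ga 1\<otimes>(ga 1\<otimes>ga 2))) (Phi serre) = B [] (ga 1\<otimes>(ga 1\<otimes>ga 2)) [1, 1, 2]
   + (- (q12 + q11 * q12)) * B [] (ga 1\<otimes>(ga 1\<otimes>ga 2)) [1, 2, 1] + (q11 * q12 ^ 2) * B [] (ga 1\<otimes>(ga 1\<otimes>ga 2)) [2, 1, 1]"
  unfolding Phi_serre R1[symmetric] using M lf_add[OF bilformD(1)[OF be ec]] lf_smult[OF bilformD(1)[OF be ec]] by simp
 have e2: "be (Phi serre) \<one> = B [1, 1, 2] \<one> [] + (- (q12 + q11 * q12)) * B [1, 2, 1] \<one> [] + (q11 * q12 ^ 2) * B [2, 1, 1] \<one> []"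
  unfolding Phi_serre R2[symmetric]
  using M lf_add[OF bilformD(2)[OF be alg_one_closed]] lf_smult[OF bilformD(2)[OF be alg_one_closed]] by simp
 have c1: "comult H (ymono ([1, 1, 2], \<one>)) be = B [1, 1, 2] \<one> [] + q12 * q12 * B [2] (ga 1\<otimes>ga 1) [1, 1] + (1 + q11) * B [1] (ga 1\<otimes>ga 2) [1, 2]
   + (1 + q11) * q12 * B [1, 2] (ga 1) [1] + B [1, 1] (ga 2) [2] + B [] (ga 1\<otimes>(ga 1\<otimes>ga 2)) [1, 1, 2]"
  unfolding comw[OF serre_words(1)] using Gc by(simp add: algebra_simps)
 have c2: "comult H (ymono ([1, 2, 1], \<one>)) be = B [1, 2, 1] \<one> [] + q12 * B [2] (ga 1\<otimes>ga 1) [1, 1] + B [1] (ga 2\<otimes>ga 1) [2, 1] + q11 * q21 * B [1] (ga 1\<otimes>ga 2) [1, 2]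
   + B [1, 2] (ga 1) [1] + q11 * q12 * B [2, 1] (ga 1) [1] + q21 * B [1, 1] (ga 2) [2] + B [] (ga 1\<otimes>(ga 1\<otimes>ga 2)) [1, 2, 1]"
  unfolding comw[OF serre_words(2)] using Gc by(simp add: e[unfolded One_nat_def])
 have c3: "comult H (ymono ([2, 1, 1], \<one>)) be = B [2, 1, 1] \<one> [] + B [2] (ga 1\<otimes>ga 1) [1, 1] + q21 * (1 + q11) * B [1] (ga 2\<otimes>ga 1) [2, 1]
   + (1 + q11) * B [2, 1] (ga 1) [1] + q21 * q21 * B [1, 1] (ga 2) [2] + B [] (ga 1\<otimes>(ga 1\<otimes>ga 2)) [2, 1, 1]"
  unfolding comw[OF serre_words(3)] using Gc by(simp add: e[unfolded One_nat_def] algebra_simps)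
 show ?thesis unfolding z e1 e2 c1 c2 c3 serre_identity cartan by simp
qed

end

context cartan_action
begin

lemma serre_weight: "[|serre (w, h) ~= 0; g:grouplikes H|] ==> h = \<one> & word_char ch w g = ch 1 g ^ 2 * ch 2 g"
 by(auto simp: serre_def single_def power2_eq_square split: if_splits)

text \<open>If one of the words \<open>1\<close>, \<open>x\<^sub>1\<close>, \<open>x\<^sub>2\<close> had the character \<open>\<chi>\<^sub>1\<^sup>2 \<chi>\<^sub>2\<close> of the Serre element, evaluation at \<open>g\<^sub>1\<close> and \<open>g\<^sub>2\<close>
 would give \<open>q\<^sub>1\<^sub>1\<^sup>2 q\<^sub>2\<^sub>2 = 1\<close>, \<open>q\<^sub>2\<^sub>2 = 1\<close> or \<open>q\<^sub>1\<^sub>1\<^sup>2 = 1\<close>, respectively.\<close>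

lemma Phi_serre_zero: "Phi serre = \<zero>"
proof -
 note G = gl12 and PH = Phi_closed[OF serre_closed]
 let ?e = "ga 1\<otimes>(ga 1\<otimes>ga 2)"
 have e: "?e:grouplikes H" by(rule gl_mult[OF G(1) gl_mult[OF G]])
 obtain x where x: "x:car Y.TB" "Phi serre = Phi x"
  and xw: "!!w h. x (w, h) ~= 0 ==> length w <= 1 & (ALL g:grouplikes H. ch 1 g ^ 2 * ch 2 g = word_char ch w g)"
  using skew_prim_form[OF skew_prim_filt[OF PH e comult_serre] e comult_serre Phi_weight[OF serre_closed serre_weight]] by auto
 have "x (w, h) = 0" for w h
 proof(rule ccontr)
  assume nz: "x (w, h) ~= 0"
  hence w: "w:words" "length w <= 1" using TB_supp[OF x(1)] xw by auto
  have c: "q11 ^ 2 * q12 = word_char ch w (ga 1)" "q21 ^ 2 * q22 = word_char ch w (ga 2)" using xw[OF nz] G by auto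
  have nz12: "q12 ~= 0" "q11 ~= 0" "q21 ~= 0" using cartan by auto
  consider "w = []" | "w = [1]" | "w = [2]"
   using w by(cases w) (auto simp: Y.words_simps)
  thus False
  proof cases
   case 1
   hence "q11 ^ 2 * q12 = 1" "q21 ^ 2 * q22 = 1" using c by auto
   moreover have "q11 ^ 2 * q22 = (q11 ^ 2 * q12) ^ 2 * (q21 ^ 2 * q22)"
    using arg_cong[OF cartan, of "%x. x ^ 2 * (q11 ^ 2 * q22)"] by(simp add: power2_eq_square ac_simps)
   ultimately have "q11 ^ 2 * q22 = 1 ^ 2 * 1" by simp
   thus False using generic by simp
  next
   case 2
   hence "q11 * q12 = 1" "q21 * q22 = 1" using c nz12 by(simp_all add: power2_eq_square)
   moreover have "q22 = (q11 * q12) * (q21 * q22)" using arg_cong[OF cartan, of "%x. x * q22"] by(simp add: ac_simps)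
   ultimately show False using q_facts by simp
  next
   case 3
   thus False using c nz12 q_facts by simp
  qed
 qed
 hence "x = (%z. 0)" by auto
 thus ?thesis using x(2) Phi_zero by simp
qed

text \<open>The coefficient of the identity in the action of the Serre element is
 \<open>(1 - q\<^sub>1\<^sub>2) (1 - q\<^sub>1\<^sub>1 q\<^sub>1\<^sub>2) w\<^sub>1\<^sup>2 w\<^sub>2\<close>.\<close>

lemma braiding_degenerate: "q12 = 1 \<or> q11 * q12 = 1"
proof -
 have cf: "cf (ymono (w, \<one>)) \<one> = wmono 2 1" if "w:{[1, 1, 2], [1, 2, 1], [2, 1, 1]}" for w
 proof -
  have w: "w:words" "count_list w 1 = 2" "count_list w 2 = 1" using that serre_words by auto
  have "a = 0 & b = 0" if "a <= count_list w 1" "b <= count_list w 2" "ALL j:{1, 2}. ch j (ga 1) ^ a * ch j (ga 2) ^ b = 1" for a b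
   using degrees_nontrivial[of a b] that w by simp
  thus ?thesis using cf_word_one[OF _ w(1)] w by(simp add: wm_def)
 qed
 note M = ymono_carrier[OF serre_words(1) one_gl] ymono_carrier[OF serre_words(2) one_gl] ymono_carrier[OF serre_words(3) one_gl]
 have "cf (Phi serre) \<one> = wmono 2 1 \<oplus>\<^sub>L (- (q12 + q11 * q12)) \<odot>\<^sub>L wmono 2 1 \<oplus>\<^sub>L (q11 * q12 ^ 2) \<odot>\<^sub>L wmono 2 1"
  unfolding Phi_serre using M cf by(simp add: cf_plus[OF one_gl] cf_scale[OF one_gl])
 also have "... = ((1 - q12) * (1 - q11 * q12)) \<odot>\<^sub>L wmono 2 1"
 proof -
  have "1 + - (q12 + q11 * q12) + q11 * q12 ^ 2 = (1 - q12) * (1 - q11 * q12)" by(simp add: algebra_simps power2_eq_square)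
  thus ?thesis using LA.smult_simps(1,4)[OF wmono_closed] by metis
 qed
 moreover have "cf (Phi serre) \<one> = \<zero>\<^sub>L"
  using Phi_serre_zero cf_scale[OF one_gl alg_one_closed, of 0] cf_closed[OF one_gl alg_one_closed] by simp
 ultimately have "(1 - q12) * (1 - q11 * q12) = 0" using LA.smult_eq_zero_iff[OF wmono_closed] wmono_nonzero by metis
 thus ?thesis by auto
qed

lemma power_eq_mod:
 fixes x :: 'k
 assumes o: "!!n. x ^ n = 1 \<longleftrightarrow> m dvd n" and e: "x ^ a = x ^ b"
 shows "a mod m = b mod m"
proof -
 have x: "x ~= 0" using o[of m] m by(cases m) auto
 have le: "a mod m = b mod m" if "x ^ a = x ^ b" "a <= b" for a b
 proof -
  have "x ^ b = x ^ a * x ^ (b - a)" using that(2) by(simp add: power_add[symmetric])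
  hence "x ^ (b - a) = 1" using that(1) x by simp
  hence "m dvd b - a" using o by simp
  thus ?thesis using mod_eq_dvd_iff_nat[OF that(2), of m] by simp
 qed
 show ?thesis using le[OF e] le[OF e[symmetric]] by linarith
qed

lemma characters_independent:
 assumes e: "!!g. g:grouplikes H ==> ch 1 g ^ a * ch 2 g ^ b = ch 1 g ^ a' * ch 2 g ^ b'"
 shows "a mod m = a' mod m & b mod m = b' mod m"
proof -
 have e1: "q11 ^ a * q12 ^ b = q11 ^ a' * q12 ^ b'" and e2: "q21 ^ a * q22 ^ b = q21 ^ a' * q22 ^ b'" using e gl12 by auto
 show ?thesis
 proof(cases "q12 = 1")
  case True
  hence a: "a mod m = a' mod m" using power_eq_mod[OF order1, of a a'] e1 by simp
  have "q21 * q11 = 1" using cartan True by(simp add: mult.commute)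
  hence i: "q21 ^ n * q11 ^ n = 1" for n by(simp add: power_mult_distrib[symmetric])
  have aa: "q11 ^ a = q11 ^ a'" using e1 True by simp
  have q: "q11 ^ a ~= 0" using cartan by auto
  have "q21 ^ a * q11 ^ a = q21 ^ a' * q11 ^ a" using i[of a] i[of a'] aa by simp
  hence "q21 ^ a = q21 ^ a'" by(rule mult_right_cancel[OF q, THEN iffD1])
  hence "q21 ^ a * q22 ^ b = q21 ^ a * q22 ^ b'" using e2 by simp
  moreover have "q21 ^ a ~= 0" using cartan by auto
  ultimately have "q22 ^ b = q22 ^ b'" by auto
  thus ?thesis using a power_eq_mod[OF order2, of b b'] by simp
 next
  case False
  hence q: "q11 * q12 = 1" using braiding_degenerate by simp
  hence "q21 = 1" using cartan by simp
  hence bb: "q22 ^ b = q22 ^ b'" using e2 by simp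
  hence b: "b mod m = b' mod m" by(rule power_eq_mod[OF order2])
  have "q12 ^ b = q12 ^ b'"
  proof -
   have i: "q12 ^ n * q11 ^ n = 1" for n using q by(simp add: power_mult_distrib[symmetric] mult.commute)
   have "q11 ^ b = q11 ^ b'"
   proof -
    have p: "q11 ^ (m * n + k) = q11 ^ k" for n k using order1[of m] by(simp add: power_add power_mult)
    have "q11 ^ b = q11 ^ (b mod m)" "q11 ^ b' = q11 ^ (b' mod m)"
     using p[of "b div m" "b mod m"] p[of "b' div m" "b' mod m"] by auto
    thus ?thesis using b by simp
   qed
   hence "q12 ^ b * q11 ^ b = q12 ^ b' * q11 ^ b" using i[of b] i[of b'] by simp
   moreover have "q11 ^ b ~= 0" using cartan by auto
   ultimately show ?thesis by auto
  qed
  hence "q11 ^ a * q12 ^ b = q11 ^ a' * q12 ^ b" using e1 by simp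
  moreover have "q12 ^ b ~= 0" using cartan by auto
  ultimately have "q11 ^ a = q11 ^ a'" by auto
  thus ?thesis using power_eq_mod[OF order1, of a a'] b by simp
 qed
qed

lemma sig_scalar: "g:grouplikes H ==> sig g (d \<odot>\<^sub>L \<one>\<^sub>L) = d \<odot>\<^sub>L \<one>\<^sub>L"
 using sig_simps(3,4)[OF _ LF.one_closed] by simp

text \<open>
 The descent: an invariant monomial is an \<open>m\<close>-th power of a monomial, which is then algebraic over the
 ground field and hence again a scalar.
\<close>

lemma wmono_scalar: "wmono a b = d \<odot>\<^sub>L \<one>\<^sub>L ==> a = 0 & b = 0"
proof(induction "a + b" arbitrary: a b d rule: less_induct)
 case less
 have "ch 1 g ^ a * ch 2 g ^ b = ch 1 g ^ 0 * ch 2 g ^ 0" if g: "g:grouplikes H" for g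
 proof -
  let ?c = "ch 1 g ^ a * ch 2 g ^ b"
  have "?c \<odot>\<^sub>L wmono a b = sig g (wmono a b)" by(rule sig_wmono[OF g, symmetric])
  also have "... = wmono a b" unfolding less.prems by(rule sig_scalar[OF g])
  finally have "?c \<odot>\<^sub>L wmono a b = wmono a b" .
  hence "(?c + (- 1)) \<odot>\<^sub>L wmono a b = \<zero>\<^sub>L"
   using LA.smult_simps(4)[OF wmono_closed, of ?c a b "-1"] LA.smult_simps(4)[OF wmono_closed, of 1 a b "-1"] by simp
  hence "?c + (- 1) = 0" using LA.smult_eq_zero_iff[OF wmono_closed] wmono_nonzero by simp
  thus ?thesis by simp
 qed
 hence "a mod m = 0" "b mod m = 0" using characters_independent[of a b 0 0] by auto
 then obtain a' b' where ab: "a = m * a'" "b = m * b'" by blast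
 have "wmono a' b' [^]\<^bsub>L\<^esub> m = d \<odot>\<^sub>L \<one>\<^sub>L" using less.prems ab wmono_pow by simp
 then obtain d' where d': "wmono a' b' = d' \<odot>\<^sub>L \<one>\<^sub>L" using root_scalar[OF wmono_closed, of m a' b' d] m by auto
 show ?case
 proof(cases "a + b = 0")
  case False
  hence "a' + b' < a + b" using ab m by(cases "a' = 0"; cases "b' = 0") (auto intro!: add_strict_mono add_le_less_mono)
  from less.hyps[OF this d'] show ?thesis using ab by simp
 qed simp
qed

end

section \<open>The Nichols ideal acts by zero\<close>

lemma wc_left_end: "(\<Sum>(c, u, v)\<leftarrow>word_comult ga ch w. if v = [] then c * K u v else 0) = K w []" for K :: "nat list => nat list => 'k::field"
proof(induction w arbitrary: K)
 case (Cons i w)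
 have "(\<Sum>(c, u, v)\<leftarrow>concat (map (%(c, u, v). [(c, i # u, v), (c * word_char ch u (ga i), u, i # v)]) xs). if v = [] then c * K u v else 0)
  = (\<Sum>(c, u, v)\<leftarrow>xs. if v = [] then c * K (i # u) v else 0)" for xs
  by(induction xs) auto
 thus ?case using Cons.IH[of "%u v. K (i # u) v"] by simp
qed simp

lemma wc_right_end: "(\<Sum>(c, u, v)\<leftarrow>word_comult ga ch w. if u = [] then c * K u v else 0) = K [] w" for K :: "nat list => nat list => 'k::field"
proof(induction w arbitrary: K)
 case (Cons i w)
 have "(\<Sum>(c, u, v)\<leftarrow>concat (map (%(c, u, v). [(c, i # u, v), (c * word_char ch u (ga i), u, i # v)]) xs). if u = [] then c * K u v else 0)
  = (\<Sum>(c, u, v)\<leftarrow>xs. if u = [] then c * K u (i # v) else 0)" for xs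
  by(induction xs) (auto simp: word_char_def)
 thus ?case using Cons.IH[of "%u v. K u (i # v)"] by simp
qed simp

lemma wc_split:
 fixes K :: "nat list => nat list => 'k::field"
 assumes w: "w ~= []"
 shows "(\<Sum>(c, u, v)\<leftarrow>word_comult ga ch w. c * K u v)
  = (\<Sum>(c, u, v)\<leftarrow>word_comult ga ch w. c * (if u ~= [] & v ~= [] then K u v else 0)) + K w [] + K [] w"
proof -
 have "(\<Sum>(c, u, v)\<leftarrow>xs. c * K u v) = (\<Sum>(c, u, v)\<leftarrow>xs. c * (if u ~= [] & v ~= [] then K u v else 0))
   + (\<Sum>(c, u, v)\<leftarrow>xs. if v = [] then c * K u v else 0) + (\<Sum>(c, u, v)\<leftarrow>xs. if u = [] then c * K u v else 0)"
  if "!!c u v. (c, u, v):set xs ==> u ~= [] \<or> v ~= []" for xs :: "('k\<times>nat list\<times>nat list) list"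
  using that
 proof(induction xs)
  case (Cons a xs)
  obtain c u v where a: "a = (c, u, v)" by(cases a)
  have "u ~= [] \<or> v ~= []" using Cons.prems[of c u v] a by simp
  thus ?case using Cons.IH[OF Cons.prems[OF list.set_intros(2)]] a by simp
 qed simp
 moreover have "u ~= [] \<or> v ~= []" if "(c, u, v):set (word_comult ga ch w)" for c u v
  using wc_counts[OF that, of 1] w by auto
 ultimately show ?thesis using wc_left_end[where K = K and ga = ga and ch = ch and w = w] wc_right_end[where K = K and ga = ga and ch = ch and w = w] by simp
qed

context cartan_action
begin

lemma fsum_slices:
 assumes y: "y:car Y.TB"
 shows "fsum y Q = (\<Sum>g\<in>grouplikes H. fsum (Y.slice y g) (%w. Q (w, g)))"
proof -
 let ?W = "fst ` {z. y z ~= 0}" and ?G = "grouplikes H"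
 have W: "finite ?W" using TB_finite[OF y] by simp
 have "fsum y Q = (\<Sum>z\<in>?W\<times>?G. y z * Q z)"
  by(rule fsum_superset) (use W finite_gls TB_supp[OF y] in \<open>auto intro: rev_image_eqI\<close>)
 also have "... = (\<Sum>w\<in>?W. \<Sum>g\<in>?G. y (w, g) * Q (w, g))" by(simp add: sum.cartesian_product)
 also have "... = (\<Sum>g\<in>?G. \<Sum>w\<in>?W. y (w, g) * Q (w, g))" by(rule sum.swap)
 also have "... = (\<Sum>g\<in>?G. fsum (Y.slice y g) (%w. Q (w, g)))"
 proof(rule sum.cong[OF refl])
  fix g
  have "fsum (Y.slice y g) (%w. Q (w, g)) = (\<Sum>w\<in>?W. Y.slice y g w * Q (w, g))"
   by(rule fsum_superset[OF W]) (auto simp: Y.slice_def intro: rev_image_eqI)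
  thus "(\<Sum>w\<in>?W. y (w, g) * Q (w, g)) = fsum (Y.slice y g) (%w. Q (w, g))" by(simp add: Y.slice_def)
 qed
 finally show ?thesis .
qed

lemma Phi_form: "lf f ==> linear_form Y.TB (%x. f (Phi x))"
 by(rule Y.TBk.linear_formI) (use Phi_closed Phi_add Phi_smult lf_add lf_smult in simp_all)

lemma Phi_emb_form:
 assumes f: "lf f" and x: "x:fin_supp words" and g: "g:grouplikes H"
 shows "f (Phi (Y.emb x g)) = fsum x (%w. f (ymono (w, g)))"
proof -
 have "f (Phi (Y.emb x g)) = fsum x (%w. f (Phi (single (w, g))))"
  using Y.form_emb[OF Phi_form[OF f] x] g by simp
 also have "... = fsum x (%w. f (ymono (w, g)))"
  by(rule fsum_cong) (use fin_suppD(2)[OF x] g in \<open>simp add: Phi_single\<close>)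
 finally show ?thesis .
qed

lemma emb_closed: "[|x:fin_supp words; g:grouplikes H|] ==> Y.emb x g:car Y.TB"
 using Y.emb_closed[of x g] by simp

lemma Phi_emb:
 assumes x: "x:fin_supp words" and g: "g:grouplikes H"
 shows "Phi (Y.emb x g) = Phi (Y.emb x \<one>)\<otimes>al g"
proof(rule eq_if_forms_eq)
 note P = Phi_closed[OF emb_closed[OF x one_gl]] and a = al_carrier(1)[OF g]
 show "Phi (Y.emb x g):car H" by(rule Phi_closed[OF emb_closed[OF x g]])
 show "Phi (Y.emb x \<one>)\<otimes>al g:car H" using P a by simp
 fix f assume f: "lf f"
 have "f (Phi (Y.emb x \<one>)\<otimes>al g) = fsum x (%w. f (ymono (w, \<one>)\<otimes>al g))"
  by(rule Phi_emb_form[OF lf_comp[OF f linmap_mult_right[OF a]] x one_gl])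
 also have "... = fsum x (%w. f (ymono (w, g)))"
 proof(rule fsum_cong)
  fix w assume "x w ~= 0"
  hence w: "w:words" using fin_suppD(2)[OF x] by simp
  show "f (ymono (w, \<one>)\<otimes>al g) = f (ymono (w, g))"
   using ymono_mult[OF _ one_gl g w, of "[]"] gl_carrier[OF g] ymono_carrier[OF w g]
   by(simp add: ymono_simps Y.words_simps)
 qed
 finally show "f (Phi (Y.emb x g)) = f (Phi (Y.emb x \<one>)\<otimes>al g)" using Phi_emb_form[OF f x g] by simp
qed

lemma NI_closed: "f:Y.NI ==> f:fin_supp words"
 using NI_carrier by auto

text \<open>
 The induction step. If \<open>Phi\<close> kills the elements of smaller length of the ideal, then it maps the homogeneous
 elements of length \<open>n\<close> to skew-primitive elements, because the ideal is a coideal.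
\<close>

lemma Phi_homogeneous_comult:
 assumes IH: "!!x. [|x:Y.NK; !!w g. x (w, g) ~= 0 ==> length w < n|] ==> Phi x = \<zero>"
  and x: "x:Y.NK" and n: "2 <= n" and len: "!!w g. x (w, g) ~= 0 ==> length w = n & g = \<one> & word_deg G ga w = e"
  and e: "e:grouplikes H" and be: "bil be"
 shows "comult H (Phi x) be = be (al e) (Phi x) + be (Phi x) \<one>"
proof -
 note xc = Y.NK_D(1)[OF x] and oc = alg_one_closed
 let ?t = "cut (%l. 0 < l & l < n)"
 let ?be' = "%u v. be (Phi (?t u)) (Phi (?t v))"
 have b': "bilinear_form Y.TB Y.TB ?be'"
  by(rule bilinear_pullback[OF be]) (use Phi_closed[OF cut_closed] Phi_add[OF cut_closed cut_closed] Phi_smult[OF cut_closed] in \<open>simp_all add: cut_linear\<close>)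
 have tz: "Phi (?t u) = \<zero>" if u: "u:Y.NK" for u
 proof -
  have "?t u = cut (%l. l < n) u"
  proof
   fix z :: "nat list\<times>'a" obtain w g where z: "z = (w, g)" by(cases z)
   have "u ([], g) = 0" for g
    using TB_supp[OF Y.NK_D(1)[OF u], of "[]" g] single_not_in_NK[OF u, of "[]" g] by(cases "u ([], g) = 0") auto
   thus "?t u z = cut (%l. l < n) u z" by(auto simp: cut_def z)
  qed
  moreover have "Phi (cut (%l. l < n) u) = \<zero>"
   by(rule IH[OF cut_NK_below[OF u]]) (simp add: cut_def split: if_splits)
  ultimately show ?thesis by simp
 qed
 have z0: "be \<zero> v = 0" "be v \<zero> = 0" if "v:car H" for v
  using lf_zero[OF bilformD(2)[OF be that]] lf_zero[OF bilformD(1)[OF be that]] by auto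
 have "comult Y.TB x ?be' = 0"
  by(rule Y.NK_coideal[OF b' _ _ x]) (use tz z0 Phi_closed[OF cut_closed] in simp_all)
 hence zero: "fsum x (%(w, g). \<Sum>(c, u, v)\<leftarrow>word_comult ga ch w. c * ?be' (single (u, word_deg G ga v\<otimes>g)) (single (v, g))) = 0"
  using bos_comult[OF b', of x] by simp
 have "comult H (Phi x) be = fsum x (%(w, g). \<Sum>(c, u, v)\<leftarrow>word_comult ga ch w. c * be (Phi (single (u, word_deg G ga v\<otimes>g))) (Phi (single (v, g))))"
  using Phi_comult[OF xc be] bos_comult[OF Phi_bilinear[OF be], of x] by simp
 also have "... = fsum x (%z. (case z of (w, g) => \<Sum>(c, u, v)\<leftarrow>word_comult ga ch w. c * ?be' (single (u, word_deg G ga v\<otimes>g)) (single (v, g)))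
   + (be (ymono z) \<one> + be (al e) (ymono z)))"
 proof(rule fsum_cong, clarify)
  fix w g assume "x (w, g) ~= 0"
  hence w: "w:words" "length w = n" "g = \<one>" "word_deg G ga w = e" using TB_supp[OF xc] len by auto
  let ?K = "%u v. be (Phi (single (u, word_deg G ga v\<otimes>g))) (Phi (single (v, g)))"
  have "w ~= []" using w n by auto
  have t: "c * (if u ~= [] & v ~= [] then ?K u v else 0) = c * ?be' (single (u, word_deg G ga v\<otimes>g)) (single (v, g))"
   if cuv: "(c, u, v):set (word_comult ga ch w)" for c u v
  proof -
   have l: "length u + length v = n" using wc_counts[OF cuv, of 1] w(2) by simp
   have uv: "u:words" "v:words" using wc_in_W[OF cuv w(1)] by auto
   have d: "word_deg G ga v\<otimes>g:grouplikes H" using Y.word_deg_closed[OF uv(2)] gl_mult w(3) one_gl by simp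
   have c: "Phi (single (u, word_deg G ga v\<otimes>g)):car H" "Phi (single (v, g)):car H"
    using Phi_single[OF uv(1) d] Phi_single[OF uv(2), of g] ymono_carrier[OF uv(1) d] ymono_carrier[OF uv(2), of g] w(3) one_gl by auto
   show ?thesis
   proof(cases "u ~= [] & v ~= []")
    case True
    hence "0 < length u & length u < n" "0 < length v & length v < n" using l by auto
    thus ?thesis by(simp add: cut_single)
   next
    case False
    hence "?t (single (u, word_deg G ga v\<otimes>g)) = (%z. 0 :: 'k) \<or> ?t (single (v, g)) = (%z. 0 :: 'k)"
     by(auto simp: cut_single)
    moreover have "Phi (?t (single (u, word_deg G ga v\<otimes>g))):car H" "Phi (?t (single (v, g))):car H"
     using c by(simp_all add: cut_single Phi_zero)
    ultimately show ?thesis using False z0 by(auto simp: Phi_zero)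
   qed
  qed
  have "?K w [] = be (ymono (w, g)) \<one>" "?K [] w = be (al e) (ymono (w, g))"
   using w Phi_single[OF w(1) one_gl] Phi_one Phi_single[of "[]" e] e gl_carrier[OF e] oc
   by(simp_all add: Y.words_simps ymono_simps)
  moreover have "(\<Sum>(c, u, v)\<leftarrow>word_comult ga ch w. c * (if u ~= [] & v ~= [] then ?K u v else 0))
   = (\<Sum>(c, u, v)\<leftarrow>word_comult ga ch w. c * ?be' (single (u, word_deg G ga v\<otimes>g)) (single (v, g)))"
   by(intro arg_cong[where f=sum_list] map_cong refl) (use t in auto)
  ultimately show "(\<Sum>(c, u, v)\<leftarrow>word_comult ga ch w. c * ?K u v)
   = (\<Sum>(c, u, v)\<leftarrow>word_comult ga ch w. c * ?be' (single (u, word_deg G ga v\<otimes>g)) (single (v, g))) + (be (ymono (w, g)) \<one> + be (al e) (ymono (w, g)))"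
   using wc_split[OF \<open>w \<noteq> []\<close>, where K = ?K and ga = ga and ch = ch] by simp
 qed
 also have "... = be (Phi x) \<one> + be (al e) (Phi x)"
  unfolding fsum_plus zero using lf_Phi[OF xc bilformD(2)[OF be oc]] lf_Phi[OF xc bilformD(1)[OF be al_carrier(1)[OF e]]] by simp
 finally show ?thesis by simp
qed

lemma cf_Phi:
 assumes x: "x:car Y.TB" and u: "u:car L"
  and t: "!!w h. x (w, h) ~= 0 ==> cf (ymono (w, h)) \<one> = t (w, h) \<odot>\<^sub>L u"
 shows "cf (Phi x) \<one> = fsum x t \<odot>\<^sub>L u"
proof -
 have "cf (\<Oplus>z\<in>J. x z\<odot>ymono z) \<one> = (\<Sum>z\<in>J. x z * t z) \<odot>\<^sub>L u & (\<Oplus>z\<in>J. x z\<odot>ymono z):car H"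
  if "finite J" "J \<subseteq> {z. x z ~= 0}" for J
  using that
 proof(induction J rule: finite_induct)
  case empty
  show ?case using u cf_scale[OF one_gl alg_one_closed, of 0] cf_closed[OF one_gl alg_one_closed] alg_one_closed by simp
 next
  case (insert z J)
  have c: "ymono v:car H" if "v:insert z J" for v using ymono_supp[OF x] that insert.prems by blast
  have "(\<Oplus>v\<in>insert z J. x v\<odot>ymono v) = x z\<odot>ymono z\<oplus>(\<Oplus>v\<in>J. x v\<odot>ymono v)"
   using insert.hyps c by(subst vec_finsum_insert) auto
  moreover have "cf (ymono z) \<one> = t z \<odot>\<^sub>L u" using t[of "fst z" "snd z"] insert.prems by auto
  ultimately show ?case using insert c[of z] u cf_scale[OF one_gl c[of z]] by(simp add: cf_plus[OF one_gl])
 qed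
 from this[OF TB_finite[OF x] subset_refl] show ?thesis by(simp add: Phi_def fsum_def)
qed

text \<open>Both expressions for the coefficient of the identity in the action of \<open>Phi x\<close> are compared: the one coming from the
 bidegree \<open>(a, b)\<close> and the one coming from the description of skew-primitive elements.\<close>

lemma skew_prim_action_zero:
 assumes x: "x:car Y.TB" and e: "e:grouplikes H" and n: "2 <= a + b"
  and hom: "!!w h. x (w, h) ~= 0 ==> h = \<one> & count_list w 1 = a & count_list w 2 = b"
  and com: "!!be. bil be ==> comult H (Phi x) be = be (al e) (Phi x) + be (Phi x) \<one>"
 shows "Phi x = \<zero>"
proof(rule ccontr)
 assume nz: "Phi x ~= \<zero>"
 note PH = Phi_closed[OF x] and one = one_gl
 have wt: "h = \<one> & word_char ch w g = ch 1 g ^ a * ch 2 g ^ b" if "x (w, h) ~= 0" for w h g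
  using hom[OF that] TB_supp[OF x that] Y.word_char_counts[of w g] by simp
 obtain y where y: "y:car Y.TB" "Phi x = Phi y"
  and yw: "!!w h. y (w, h) ~= 0 ==> length w <= 1 & (ALL g:grouplikes H. ch 1 g ^ a * ch 2 g ^ b = word_char ch w g)"
  and y1: "!!i h. y ([i], h) ~= 0 ==> h = \<one> & e = ga i"
  and y0: "!!h. y ([], h) ~= 0 ==> h = \<one> \<or> h = e" "y ([], \<one>) + y ([], e) = 0"
  using skew_prim_form[OF skew_prim_filt[OF PH e com] e com Phi_weight[OF x wt]] by auto
 \<comment> \<open>all words that occur in \<open>y\<close> have the same character, hence coincide\<close>
 have cong: "count_list w 1 = a mod m & count_list w 2 = b mod m" if "y (w, h) ~= 0" for w h
 proof -
  have w: "w:words" "length w <= 1" using TB_supp[OF y(1) that] yw[OF that] by auto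
  have "a mod m = count_list w 1 mod m & b mod m = count_list w 2 mod m"
   by(rule characters_independent) (use yw[OF that] Y.word_char_counts[OF w(1)] in simp)
  moreover have "count_list w 1 < m" "count_list w 2 < m" using w m count_le_length[of w 1] count_le_length[of w 2] by linarith+
  ultimately show ?thesis by simp
 qed
 have "EX z. y z ~= 0"
 proof(rule ccontr)
  assume "\<not> (EX z. y z ~= 0)"
  hence "y = (%z. 0)" by auto
  thus False using y(2) nz Phi_zero by simp
 qed
 then obtain w h where wh: "y (w, h) ~= 0" by auto
 have w: "w:words" "length w <= 1" using TB_supp[OF y(1) wh] yw[OF wh] by auto
 have same: "v = w" if "y (v, k) ~= 0" for v k
 proof -
  have v: "v:words" "length v <= 1" using TB_supp[OF y(1) that] yw[OF that] by auto
  have "count_list v 1 = count_list w 1" "count_list v 2 = count_list w 2" using cong[OF that] cong[OF wh] by auto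
  thus ?thesis using v w by(cases v; cases w) (auto simp: Y.words_simps)
 qed
 have cfy: "cf (ymono (w, k)) \<one> = (if k = \<one> then 1 else 0) \<odot>\<^sub>L wm w" if nz: "y (w, k) ~= 0" for k
 proof(cases w)
  case Nil
  have k: "k:grouplikes H" using TB_supp[OF y(1) nz] by blast
  show ?thesis using cf_al[OF one k] Nil by(simp add: ymono_simps wm_simps)
 next
  case (Cons i v)
  hence "w = [i]" using w by auto
  hence k: "k = \<one>" using y1 nz by blast
  have "cf (ymono (w, \<one>)) \<one> = wm w"
  proof(rule cf_word_one[OF _ w(1)])
   fix a b assume ab: "a <= count_list w 1" "b <= count_list w 2" "ALL j:{1, 2}. ch j (ga 1) ^ a * ch j (ga 2) ^ b = 1"
   have "a <= 2" "b <= 1" using ab(1,2) w(2) count_le_length[of w 1] count_le_length[of w 2] by linarith+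
   thus "a = 0 & b = 0" using degrees_nontrivial[of a b] ab(3) by simp
  qed
  thus ?thesis using k wm_closed by simp
 qed
 have "cf (Phi y) \<one> = fsum y (%z. if z = (w, \<one>) then 1 else 0) \<odot>\<^sub>L wm w"
  by(rule cf_Phi[OF y(1) wm_closed]) (use same cfy in auto)
 moreover have "y (w, \<one>) ~= 0"
 proof(cases w)
  case Nil
  thus ?thesis using y0(1)[of h] y0(2) wh by auto
 next
  case (Cons i v)
  hence "w = [i]" using w by auto
  thus ?thesis using y1 wh by blast
 qed
 ultimately have "EX c. c ~= 0 & cf (Phi x) \<one> = c \<odot>\<^sub>L wm w" using y(2) fsum_point[OF TB_finite[OF y(1)], of "(w, \<one>)" 1] by auto
 then obtain c where c: "c ~= 0" "cf (Phi x) \<one> = c \<odot>\<^sub>L wm w" by auto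
 have "EX c. x z ~= 0 --> cf (ymono z) \<one> = c \<odot>\<^sub>L wmono a b" for z
  using cf_word[OF _ one, of "fst z"] hom[of "fst z" "snd z"] TB_supp[OF x, of "fst z" "snd z"] by(cases z) (auto simp: wm_def)
 then obtain t where t: "!!z. x z ~= 0 ==> cf (ymono z) \<one> = t z \<odot>\<^sub>L wmono a b" by metis
 define \<theta> where "\<theta> = fsum x t"
 have \<theta>: "cf (Phi x) \<one> = \<theta> \<odot>\<^sub>L wmono a b" unfolding \<theta>_def by(rule cf_Phi[OF x wmono_closed t])
 let ?a = "count_list w 1" and ?b = "count_list w 2"
 obtain a' b' where ab: "a = ?a + m * a'" "b = ?b + m * b'" using cong[OF wh] mod_mult_div_eq[of a m] mod_mult_div_eq[of b m] by metis
 let ?u = "wmono (m * a') (m * b')"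
 have wab: "wmono a b = wm w\<bullet>?u" unfolding wm_def using ab wmono_add by simp
 have nzw: "wm w ~= \<zero>\<^sub>L" by(simp add: wm_def wmono_nonzero)
 have "wm w\<bullet>(\<theta> \<odot>\<^sub>L ?u) = wm w\<bullet>(c \<odot>\<^sub>L \<one>\<^sub>L)"
  using \<theta> c(2) wab by(simp add: LA.smult_mult_right)
 hence eq: "\<theta> \<odot>\<^sub>L ?u = c \<odot>\<^sub>L \<one>\<^sub>L" using LF.m_lcancel[OF nzw wm_closed] by simp
 have "\<theta> ~= 0"
 proof
  assume "\<theta> = 0"
  hence "c \<odot>\<^sub>L \<one>\<^sub>L = \<zero>\<^sub>L" using eq by simp
  thus False using c(1) LA.smult_eq_zero_iff[OF LF.one_closed] LF.one_not_zero by simp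
 qed
 hence "?u = (inverse \<theta> * c) \<odot>\<^sub>L \<one>\<^sub>L"
  using arg_cong[OF eq, of "%v. inverse \<theta> \<odot>\<^sub>L v"] by simp
 hence "m * a' = 0" "m * b' = 0" using wmono_scalar by blast+
 hence "a + b = ?a + ?b" using ab by simp
 also have "... = length w" using Y.count_two[OF w(1)] by simp
 finally show False using w(2) n by simp
qed

end

context kspace
begin

lemma vec_zero_zero: "\<zero> \<oplus> \<zero> = \<zero>"
 by simp

lemma vec_minus_self: "x:car M ==> x\<ominus>x = \<zero>"
 by(simp add: M.minus_eq M.r_neg)

end

context cartan_action
begin

lemma Phi_NI_homogeneous:
 assumes IH: "!!x. [|x:Y.NK; !!w g. x (w, g) ~= 0 ==> length w < n|] ==> Phi x = \<zero>"
  and n: "2 <= n" and f: "f:Y.NI" "!!w. f w ~= 0 ==> count_list w 1 = a & length w = n"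
 shows "Phi (Y.emb f \<one>) = \<zero>"
proof(cases "f = (%w. 0)")
 case True
 hence "Y.emb f \<one> = (%z. 0)" by(auto simp: Y.emb_def)
 thus ?thesis by(simp add: Phi_zero)
next
 case False
 then obtain w0 where w0: "f w0 ~= 0" by auto
 let ?x = "Y.emb f \<one>"
 note fc = NI_closed[OF f(1)] and one = one_gl
 have x: "?x:Y.NK" using Y.emb_NK[OF f(1), of \<one>] one by simp
 have w0W: "w0:words" using fin_suppD(2)[OF fc w0] .
 have e: "word_deg G ga w0:grouplikes H" using Y.word_deg_closed[OF w0W] by simp
 have supp: "w:words & h = \<one> & count_list w 1 = a & count_list w 2 = n - a & length w = n" if "?x (w, h) ~= 0" for w h
 proof -
  have h: "h = \<one>" "f w ~= 0" using that by(auto simp: Y.emb_def split: if_splits)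
  have "w:words" using fin_suppD(2)[OF fc h(2)] .
  thus ?thesis using Y.count_two[of w] f(2)[OF h(2)] h(1) by simp
 qed
 have "?x (w0, \<one>) ~= 0" using w0 by(simp add: Y.emb_def)
 note s0 = supp[OF this]
 have com: "comult H (Phi ?x) be = be (al (word_deg G ga w0)) (Phi ?x) + be (Phi ?x) \<one>" if "bil be" for be
 proof(rule Phi_homogeneous_comult[OF IH x n _ e that])
  fix w g assume "?x (w, g) ~= 0"
  from supp[OF this] s0 show "length w = n & g = \<one> & word_deg G ga w = word_deg G ga w0"
   using Y.word_deg_counts[of w] Y.word_deg_counts[of w0] by simp
 qed
 have "a + (n - a) = n" using s0 Y.count_two[OF w0W] by simp
 have "2 <= a + (n - a)" using n by simp
 thus ?thesis
  by(rule skew_prim_action_zero[OF Y.NK_D(1)[OF x] e _ _ com]) (use supp in blast)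
qed

lemma Phi_NK_bounded: "[|x:Y.NK; !!w g. x (w, g) ~= 0 ==> length w < n|] ==> Phi x = \<zero>"
proof(induction n arbitrary: x)
 case 0
 hence "x = (%z. 0)" by fastforce
 thus ?case by(simp add: Phi_zero)
next
 case (Suc n)
 note xc = Y.NK_D(1)[OF Suc.prems(1)]
 show ?case
 proof(cases "n < 2")
  case True
  have "x z = 0" for z
  proof(rule ccontr)
   obtain w g where z: "z = (w, g)" by(cases z)
   assume "x z ~= 0"
   hence "g:grouplikes H" "length w < 2" using TB_supp[OF xc] Suc.prems(2)[of w g] True z by auto
   thus False using single_not_in_NK[OF Suc.prems(1)] \<open>x z \<noteq> 0\<close> z by simp
  qed
  hence "x = (%z. 0)" by auto
  thus ?thesis by(simp add: Phi_zero)
 next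
  case False
  let ?r = "cut (%l. l < n) x" and ?p = "cut (%l. l = n) x"
  have r: "Phi ?r = \<zero>" by(rule Suc.IH[OF cut_NK_below[OF Suc.prems(1)]]) (simp add: cut_def split: if_splits)
  have emb: "Phi (Y.emb (len_part n f) \<one>) = \<zero>" if "f:Y.NI" for f
   using that
  proof(induction rule: nichols_bihomogeneous_induct)
   case (homogeneous f a n')
   show ?case
   proof(cases "n' = n")
    case True
    hence "len_part n f = f" using homogeneous(2) by(auto simp: len_part_def fun_eq_iff)
    thus ?thesis using Phi_NI_homogeneous[OF Suc.IH _ homogeneous(1), of n a] homogeneous(2) True False by simp
   next
    case False
    hence "len_part n f = (%w. 0)" using homogeneous(2) by(auto simp: len_part_def fun_eq_iff)
    hence "Y.emb (len_part n f) \<one> = (%z. 0)" by(auto simp: Y.emb_def)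
    thus ?thesis by(simp add: Phi_zero)
   qed
  next
   case (add f h)
   note c = emb_closed[OF len_part_closed[OF NI_closed[OF add(1)]] one_gl, of n]
    emb_closed[OF len_part_closed[OF NI_closed[OF add(2)]] one_gl, of n]
   have "Y.emb (len_part n (%w. f w + h w)) \<one> = (%z. Y.emb (len_part n f) \<one> z + Y.emb (len_part n h) \<one> z)"
    by(auto simp: Y.emb_def len_part_def)
   thus ?case using Phi_add[OF c] add(3,4) by simp
  qed
  have p: "Phi ?p = \<zero>"
  proof(rule eq_if_forms_eq[OF Phi_closed[OF cut_closed[OF xc]] sub_zero[OF whole_sub]])
   fix f assume f: "lf f"
   have slice: "Y.slice ?p g = len_part n (Y.slice x g)" for g by(auto simp: cut_def Y.slice_def len_part_def)
   have "fsum (Y.slice ?p g) (%w. f (ymono (w, g))) = 0" if g: "g:grouplikes H" for g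
   proof -
    have s: "Y.slice x g:Y.NI" using Y.NK_D(2)[OF Suc.prems(1), of g] g by simp
    note lc = len_part_closed[OF NI_closed[OF s], of n]
    have "Phi (Y.emb (len_part n (Y.slice x g)) g) = \<zero>"
     using Phi_emb[OF lc g] emb[OF s] ring.ring_simprules(24)[OF alg_ring al_carrier(1)[OF g]] by simp
    thus ?thesis using Phi_emb_form[OF f lc g] lf_zero[OF f] slice by simp
   qed
   thus "f (Phi ?p) = f \<zero>"
    using lf_Phi[OF cut_closed[OF xc] f, of "%l. l = n"] fsum_slices[OF cut_closed[OF xc], of "%l. l = n" "%z. f (ymono z)"] lf_zero[OF f] by simp
  qed
  have "x = (%z. ?r z + ?p z)"
  proof
   fix z :: "nat list\<times>'a" obtain w g where z: "z = (w, g)" by(cases z)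
   show "x z = ?r z + ?p z" using Suc.prems(2)[of w g] by(cases "x (w, g) = 0") (auto simp: cut_def z)
  qed
  hence "Phi x = Phi (%z. ?r z + ?p z)" by simp
  thus ?thesis using Phi_add[OF cut_closed[OF xc] cut_closed[OF xc], of "%l. l < n" "%l. l = n"] r p vec_zero_zero by simp
 qed
qed

lemma length_bound: "x:car Y.TB ==> EX N. ALL w g. x (w, g) ~= 0 --> length w < N"
proof -
 assume "x:car Y.TB"
 hence "finite ((%z. length (fst z)) ` {z. x z ~= 0})" using TB_finite by simp
 then obtain N where "ALL l:(%z. length (fst z)) ` {z. x z ~= 0}. l < N" using finite_nat_set_iff_bounded by auto
 thus ?thesis by(intro exI[of _ N]) force
qed

lemma Phi_zero_iff:
 assumes x: "x:car Y.TB"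
 shows "Phi x = \<zero> \<longleftrightarrow> x:Y.NK"
proof
 assume "x:Y.NK"
 thus "Phi x = \<zero>" using Phi_NK_bounded[of x] length_bound[OF x] by auto
next
 have "[|x:car Y.TB; !!w g. x (w, g) ~= 0 ==> length w < n; Phi x = \<zero>|] ==> x:Y.NK" for n x
 proof(induction n arbitrary: x)
  case 0
  hence "x = (%z. 0)" by fastforce
  thus ?case using NK_zero by simp
 next
  case (Suc n)
  let ?r = "cut (%l. l < n) x" and ?p = "cut (%l. l = n) x"
  note c = cut_closed[OF Suc.prems(1)]
  have "Phi x:Kb n" using Suc.prems(3) sub_zero[OF below_sub] by simp
  hence p: "?p:Y.NK" by(rule leading_part[OF Suc.prems(1)]) (use Suc.prems(2) in fastforce)
  have xz: "x = (%z. ?r z + ?p z)"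
  proof
   fix z :: "nat list\<times>'a" obtain w g where z: "z = (w, g)" by(cases z)
   show "x z = ?r z + ?p z" using Suc.prems(2)[of w g] by(cases "x (w, g) = 0") (auto simp: cut_def z)
  qed
  have "Phi ?p = \<zero>" by(rule Phi_NK_bounded[OF p, of "Suc n"]) (simp add: cut_def split: if_splits)
  moreover have "Phi x = Phi ?r\<oplus>Phi ?p" using arg_cong[OF xz, of Phi] Phi_add[OF c c, of "%l. l < n" "%l. l = n"] by simp
  ultimately have "Phi ?r = \<zero>" using Suc.prems(3) Phi_closed[OF c] by simp
  hence "?r:Y.NK" by(intro Suc.IH[OF c]) (simp_all add: cut_def split: if_splits)
  from NK_add[OF this p] xz show ?case by simp
 qed
 thus "Phi x = \<zero> ==> x:Y.NK" using length_bound[OF x] x by auto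
qed

definition lift :: "'a => nat list\<times>'a => 'k" where
 "lift h = (SOME x. x:car Y.TB & Phi x = h)"

lemma lift: "h:car H ==> lift h:car Y.TB & Phi (lift h) = h"
proof -
 assume "h:car H"
 then obtain x where "x:car Y.TB" "Phi x = h" using Phi_surj[of h] by auto
 hence "EX x. x:car Y.TB & Phi x = h" by auto
 thus ?thesis unfolding lift_def by(rule someI_ex)
qed

definition to_gr :: "'a => nat => 'a set" where
 "to_gr h = kap (lift h)"

lemma to_gr_Phi: "x:car Y.TB ==> to_gr (Phi x) = kap x"
proof -
 assume x: "x:car Y.TB"
 note l = lift[OF Phi_closed[OF x]]
 have "Phi (%z. lift (Phi x) z + (- 1) * x z) = Phi x\<ominus>Phi x" using Phi_diff[of "lift (Phi x)" x] l x by simp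
 also have "... = \<zero>" using vec_minus_self[OF Phi_closed[OF x]] .
 finally have "(%z. lift (Phi x) z + (- 1) * x z):Y.NK" using Phi_zero_iff[OF TB_diff[of "lift (Phi x)" x]] l x by simp
 thus ?thesis unfolding to_gr_def using kap_eq_iff[of "lift (Phi x)" x] l x by simp
qed

lemma to_gr_closed: "h:car H ==> to_gr h:car gra"
 using kap_closed lift by(simp add: to_gr_def)

lemma to_gr_bij: "bij_betw to_gr (car H) (car gra)"
 unfolding bij_betw_def
proof
 show "inj_on to_gr (car H)"
 proof(rule inj_onI)
  fix h k assume hk: "h:car H" "k:car H" "to_gr h = to_gr k"
  note l = lift[OF hk(1)] lift[OF hk(2)]
  have "(%z. lift h z + (- 1) * lift k z):Y.NK" using kap_eq_iff[of "lift h" "lift k"] l hk(3) by(simp add: to_gr_def)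
  hence "Phi (%z. lift h z + (- 1) * lift k z) = \<zero>" using Phi_zero_iff[OF TB_diff[of "lift h" "lift k"]] l by simp
  hence "h\<ominus>k = \<zero>" using Phi_diff[of "lift h" "lift k"] l by simp
  thus "h = k" by(rule eq_if_minus_zero[OF hk(1,2)])
 qed
 show "to_gr ` car H = car gra"
 proof(intro equalityI subsetI)
  fix c assume "c:to_gr ` car H"
  thus "c:car gra" using kap_closed lift by(auto simp: to_gr_def)
 next
  fix c assume "c:car gra"
  then obtain x where "x:car Y.TB" "c = kap x" using kap_surj by auto
  thus "c:to_gr ` car H" using to_gr_Phi[of x] Phi_closed[of x] by(metis imageI)
 qed
qed

lemma to_gr_hom:
 assumes h: "h:car H"
 shows "k:car H ==> to_gr (h\<otimes>k) = to_gr h \<otimes>\<^sub>g to_gr k" "k:car H ==> to_gr (h\<oplus>k) = to_gr h \<oplus>\<^sub>g to_gr k"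
  "to_gr (a\<odot>h) = a \<odot>\<^sub>g to_gr h"
proof -
 note l = lift[OF h, THEN conjunct1] lift[OF h, THEN conjunct2]
 show "to_gr (h\<otimes>k) = to_gr h \<otimes>\<^sub>g to_gr k" if k: "k:car H"
 proof -
  note l' = lift[OF k, THEN conjunct1] lift[OF k, THEN conjunct2]
  show ?thesis using to_gr_Phi[OF Y.TB_mult_closed[OF l(1) l'(1)]] Phi_mult[OF l(1) l'(1)] kap_mult[OF l(1) l'(1)] l(2) l'(2) by(simp add: to_gr_def)
 qed
 show "to_gr (h\<oplus>k) = to_gr h \<oplus>\<^sub>g to_gr k" if k: "k:car H"
 proof -
  note l' = lift[OF k, THEN conjunct1] lift[OF k, THEN conjunct2]
  show ?thesis using to_gr_Phi[OF Y.TB_closed(1)[OF l(1) l'(1)]] Phi_add[OF l(1) l'(1)] kap_add[OF l(1) l'(1)] l(2) l'(2) by(simp add: to_gr_def)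
 qed
 show "to_gr (a\<odot>h) = a \<odot>\<^sub>g to_gr h"
  using to_gr_Phi[OF Y.TB_closed(2)[OF l(1)], of a] Phi_smult[OF l(1), of a] kap_smult[OF l(1), of a] l(2) by(simp add: to_gr_def)
qed

lemma to_gr_comult:
 assumes h: "h:car H"
 shows "comult (gr H) (to_gr h) = tensor_map (gr H) to_gr (comult H h)"
proof
 fix be
 note l = lift[OF h, THEN conjunct1] lift[OF h, THEN conjunct2]
 have tc: "to_gr h:car gra" using kap_closed[OF l(1)] by(simp add: to_gr_def)
 show "comult (gr H) (to_gr h) be = tensor_map (gr H) to_gr (comult H h) be"
 proof(cases "bilinear_form gra gra be")
  case True
  have b: "bil (%u v. be (to_gr u) (to_gr v))"
   by(rule bilinear_pullback[OF True to_gr_closed to_gr_hom(2) to_gr_hom(3)])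
  have bk: "bilinear_form Y.TB Y.TB (%u v. be (kap u) (kap v))"
   by(rule bilinear_pullback[OF True]) (use kap_closed kap_add kap_smult in simp_all)
  have "comult H h (%u v. be (to_gr u) (to_gr v)) = comult Y.TB (lift h) (%u v. be (to_gr (Phi u)) (to_gr (Phi v)))"
   using Phi_comult[OF l(1) b] l(2) by simp
  also have "... = comult Y.TB (lift h) (%u v. be (kap u) (kap v))"
   unfolding bos_comult[OF Phi_bilinear[OF b]] bos_comult[OF bk]
  proof(rule fsum_cong, clarify)
   fix w g assume "lift h (w, g) ~= 0"
   hence wg: "w:words" "g:grouplikes H" using TB_supp[OF l(1)] by auto
   have "to_gr (Phi (single (u, word_deg G ga v\<otimes>\<^bsub>G\<^esub>g))) = kap (single (u, word_deg G ga v\<otimes>\<^bsub>G\<^esub>g)) & to_gr (Phi (single (v, g))) = kap (single (v, g))"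
    if "(c, u, v):set (word_comult ga ch w)" for c u v
   proof -
    note uv = wc_in_W[OF that wg(1)]
    have "word_deg G ga v\<otimes>\<^bsub>G\<^esub>g:car G" using Y.word_deg_closed[OF uv(2)] wg(2) gl_mult by simp
    from Y.single_closed[OF uv(1) this] Y.single_closed[OF uv(2), of g] wg(2) show ?thesis by(simp add: to_gr_Phi del: bos_simps)
   qed
   thus "(\<Sum>(c, u, v)\<leftarrow>word_comult ga ch w. c * be (to_gr (Phi (single (u, word_deg G ga v\<otimes>\<^bsub>G\<^esub>g)))) (to_gr (Phi (single (v, g)))))
    = (\<Sum>(c, u, v)\<leftarrow>word_comult ga ch w. c * be (kap (single (u, word_deg G ga v\<otimes>\<^bsub>G\<^esub>g))) (kap (single (v, g))))"
    by(intro arg_cong[where f=sum_list] map_cong refl) auto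
  qed
  finally have "comult H h (%u v. be (to_gr u) (to_gr v)) = comult Y.TB (lift h) (%u v. be (kap u) (kap v))" .
  thus ?thesis
   unfolding tensor_map_def bilform_gr to_gr_def[of h] kap_comult[OF l(1) True] using True by simp
 next
  case False
  obtain ps where "comult (gr H) (to_gr h) = tensor_sum gra gra ps" using gr_comult_tensor[OF tc] unfolding tensors_def by auto
  hence "comult (gr H) (to_gr h) be = 0" using False by(simp add: tensor_sum_eval del: gr_simps)
  thus ?thesis unfolding tensor_map_def bilform_gr using False by simp
 qed
qed

lemma to_gr_counit: "h:car H ==> counit (gr H) (to_gr h) = counit H h"
proof -
 assume h: "h:car H"
 note l = lift[OF h, THEN conjunct1] lift[OF h, THEN conjunct2]
 have "counit (gr H) (kap (lift h)) = counit Y.D (F (kap (lift h)))" using F_counit[of "kap (lift h)"] kap_closed[OF l(1)] by simp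
 also have "... = counit Y.TB (rep (Y.cls (lift h)))" unfolding F_kap[OF l(1)] by(simp add: Y.D_simps)
 also have "... = counit H (Phi (rep (Y.cls (lift h))))" using Phi_counit[OF Y.rep_cls(1)[OF l(1)]] by simp
 also have "Phi (rep (Y.cls (lift h))) = h"
 proof -
  note r = Y.rep_cls[OF l(1)]
  have "Phi (rep (Y.cls (lift h)))\<ominus>Phi (lift h) = \<zero>" using Phi_diff[OF r(1) l(1)] Phi_zero_iff[OF TB_diff[OF r(1) l(1)]] r(2) by simp
  thus ?thesis using eq_if_minus_zero[OF Phi_closed[OF r(1)] Phi_closed[OF l(1)]] l(2) by simp
 qed
 finally show ?thesis by(simp add: to_gr_def)
qed

theorem isomorphic_to_gr: "hopf_isomorphic H (gr H)"
proof -
 have "to_gr:ring_hom H (gr H)"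
 proof(rule ring_hom_memI)
  show "to_gr \<one> = \<one>\<^bsub>gr H\<^esub>"
   using to_gr_Phi[OF G_carrier[OF one_gl]] Phi_one kap_one by simp
 qed (use to_gr_hom to_gr_bij bij_betwE in \<open>fastforce simp: gr_simps\<close>)+
 hence "to_gr:ring_iso H (gr H)" using to_gr_bij by(simp add: ring_iso_def)
 thus ?thesis
  unfolding hopf_isomorphic_def by(intro bexI[of _ to_gr]) (use to_gr_comult to_gr_counit to_gr_hom(3) in \<open>auto simp: gr_simps\<close>)
qed

end

lemma order_power_iff:
 fixes q :: "'k::field"
 assumes q: "root_of_unity_of_order q m"
 shows "q ^ n = 1 \<longleftrightarrow> m dvd n"
proof -
 have m: "0 < m" "q ^ m = 1" "!!j. [|0 < j; j < m|] ==> q ^ j ~= 1" using q by(auto simp: root_of_unity_of_order_def)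
 have "q ^ n = q ^ (n mod m)"
  using power_add[of q "m * (n div m)" "n mod m"] m(2) by(simp add: power_mult)
 thus ?thesis using m(3)[of "n mod m"] m(1) by auto
qed

theorem theorem1p9:
  fixes H :: "('k::{alg_closed_field, field_char_0}, 'a) bialg"
    and \<gamma> :: "nat \<Rightarrow> 'a" and \<chi> :: "nat \<Rightarrow> 'a \<Rightarrow> 'k" and q :: 'k and m :: nat
  assumes "hopf_algebra H" and "finite_dimensional H" and "pointed H"
    and "comm_group (grouplike_group H)"
    and "yd_datum (grouplike_group H) \<gamma> \<chi>"
    and "odd m" and "1 < m" and "root_of_unity_of_order q m"
    and "type_A2 \<gamma> \<chi> q \<and> 5 \<le> m \<or> type_B2 \<gamma> \<chi> q \<and> m \<noteq> 5"
    and "hopf_isomorphic (gr H) (nichols_bosonization (grouplike_group H) \<gamma> \<chi>)"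
    and "galois_theoretical TYPE('l) H"
  shows "coradically_graded H"
proof -
 obtain L :: "('k, 'l) module" and act where act: "field L" "module_algebra H L act" "inner_faithful H L act"
  using assms(11) by (auto simp: galois_theoretical_def)
 obtain F where F: "F:ring_iso (gr H) (nichols_bosonization (grouplike_group H) \<gamma> \<chi>)"
  "!!c a. c:carrier (gr H) ==> F (a \<odot>\<^bsub>gr H\<^esub> c) = a \<odot>\<^bsub>nichols_bosonization (grouplike_group H) \<gamma> \<chi>\<^esub> F c"
  "!!c. c:carrier (gr H) ==> comult (nichols_bosonization (grouplike_group H) \<gamma> \<chi>) (F c)
   = tensor_map (nichols_bosonization (grouplike_group H) \<gamma> \<chi>) F (comult (gr H) c)"
  "!!c. c:carrier (gr H) ==> counit (nichols_bosonization (grouplike_group H) \<gamma> \<chi>) (F c) = counit (gr H) c"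
  using assms(10) unfolding hopf_isomorphic_def by auto
 note order = order_power_iff[OF assms(8)]
 have q0: "q ~= 0" using order[of m] assms(7) by (cases m) auto
 have small: "\<not> m dvd 1" "\<not> m dvd 2" "\<not> m dvd 4"
 proof -
  show "\<not> m dvd 1" using assms(7) by simp
  have cop: "coprime m 2" using assms(6) by simp
  show "\<not> m dvd 2" using coprime_dvd_mult_right_iff[OF cop, of 1] assms(7) by simp
  show "\<not> m dvd 4" using coprime_dvd_mult_right_iff[OF cop, of 2] coprime_dvd_mult_right_iff[OF cop, of 1] assms(7) by simp
 qed
 have double: "m dvd 2 * n \<longleftrightarrow> m dvd n" for n
  using coprime_dvd_mult_right_iff[of m 2 n] assms(6) by simp
 \<comment> \<open>What the two types have in common. The bounds on \<open>m\<close> ensure that \<open>q\<^sub>1\<^sub>1\<^sup>2 q\<^sub>2\<^sub>2\<close>, which is \<open>q\<^sup>3\<close> or \<open>q\<^sup>5\<close>, is not \<open>1\<close>.\<close>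
 have braiding: "(ALL n. \<chi> 1 (\<gamma> 1) ^ n = 1 \<longleftrightarrow> m dvd n) & (ALL n. \<chi> 2 (\<gamma> 2) ^ n = 1 \<longleftrightarrow> m dvd n) &
  \<chi> 1 (\<gamma> 1) * \<chi> 2 (\<gamma> 1) * \<chi> 1 (\<gamma> 2) = 1 & \<chi> 1 (\<gamma> 1) ^ 2 * \<chi> 2 (\<gamma> 2) ~= 1"
  using assms(9)
 proof
  assume A: "type_A2 \<gamma> \<chi> q & 5 <= m"
  hence t: "\<chi> 1 (\<gamma> 1) = q" "\<chi> 2 (\<gamma> 2) = q" "\<chi> 1 (\<gamma> 2) * \<chi> 2 (\<gamma> 1) = inverse q" by (auto simp: type_A2_def)
  have "q ^ 3 ~= 1" using order[of 3] A dvd_imp_le[of m 3] by auto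
  hence "q ^ 2 * q ~= 1" by (simp add: power3_eq_cube power2_eq_square)
  moreover have "q * \<chi> 2 (\<gamma> 1) * \<chi> 1 (\<gamma> 2) = 1" using arg_cong[OF t(3), of "%x. q * x"] q0 by (simp add: ac_simps)
  ultimately show ?thesis unfolding t using order by simp
 next
  assume B: "type_B2 \<gamma> \<chi> q & m ~= 5"
  hence t: "\<chi> 1 (\<gamma> 1) = q ^ 2" "\<chi> 2 (\<gamma> 2) = q" "\<chi> 1 (\<gamma> 2) * \<chi> 2 (\<gamma> 1) = inverse (q ^ 2)" by (auto simp: type_B2_def)
  have "\<not> m dvd 5"
  proof
   assume d: "m dvd 5"
   hence "m <= 5" by (rule dvd_imp_le) simp
   hence "m = 2 \<or> m = 3 \<or> m = 4 \<or> m = 5" using assms(7) by auto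
   thus False using B d by auto
  qed
  hence "q ^ 5 ~= 1" using order by simp
  moreover have "(q ^ 2) ^ 2 * q = q ^ 5" by (simp add: power_Suc2[symmetric])
  ultimately have "(q ^ 2) ^ 2 * q ~= 1" by simp
  moreover have "q ^ 2 * \<chi> 2 (\<gamma> 1) * \<chi> 1 (\<gamma> 2) = 1" using arg_cong[OF t(3), of "%x. q ^ 2 * x"] q0 by (simp add: ac_simps)
  moreover have "(q ^ 2) ^ n = 1 \<longleftrightarrow> m dvd n" for n using order[of "2 * n"] double by (simp add: power_mult)
  ultimately show ?thesis unfolding t using order by simp
 qed
 have ne: "\<chi> i (\<gamma> i) ~= 1" if "i:{1, 2}" for i
  using braiding small(1) that by (auto dest: spec[of _ 1])
 have "cartan_action H \<gamma> \<chi> F L act m"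
 proof -
  have "bialgebra H" using assms(1) by (simp add: hopf_algebra_def)
  hence "pointed_fd_bialgebra H"
   using assms(2,3) by (intro pointed_fd_bialgebra.intro fd_bialgebra.intro pointed_fd_bialgebra_axioms.intro fd_bialgebra_axioms.intro)
  hence "nichols_type H \<gamma> \<chi> F"
   using assms(4,5) F by (intro nichols_type.intro nichols_type_axioms.intro)
  hence "nontrivial_nichols_type H \<gamma> \<chi> F"
   using ne by (intro nontrivial_nichols_type.intro nontrivial_nichols_type_axioms.intro)
  hence "field_action H \<gamma> \<chi> F L act"
   using act by (intro field_action.intro field_action_axioms.intro)
  hence "field_action_closed H \<gamma> \<chi> F L act" by (intro field_action_closed.intro)
  thus ?thesis using assms(6,7) braiding by (intro cartan_action.intro cartan_action_axioms.intro) auto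
 qed
 then interpret cartan_action H \<gamma> \<chi> F L act m .
 show ?thesis unfolding coradically_graded_def by (rule isomorphic_to_gr)
qed

end
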